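(* Let $\Bbbk$ be a field of characteristic different from $2$ and let $\mathbf f:\mathfrak X\to\mathfrak Y$ be a faithfully flat map of formal superschemes over $\Bbbk$. Then the diagram $$\mathfrak X\times_{\mathfrak Y}\mathfrak X\ \underset{\pi_2}{\overset{\pi_1}{\rightrightarrows}}\ \mathfrak X\ \xrightarrow{\ \mathbf f\ }\ \mathfrak Y$$ is exact in the category of formal superschemes, i.e. $\mathbf f$ is the coequalizer of the two projections $\pi_1,\pi_2$ in that category.
   Context: "Super" means $\mathbb{Z}/2$-graded, with parity-preserving morphisms; $\otimes=\otimes_\Bbbk$. A superalgebra is supercommutative if $xy=(-1)^{|x||y|}yx$ for homogeneous $x,y$. A super-coalgebra is a super vector space $C$ with parity-preserving coassociative coproduct $\Delta$ and counit $\epsilon$; it is super-cocommutative if $\Delta=c\circ\Delta$, where $c(v\otimes w)=(-1)^{|v||w|}w\otimes v$. $\mathsf{SAlgf}_\Bbbk$ is the category of finite-dimensional supercommutative $\Bbbk$-superalgebras, and $\mathrm{SSpf}\,A=\mathrm{Hom}_{\mathsf{SAlgf}_\Bbbk}(A,-)$. A formal superscheme over $\Bbbk$ is a functor $\mathsf{SAlgf}_\Bbbk\to\mathsf{Sets}$ isomorphic to a filtered inductive limit of functors $\mathrm{SSpf}\,A_\lambda$ ($A_\lambda\in\mathsf{SAlgf}_\Bbbk$) with transition morphisms induced by surjections $A_\mu\to A_\lambda$; morphisms are natural transformations. For a super-cocommutative super-coalgebra $C$, $\mathrm{SSp}^*C$ is the functor $R\mapsto\{u\in(R\otimes C)_{\bar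 0}\mid\Delta(u)=u\otimes_R u,\ \epsilon(u)=1\}$. The functor $C\mapsto\mathrm{SSp}^*C$ is an equivalence from super-cocommutative super-coalgebras to formal superschemes; $\mathcal O_*$ denotes its quasi-inverse. For a right $C$-super-comodule $M$ and a left $C$-super-comodule $N$ with structure maps $\theta_M,\theta_N$, the cotensor product $M\square_C N$ is the equalizer of $\theta_M\otimes \mathrm{Id},\ \mathrm{Id}\otimes\theta_N: M\otimes N\rightrightarrows M\otimes C\otimes N$. Fiber products are $\mathrm{SSp}^*C_1\times_{\mathrm{SSp}^*C}\mathrm{SSp}^*C_2=\mathrm{SSp}^*(C_1\square_C C_2)$. An $\mathfrak X$-supermodule is an $\mathcal O_*(\mathfrak X)$-super-comodule; these form an abelian category $\mathsf{SMod}_{\mathfrak X}$. For $\mathbf f:\mathfrak X\to\mathfrak Y$ let $\mathbf f^*:\mathsf{SMod}_{\mathfrak Y}\to\mathsf{SMod}_{\mathfrak X}$, $M\mapsto M\square_{\mathcal O_*(\mathfrak Y)}\mathcal O_*(\mathfrak X)$. The map $\mathbf f$ is flat (resp. faithfully flat) if $\mathbf f^*$ is exact (resp. faithfully exact, i.e. exact and faithful; equivalently it preserves and reflects exact sequences). *)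

theory Defs
  imports Complex_Main "HOL-Library.Function_Algebras" "HOL-Library.FuncSet" "HOL-Library.Z2"
begin

section \<open>Super vector spaces\<close>

text \<open>
  All vector spaces over the field \<open>'k\<close> are realised as linear subspaces of function spaces
  \<open>'i \<Rightarrow> 'k\<close> (with the pointwise operations); by choosing a basis, every vector space is isomorphic
  to one of this kind for some \<open>'i\<close>.  The grading group is the additive group of the
  two-element type \<open>bit\<close>, and a super vector space is given by its two homogeneous components.
\<close>

definition fscale :: "'k::field \<Rightarrow> ('i \<Rightarrow> 'k) \<Rightarrow> 'i \<Rightarrow> 'k" where
  "fscale c v = (\<lambda>i. c * v i)"

interpretation fs: vector_space "fscale :: 'k::field \<Rightarrow> ('i \<Rightarrow> 'k) \<Rightarrow> 'i \<Rightarrow> 'k"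
  by unfold_locales (auto simp: fscale_def fun_eq_iff algebra_simps)

type_synonym ('i, 'k) svs = "bit \<Rightarrow> ('i \<Rightarrow> 'k) set"

definition super_space :: "('i, 'k::field) svs \<Rightarrow> bool" where
  "super_space V \<longleftrightarrow> (\<forall>p. fs.subspace (V p)) \<and> V 0 \<inter> V 1 = {0}"

definition svcar :: "('i, 'k::field) svs \<Rightarrow> ('i \<Rightarrow> 'k) set" where
  "svcar V = {x + y | x y. x \<in> V 0 \<and> y \<in> V 1}"

definition hcomp :: "('i, 'k::field) svs \<Rightarrow> bit \<Rightarrow> ('i \<Rightarrow> 'k) \<Rightarrow> 'i \<Rightarrow> 'k" where
  "hcomp V p v = (THE u. u \<in> V p \<and> v - u \<in> V (p + 1))"

definition lin_on :: "('i \<Rightarrow> 'k::field) set \<Rightarrow> (('i \<Rightarrow> 'k) \<Rightarrow> ('j \<Rightarrow> 'k)) \<Rightarrow> bool" where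
  "lin_on S g \<longleftrightarrow> (\<forall>x\<in>S. \<forall>y\<in>S. g (x + y) = g x + g y) \<and>
     (\<forall>c. \<forall>x\<in>S. g (fscale c x) = fscale c (g x))"

definition super_hom ::
  "('i, 'k::field) svs \<Rightarrow> ('j, 'k) svs \<Rightarrow> (('i \<Rightarrow> 'k) \<Rightarrow> ('j \<Rightarrow> 'k)) \<Rightarrow> bool" where
  "super_hom V W g \<longleftrightarrow> lin_on (svcar V) g \<and> (\<forall>p. g ` V p \<subseteq> W p)"

definition koszul :: "bit \<Rightarrow> bit \<Rightarrow> 'k::field" where
  "koszul p q = (if p = 1 \<and> q = 1 then - 1 else 1)"

subsection \<open>Tensor products\<close>

definition ptens :: "('i \<Rightarrow> 'k::field) \<Rightarrow> ('j \<Rightarrow> 'k) \<Rightarrow> 'i \<times> 'j \<Rightarrow> 'k" where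
  "ptens v w = (\<lambda>(i, j). v i * w j)"

text \<open>
  For subspaces \<open>V\<close> of \<open>'i \<Rightarrow> 'k\<close> and \<open>W\<close> of \<open>'j \<Rightarrow> 'k\<close> the linear map from the tensor product of
  \<open>V\<close> and \<open>W\<close> to \<open>'i \<times> 'j \<Rightarrow> 'k\<close> given by \<open>ptens\<close> is injective, so the tensor product is the span of
  the functions \<open>ptens v w\<close>.
\<close>

definition tensor :: "('i, 'k::field) svs \<Rightarrow> ('j, 'k) svs \<Rightarrow> ('i \<times> 'j, 'k) svs" where
  "tensor V W p = fs.span {ptens v w | v w q r. q + r = p \<and> v \<in> V q \<and> w \<in> W r}"

text \<open>
  If \<open>t\<close> lies in the tensor product of \<open>V\<close> and \<open>W\<close>, all slices \<open>\<lambda>j. t (i, j)\<close> lie in \<open>W\<close> and all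
  slices \<open>\<lambda>i. t (i, j)\<close> lie in \<open>V\<close>.  Hence the tensor product of two linear maps, which sends
  \<open>ptens v w\<close> to \<open>ptens (g v) (h w)\<close>, can be computed slicewise.
\<close>

definition tmap ::
  "(('i \<Rightarrow> 'k) \<Rightarrow> ('i' \<Rightarrow> 'k)) \<Rightarrow> (('j \<Rightarrow> 'k) \<Rightarrow> ('j' \<Rightarrow> 'k)) \<Rightarrow>
   ('i \<times> 'j \<Rightarrow> 'k::field) \<Rightarrow> 'i' \<times> 'j' \<Rightarrow> 'k" where
  "tmap g h t = (\<lambda>(i', j'). g (\<lambda>i. h (\<lambda>j. t (i, j)) j') i')"

lemma tmap_ptens:
  assumes "lin_on S g" "lin_on T h" "v \<in> S" "w \<in> T"
  shows "tmap g h (ptens v w) = ptens (g v) (h w)"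
proof -
  have "h (\<lambda>j. v i * w j) = (\<lambda>j. v i * h w j)" for i
    using assms(2,4) by (auto simp: lin_on_def fscale_def)
  moreover have "g (\<lambda>i. v i * c) = (\<lambda>i. g v i * c)" for c
    using assms(1,3) by (auto simp: lin_on_def fscale_def mult.commute)
  ultimately show ?thesis
    by (auto simp: tmap_def ptens_def)
qed

definition braid ::
  "('i, 'k::field) svs \<Rightarrow> ('j, 'k) svs \<Rightarrow> ('i \<times> 'j \<Rightarrow> 'k) \<Rightarrow> 'j \<times> 'i \<Rightarrow> 'k" where
  "braid V W t = (\<lambda>(j, i). \<Sum>p\<in>{0, 1}. \<Sum>q\<in>{0, 1}.
     koszul p q * tmap (hcomp V p) (hcomp W q) t (i, j))"

lemma hcomp_homogeneous:
  assumes V: "super_space V" and v: "v \<in> V q"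
  shows "hcomp V p v = (if p = q then v else 0)"
proof -
  have sub: "fs.subspace (V r)" for r
    using V by (simp add: super_space_def)
  have disj: "u = 0" if "u \<in> V r" "u \<in> V (r + 1)" for u r
    using V that by (cases r) (auto simp: super_space_def)
  have uniq: "u = u'" if "u \<in> V p" "v - u \<in> V (p + 1)" "u' \<in> V p" "v - u' \<in> V (p + 1)" for u u'
  proof -
    have "(v - u') - (v - u) \<in> V (p + 1)"
      using fs.subspace_diff[OF sub that(2) that(4)] fs.subspace_diff[OF sub that(4) that(2)]
      by simp
    moreover have "u - u' \<in> V p"
      by (rule fs.subspace_diff[OF sub that(1) that(3)])
    ultimately have "u - u' = 0"
      by (intro disj[of _ p]) auto
    then show ?thesis by simp
  qed
  have ex: "(if p = q then v else 0) \<in> V p \<and> v - (if p = q then v else 0) \<in> V (p + 1)"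
  proof (cases "p = q")
    case True
    then show ?thesis using v fs.subspace_0[OF sub[of "p + 1"]] by simp
  next
    case False
    then have "q = p + 1" by (cases p; cases q) auto
    then show ?thesis using False v fs.subspace_0[OF sub[of p]] by simp
  qed
  show ?thesis
    unfolding hcomp_def using ex uniq by (intro the_equality) blast+
qed

lemma hcomp_fscale:
  assumes "super_space V" "v \<in> V q"
  shows "hcomp V p (\<lambda>i. c * v i) = (if p = q then (\<lambda>i. c * v i) else 0)"
proof -
  have "fscale c v \<in> V q"
    using assms by (intro fs.subspace_scale) (auto simp: super_space_def)
  from hcomp_homogeneous[OF assms(1) this] show ?thesis
    by (simp add: fscale_def)
qed

lemma braid_ptens:
  assumes "super_space V" "super_space W" "v \<in> V p" "w \<in> W q"
  shows "braid V W (ptens v w) = fscale (koszul p q) (ptens w v)"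
proof -
  have *: "tmap (hcomp V p') (hcomp W q') (ptens v w) =
      (if p' = p \<and> q' = q then ptens v w else 0)" for p' q'
  proof -
    have "hcomp W q' (\<lambda>j. v i * w j) j' = (if q' = q then v i * w j' else 0)" for i j'
      using hcomp_fscale[OF assms(2,4), of q' "v i"] by simp
    then have "tmap (hcomp V p') (hcomp W q') (ptens v w) =
        (\<lambda>(i', j'). hcomp V p' (\<lambda>i. (if q' = q then w j' else 0) * v i) i')"
      by (auto simp: tmap_def ptens_def fun_eq_iff mult.commute intro!: arg_cong2[where f = "hcomp V p'"])
    then show ?thesis
      unfolding hcomp_fscale[OF assms(1,3)] by (auto simp: ptens_def fun_eq_iff)
  qed
  show ?thesis
    unfolding braid_def * by (cases p; cases q) (auto simp: fscale_def ptens_def fun_eq_iff)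
qed


section \<open>Finite-dimensional supercommutative superalgebras\<close>

record 'k salg =
  asp :: "(nat, 'k) svs"
  amult :: "(nat \<Rightarrow> 'k) \<Rightarrow> (nat \<Rightarrow> 'k) \<Rightarrow> nat \<Rightarrow> 'k"
  aone :: "nat \<Rightarrow> 'k"

abbreviation acar :: "'k::field salg \<Rightarrow> (nat \<Rightarrow> 'k) set" where
  "acar A \<equiv> svcar (asp A)"

text \<open>
  Up to isomorphism, every finite-dimensional superalgebra has its underlying space inside
  \<open>nat \<Rightarrow> 'k\<close>.
\<close>

definition SAlgf :: "'k::field salg set" where
  "SAlgf = {A. super_space (asp A) \<and>
     (\<exists>B. finite B \<and> acar A = fs.span B) \<and>
     (\<forall>x\<in>acar A. lin_on (acar A) (amult A x) \<and> lin_on (acar A) (\<lambda>y. amult A y x)) \<and>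
     (\<forall>p q. \<forall>x\<in>asp A p. \<forall>y\<in>asp A q. amult A x y \<in> asp A (p + q)) \<and>
     (\<forall>x\<in>acar A. \<forall>y\<in>acar A. \<forall>z\<in>acar A.
        amult A (amult A x y) z = amult A x (amult A y z)) \<and>
     aone A \<in> asp A 0 \<and>
     (\<forall>x\<in>acar A. amult A (aone A) x = x \<and> amult A x (aone A) = x) \<and>
     (\<forall>p q. \<forall>x\<in>asp A p. \<forall>y\<in>asp A q. amult A x y = fscale (koszul p q) (amult A y x))}"

text \<open>
  Morphisms are extensional functions, so that each is a single element of the function type;
  composition is \<open>compose (acar A)\<close>.
\<close>

definition alg_hom :: "'k::field salg \<Rightarrow> 'k salg \<Rightarrow> ((nat \<Rightarrow> 'k) \<Rightarrow> (nat \<Rightarrow> 'k)) set" where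
  "alg_hom A B = {\<phi> \<in> acar A \<rightarrow>\<^sub>E acar B. super_hom (asp A) (asp B) \<phi> \<and>
     \<phi> (aone A) = aone B \<and>
     (\<forall>x\<in>acar A. \<forall>y\<in>acar A. \<phi> (amult A x y) = amult B (\<phi> x) (\<phi> y))}"


section \<open>Functors from superalgebras to sets\<close>

record ('k, 'x) kfun =
  Ob :: "'k salg \<Rightarrow> 'x set"
  Ar :: "'k salg \<Rightarrow> 'k salg \<Rightarrow> ((nat \<Rightarrow> 'k) \<Rightarrow> (nat \<Rightarrow> 'k)) \<Rightarrow> 'x \<Rightarrow> 'x"

definition kfunctor :: "('k::field, 'x) kfun \<Rightarrow> bool" where
  "kfunctor X \<longleftrightarrow>
     (\<forall>A\<in>SAlgf. \<forall>B\<in>SAlgf. \<forall>\<phi>\<in>alg_hom A B. Ar X A B \<phi> \<in> Ob X A \<rightarrow> Ob X B) \<and>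
     (\<forall>A\<in>SAlgf. \<forall>x\<in>Ob X A. Ar X A A (\<lambda>a\<in>acar A. a) x = x) \<and>
     (\<forall>A\<in>SAlgf. \<forall>B\<in>SAlgf. \<forall>E\<in>SAlgf. \<forall>\<phi>\<in>alg_hom A B. \<forall>\<psi>\<in>alg_hom B E. \<forall>x\<in>Ob X A.
        Ar X A E (compose (acar A) \<psi> \<phi>) x = Ar X B E \<psi> (Ar X A B \<phi> x))"

definition nat_trans ::
  "('k::field, 'x) kfun \<Rightarrow> ('k, 'y) kfun \<Rightarrow> ('k salg \<Rightarrow> 'x \<Rightarrow> 'y) \<Rightarrow> bool" where
  "nat_trans X Y f \<longleftrightarrow>
     (\<forall>A\<in>SAlgf. f A \<in> Ob X A \<rightarrow> Ob Y A) \<and>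
     (\<forall>A\<in>SAlgf. \<forall>B\<in>SAlgf. \<forall>\<phi>\<in>alg_hom A B. \<forall>x\<in>Ob X A.
        f B (Ar X A B \<phi> x) = Ar Y A B \<phi> (f A x))"

definition nat_iso ::
  "('k::field, 'x) kfun \<Rightarrow> ('k, 'y) kfun \<Rightarrow> ('k salg \<Rightarrow> 'x \<Rightarrow> 'y) \<Rightarrow> bool" where
  "nat_iso X Y f \<longleftrightarrow> nat_trans X Y f \<and> (\<forall>A\<in>SAlgf. bij_betw (f A) (Ob X A) (Ob Y A))"

definition nat_eq ::
  "('k::field, 'x) kfun \<Rightarrow> ('k salg \<Rightarrow> 'x \<Rightarrow> 'y) \<Rightarrow> ('k salg \<Rightarrow> 'x \<Rightarrow> 'y) \<Rightarrow> bool" where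
  "nat_eq X f g \<longleftrightarrow> (\<forall>A\<in>SAlgf. \<forall>x\<in>Ob X A. f A x = g A x)"

definition nat_comp ::
  "('k salg \<Rightarrow> 'y \<Rightarrow> 'z) \<Rightarrow> ('k salg \<Rightarrow> 'x \<Rightarrow> 'y) \<Rightarrow> 'k salg \<Rightarrow> 'x \<Rightarrow> 'z" where
  "nat_comp g f = (\<lambda>A x. g A (f A x))"

text \<open>
  Fibre products are formed pointwise.  Formal superschemes are closed under them, so this is also
  the fibre product of formal superschemes.
\<close>

definition fibre_product ::
  "('k::field, 'x) kfun \<Rightarrow> ('k salg \<Rightarrow> 'x \<Rightarrow> 'y) \<Rightarrow> ('k, 'w) kfun \<Rightarrow> ('k salg \<Rightarrow> 'w \<Rightarrow> 'y) \<Rightarrow>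
   ('k, 'x \<times> 'w) kfun" where
  "fibre_product X f W g =
     \<lparr>Ob = (\<lambda>A. {(x, w). x \<in> Ob X A \<and> w \<in> Ob W A \<and> f A x = g A w}),
      Ar = (\<lambda>A B \<phi> (x, w). (Ar X A B \<phi> x, Ar W A B \<phi> w))\<rparr>"

section \<open>Formal superschemes\<close>

text \<open>
  A filtered inductive system of functors \<open>SSpf (A i)\<close> over the directed preordered set \<open>(I, le)\<close>;
  for \<open>le i j\<close> the transition \<open>SSpf (A i) \<rightarrow> SSpf (A j)\<close> is precomposition with the surjection
  \<open>t i j\<close> from \<open>A j\<close> to \<open>A i\<close>.
\<close>

definition directed_system ::
  "'l set \<Rightarrow> ('l \<Rightarrow> 'l \<Rightarrow> bool) \<Rightarrow> ('l \<Rightarrow> 'k::field salg) \<Rightarrow>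
   ('l \<Rightarrow> 'l \<Rightarrow> (nat \<Rightarrow> 'k) \<Rightarrow> (nat \<Rightarrow> 'k)) \<Rightarrow> bool" where
  "directed_system I le A t \<longleftrightarrow>
     I \<noteq> {} \<and>
     (\<forall>i\<in>I. le i i) \<and>
     (\<forall>i\<in>I. \<forall>j\<in>I. \<forall>k\<in>I. le i j \<longrightarrow> le j k \<longrightarrow> le i k) \<and>
     (\<forall>i\<in>I. \<forall>j\<in>I. \<exists>k\<in>I. le i k \<and> le j k) \<and>
     (\<forall>i\<in>I. A i \<in> SAlgf) \<and>
     (\<forall>i\<in>I. \<forall>j\<in>I. le i j \<longrightarrow> t i j \<in> alg_hom (A j) (A i) \<and> t i j ` acar (A j) = acar (A i)) \<and>
     (\<forall>i\<in>I. t i i = (\<lambda>a\<in>acar (A i). a)) \<and>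
     (\<forall>i\<in>I. \<forall>j\<in>I. \<forall>k\<in>I. le i j \<longrightarrow> le j k \<longrightarrow> t i k = compose (acar (A k)) (t i j) (t j k))"

text \<open>Inductive limits of set-valued functors are formed pointwise, by the usual quotient.\<close>

definition colim_rel ::
  "'l set \<Rightarrow> ('l \<Rightarrow> 'l \<Rightarrow> bool) \<Rightarrow> ('l \<Rightarrow> 'k::field salg) \<Rightarrow>
   ('l \<Rightarrow> 'l \<Rightarrow> (nat \<Rightarrow> 'k) \<Rightarrow> (nat \<Rightarrow> 'k)) \<Rightarrow> 'k salg \<Rightarrow>
   (('l \<times> ((nat \<Rightarrow> 'k) \<Rightarrow> (nat \<Rightarrow> 'k))) \<times> ('l \<times> ((nat \<Rightarrow> 'k) \<Rightarrow> (nat \<Rightarrow> 'k)))) set" where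
  "colim_rel I le A t R = {((i, u), (j, v)). i \<in> I \<and> j \<in> I \<and>
     u \<in> alg_hom (A i) R \<and> v \<in> alg_hom (A j) R \<and>
     (\<exists>k\<in>I. le i k \<and> le j k \<and>
        compose (acar (A k)) u (t i k) = compose (acar (A k)) v (t j k))}"

definition SSpf_colim ::
  "'l set \<Rightarrow> ('l \<Rightarrow> 'l \<Rightarrow> bool) \<Rightarrow> ('l \<Rightarrow> 'k::field salg) \<Rightarrow>
   ('l \<Rightarrow> 'l \<Rightarrow> (nat \<Rightarrow> 'k) \<Rightarrow> (nat \<Rightarrow> 'k)) \<Rightarrow>
   ('k, ('l \<times> ((nat \<Rightarrow> 'k) \<Rightarrow> (nat \<Rightarrow> 'k))) set) kfun" where
  "SSpf_colim I le A t =
     \<lparr>Ob = (\<lambda>R. (SIGMA i:I. alg_hom (A i) R) // colim_rel I le A t R),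
      Ar = (\<lambda>R S \<phi> K. colim_rel I le A t S ``
              ((\<lambda>(i, u). (i, compose (acar (A i)) \<phi> u)) ` K))\<rparr>"

text \<open>
  The existential quantifier over systems needs a fixed index type; \<open>'k salg \<times> 'x\<close> loses nothing, see
  \<open>formal_superschemeI\<close> below.
\<close>

definition formal_superscheme :: "('k::field, 'x) kfun \<Rightarrow> bool" where
  "formal_superscheme X \<longleftrightarrow> kfunctor X \<and>
     (\<exists>(I :: ('k salg \<times> 'x) set) le A t.
        directed_system I le A t \<and> (\<exists>\<sigma>. nat_iso (SSpf_colim I le A t) X \<sigma>))"

subsection \<open>Independence of the index type\<close>

lemma alg_homD:
  assumes "\<phi> \<in> alg_hom A B"
  shows "\<phi> \<in> acar A \<rightarrow>\<^sub>E acar B" "\<phi> \<in> acar A \<rightarrow> acar B" "\<phi> \<in> extensional (acar A)"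
  using assms by (auto simp: alg_hom_def PiE_def)

lemma svcar_homogeneous:
  assumes "super_space V" "x \<in> V p"
  shows "x \<in> svcar V"
proof -
  have zero: "0 \<in> V r" for r
    using assms(1) by (auto simp: super_space_def intro: fs.subspace_0)
  have "x = x + 0" "x = 0 + x"
    by simp_all
  then show ?thesis
    using assms(2) zero unfolding svcar_def by (cases p) blast+
qed

lemma svcar_closed:
  assumes "super_space V" "x \<in> svcar V" "y \<in> svcar V"
  shows "x + y \<in> svcar V" "fscale c x \<in> svcar V"
proof -
  have sub: "fs.subspace (V r)" for r
    using assms(1) by (simp add: super_space_def)
  obtain a b a' b' where *: "x = a + b" "y = a' + b'" "a \<in> V 0" "b \<in> V 1" "a' \<in> V 0" "b' \<in> V 1"
    using assms by (auto simp: svcar_def)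
  have "x + y = (a + a') + (b + b')"
    using * by simp
  moreover have "a + a' \<in> V 0" "b + b' \<in> V 1"
    using * fs.subspace_add[OF sub] by auto
  ultimately show "x + y \<in> svcar V"
    unfolding svcar_def by blast
  have "fscale c x = fscale c a + fscale c b"
    using * by (simp add: fs.scale_right_distrib)
  moreover have "fscale c a \<in> V 0" "fscale c b \<in> V 1"
    using * fs.subspace_scale[OF sub] by auto
  ultimately show "fscale c x \<in> svcar V"
    unfolding svcar_def by blast
qed

lemma SAlgfD:
  assumes "A \<in> SAlgf"
  shows "super_space (asp A)" "aone A \<in> acar A"
    "x \<in> acar A \<Longrightarrow> y \<in> acar A \<Longrightarrow> amult A x y \<in> acar A"
proof -
  show A: "super_space (asp A)" and "aone A \<in> acar A"
    using assms svcar_homogeneous[of "asp A" "aone A" 0] unfolding SAlgf_def by blast+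
  have lin: "lin_on (acar A) (amult A u)" "lin_on (acar A) (\<lambda>y. amult A y u)" if "u \<in> acar A" for u
    using assms that unfolding SAlgf_def by blast+
  have hom: "amult A u v \<in> acar A" if "u \<in> asp A p" "v \<in> asp A q" for u v p q
  proof -
    have "amult A u v \<in> asp A (p + q)"
      using assms that unfolding SAlgf_def by blast
    then show ?thesis
      by (rule svcar_homogeneous[OF A])
  qed
  assume x: "x \<in> acar A" and y: "y \<in> acar A"
  obtain a b a' b' where *: "x = a + b" "y = a' + b'"
    and in0: "a \<in> asp A 0" "b \<in> asp A 1" "a' \<in> asp A 0" "b' \<in> asp A 1"
    using x y by (auto simp: svcar_def)
  have in1: "a \<in> acar A" "b \<in> acar A" "a' \<in> acar A" "b' \<in> acar A"
    using in0 svcar_homogeneous[OF A] by auto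
  have "amult A x y = amult A x a' + amult A x b'"
    using lin(1)[OF x] in1 by (simp add: lin_on_def *)
  also have "\<dots> = (amult A a a' + amult A b a') + (amult A a b' + amult A b b')"
    using lin(2)[OF in1(3)] lin(2)[OF in1(4)] in1 by (simp add: lin_on_def *)
  also have "\<dots> \<in> acar A"
    by (rule svcar_closed(1)[OF A svcar_closed(1)[OF A hom[OF in0(1,3)] hom[OF in0(2,3)]]
        svcar_closed(1)[OF A hom[OF in0(1,4)] hom[OF in0(2,4)]]])
  finally show "amult A x y \<in> acar A" .
qed

lemma alg_homI:
  assumes "\<phi> \<in> extensional (acar A)" "\<And>x. x \<in> acar A \<Longrightarrow> \<phi> x \<in> acar B"
    and "\<And>x y. x \<in> acar A \<Longrightarrow> y \<in> acar A \<Longrightarrow> \<phi> (x + y) = \<phi> x + \<phi> y"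
    and "\<And>c x. x \<in> acar A \<Longrightarrow> \<phi> (fscale c x) = fscale c (\<phi> x)"
    and "\<And>p x. x \<in> asp A p \<Longrightarrow> \<phi> x \<in> asp B p"
    and "\<phi> (aone A) = aone B"
    and "\<And>x y. x \<in> acar A \<Longrightarrow> y \<in> acar A \<Longrightarrow> \<phi> (amult A x y) = amult B (\<phi> x) (\<phi> y)"
  shows "\<phi> \<in> alg_hom A B"
  using assms unfolding alg_hom_def super_hom_def lin_on_def PiE_def by blast

lemma alg_homE:
  assumes "\<phi> \<in> alg_hom A B"
  shows "x \<in> acar A \<Longrightarrow> \<phi> x \<in> acar B"
    "x \<in> acar A \<Longrightarrow> y \<in> acar A \<Longrightarrow> \<phi> (x + y) = \<phi> x + \<phi> y"
    "x \<in> acar A \<Longrightarrow> \<phi> (fscale c x) = fscale c (\<phi> x)"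
    "x \<in> asp A p \<Longrightarrow> \<phi> x \<in> asp B p"
    "\<phi> (aone A) = aone B"
    "x \<in> acar A \<Longrightarrow> y \<in> acar A \<Longrightarrow> \<phi> (amult A x y) = amult B (\<phi> x) (\<phi> y)"
  using assms unfolding alg_hom_def super_hom_def lin_on_def PiE_def by blast+

lemma alg_hom_id:
  assumes "A \<in> SAlgf"
  shows "(\<lambda>a\<in>acar A. a) \<in> alg_hom A A"
  using SAlgfD[OF assms] svcar_closed[OF SAlgfD(1)[OF assms]]
    svcar_homogeneous[OF SAlgfD(1)[OF assms]]
  by (intro alg_homI) simp_all

lemma alg_hom_compose:
  assumes "A \<in> SAlgf" "\<phi> \<in> alg_hom A B" "\<psi> \<in> alg_hom B E"
  shows "compose (acar A) \<psi> \<phi> \<in> alg_hom A E"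
  using SAlgfD[OF assms(1)] svcar_closed[OF SAlgfD(1)[OF assms(1)]]
    svcar_homogeneous[OF SAlgfD(1)[OF assms(1)]] alg_homE[OF assms(2)] alg_homE[OF assms(3)]
  by (intro alg_homI) (simp_all add: compose_def)

lemma compose_alg_assoc:
  assumes "f \<in> alg_hom A B"
  shows "compose (acar A) h (compose (acar A) g f) = compose (acar A) (compose (acar B) h g) f"
  using compose_assoc[of f "acar A" "acar B" h g] alg_homD(2)[OF assms] by simp

lemma compose_alg_id:
  assumes "f \<in> alg_hom A B"
  shows "compose (acar A) f (\<lambda>a\<in>acar A. a) = f" "compose (acar A) (\<lambda>b\<in>acar B. b) f = f"
  using alg_homD[OF assms] by (auto simp: compose_def fun_eq_iff extensional_def Pi_iff)

context
  fixes I :: "'l set" and le and A :: "'l \<Rightarrow> 'k::field salg" and t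
  assumes sys: "directed_system I le A t"
begin

lemma sysD:
  "I \<noteq> {}" "i \<in> I \<Longrightarrow> le i i"
  "i \<in> I \<Longrightarrow> j \<in> I \<Longrightarrow> k \<in> I \<Longrightarrow> le i j \<Longrightarrow> le j k \<Longrightarrow> le i k"
  "i \<in> I \<Longrightarrow> j \<in> I \<Longrightarrow> \<exists>k\<in>I. le i k \<and> le j k"
  "i \<in> I \<Longrightarrow> A i \<in> SAlgf"
  "i \<in> I \<Longrightarrow> j \<in> I \<Longrightarrow> le i j \<Longrightarrow> t i j \<in> alg_hom (A j) (A i)"
  "i \<in> I \<Longrightarrow> j \<in> I \<Longrightarrow> le i j \<Longrightarrow> t i j ` acar (A j) = acar (A i)"
  "i \<in> I \<Longrightarrow> t i i = (\<lambda>a\<in>acar (A i). a)"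
  "i \<in> I \<Longrightarrow> j \<in> I \<Longrightarrow> k \<in> I \<Longrightarrow> le i j \<Longrightarrow> le j k \<Longrightarrow>
    t i k = compose (acar (A k)) (t i j) (t j k)"
proof -
  note s = sys[unfolded directed_system_def]
  show "I \<noteq> {}"
    using s[THEN conjunct1] by blast
  show "i \<in> I \<Longrightarrow> le i i"
    using s[THEN conjunct2, THEN conjunct1] by blast
  show "i \<in> I \<Longrightarrow> j \<in> I \<Longrightarrow> k \<in> I \<Longrightarrow> le i j \<Longrightarrow> le j k \<Longrightarrow> le i k"
    using s[THEN conjunct2, THEN conjunct2, THEN conjunct1] by blast
  show "i \<in> I \<Longrightarrow> j \<in> I \<Longrightarrow> \<exists>k\<in>I. le i k \<and> le j k"
    using s[THEN conjunct2, THEN conjunct2, THEN conjunct2, THEN conjunct1] by blast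
  show "i \<in> I \<Longrightarrow> A i \<in> SAlgf"
    using s[THEN conjunct2, THEN conjunct2, THEN conjunct2, THEN conjunct2, THEN conjunct1] by blast
  show "i \<in> I \<Longrightarrow> j \<in> I \<Longrightarrow> le i j \<Longrightarrow> t i j \<in> alg_hom (A j) (A i)"
    "i \<in> I \<Longrightarrow> j \<in> I \<Longrightarrow> le i j \<Longrightarrow> t i j ` acar (A j) = acar (A i)"
    using s[THEN conjunct2, THEN conjunct2, THEN conjunct2, THEN conjunct2, THEN conjunct2, THEN conjunct1] by blast+
  show "i \<in> I \<Longrightarrow> t i i = (\<lambda>a\<in>acar (A i). a)"
    using s[THEN conjunct2, THEN conjunct2, THEN conjunct2, THEN conjunct2, THEN conjunct2, THEN conjunct2, THEN conjunct1] by blast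
  show "i \<in> I \<Longrightarrow> j \<in> I \<Longrightarrow> k \<in> I \<Longrightarrow> le i j \<Longrightarrow> le j k \<Longrightarrow>
      t i k = compose (acar (A k)) (t i j) (t j k)"
    using s[THEN conjunct2, THEN conjunct2, THEN conjunct2, THEN conjunct2, THEN conjunct2, THEN conjunct2, THEN conjunct2] by blast
qed

lemma colim_rel_lift:
  assumes "i \<in> I" "j \<in> I" "k \<in> I" "l \<in> I" "le i k" "le j k" "le k l"
    "compose (acar (A k)) u (t i k) = compose (acar (A k)) v (t j k)"
  shows "compose (acar (A l)) u (t i l) = compose (acar (A l)) v (t j l)"
proof -
  have kl: "t k l \<in> alg_hom (A l) (A k)"
    by (rule sysD(6)) fact+
  have "compose (acar (A l)) u (t i l) = compose (acar (A l)) (compose (acar (A k)) u (t i k)) (t k l)"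
    by (simp add: sysD(9)[OF assms(1,3,4,5,7)] compose_alg_assoc[OF kl])
  also have "\<dots> = compose (acar (A l)) v (t j l)"
    by (simp add: sysD(9)[OF assms(2,3,4,6,7)] compose_alg_assoc[OF kl] assms(8))
  finally show ?thesis .
qed

lemma colim_rel_equiv: "equiv (SIGMA i:I. alg_hom (A i) R) (colim_rel I le A t R)"
proof (rule equivI)
  show "colim_rel I le A t R \<subseteq> (SIGMA i:I. alg_hom (A i) R) \<times> (SIGMA i:I. alg_hom (A i) R)"
    by (auto simp: colim_rel_def)
  show "refl_on (SIGMA i:I. alg_hom (A i) R) (colim_rel I le A t R)"
    using sysD(2) by (auto simp: refl_on_def colim_rel_def)
  show "sym (colim_rel I le A t R)"
    unfolding sym_def colim_rel_def by (auto; metis)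
  show "trans (colim_rel I le A t R)"
  proof (rule transI)
    fix a b c
    assume ab: "(a, b) \<in> colim_rel I le A t R" and bc: "(b, c) \<in> colim_rel I le A t R"
    obtain i u j v l w where abc: "a = (i, u)" "b = (j, v)" "c = (l, w)"
      by (metis surj_pair)
    obtain k where k: "k \<in> I" "le i k" "le j k"
      "compose (acar (A k)) u (t i k) = compose (acar (A k)) v (t j k)"
      using ab abc by (auto simp: colim_rel_def)
    obtain k' where k': "k' \<in> I" "le j k'" "le l k'"
      "compose (acar (A k')) v (t j k') = compose (acar (A k')) w (t l k')"
      using bc abc by (auto simp: colim_rel_def)
    have mem: "i \<in> I" "j \<in> I" "l \<in> I" "u \<in> alg_hom (A i) R" "w \<in> alg_hom (A l) R"
      using ab bc abc by (auto simp: colim_rel_def)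
    obtain m where m: "m \<in> I" "le k m" "le k' m"
      using sysD(4) k k' by metis
    have "compose (acar (A m)) u (t i m) = compose (acar (A m)) w (t l m)"
      using colim_rel_lift[of i j k m u v] colim_rel_lift[of j l k' m v w] mem k k' m by simp
    moreover have "le i m" "le l m"
      using sysD(3) mem k k' m by metis+
    ultimately show "(a, c) \<in> colim_rel I le A t R"
      using mem m abc by (auto simp: colim_rel_def)
  qed
qed

lemma colim_rel_post:
  assumes "((i, u), (j, v)) \<in> colim_rel I le A t R" "\<phi> \<in> alg_hom R S"
  shows "((i, compose (acar (A i)) \<phi> u), (j, compose (acar (A j)) \<phi> v)) \<in> colim_rel I le A t S"
proof -
  have mem: "i \<in> I" "j \<in> I" "u \<in> alg_hom (A i) R" "v \<in> alg_hom (A j) R"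
    using assms by (auto simp: colim_rel_def)
  obtain k where k: "k \<in> I" "le i k" "le j k"
    "compose (acar (A k)) u (t i k) = compose (acar (A k)) v (t j k)"
    using assms by (auto simp: colim_rel_def)
  have tik: "t i k \<in> alg_hom (A k) (A i)" and tjk: "t j k \<in> alg_hom (A k) (A j)"
    using sysD(6) mem k by auto
  have "compose (acar (A k)) (compose (acar (A i)) \<phi> u) (t i k) =
      compose (acar (A k)) (compose (acar (A j)) \<phi> v) (t j k)"
    using k(4) compose_alg_assoc[OF tik, of \<phi> u] compose_alg_assoc[OF tjk, of \<phi> v] by simp
  moreover have "compose (acar (A i)) \<phi> u \<in> alg_hom (A i) S" "compose (acar (A j)) \<phi> v \<in> alg_hom (A j) S"
    using alg_hom_compose[OF sysD(5)[OF mem(1)] mem(3) assms(2)]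
      alg_hom_compose[OF sysD(5)[OF mem(2)] mem(4) assms(2)] by simp_all
  ultimately show ?thesis
    using mem k by (auto simp: colim_rel_def)
qed

lemma SSpf_colim_Ar:
  assumes "i \<in> I" "u \<in> alg_hom (A i) R" "\<phi> \<in> alg_hom R S"
  shows "Ar (SSpf_colim I le A t) R S \<phi> (colim_rel I le A t R `` {(i, u)}) =
    colim_rel I le A t S `` {(i, compose (acar (A i)) \<phi> u)}" (is "?L = ?R")
proof -
  let ?c = "colim_rel I le A t S"
  have self: "((i, u), (i, u)) \<in> colim_rel I le A t R"
    using assms sysD(2) by (auto simp: colim_rel_def)
  have L: "?L = ?c `` ((\<lambda>(i, u). (i, compose (acar (A i)) \<phi> u)) ` (colim_rel I le A t R `` {(i, u)}))"
    by (simp add: SSpf_colim_def)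
  have eq: "?c `` {(j, compose (acar (A j)) \<phi> v)} = ?R"
    if "((i, u), (j, v)) \<in> colim_rel I le A t R" for j v
    using equiv_class_eq[OF colim_rel_equiv colim_rel_post[OF that assms(3)]] by simp
  show ?thesis
    unfolding L
  proof (intro subset_antisym subsetI)
    fix w assume "w \<in> ?c `` ((\<lambda>(i, u). (i, compose (acar (A i)) \<phi> u)) ` (colim_rel I le A t R `` {(i, u)}))"
    then obtain j v where "((i, u), (j, v)) \<in> colim_rel I le A t R"
      "w \<in> ?c `` {(j, compose (acar (A j)) \<phi> v)}"
      by auto
    then show "w \<in> ?R"
      using eq by metis
  next
    fix w assume "w \<in> ?R"
    then show "w \<in> ?c `` ((\<lambda>(i, u). (i, compose (acar (A i)) \<phi> u)) ` (colim_rel I le A t R `` {(i, u)}))"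
      using self by force
  qed
qed

end

lemma nat_iso_cone:
  assumes sys: "directed_system I le A t" and iso: "nat_iso (SSpf_colim I le A t) X \<sigma>"
  defines "x \<equiv> \<lambda>i. \<sigma> (A i) (colim_rel I le A t (A i) `` {(i, \<lambda>a\<in>acar (A i). a)})"
  shows "i \<in> I \<Longrightarrow> x i \<in> Ob X (A i)"
    and "R \<in> SAlgf \<Longrightarrow> y \<in> Ob X R \<Longrightarrow> \<exists>i\<in>I. \<exists>u\<in>alg_hom (A i) R. y = Ar X (A i) R u (x i)"
    and "R \<in> SAlgf \<Longrightarrow> i \<in> I \<Longrightarrow> j \<in> I \<Longrightarrow> u \<in> alg_hom (A i) R \<Longrightarrow> v \<in> alg_hom (A j) R \<Longrightarrow>
      Ar X (A i) R u (x i) = Ar X (A j) R v (x j) \<longleftrightarrow> ((i, u), (j, v)) \<in> colim_rel I le A t R"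
proof -
  let ?c = "colim_rel I le A t"
  have cls: "?c R `` {(i, u)} \<in> Ob (SSpf_colim I le A t) R" if "i \<in> I" "u \<in> alg_hom (A i) R" for i u R
    using that by (auto simp: SSpf_colim_def intro: quotientI)
  have bij: "bij_betw (\<sigma> R) (Ob (SSpf_colim I le A t) R) (Ob X R)" if "R \<in> SAlgf" for R
    using iso that by (simp add: nat_iso_def)
  have val: "Ar X (A i) R u (x i) = \<sigma> R (?c R `` {(i, u)})"
    if "R \<in> SAlgf" "i \<in> I" "u \<in> alg_hom (A i) R" for i u R
  proof -
    have "\<sigma> R (Ar (SSpf_colim I le A t) (A i) R u (?c (A i) `` {(i, \<lambda>a\<in>acar (A i). a)})) =
        Ar X (A i) R u (x i)"
      using iso that sysD(5)[OF sys] cls alg_hom_id unfolding nat_iso_def nat_trans_def x_def by blast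
    then show ?thesis
      unfolding SSpf_colim_Ar[OF sys that(2) alg_hom_id[OF sysD(5)[OF sys that(2)]] that(3)]
        compose_alg_id(1)[OF that(3)] by (rule sym)
  qed
  show "x i \<in> Ob X (A i)" if "i \<in> I"
    unfolding x_def
    by (rule bij_betw_apply[OF bij[OF sysD(5)[OF sys that]]
          cls[OF that alg_hom_id[OF sysD(5)[OF sys that]]]])
  show "\<exists>i\<in>I. \<exists>u\<in>alg_hom (A i) R. y = Ar X (A i) R u (x i)"
    if R: "R \<in> SAlgf" and y: "y \<in> Ob X R"
  proof -
    obtain K where K: "K \<in> Ob (SSpf_colim I le A t) R" "y = \<sigma> R K"
      using bij[OF R] y by (auto simp: bij_betw_def)
    then obtain i u where "i \<in> I" "u \<in> alg_hom (A i) R" "K = ?c R `` {(i, u)}"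
      by (auto simp: SSpf_colim_def elim!: quotientE)
    then show ?thesis
      using K val[OF R] by metis
  qed
  show "Ar X (A i) R u (x i) = Ar X (A j) R v (x j) \<longleftrightarrow> ((i, u), (j, v)) \<in> ?c R"
    if "R \<in> SAlgf" "i \<in> I" "j \<in> I" "u \<in> alg_hom (A i) R" "v \<in> alg_hom (A j) R"
  proof -
    have "Ar X (A i) R u (x i) = Ar X (A j) R v (x j) \<longleftrightarrow> ?c R `` {(i, u)} = ?c R `` {(j, v)}"
      using val that bij[OF that(1)] cls inj_on_eq_iff unfolding bij_betw_def by metis
    also have "\<dots> \<longleftrightarrow> ((i, u), (j, v)) \<in> ?c R"
      using eq_equiv_class_iff[OF colim_rel_equiv[OF sys]] that by (metis SigmaI)
    finally show ?thesis .
  qed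
qed

theorem formal_superschemeI:
  fixes I :: "'l set" and X :: "('k::field, 'x) kfun"
  assumes X: "kfunctor X" and sys: "directed_system I le A t"
    and iso: "nat_iso (SSpf_colim I le A t) X \<sigma>"
  shows "formal_superscheme X"
proof -
  define x where "x = (\<lambda>i. \<sigma> (A i) (colim_rel I le A t (A i) `` {(i, \<lambda>a\<in>acar (A i). a)}))"
  have x_eq: "\<sigma> (A i) (colim_rel I le A t (A i) `` {(i, \<lambda>a\<in>acar (A i). a)}) = x i" for i
    by (simp only: x_def)
  note cone = nat_iso_cone[OF sys iso, unfolded x_eq]
  note sD = sysD[OF sys]
  have fid: "Ar X B B (\<lambda>a\<in>acar B. a) y = y" if "B \<in> SAlgf" "y \<in> Ob X B" for B y
    using X that by (simp add: kfunctor_def)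
  have fcomp: "Ar X B F (compose (acar B) \<psi> \<phi>) y = Ar X E F \<psi> (Ar X B E \<phi> y)"
    if "B \<in> SAlgf" "E \<in> SAlgf" "F \<in> SAlgf" "\<phi> \<in> alg_hom B E" "\<psi> \<in> alg_hom E F" "y \<in> Ob X B"
    for B E F \<phi> \<psi> y
    using X that unfolding kfunctor_def by blast
  have fmap: "Ar X B E \<phi> y \<in> Ob X E" if "B \<in> SAlgf" "E \<in> SAlgf" "\<phi> \<in> alg_hom B E" "y \<in> Ob X B"
    for B E \<phi> y
    using X that unfolding kfunctor_def by blast
  define J where "J = (\<lambda>i. (A i, x i)) ` I"
  define adm where "adm = (\<lambda>(a :: 'k salg \<times> 'x) b \<phi>. \<phi> \<in> alg_hom (fst b) (fst a) \<and>
    \<phi> ` acar (fst b) = acar (fst a) \<and> Ar X (fst b) (fst a) \<phi> (snd b) = snd a)"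
  define le' where "le' = (\<lambda>a b. \<exists>\<phi>. adm a b \<phi>)"
  define t' where "t' = (\<lambda>a b. SOME \<phi>. adm a b \<phi>)"
  have J_alg: "fst a \<in> SAlgf" "snd a \<in> Ob X (fst a)" if "a \<in> J" for a
    using that sD(5) cone(1) by (auto simp: J_def)
  have uniq: "\<phi> = \<psi>" if "b \<in> J" "R \<in> SAlgf" "\<phi> \<in> alg_hom (fst b) R" "\<psi> \<in> alg_hom (fst b) R"
      "Ar X (fst b) R \<phi> (snd b) = Ar X (fst b) R \<psi> (snd b)" for b R \<phi> \<psi>
  proof -
    obtain j where j: "j \<in> I" "b = (A j, x j)"
      using \<open>b \<in> J\<close> by (auto simp: J_def)
    have "((j, \<phi>), (j, \<psi>)) \<in> colim_rel I le A t R"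
      using cone(3)[of R j j \<phi> \<psi>] that j by simp
    then obtain k where k: "k \<in> I" "le j k"
      "compose (acar (A k)) \<phi> (t j k) = compose (acar (A k)) \<psi> (t j k)"
      by (auto simp: colim_rel_def)
    have agree: "\<phi> a = \<psi> a" if a: "a \<in> acar (A j)" for a
    proof -
      have "a \<in> t j k ` acar (A k)"
        using sD(7)[OF j(1) k(1,2)] a by simp
      then obtain z where "z \<in> acar (A k)" "a = t j k z"
        by blast
      then show ?thesis
        using fun_cong[OF k(3), of z] by (simp add: compose_def)
    qed
    show ?thesis
      using alg_homD(3)[OF that(3)] alg_homD(3)[OF that(4)] agree j
      by (intro extensionalityI[of _ "acar (A j)"]) simp_all
  qed
  have adm_t: "adm a b (t' a b)" if "le' a b" for a b
    using that unfolding le'_def t'_def by (rule someI_ex)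
  have t_eq: "t' a b = \<phi>" if "a \<in> J" "b \<in> J" "adm a b \<phi>" for a b \<phi>
  proof -
    have "adm a b (t' a b)"
      using adm_t[of a b] that(3) unfolding le'_def by blast
    then show ?thesis
      using that J_alg by (intro uniq[of b "fst a"]) (auto simp: adm_def)
  qed
  have adm_id: "adm a a (\<lambda>z\<in>acar (fst a). z)" if "a \<in> J" for a
    using J_alg[OF that] fid alg_hom_id by (auto simp: adm_def)
  have adm_comp: "adm a c (compose (acar (fst c)) \<phi> \<psi>)"
    if "a \<in> J" "b \<in> J" "c \<in> J" "adm a b \<phi>" "adm b c \<psi>" for a b c \<phi> \<psi>
  proof -
    have "compose (acar (fst c)) \<phi> \<psi> ` acar (fst c) = \<phi> ` \<psi> ` acar (fst c)"
      by (auto simp: compose_def)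
    then show ?thesis
      using that J_alg[OF that(1)] J_alg[OF that(2)] J_alg[OF that(3)]
        fcomp[of "fst c" "fst b" "fst a" \<psi> \<phi> "snd c"]
        alg_hom_compose[of "fst c" \<psi> "fst b" \<phi> "fst a"]
      unfolding adm_def by simp
  qed
  have adm_sys: "adm (A i, x i) (A k, x k) (t i k)" if "i \<in> I" "k \<in> I" "le i k" for i k
  proof -
    have tik: "t i k \<in> alg_hom (A k) (A i)"
      using sD(6) that by simp
    let ?id = "\<lambda>a\<in>acar (A i). a"
    have "compose (acar (A k)) (t i k) (t k k) = compose (acar (A k)) ?id (t i k)"
      using compose_alg_id[OF tik] sD(8) that by simp
    then have "((k, t i k), (i, ?id)) \<in> colim_rel I le A t (A i)"
      using that sD(2) sD(5) tik alg_hom_id by (auto simp: colim_rel_def)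
    then have "Ar X (A k) (A i) (t i k) (x k) = Ar X (A i) (A i) ?id (x i)"
      using cone(3)[OF sD(5)[OF that(1)] that(2,1) tik alg_hom_id[OF sD(5)[OF that(1)]]] by blast
    also have "\<dots> = x i"
      by (rule fid[OF sD(5)[OF that(1)] cone(1)[OF that(1)]])
    finally show ?thesis
      using tik sD(7) that by (simp add: adm_def)
  qed
  have sys': "directed_system J le' fst t'"
    unfolding directed_system_def
  proof (intro conjI ballI impI)
    show "J \<noteq> {}"
      using sD(1) by (simp add: J_def)
    show "le' a a" if "a \<in> J" for a
      using adm_id[OF that] unfolding le'_def by blast
    show "le' a c" if "a \<in> J" "b \<in> J" "c \<in> J" "le' a b" "le' b c" for a b c
      using adm_comp[OF that(1-3)] that(4,5) unfolding le'_def by blast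
    show "\<exists>c\<in>J. le' a c \<and> le' b c" if "a \<in> J" "b \<in> J" for a b
    proof -
      obtain i j where ij: "i \<in> I" "j \<in> I" "a = (A i, x i)" "b = (A j, x j)"
        using \<open>a \<in> J\<close> \<open>b \<in> J\<close> by (auto simp: J_def)
      obtain k where "k \<in> I" "le i k" "le j k"
        using sD(4) ij by metis
      then show ?thesis
        using adm_sys[of i k] adm_sys[of j k] ij unfolding le'_def J_def by blast
    qed
    show "fst a \<in> SAlgf" if "a \<in> J" for a
      using J_alg that by simp
    show "t' a b \<in> alg_hom (fst b) (fst a)" "t' a b ` acar (fst b) = acar (fst a)"
      if "le' a b" for a b
      using adm_t[OF that] by (auto simp: adm_def)
    show "t' a a = (\<lambda>z\<in>acar (fst a). z)" if "a \<in> J" for a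
      by (rule t_eq[OF that that adm_id[OF that]])
    show "t' a c = compose (acar (fst c)) (t' a b) (t' b c)"
      if "a \<in> J" "b \<in> J" "c \<in> J" "le' a b" "le' b c" for a b c
      by (rule t_eq[OF that(1,3) adm_comp[OF that(1-3) adm_t[OF that(4)] adm_t[OF that(5)]]])
  qed
  let ?c = "colim_rel J le' fst t'" and ?L = "SSpf_colim J le' fst t'"
  have rel: "((a, u), (b, v)) \<in> ?c R \<longleftrightarrow> Ar X (fst a) R u (snd a) = Ar X (fst b) R v (snd b)"
    if "R \<in> SAlgf" "a \<in> J" "b \<in> J" "u \<in> alg_hom (fst a) R" "v \<in> alg_hom (fst b) R" for a b u v R
  proof
    assume "((a, u), (b, v)) \<in> ?c R"
    then obtain c where c: "c \<in> J" "le' a c" "le' b c"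
      "compose (acar (fst c)) u (t' a c) = compose (acar (fst c)) v (t' b c)"
      by (auto simp: colim_rel_def)
    have "Ar X (fst a) R u (snd a) = Ar X (fst c) R (compose (acar (fst c)) u (t' a c)) (snd c)"
      using adm_t[OF c(2)] fcomp[of "fst c" "fst a" R "t' a c" u "snd c"] J_alg c(1) that
      by (simp add: adm_def)
    moreover have "Ar X (fst b) R v (snd b) = Ar X (fst c) R (compose (acar (fst c)) v (t' b c)) (snd c)"
      using adm_t[OF c(3)] fcomp[of "fst c" "fst b" R "t' b c" v "snd c"] J_alg c(1) that
      by (simp add: adm_def)
    ultimately show "Ar X (fst a) R u (snd a) = Ar X (fst b) R v (snd b)"
      using c(4) by simp
  next
    assume eq: "Ar X (fst a) R u (snd a) = Ar X (fst b) R v (snd b)"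
    obtain i j where ij: "i \<in> I" "j \<in> I" "a = (A i, x i)" "b = (A j, x j)"
      using \<open>a \<in> J\<close> \<open>b \<in> J\<close> by (auto simp: J_def)
    have "((i, u), (j, v)) \<in> colim_rel I le A t R"
      using cone(3)[of R i j u v] eq that ij by simp
    then obtain k where k: "k \<in> I" "le i k" "le j k"
      "compose (acar (A k)) u (t i k) = compose (acar (A k)) v (t j k)"
      by (auto simp: colim_rel_def)
    have kJ: "(A k, x k) \<in> J"
      using k by (simp add: J_def)
    have "t' a (A k, x k) = t i k" "t' b (A k, x k) = t j k" "le' a (A k, x k)" "le' b (A k, x k)"
      using adm_sys[OF ij(1) k(1,2)] adm_sys[OF ij(2) k(1,3)] t_eq[OF that(2) kJ] t_eq[OF that(3) kJ] ij
      by (auto simp: le'_def)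
    then show "((a, u), (b, v)) \<in> ?c R"
      using that kJ k(4) by (force simp: colim_rel_def)
  qed
  define \<tau> where "\<tau> = (\<lambda>R K. let (a, u) = (SOME w. w \<in> K) in Ar X (fst a) R u (snd a))"
  have val: "\<tau> R (?c R `` {(a, u)}) = Ar X (fst a) R u (snd a)"
    if "R \<in> SAlgf" "a \<in> J" "u \<in> alg_hom (fst a) R" for R a u
  proof -
    obtain b v where bv: "(SOME w. w \<in> ?c R `` {(a, u)}) = (b, v)"
      by fastforce
    have "(a, u) \<in> ?c R `` {(a, u)}"
      using rel[of R a a u u] that by simp
    then have "(b, v) \<in> ?c R `` {(a, u)}"
      unfolding bv[symmetric] by (rule someI)
    then have "((a, u), (b, v)) \<in> ?c R" "b \<in> J" "v \<in> alg_hom (fst b) R"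
      by (auto simp: colim_rel_def)
    then show ?thesis
      using rel that unfolding \<tau>_def bv by auto
  qed
  have obE: "\<exists>a u. a \<in> J \<and> u \<in> alg_hom (fst a) R \<and> K = ?c R `` {(a, u)}"
    if "K \<in> Ob ?L R" for K R
    using that unfolding SSpf_colim_def by (force elim!: quotientE)
  have "nat_iso ?L X \<tau>"
    unfolding nat_iso_def nat_trans_def
  proof (intro conjI ballI)
    fix R :: "'k salg" assume R: "R \<in> SAlgf"
    show map: "\<tau> R \<in> Ob ?L R \<rightarrow> Ob X R"
    proof
      fix K assume "K \<in> Ob ?L R"
      then obtain a u where "a \<in> J" "u \<in> alg_hom (fst a) R" "K = ?c R `` {(a, u)}"
        using obE by blast
      then show "\<tau> R K \<in> Ob X R"
        using val R fmap J_alg by simp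
    qed
    show "bij_betw (\<tau> R) (Ob ?L R) (Ob X R)"
      unfolding bij_betw_def
    proof (intro conjI)
      show "inj_on (\<tau> R) (Ob ?L R)"
      proof (rule inj_onI)
        fix K K' assume K: "K \<in> Ob ?L R" "K' \<in> Ob ?L R" "\<tau> R K = \<tau> R K'"
        obtain a u where a: "a \<in> J" "u \<in> alg_hom (fst a) R" "K = ?c R `` {(a, u)}"
          using obE K(1) by blast
        obtain b v where b: "b \<in> J" "v \<in> alg_hom (fst b) R" "K' = ?c R `` {(b, v)}"
          using obE K(2) by blast
        have "((a, u), (b, v)) \<in> ?c R"
          using rel val R a b K(3) by simp
        then show "K = K'"
          using equiv_class_eq[OF colim_rel_equiv[OF sys']] a b by simp
      qed
      have "y \<in> \<tau> R ` Ob ?L R" if y: "y \<in> Ob X R" for y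
      proof -
        obtain i u where i: "i \<in> I" "u \<in> alg_hom (A i) R" "y = Ar X (A i) R u (x i)"
          using cone(2)[OF R y] by blast
        then have iJ: "(A i, x i) \<in> J"
          by (simp add: J_def)
        then have "?c R `` {((A i, x i), u)} \<in> Ob ?L R"
          using i by (auto simp: SSpf_colim_def intro!: quotientI)
        moreover have "\<tau> R (?c R `` {((A i, x i), u)}) = y"
          using val[OF R iJ] i by simp
        ultimately show ?thesis
          by blast
      qed
      then show "\<tau> R ` Ob ?L R = Ob X R"
        using map by blast
    qed
  next
    fix R S :: "'k salg" and \<phi> K
    assume R: "R \<in> SAlgf" and S: "S \<in> SAlgf" and \<phi>: "\<phi> \<in> alg_hom R S" and K: "K \<in> Ob ?L R"
    obtain a u where a: "a \<in> J" "u \<in> alg_hom (fst a) R" "K = ?c R `` {(a, u)}"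
      using obE K by blast
    have "\<tau> S (Ar ?L R S \<phi> K) = Ar X (fst a) S (compose (acar (fst a)) \<phi> u) (snd a)"
      using SSpf_colim_Ar[OF sys' a(1,2) \<phi>] val[OF S a(1)] alg_hom_compose[OF J_alg(1)[OF a(1)] a(2) \<phi>] a
      by simp
    also have "\<dots> = Ar X R S \<phi> (\<tau> R K)"
      using fcomp[OF J_alg(1)[OF a(1)] R S a(2) \<phi> J_alg(2)[OF a(1)]] val[OF R a(1,2)] a by simp
    finally show "\<tau> S (Ar ?L R S \<phi> K) = Ar X R S \<phi> (\<tau> R K)" .
  qed
  then show ?thesis
    using X sys' unfolding formal_superscheme_def by blast
qed


section \<open>Super-coalgebras\<close>

record ('c, 'k) scoalg =
  csp :: "('c, 'k) svs"
  comult :: "('c \<Rightarrow> 'k) \<Rightarrow> 'c \<times> 'c \<Rightarrow> 'k"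
  counit :: "('c \<Rightarrow> 'k) \<Rightarrow> 'k"

abbreviation ccar :: "('c, 'k::field) scoalg \<Rightarrow> ('c \<Rightarrow> 'k) set" where
  "ccar C \<equiv> svcar (csp C)"

definition super_coalgebra :: "('c, 'k::field) scoalg \<Rightarrow> bool" where
  "super_coalgebra C \<longleftrightarrow> super_space (csp C) \<and>
     super_hom (csp C) (tensor (csp C) (csp C)) (comult C) \<and>
     (\<forall>x\<in>ccar C. \<forall>y\<in>ccar C. counit C (x + y) = counit C x + counit C y) \<and>
     (\<forall>a. \<forall>x\<in>ccar C. counit C (fscale a x) = a * counit C x) \<and>
     (\<forall>x\<in>csp C 1. counit C x = 0) \<and>
     (\<forall>x\<in>ccar C. \<forall>a b c.
        tmap (comult C) id (comult C x) ((a, b), c) =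
        tmap id (comult C) (comult C x) (a, (b, c))) \<and>
     (\<forall>x\<in>ccar C. (\<lambda>b. counit C (\<lambda>a. comult C x (a, b))) = x \<and>
                 (\<lambda>a. counit C (\<lambda>b. comult C x (a, b))) = x)"

definition super_cocommutative :: "('c, 'k::field) scoalg \<Rightarrow> bool" where
  "super_cocommutative C \<longleftrightarrow>
     (\<forall>x\<in>ccar C. comult C x = braid (csp C) (csp C) (comult C x))"

definition coalg_hom ::
  "('c, 'k::field) scoalg \<Rightarrow> ('d, 'k) scoalg \<Rightarrow> (('c \<Rightarrow> 'k) \<Rightarrow> ('d \<Rightarrow> 'k)) \<Rightarrow> bool" where
  "coalg_hom C D \<phi> \<longleftrightarrow> super_hom (csp C) (csp D) \<phi> \<and>
     (\<forall>x\<in>ccar C. comult D (\<phi> x) = tmap \<phi> \<phi> (comult C x) \<and> counit D (\<phi> x) = counit C x)"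

text \<open>
  The product over \<open>R\<close> of \<open>u\<close> and \<open>v\<close> in the base change of \<open>C\<close> to \<open>R\<close>, as an element of the base change
  of the tensor square of \<open>C\<close>: for homogeneous \<open>c\<close>, \<open>s\<close> it maps \<open>ptens r c\<close> and \<open>ptens s d\<close> to
  \<open>koszul |c| |s|\<close> times \<open>ptens (r s) (ptens c d)\<close>.
\<close>

definition base_prod ::
  "'k::field salg \<Rightarrow> ('c, 'k) scoalg \<Rightarrow> (nat \<times> 'c \<Rightarrow> 'k) \<Rightarrow> (nat \<times> 'c \<Rightarrow> 'k) \<Rightarrow>
   nat \<times> ('c \<times> 'c) \<Rightarrow> 'k" where
  "base_prod R C u v = (\<lambda>(n, (c, d)). \<Sum>p\<in>{0, 1}. \<Sum>q\<in>{0, 1}.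
     koszul p q * amult R (\<lambda>m. tmap id (hcomp (csp C) p) u (m, c))
                          (\<lambda>m. tmap (hcomp (asp R) q) id v (m, d)) n)"

definition SSp :: "('c, 'k::field) scoalg \<Rightarrow> ('k, nat \<times> 'c \<Rightarrow> 'k) kfun" where
  "SSp C =
     \<lparr>Ob = (\<lambda>R. {u \<in> tensor (asp R) (csp C) 0.
              tmap id (comult C) u = base_prod R C u u \<and>
              (\<lambda>n. counit C (\<lambda>c. u (n, c))) = aone R}),
      Ar = (\<lambda>R S \<psi>. tmap \<psi> id)\<rparr>"

definition SSp_map ::
  "(('c \<Rightarrow> 'k) \<Rightarrow> ('d \<Rightarrow> 'k)) \<Rightarrow> 'k::field salg \<Rightarrow> (nat \<times> 'c \<Rightarrow> 'k) \<Rightarrow> nat \<times> 'd \<Rightarrow> 'k" where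
  "SSp_map \<phi> = (\<lambda>R. tmap id \<phi>)"

text \<open>
  The quasi-inverse of \<open>SSp\<close> is determined only up to isomorphism: a value at \<open>X\<close> is a
  super-cocommutative super-coalgebra \<open>C\<close> together with an isomorphism from \<open>SSp C\<close> to \<open>X\<close>, and
  a morphism \<open>f\<close> then corresponds to the coalgebra morphism inducing \<open>f\<close> under these isomorphisms.
\<close>

definition O_star ::
  "('k::field, 'x) kfun \<Rightarrow> ('c, 'k) scoalg \<Rightarrow> ('k salg \<Rightarrow> (nat \<times> 'c \<Rightarrow> 'k) \<Rightarrow> 'x) \<Rightarrow> bool" where
  "O_star X C \<alpha> \<longleftrightarrow> super_coalgebra C \<and> super_cocommutative C \<and> nat_iso (SSp C) X \<alpha>"

definition O_star_map ::
  "('k salg \<Rightarrow> 'x \<Rightarrow> 'y) \<Rightarrow>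
   ('c, 'k::field) scoalg \<Rightarrow> ('k salg \<Rightarrow> (nat \<times> 'c \<Rightarrow> 'k) \<Rightarrow> 'x) \<Rightarrow>
   ('d, 'k) scoalg \<Rightarrow> ('k salg \<Rightarrow> (nat \<times> 'd \<Rightarrow> 'k) \<Rightarrow> 'y) \<Rightarrow>
   (('c \<Rightarrow> 'k) \<Rightarrow> ('d \<Rightarrow> 'k)) \<Rightarrow> bool" where
  "O_star_map f C \<alpha> D \<beta> \<phi> \<longleftrightarrow> coalg_hom C D \<phi> \<and>
     nat_eq (SSp C) (nat_comp f \<alpha>) (nat_comp \<beta> (SSp_map \<phi>))"


section \<open>Supercomodules\<close>

record ('m, 'd, 'k) scomod =
  msp :: "('m, 'k) svs"
  coact :: "('m \<Rightarrow> 'k) \<Rightarrow> 'm \<times> 'd \<Rightarrow> 'k"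

abbreviation mcar :: "('m, 'd, 'k::field) scomod \<Rightarrow> ('m \<Rightarrow> 'k) set" where
  "mcar M \<equiv> svcar (msp M)"

definition supercomodule :: "('d, 'k::field) scoalg \<Rightarrow> ('m, 'd, 'k) scomod \<Rightarrow> bool" where
  "supercomodule D M \<longleftrightarrow> super_space (msp M) \<and>
     super_hom (msp M) (tensor (msp M) (csp D)) (coact M) \<and>
     (\<forall>x\<in>mcar M. \<forall>m a b.
        tmap (coact M) id (coact M x) ((m, a), b) =
        tmap id (comult D) (coact M x) (m, (a, b))) \<and>
     (\<forall>x\<in>mcar M. (\<lambda>m. counit D (\<lambda>a. coact M x (m, a))) = x)"

definition comod_hom ::
  "('m, 'd, 'k::field) scomod \<Rightarrow> ('n, 'd, 'k) scomod \<Rightarrow> (('m \<Rightarrow> 'k) \<Rightarrow> ('n \<Rightarrow> 'k)) \<Rightarrow> bool" where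
  "comod_hom M N g \<longleftrightarrow> super_hom (msp M) (msp N) g \<and>
     (\<forall>x\<in>mcar M. coact N (g x) = tmap g id (coact M x))"

text \<open>Here \<open>\<theta>\<close> is a right and \<open>\<eta>\<close> a left coaction; the two sides of the equalizer differ by the associator.\<close>

definition cotensor ::
  "('m, 'k::field) svs \<Rightarrow> (('m \<Rightarrow> 'k) \<Rightarrow> ('m \<times> 'd \<Rightarrow> 'k)) \<Rightarrow>
   ('n, 'k) svs \<Rightarrow> (('n \<Rightarrow> 'k) \<Rightarrow> ('d \<times> 'n \<Rightarrow> 'k)) \<Rightarrow> ('m \<times> 'n, 'k) svs" where
  "cotensor V \<theta> W \<eta> p = {t \<in> tensor V W p.
     \<forall>m d n. tmap \<theta> id t ((m, d), n) = tmap id \<eta> t (m, (d, n))}"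

text \<open>
  The functor \<open>f\<^sup>*\<close> for a coalgebra morphism \<open>\<phi>\<close> to \<open>D\<close> from \<open>C\<close>, which is a left \<open>D\<close>-comodule
  through \<open>\<phi>\<close>; the \<open>C\<close>-coaction is induced by the coproduct of \<open>C\<close>.
\<close>

definition pullback ::
  "('c, 'k::field) scoalg \<Rightarrow> (('c \<Rightarrow> 'k) \<Rightarrow> ('d \<Rightarrow> 'k)) \<Rightarrow> ('m, 'd, 'k) scomod \<Rightarrow>
   ('m \<times> 'c, 'c, 'k) scomod" where
  "pullback C \<phi> M =
     \<lparr>msp = cotensor (msp M) (coact M) (csp C) (\<lambda>x. tmap \<phi> id (comult C x)),
      coact = (\<lambda>t. (\<lambda>((m, c), c'). tmap id (comult C) t (m, (c, c'))))\<rparr>"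

definition pullback_map ::
  "(('m \<Rightarrow> 'k) \<Rightarrow> ('n \<Rightarrow> 'k)) \<Rightarrow> ('m \<times> 'c \<Rightarrow> 'k::field) \<Rightarrow> 'n \<times> 'c \<Rightarrow> 'k" where
  "pullback_map g = tmap g id"

text \<open>Kernels and images of supercomodules over a field are those of the underlying spaces.\<close>

definition exact_at ::
  "('l, 'd, 'k::field) scomod \<Rightarrow> (('l \<Rightarrow> 'k) \<Rightarrow> ('m \<Rightarrow> 'k)) \<Rightarrow>
   ('m, 'd, 'k) scomod \<Rightarrow> (('m \<Rightarrow> 'k) \<Rightarrow> ('n \<Rightarrow> 'k)) \<Rightarrow> bool" where
  "exact_at L g M h \<longleftrightarrow> g ` mcar L = {x \<in> mcar M. h x = 0}"

text \<open>
  The index type \<open>'i\<close> of the coalgebras also serves as the universe for the comodules.  It should be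
  infinite: then it accommodates every finite-dimensional comodule, and by local finiteness of
  comodules neither exactness nor faithfulness depends on its choice.
\<close>

definition pullback_exact ::
  "('i, 'k::field) scoalg \<Rightarrow> ('i, 'k) scoalg \<Rightarrow> (('i \<Rightarrow> 'k) \<Rightarrow> ('i \<Rightarrow> 'k)) \<Rightarrow> bool" where
  "pullback_exact C D \<phi> \<longleftrightarrow>
     (\<forall>(L :: ('i, 'i, 'k) scomod) (M :: ('i, 'i, 'k) scomod) (N :: ('i, 'i, 'k) scomod) g h.
        supercomodule D L \<longrightarrow> supercomodule D M \<longrightarrow> supercomodule D N \<longrightarrow>
        comod_hom L M g \<longrightarrow> comod_hom M N h \<longrightarrow> exact_at L g M h \<longrightarrow>
        exact_at (pullback C \<phi> L) (pullback_map g) (pullback C \<phi> M) (pullback_map h))"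

definition pullback_faithful ::
  "('i, 'k::field) scoalg \<Rightarrow> ('i, 'k) scoalg \<Rightarrow> (('i \<Rightarrow> 'k) \<Rightarrow> ('i \<Rightarrow> 'k)) \<Rightarrow> bool" where
  "pullback_faithful C D \<phi> \<longleftrightarrow>
     (\<forall>(M :: ('i, 'i, 'k) scomod) (N :: ('i, 'i, 'k) scomod) g h.
        supercomodule D M \<longrightarrow> supercomodule D N \<longrightarrow> comod_hom M N g \<longrightarrow> comod_hom M N h \<longrightarrow>
        (\<forall>t\<in>mcar (pullback C \<phi> M). pullback_map g t = pullback_map h t) \<longrightarrow>
        (\<forall>x\<in>mcar M. g x = h x))"

definition faithfully_flat ::
  "'i itself \<Rightarrow> ('k::field, 'x) kfun \<Rightarrow> ('k, 'y) kfun \<Rightarrow> ('k salg \<Rightarrow> 'x \<Rightarrow> 'y) \<Rightarrow> bool" where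
  "faithfully_flat (_ :: 'i itself) X Y f \<longleftrightarrow>
     (\<exists>(C :: ('i, 'k) scoalg) \<alpha> (D :: ('i, 'k) scoalg) \<beta> \<phi>.
        O_star X C \<alpha> \<and> O_star Y D \<beta> \<and> O_star_map f C \<alpha> D \<beta> \<phi> \<and>
        pullback_exact C D \<phi> \<and> pullback_faithful C D \<phi>)"


section \<open>Coequalizers of formal superschemes\<close>

text \<open>The test objects take values in subsets of the type \<open>'z\<close>, which is arbitrary.\<close>

definition coequalizer ::
  "'z itself \<Rightarrow> ('k::field, 'p) kfun \<Rightarrow> ('k, 'x) kfun \<Rightarrow> ('k, 'y) kfun \<Rightarrow>
   ('k salg \<Rightarrow> 'p \<Rightarrow> 'x) \<Rightarrow> ('k salg \<Rightarrow> 'p \<Rightarrow> 'x) \<Rightarrow> ('k salg \<Rightarrow> 'x \<Rightarrow> 'y) \<Rightarrow> bool" where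
  "coequalizer (_ :: 'z itself) P X Y p q f \<longleftrightarrow>
     nat_trans P X p \<and> nat_trans P X q \<and> nat_trans X Y f \<and>
     nat_eq P (nat_comp f p) (nat_comp f q) \<and>
     (\<forall>(Z :: ('k, 'z) kfun) g. formal_superscheme Z \<longrightarrow> nat_trans X Z g \<longrightarrow>
        nat_eq P (nat_comp g p) (nat_comp g q) \<longrightarrow>
        (\<exists>h. nat_trans Y Z h \<and> nat_eq X (nat_comp h f) g \<and>
           (\<forall>h'. nat_trans Y Z h' \<and> nat_eq X (nat_comp h' f) g \<longrightarrow> nat_eq Y h' h)))"

end

theory Submission imports Defs begin

text \<open>
  Write \<open>\<phi> : C \<rightarrow> D\<close> for the map of super-coalgebras corresponding to \<open>f\<close>. Testing faithfulness of the
  pullback on quotient maps out of \<open>D\<close> and \<open>ker \<phi>\<close> shows that \<open>\<phi>\<close> is onto and that its kernel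
  consists of the differences of the two projections of the cotensor square. Points of \<open>SSp C\<close> are
  algebra homomorphisms on functionals, so a finite-dimensional sub-coalgebra \<open>E\<close> of \<open>C\<close> has a
  universal point \<open>u\<close>, with values in the dual algebra of \<open>E\<close>. Given \<open>g : SSp C \<rightarrow> Z\<close> equalizing the
  two projections, the point \<open>g(u)\<close> comes from a homomorphism \<open>\<alpha> : B\<^sub>0 \<rightarrow> E'\<^sup>*\<close> for some larger \<open>E'\<close>.
  On the two tautological points of the cotensor square of \<open>E'\<close> the values of \<open>g\<close> agree, so the
  functionals in the image of \<open>\<alpha>\<close> vanish on \<open>ker \<phi> \<inter> E\<close>, that is, they restrict to functionals of
  \<open>\<phi>(E)\<close>, and \<open>g(u)\<close> descends to the dual algebra of \<open>\<phi>(E)\<close>. The descended points are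
  compatible, since \<open>Z\<close> respects injections, and every point of \<open>SSp D\<close> is a specialisation of the universal
  point of some \<open>\<phi>(E)\<close>; this gives existence, and uniqueness follows in the same way.
\<close>

text \<open>The target \<open>Z\<close> is only a filtered limit of representable functors, so a
  point of \<open>Z\<close> is controlled by one finite-dimensional algebra at a time, while
  \<open>C\<close> may be infinite-dimensional; this forces the work on finite-dimensional
  sub-coalgebras. Passing from \<open>E\<close> to a larger one is natural: an element of the kernel
  of \<phi> in \<open>E\<close> is a difference of projections of a tensor in the cotensor square of
  \<open>C\<close>, and the factors of this tensor need not lie in \<open>E\<close>. Finitely many
  elements span this kernel, so one finite-dimensional enlargement serves them all. The transition
  maps of \<open>Z\<close> are induced by surjections, hence a homomorphism out of the presenting
  algebra is determined by the point it produces; this turns an equality of values of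
  \<open>g\<close> into an equality of homomorphisms, to which functionals can be applied. Points
  need values in two kinds of algebras: duals of sub-coalgebras and the dual of a cotensor square.
  Both are built as algebras of supercommuting operators with a separating functional, so that no
  coalgebra structure, with its signs, has to be put on the cotensor square.\<close>

text \<open>Parities are added as elements of \<open>\<int>/2\<close>; these rules would turn them into bit strings.\<close>

declare add_bit_eq_xor [simp del] mult_bit_eq_and [simp del] xor_bit_def [simp del]

section \<open>Graded linear algebra\<close>

lemma bit_add_self [simp]: "p + p = (0::bit)" "p + (p + q) = q"
  by (cases p; simp; cases q; simp)+

lemma bit_add_eq_iff: "p + q = (r::bit) \<longleftrightarrow> q = p + r"
  by (cases p; cases q; cases r) simp_all

lemma koszul_add: "koszul (p + p') q = (koszul p q * koszul p' q :: 'k::field)"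
  "koszul p (q + q') = (koszul p q * koszul p q' :: 'k::field)"
  by (cases p; cases p'; cases q; cases q'; simp add: koszul_def)+

lemma koszul_commute: "koszul p q = koszul q p"
  by (auto simp: koszul_def)

lemma koszul_simps [simp]: "koszul 0 q = 1" "koszul p 0 = 1"
  "koszul p q * koszul p q = (1 :: 'k::field)" "koszul p q * (koszul p q * x) = (x :: 'k)"
  by (auto simp: koszul_def)

section \<open>Functionals and linear maps on subspaces of function spaces\<close>

definition lform :: "('i \<Rightarrow> 'k::field) set \<Rightarrow> (('i \<Rightarrow> 'k) \<Rightarrow> 'k) \<Rightarrow> bool" where
  "lform S f \<longleftrightarrow> (\<forall>x\<in>S. \<forall>y\<in>S. f (x + y) = f x + f y) \<and> (\<forall>c. \<forall>x\<in>S. f (fscale c x) = c * f x)"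

lemma lformD:
  assumes "lform S f"
  shows "x \<in> S \<Longrightarrow> y \<in> S \<Longrightarrow> f (x + y) = f x + f y" "x \<in> S \<Longrightarrow> f (fscale c x) = c * f x"
  using assms by (auto simp: lform_def)

lemma lform_zero:
  assumes "lform S f" "0 \<in> S"
  shows "f 0 = 0" "f (\<lambda>i. 0) = 0"
  using lformD(2)[OF assms, of 0] by (simp_all add: fscale_def zero_fun_def)

lemma lform_diff:
  assumes "lform S f" "fs.subspace S" "x \<in> S" "y \<in> S"
  shows "f (x - y) = f x - f y"
proof -
  have "f ((x - y) + y) = f (x - y) + f y"
    using lformD(1)[OF assms(1) fs.subspace_diff[OF assms(2-4)] assms(4)] .
  then show ?thesis by simp
qed

lemma lform_eval [simp]: "lform S (\<lambda>x. x i)"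
  by (simp add: lform_def fscale_def)

lemma lform_subset: "lform S f \<Longrightarrow> T \<subseteq> S \<Longrightarrow> lform T f"
  unfolding lform_def by blast

lemma lform_add: "lform S f \<Longrightarrow> lform S g \<Longrightarrow> lform S (\<lambda>x. f x + g x)"
  by (simp add: lform_def algebra_simps)

lemma lform_scaled: "lform S f \<Longrightarrow> lform S (\<lambda>x. c * f x)"
  by (simp add: lform_def algebra_simps)

text \<open>Maps between function spaces are handled through their coordinate functionals, so that
  statements about functionals, such as \<open>tensor_fubini\<close>, apply to them.\<close>

lemma lin_on_iff_lform: "lin_on S g \<longleftrightarrow> (\<forall>j. lform S (\<lambda>x. g x j))"
  by (auto simp: lin_on_def lform_def fscale_def fun_eq_iff)

lemma lform_lin_on: "lin_on S g \<Longrightarrow> lform S (\<lambda>x. g x j)"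
  by (simp add: lin_on_iff_lform)

lemma lin_on_subset: "lin_on S g \<Longrightarrow> T \<subseteq> S \<Longrightarrow> lin_on T g"
  unfolding lin_on_def by blast

lemma lform_comp:
  assumes "lin_on S g" "\<And>x. x \<in> S \<Longrightarrow> g x \<in> T" "lform T f"
  shows "lform S (\<lambda>x. f (g x))"
  using assms by (simp add: lform_def lin_on_def)

lemma lin_on_comp:
  assumes "lin_on S g" "\<And>x. x \<in> S \<Longrightarrow> g x \<in> T" "lin_on T f"
  shows "lin_on S (\<lambda>x. f (g x))"
  using assms by (simp add: lin_on_def)

lemma lin_on_id [simp]: "lin_on S (\<lambda>x. x)" "lin_on S id"
  by (simp_all add: lin_on_def)

lemma lin_on_zero:
  assumes "lin_on S g" "0 \<in> S"
  shows "g 0 = 0"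
proof -
  have "g (fscale 0 0) = fscale 0 (g 0)"
    using assms unfolding lin_on_def by blast
  then show ?thesis by simp
qed

lemma lin_on_diff:
  assumes "lin_on S g" "fs.subspace S" "x \<in> S" "y \<in> S"
  shows "g (x - y) = g x - g y"
  using lform_diff[OF lform_lin_on[OF assms(1)] assms(2-)] by (simp add: fun_eq_iff)

lemma lin_on_span_image:
  assumes "lin_on (fs.span B) g"
  shows "g ` fs.span B \<subseteq> fs.span (g ` B)"
proof
  fix y assume "y \<in> g ` fs.span B"
  then obtain x where x: "x \<in> fs.span B" "y = g x"
    by blast
  have "x \<in> fs.span B \<and> g x \<in> fs.span (g ` B)"
    using x(1)
  proof (induction rule: fs.span_induct_alt)
    case base
    show "0 \<in> fs.span B \<and> g 0 \<in> fs.span (g ` B)"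
      using lin_on_zero[OF assms fs.span_zero] fs.span_zero by metis
  next
    case (step c x y)
    have "fscale c x \<in> fs.span B" "x \<in> fs.span B"
      using step by (auto intro: fs.span_scale fs.span_base)
    then have "g (fscale c x + y) = fscale c (g x) + g y"
      using assms step by (simp add: lin_on_def)
    moreover have "fscale c (g x) \<in> fs.span (g ` B)"
      using step by (auto intro: fs.span_scale fs.span_base)
    ultimately show "fscale c x + y \<in> fs.span B \<and> g (fscale c x + y) \<in> fs.span (g ` B)"
      using step \<open>fscale c x \<in> fs.span B\<close> fs.span_add by metis
  qed
  then show "y \<in> fs.span (g ` B)"
    using x by simp
qed

lemma subspace_lin_image:
  assumes "lin_on S g" "fs.subspace S"
  shows "fs.subspace (g ` S)"
  unfolding fs.subspace_def
proof (intro conjI ballI allI)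
  show "0 \<in> g ` S"
    using lin_on_zero[OF assms(1) fs.subspace_0[OF assms(2)]] fs.subspace_0[OF assms(2)] by force
  show "x + y \<in> g ` S" if xy: "x \<in> g ` S" "y \<in> g ` S" for x y
  proof -
    obtain a b where ab: "a \<in> S" "b \<in> S" "x = g a" "y = g b"
      using xy by blast
    then have "x + y = g (a + b)"
      using assms(1) by (simp add: lin_on_def)
    then show ?thesis
      using fs.subspace_add[OF assms(2) ab(1,2)] by blast
  qed
  show "fscale c x \<in> g ` S" if x: "x \<in> g ` S" for c x
  proof -
    obtain a where a: "a \<in> S" "x = g a"
      using x by blast
    then have "fscale c x = g (fscale c a)"
      using assms(1) by (simp add: lin_on_def)
    then show ?thesis
      using fs.subspace_scale[OF assms(2) a(1)] by blast
  qed
qed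

section \<open>Homogeneous components\<close>

lemma super_spaceD:
  assumes "super_space V"
  shows "fs.subspace (V p)" "0 \<in> V p" "x \<in> V p \<Longrightarrow> y \<in> V p \<Longrightarrow> x + y \<in> V p"
    "x \<in> V p \<Longrightarrow> y \<in> V p \<Longrightarrow> x - y \<in> V p"
    "x \<in> V p \<Longrightarrow> fscale c x \<in> V p" "x \<in> V p \<Longrightarrow> x \<in> V (p + 1) \<Longrightarrow> x = 0"
    "x \<in> V p \<Longrightarrow> x \<in> V q \<Longrightarrow> p \<noteq> q \<Longrightarrow> x = 0"
proof -
  show sub: "fs.subspace (V p)" for p
    using assms by (simp add: super_space_def)
  show "0 \<in> V p" "x \<in> V p \<Longrightarrow> y \<in> V p \<Longrightarrow> x + y \<in> V p" "x \<in> V p \<Longrightarrow> y \<in> V p \<Longrightarrow> x - y \<in> V p"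
    "x \<in> V p \<Longrightarrow> fscale c x \<in> V p"
    using sub by (auto intro: fs.subspace_0 fs.subspace_add fs.subspace_diff fs.subspace_scale)
  show *: "x \<in> V p \<Longrightarrow> x \<in> V (p + 1) \<Longrightarrow> x = 0" for p
    using assms by (cases p) (auto simp: super_space_def)
  show "x \<in> V p \<Longrightarrow> x \<in> V q \<Longrightarrow> p \<noteq> q \<Longrightarrow> x = 0"
    using *[of 0] by (cases p; cases q) auto
qed

lemma svcar_subspace: "super_space V \<Longrightarrow> fs.subspace (svcar V)"
  using svcar_closed svcar_homogeneous super_spaceD(2) unfolding fs.subspace_def by blast

lemma svcarD:
  assumes "super_space V"
  shows "0 \<in> svcar V" "(\<lambda>i. 0) \<in> svcar V" "x \<in> svcar V \<Longrightarrow> y \<in> svcar V \<Longrightarrow> x - y \<in> svcar V"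
    "x \<in> svcar V \<Longrightarrow> (\<lambda>i. c * x i) \<in> svcar V" "x \<in> svcar V \<Longrightarrow> (\<lambda>i. x i * c) \<in> svcar V"
proof -
  show 0: "0 \<in> svcar V"
    by (rule fs.subspace_0[OF svcar_subspace[OF assms]])
  show "(\<lambda>i. 0) \<in> svcar V"
    using 0 by (simp add: zero_fun_def)
  show "x \<in> svcar V \<Longrightarrow> y \<in> svcar V \<Longrightarrow> x - y \<in> svcar V"
    by (rule fs.subspace_diff[OF svcar_subspace[OF assms]])
  show "x \<in> svcar V \<Longrightarrow> (\<lambda>i. c * x i) \<in> svcar V" "x \<in> svcar V \<Longrightarrow> (\<lambda>i. x i * c) \<in> svcar V"
    using svcar_closed(2)[OF assms, of x x c] by (simp_all add: fscale_def mult.commute)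
qed

lemma hcomp_eq:
  assumes V: "super_space V" and "u \<in> V p" "x - u \<in> V (p + 1)"
  shows "hcomp V p x = u"
  unfolding hcomp_def
proof (rule the_equality)
  fix u' assume u': "u' \<in> V p \<and> x - u' \<in> V (p + 1)"
  have "u' - u \<in> V p"
    using u' assms super_spaceD(4) by blast
  moreover have "u' - u = (x - u) - (x - u')" by simp
  then have "u' - u \<in> V (p + 1)"
    using u' assms super_spaceD(4) by metis
  ultimately have "u' - u = 0"
    using super_spaceD(6)[OF V] by blast
  then show "u' = u" by simp
qed (use assms in simp)

lemma hcomp_add:
  assumes V: "super_space V" and "a \<in> V 0" "b \<in> V 1"
  shows "hcomp V 0 (a + b) = a" "hcomp V 1 (a + b) = b"
  using assms by (auto intro!: hcomp_eq)

lemma hcomp_in: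
  assumes V: "super_space V" and "x \<in> svcar V"
  shows "hcomp V p x \<in> V p" "hcomp V 0 x + hcomp V 1 x = x"
proof -
  obtain a b where "x = a + b" "a \<in> V 0" "b \<in> V 1"
    using assms by (auto simp: svcar_def)
  then show "hcomp V p x \<in> V p" "hcomp V 0 x + hcomp V 1 x = x"
    using hcomp_add[OF V] by (cases p; simp)+
qed

lemma hcomp_lin:
  assumes V: "super_space V"
  shows "lin_on (svcar V) (hcomp V p)"
  unfolding lin_on_def
proof (intro conjI ballI allI)
  fix x y assume xy: "x \<in> svcar V" "y \<in> svcar V"
  have 1: "x - hcomp V p x = hcomp V (p + 1) x" if "x \<in> svcar V" for x p
    using hcomp_in(2)[OF V that] by (cases p) (auto simp: algebra_simps)
  show "hcomp V p (x + y) = hcomp V p x + hcomp V p y"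
  proof (rule hcomp_eq[OF V])
    show "hcomp V p x + hcomp V p y \<in> V p"
      using hcomp_in[OF V] xy super_spaceD(3)[OF V] by blast
    have "x + y - (hcomp V p x + hcomp V p y) = (x - hcomp V p x) + (y - hcomp V p y)"
      by (simp add: algebra_simps)
    then show "x + y - (hcomp V p x + hcomp V p y) \<in> V (p + 1)"
      using 1 hcomp_in[OF V] xy super_spaceD(3)[OF V] by metis
  qed
  show "hcomp V p (fscale c x) = fscale c (hcomp V p x)" for c
  proof (rule hcomp_eq[OF V])
    show "fscale c (hcomp V p x) \<in> V p"
      using hcomp_in[OF V] xy super_spaceD(5)[OF V] by blast
    have "fscale c x - fscale c (hcomp V p x) = fscale c (x - hcomp V p x)"
      by (simp add: fs.scale_right_diff_distrib)
    then show "fscale c x - fscale c (hcomp V p x) \<in> V (p + 1)"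
      using 1 hcomp_in[OF V] xy super_spaceD(5)[OF V] by metis
  qed
qed

lemma svcar_mono: "(\<And>p. V p \<subseteq> W p) \<Longrightarrow> svcar V \<subseteq> svcar W"
  unfolding svcar_def by blast

lemma super_space_sub:
  assumes "super_space V" "\<And>p. fs.subspace (V' p)" "\<And>p. V' p \<subseteq> V p"
  shows "super_space V'"
proof -
  have "x = 0" if "x \<in> V' 0" "x \<in> V' 1" for x
    using super_spaceD(7)[OF assms(1), of x 0 1] that assms(3) by auto
  moreover have "0 \<in> V' p" for p
    using assms(2) by (rule fs.subspace_0)
  ultimately show ?thesis
    using assms(2) by (auto simp: super_space_def)
qed

lemma hcomp_sub:
  assumes V: "super_space V" and V': "super_space V'" and sub: "\<And>p. V' p \<subseteq> V p" and x: "x \<in> svcar V'"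
  shows "hcomp V p x = hcomp V' p x"
proof (rule hcomp_eq[OF V])
  show "hcomp V' p x \<in> V p"
    using hcomp_in(1)[OF V' x] sub by blast
  have "x - hcomp V' p x = hcomp V' (p + 1) x"
    using hcomp_in(2)[OF V' x] by (cases p) (auto simp: algebra_simps)
  then show "x - hcomp V' p x \<in> V (p + 1)"
    using hcomp_in(1)[OF V' x, of "p + 1"] sub by auto
qed

lemma homogeneous_in_sub:
  assumes "super_space V" "super_space V'" "\<And>q. V' q \<subseteq> V q" "x \<in> V p" "x \<in> svcar V'"
  shows "x \<in> V' p"
proof -
  have "x = hcomp V' p x"
    using hcomp_sub[OF assms(1-3,5), of p] hcomp_homogeneous[OF assms(1,4), of p] by simp
  then show ?thesis
    using hcomp_in(1)[OF assms(2,5), of p] by simp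
qed

section \<open>Homogeneous maps of arbitrary degree and graded projections\<close>

definition dhom ::
  "bit \<Rightarrow> ('i, 'k::field) svs \<Rightarrow> ('j, 'k) svs \<Rightarrow> (('i \<Rightarrow> 'k) \<Rightarrow> ('j \<Rightarrow> 'k)) \<Rightarrow> bool" where
  "dhom d V W g \<longleftrightarrow> lin_on (svcar V) g \<and> (\<forall>p. \<forall>x\<in>V p. g x \<in> W (d + p))"

lemma super_hom_iff_dhom: "super_hom V W g \<longleftrightarrow> dhom 0 V W g"
  by (auto simp: super_hom_def dhom_def)

lemma dhomD:
  assumes "dhom d V W g"
  shows "lin_on (svcar V) g" "x \<in> V p \<Longrightarrow> g x \<in> W (d + p)"
  using assms by (auto simp: dhom_def)

lemma dhom_car:
  assumes "dhom d V W g" "super_space V" "super_space W" "x \<in> svcar V"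
  shows "g x \<in> svcar W"
proof -
  have "g x = g (hcomp V 0 x) + g (hcomp V 1 x)"
    using dhomD(1)[OF assms(1)] hcomp_in[OF assms(2,4)] svcar_homogeneous[OF assms(2)]
    unfolding lin_on_def by metis
  moreover have "g (hcomp V p x) \<in> svcar W" for p
    by (rule svcar_homogeneous[OF assms(3) dhomD(2)[OF assms(1) hcomp_in(1)[OF assms(2,4)]]])
  ultimately show ?thesis
    using svcar_closed(1)[OF assms(3)] by simp
qed

lemma dhom_id [simp]: "dhom 0 V V (\<lambda>x. x)" "dhom 0 V V id"
  by (auto simp: dhom_def)

lemma super_hom_id: "super_hom V V id"
  by (simp add: super_hom_iff_dhom)

lemma dhom_comp:
  assumes "super_space V" "super_space W" "dhom d V W g" "dhom e W U h"
  shows "dhom (e + d) V U (\<lambda>x. h (g x))"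
  using assms dhom_car[OF assms(3,1,2)] unfolding dhom_def
  by (auto intro: lin_on_comp simp: add.assoc)

lemma super_hom_hcomp:
  assumes "super_hom V W g" "super_space V" "super_space W" "x \<in> svcar V"
  shows "g (hcomp V p x) = hcomp W p (g x)"
proof -
  note g = assms(1)[unfolded super_hom_iff_dhom]
  have "g x = g (hcomp V 0 x) + g (hcomp V 1 x)"
    using dhomD(1)[OF g] hcomp_in[OF assms(2,4)] svcar_homogeneous[OF assms(2)]
    unfolding lin_on_def by metis
  moreover have "g (hcomp V p x) \<in> W p" for p
    using dhomD(2)[OF g hcomp_in(1)[OF assms(2,4), of p]] by simp
  ultimately show ?thesis
    using hcomp_add[OF assms(3), of "g (hcomp V 0 x)" "g (hcomp V 1 x)"] by (cases p) auto
qed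

lemma lin_on_eqI:
  assumes "super_space V" "lin_on (svcar V) g" "lin_on (svcar V) h" "x \<in> svcar V"
    and "\<And>p x. x \<in> V p \<Longrightarrow> g x = h x"
  shows "g x = h x"
proof -
  have "g x = g (hcomp V 0 x) + g (hcomp V 1 x)" "h x = h (hcomp V 0 x) + h (hcomp V 1 x)"
    using assms(2,3) hcomp_in[OF assms(1,4)] svcar_homogeneous[OF assms(1)]
    unfolding lin_on_def by metis+
  then show ?thesis
    using assms(5)[OF hcomp_in(1)[OF assms(1,4)]] by simp
qed

lemma subspace_projection:
  fixes U :: "('i \<Rightarrow> 'k::field) set"
  assumes "fs.subspace U"
  shows "\<exists>r. lin_on UNIV r \<and> (\<forall>x. r x \<in> U) \<and> (\<forall>x\<in>U. r x = x)"
proof -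
  interpret vector_space_pair "fscale :: 'k \<Rightarrow> ('i \<Rightarrow> 'k) \<Rightarrow> 'i \<Rightarrow> 'k" "fscale :: 'k \<Rightarrow> ('i \<Rightarrow> 'k) \<Rightarrow> 'i \<Rightarrow> 'k"
    by unfold_locales
  obtain r where r: "r ` UNIV \<subseteq> U" "Vector_Spaces.linear fscale fscale r" "\<forall>v\<in>U. r (id v) = v"
    using linear_exists_left_inverse_on[OF fs.linear_id assms] by auto
  interpret r: Vector_Spaces.linear fscale fscale r by fact
  show ?thesis
    using r by (intro exI[of _ r]) (auto simp: lin_on_def r.add r.scale)
qed

text \<open>A linear projection onto \<open>V' p\<close> ignores parity; splitting the argument with
  \<open>hcomp\<close> first and projecting the two parts separately gives an even map. Such
  projections serve both to shrink tensor factors and to realise quotients.\<close>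

lemma graded_projection:
  assumes V: "super_space V" and sub: "\<And>p. fs.subspace (V' p)" and le: "\<And>p. V' p \<subseteq> V p"
  shows "\<exists>r. super_hom V V' r \<and> (\<forall>x\<in>svcar V'. r x = x)"
proof -
  note V' = super_space_sub[OF V sub le]
  have "\<exists>r. lin_on UNIV r \<and> (\<forall>x. r x \<in> V' p) \<and> (\<forall>x\<in>V' p. r x = x)" for p
    by (rule subspace_projection[OF sub])
  then obtain r where r: "lin_on UNIV (r p)" "r p x \<in> V' p" "x \<in> V' p \<Longrightarrow> r p x = x" for p x
    by metis
  define s where "s x = r 0 (hcomp V 0 x) + r 1 (hcomp V 1 x)" for x
  have r0: "r p 0 = 0" for p
    using lin_on_zero[OF r(1)] by simp
  have "s x \<in> V' p" if "x \<in> V p" for x p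
    unfolding s_def hcomp_homogeneous[OF V that] using r(2)[of p x] r0 by (cases p) simp_all
  moreover have "lin_on (svcar V) s"
    using hcomp_lin[OF V] r(1) unfolding s_def lin_on_def
    by (simp add: fs.scale_right_distrib algebra_simps)
  moreover have "s x = x" if x: "x \<in> svcar V'" for x
    using hcomp_sub[OF V V' le x] hcomp_in[OF V' x] r(3) unfolding s_def by simp
  ultimately show ?thesis
    unfolding super_hom_def by blast
qed

section \<open>Tensor products and slices\<close>

lemma ptens_simps:
  "ptens (v + v') w = ptens v w + ptens v' w" "ptens v (w + w') = ptens v w + ptens v w'"
  "ptens (fscale c v) w = fscale c (ptens v w)" "ptens v (fscale c w) = fscale c (ptens v w)"
  by (auto simp: ptens_def fscale_def fun_eq_iff algebra_simps)

lemma tensor_subspace [simp]: "fs.subspace (tensor V W p)"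
  by (simp add: tensor_def)

lemma ptens_in: "v \<in> V q \<Longrightarrow> w \<in> W r \<Longrightarrow> q + r = p \<Longrightarrow> ptens v w \<in> tensor V W p"
  unfolding tensor_def by (rule fs.span_base) blast

text \<open>Span induction with the scalar absorbed into the left factor, so that the step only has
  to add one pure tensor of homogeneous vectors.\<close>

lemma tensor_induct [consumes 2, case_names zero add]:
  assumes "super_space V" "t \<in> tensor V W p" "P 0"
    and "\<And>v w q r y. v \<in> V q \<Longrightarrow> w \<in> W r \<Longrightarrow> q + r = p \<Longrightarrow> y \<in> tensor V W p \<Longrightarrow> P y \<Longrightarrow> P (ptens v w + y)"
  shows "P t"
proof -
  have "t \<in> tensor V W p \<and> P t"
    using assms(2)[unfolded tensor_def]
  proof (induction rule: fs.span_induct_alt)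
    case base
    show "0 \<in> tensor V W p \<and> P 0"
      using assms(3) fs.span_zero unfolding tensor_def by blast
  next
    case (step c x y)
    then obtain v w q r where *: "q + r = p" "v \<in> V q" "w \<in> W r" "x = ptens v w"
      by blast
    have "fscale c x = ptens (fscale c v) w" and cv: "fscale c v \<in> V q"
      using * super_spaceD[OF assms(1)] by (auto simp: ptens_simps)
    moreover have "ptens (fscale c v) w + y \<in> tensor V W p"
      using step * cv by (intro fs.subspace_add) (auto intro!: ptens_in simp: tensor_def[symmetric])
    ultimately show ?case
      using assms(4)[OF cv *(3,1)] step by metis
  qed
  then show ?thesis by simp
qed

lemma tensor_car_induct [consumes 2, case_names zero add]:
  assumes "super_space V" "t \<in> svcar (tensor V W)" "P 0"
    and "\<And>v w q r y. v \<in> V q \<Longrightarrow> w \<in> W r \<Longrightarrow> y \<in> svcar (tensor V W) \<Longrightarrow> P y \<Longrightarrow> P (ptens v w + y)"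
  shows "P t"
proof -
  obtain a b where ab: "t = a + b" "a \<in> tensor V W 0" "b \<in> tensor V W 1"
    using assms(2) by (auto simp: svcar_def)
  have car: "x + y \<in> svcar (tensor V W)" if "x \<in> tensor V W 0" "y \<in> tensor V W 1" for x y
    using that by (auto simp: svcar_def)
  have Pb: "P b"
    using assms(1) ab(3)
  proof (induction rule: tensor_induct)
    case (add v w q r y)
    then show ?case
      using assms(4)[OF add(1,2)] car[OF fs.subspace_0[OF tensor_subspace] add(4)] by (metis add_0)
  qed (rule assms)
  have "P (a + b)"
    using assms(1) ab(2)
  proof (induction rule: tensor_induct)
    case (add v w q r y)
    show "P ((ptens v w + y) + b)"
      unfolding add.assoc by (rule assms(4)[OF add(1,2) car[OF add(4) ab(3)] add(5)])
  qed (simp add: Pb)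
  then show ?thesis using ab by simp
qed

context
  fixes V :: "('i, 'k::field) svs" and W :: "('j, 'k) svs"
  assumes V: "super_space V" and W: "super_space W"
begin

lemma tensor_slice:
  assumes "t \<in> svcar (tensor V W)"
  shows "(\<lambda>j. t (i, j)) \<in> svcar W" "(\<lambda>i. t (i, j)) \<in> svcar V"
    "lform (svcar W) g \<Longrightarrow> (\<lambda>i. g (\<lambda>j. t (i, j))) \<in> svcar V"
    "lform (svcar V) f \<Longrightarrow> (\<lambda>j. f (\<lambda>i. t (i, j))) \<in> svcar W"
proof -
  have 1: "(\<forall>i. (\<lambda>j. t (i, j)) \<in> svcar W) \<and> (\<forall>j. (\<lambda>i. t (i, j)) \<in> svcar V)"
    using V assms
  proof (induction rule: tensor_car_induct)
    case zero
    then show ?case using svcarD(2)[OF V] svcarD(2)[OF W] by simp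
  next
    case (add v w q r y)
    have "(\<lambda>j. (ptens v w + y) (i, j)) = fscale (v i) w + (\<lambda>j. y (i, j))"
      "(\<lambda>i. (ptens v w + y) (i, j)) = fscale (w j) v + (\<lambda>i. y (i, j))" for i j
      by (auto simp: ptens_def fscale_def)
    then show ?case
      using add svcar_closed[OF V] svcar_closed[OF W] svcar_homogeneous[OF V] svcar_homogeneous[OF W]
      by metis
  qed
  then show "(\<lambda>j. t (i, j)) \<in> svcar W" "(\<lambda>i. t (i, j)) \<in> svcar V"
    by blast+
  show "(\<lambda>i. g (\<lambda>j. t (i, j))) \<in> svcar V" if g: "lform (svcar W) g"
  proof -
    \<comment> \<open>Membership of the slices is part of the induction because \<open>g\<close> is
      additive on \<open>svcar W\<close> only.\<close>
    have "(\<forall>i. (\<lambda>j. t (i, j)) \<in> svcar W) \<and> (\<lambda>i. g (\<lambda>j. t (i, j))) \<in> svcar V"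
      using V assms
    proof (induction rule: tensor_car_induct)
      case zero
      then show ?case using svcarD(2)[OF V] svcarD(2)[OF W] lform_zero[OF g] svcarD(1)[OF W] by simp
    next
      case (add v w q r y)
      have *: "(\<lambda>j. (ptens v w + y) (i, j)) = fscale (v i) w + (\<lambda>j. y (i, j))" for i
        by (auto simp: ptens_def fscale_def)
      have w: "fscale (v i) w \<in> svcar W" "w \<in> svcar W" for i
        using add svcar_homogeneous[OF W] super_spaceD(5)[OF W] by blast+
      have "(\<lambda>i. g (\<lambda>j. (ptens v w + y) (i, j))) = fscale (g w) v + (\<lambda>i. g (\<lambda>j. y (i, j)))"
        using lformD[OF g] w add unfolding * by (auto simp: fscale_def)
      then show ?case
        using add svcar_closed[OF V] svcar_closed[OF W] svcar_homogeneous[OF V] w * by metis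
    qed
    then show ?thesis by blast
  qed
  show "(\<lambda>j. f (\<lambda>i. t (i, j))) \<in> svcar W" if f: "lform (svcar V) f"
  proof -
    have "(\<forall>j. (\<lambda>i. t (i, j)) \<in> svcar V) \<and> (\<lambda>j. f (\<lambda>i. t (i, j))) \<in> svcar W"
      using V assms
    proof (induction rule: tensor_car_induct)
      case zero
      then show ?case using svcarD(2)[OF V] svcarD(2)[OF W] lform_zero[OF f] svcarD(1)[OF V] by simp
    next
      case (add v w q r y)
      have *: "(\<lambda>i. (ptens v w + y) (i, j)) = fscale (w j) v + (\<lambda>i. y (i, j))" for j
        by (auto simp: ptens_def fscale_def)
      have v: "fscale (w j) v \<in> svcar V" "v \<in> svcar V" for j
        using add svcar_homogeneous[OF V] super_spaceD(5)[OF V] by blast+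
      have "(\<lambda>j. f (\<lambda>i. (ptens v w + y) (i, j))) = fscale (f v) w + (\<lambda>j. f (\<lambda>i. y (i, j)))"
        using lformD[OF f] v add unfolding * by (auto simp: fscale_def)
      then show ?case
        using add svcar_closed[OF W] svcar_closed[OF V] svcar_homogeneous[OF W] v * by metis
    qed
    then show ?thesis by blast
  qed
qed

text \<open>Both sides evaluate the tensor product of \<open>f\<close> and \<open>g\<close> at
  \<open>t\<close>: on a pure tensor each is \<open>f v * g w\<close>, and \<open>t\<close> is a
  finite sum of those. This exchange is used below wherever maps on different tensor factors have to
  be commuted.\<close>

lemma tensor_fubini:
  assumes t: "t \<in> svcar (tensor V W)" and f: "lform (svcar V) f" and g: "lform (svcar W) g"
  shows "f (\<lambda>i. g (\<lambda>j. t (i, j))) = g (\<lambda>j. f (\<lambda>i. t (i, j)))"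
  using V t
proof (induction rule: tensor_car_induct)
  case zero
  then show ?case
    using lform_zero[OF f svcarD(1)[OF V]] lform_zero[OF g svcarD(1)[OF W]] by simp
next
  case (add v w q r y)
  have *: "(\<lambda>i. (ptens v w + y) (i, j)) = fscale (w j) v + (\<lambda>i. y (i, j))"
    "(\<lambda>j. (ptens v w + y) (i, j)) = fscale (v i) w + (\<lambda>j. y (i, j))" for i j
    by (auto simp: ptens_def fscale_def)
  have v: "fscale c v \<in> svcar V" "v \<in> svcar V" "fscale c w \<in> svcar W" "w \<in> svcar W" for c
    using add svcar_homogeneous[OF V] super_spaceD(5)[OF V] svcar_homogeneous[OF W] super_spaceD(5)[OF W]
    by blast+
  note y = tensor_slice[OF add(3)]
  have "(\<lambda>i. g (\<lambda>j. (ptens v w + y) (i, j))) = fscale (g w) v + (\<lambda>i. g (\<lambda>j. y (i, j)))"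
    using lformD[OF g] v y unfolding * by (auto simp: fscale_def)
  moreover have "(\<lambda>j. f (\<lambda>i. (ptens v w + y) (i, j))) = fscale (f v) w + (\<lambda>j. f (\<lambda>i. y (i, j)))"
    using lformD[OF f] v y unfolding * by (auto simp: fscale_def)
  ultimately show ?case
    using add lformD[OF f] lformD[OF g] v y(3)[OF g] y(4)[OF f] by simp
qed

lemma tmap_add:
  assumes g: "lin_on (svcar V) g" and h: "lin_on (svcar W) h"
    and "t \<in> svcar (tensor V W)" "t' \<in> svcar (tensor V W)"
  shows "tmap g h (t + t') = tmap g h t + tmap g h t'"
proof -
  note h' = lform_lin_on[OF h]
  have "h (\<lambda>j. (t + t') (i, j)) = h (\<lambda>j. t (i, j)) + h (\<lambda>j. t' (i, j))" for i
    using h tensor_slice(1)[OF assms(3), of i] tensor_slice(1)[OF assms(4), of i]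
    unfolding lin_on_def by (simp add: plus_fun_def)
  moreover have "g (\<lambda>i. h (\<lambda>j. t (i, j)) j' + h (\<lambda>j. t' (i, j)) j') =
      g (\<lambda>i. h (\<lambda>j. t (i, j)) j') + g (\<lambda>i. h (\<lambda>j. t' (i, j)) j')" for j'
    using g tensor_slice(3)[OF assms(3) h'[of j']] tensor_slice(3)[OF assms(4) h'[of j']]
    unfolding lin_on_def by (simp add: plus_fun_def)
  ultimately show ?thesis
    by (auto simp: tmap_def fun_eq_iff)
qed

lemma tmap_scale:
  assumes g: "lin_on (svcar V) g" and h: "lin_on (svcar W) h" and "t \<in> svcar (tensor V W)"
  shows "tmap g h (fscale c t) = fscale c (tmap g h t)"
proof -
  note h' = lform_lin_on[OF h]
  have "h (\<lambda>j. fscale c t (i, j)) = fscale c (h (\<lambda>j. t (i, j)))" for i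
    using h tensor_slice(1)[OF assms(3), of i] unfolding lin_on_def by (simp add: fscale_def)
  moreover have "g (\<lambda>i. c * h (\<lambda>j. t (i, j)) j') =
      fscale c (g (\<lambda>i. h (\<lambda>j. t (i, j)) j'))" for j'
    using g tensor_slice(3)[OF assms(3) h'[of j']] unfolding lin_on_def by (simp add: fscale_def)
  ultimately show ?thesis
    by (auto simp: tmap_def fun_eq_iff fscale_def)
qed

lemma tmap_lin_on:
  "lin_on (svcar V) g \<Longrightarrow> lin_on (svcar W) h \<Longrightarrow> lin_on (svcar (tensor V W)) (tmap g h)"
  by (simp add: lin_on_def[of "svcar (tensor V W)"] tmap_add tmap_scale)

lemma tensor_car: "tensor V W p \<subseteq> svcar (tensor V W)"
proof
  fix x assume "x \<in> tensor V W p"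
  then have "x = x + 0 \<and> x \<in> tensor V W 0 \<or> x = 0 + x \<and> x \<in> tensor V W 1"
    by (cases p) auto
  then show "x \<in> svcar (tensor V W)"
    unfolding svcar_def using fs.subspace_0[OF tensor_subspace] by fastforce
qed

lemma tmap_ptens_car:
  assumes "lin_on (svcar V) g" "lin_on (svcar W) h" "v \<in> V q" "w \<in> W r"
  shows "tmap g h (ptens v w) = ptens (g v) (h w)"
  using assms svcar_homogeneous[OF V] svcar_homogeneous[OF W] by (blast intro: tmap_ptens)

lemma tmap_ptens_add:
  assumes "lin_on (svcar V) g" "lin_on (svcar W) h" "v \<in> V q" "w \<in> W r" "y \<in> tensor V W p"
  shows "tmap g h (ptens v w + y) = ptens (g v) (h w) + tmap g h y"
proof -
  have "ptens v w \<in> tensor V W (q + r)"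
    using assms by (intro ptens_in) simp_all
  then show ?thesis
    using tmap_add[OF assms(1,2) subsetD[OF tensor_car] subsetD[OF tensor_car assms(5)]]
      tmap_ptens_car[OF assms(1-4)] by simp
qed

lemma tmap_0: "lin_on (svcar V) g \<Longrightarrow> lin_on (svcar W) h \<Longrightarrow> tmap g h 0 = 0"
  using tmap_lin_on tensor_car[of 0] fs.subspace_0[OF tensor_subspace[of V W 0]]
  by (auto intro: lin_on_zero)

text \<open>The four maps \<open>tmap (hcomp V q) (hcomp W r)\<close> add up to the identity, and
  those with \<open>q + r\<close> different from \<open>p\<close> kill degree \<open>p\<close>. An
  element of both degrees is therefore killed by all four.\<close>

lemma super_space_tensor: "super_space (tensor V W)"
proof -
  note hV = hcomp_lin[OF V] and hW = hcomp_lin[OF W]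
  have part: "tmap (hcomp V q) (hcomp W r) t = 0" if "t \<in> tensor V W p" "q + r \<noteq> p" for t p q r
    using V that(1)
  proof (induction rule: tensor_induct)
    case zero
    show "tmap (hcomp V q) (hcomp W r) 0 = 0" by (simp add: tmap_0 hV hW)
  next
    case (add v w q' r' y)
    have "ptens (hcomp V q v) (hcomp W r w) = 0"
    proof (cases "q = q'")
      case True
      then have "hcomp W r w = 0"
        using that(2) add(3) hcomp_homogeneous[OF W add(2), of r] by auto
      then show ?thesis by (auto simp: ptens_def)
    next
      case False
      then have "hcomp V q v = 0"
        using hcomp_homogeneous[OF V add(1), of q] by simp
      then show ?thesis by (auto simp: ptens_def)
    qed
    then show "tmap (hcomp V q) (hcomp W r) (ptens v w + y) = 0"
      using tmap_ptens_add[OF hV hW add(1,2,4)] add(5) by (metis add_0)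
  qed
  have total: "t = (\<Sum>q\<in>{0,1}. \<Sum>r\<in>{0,1}. tmap (hcomp V q) (hcomp W r) t)" if "t \<in> tensor V W p" for t p
    using V that
  proof (induction rule: tensor_induct)
    case zero
    show "0 = (\<Sum>q\<in>{0,1}. \<Sum>r\<in>{0,1}. tmap (hcomp V q) (hcomp W r) 0)" by (simp add: tmap_0 hV hW)
  next
    case (add v w q' r' y)
    note * = tmap_ptens_add[OF hV hW add(1,2,4)]
    have "(\<Sum>q\<in>{0,1}. \<Sum>r\<in>{0,1}. ptens (hcomp V q v) (hcomp W r w)) = ptens v w"
      using hcomp_in(2)[OF V svcar_homogeneous[OF V add(1)]] hcomp_in(2)[OF W svcar_homogeneous[OF W add(2)]]
      by (simp add: ptens_simps[symmetric])
    then show "ptens v w + y = (\<Sum>q\<in>{0,1}. \<Sum>r\<in>{0,1}. tmap (hcomp V q) (hcomp W r) (ptens v w + y))"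
      unfolding * sum.distrib add(5)[symmetric] by (rule arg_cong2[where f = plus, OF sym refl])
  qed
  have "t = 0" if "t \<in> tensor V W 0" "t \<in> tensor V W 1" for t
    using total[OF that(1)] part[OF that(1)] part[OF that(2)] by simp
  then show ?thesis
    using fs.subspace_0[OF tensor_subspace] by (auto simp: super_space_def)
qed

text \<open>The maps are applied slicewise, so no sign arises even when they are odd; signs are
  added separately where they are needed.\<close>

lemma tmap_dhom:
  assumes "dhom d V V' g" "dhom e W W' h"
  shows "dhom (d + e) (tensor V W) (tensor V' W') (tmap g h)"
  unfolding dhom_def
proof (intro conjI allI ballI)
  note g = dhomD(1)[OF assms(1)] and h = dhomD(1)[OF assms(2)]
  show "lin_on (svcar (tensor V W)) (tmap g h)"
    by (rule tmap_lin_on[OF g h])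
  fix p t assume "t \<in> tensor V W p"
  with V show "tmap g h t \<in> tensor V' W' (d + e + p)"
  proof (induction rule: tensor_induct)
    case zero
    show "tmap g h 0 \<in> tensor V' W' (d + e + p)"
      unfolding tmap_0[OF g h] by (rule fs.subspace_0[OF tensor_subspace])
  next
    case (add v w q r y)
    have "tmap g h (ptens v w + y) = ptens (g v) (h w) + tmap g h y"
      by (rule tmap_ptens_add[OF g h add(1,2,4)])
    moreover have "ptens (g v) (h w) \<in> tensor V' W' (d + e + p)"
      using dhomD(2)[OF assms(1) add(1)] dhomD(2)[OF assms(2) add(2)] add(3)
      by (auto intro!: ptens_in simp: algebra_simps)
    ultimately show "tmap g h (ptens v w + y) \<in> tensor V' W' (d + e + p)"
      using fs.subspace_add[OF tensor_subspace _ add(5)] by metis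
  qed
qed

lemma tmap_super_hom:
  "super_hom V V' g \<Longrightarrow> super_hom W W' h \<Longrightarrow> super_hom (tensor V W) (tensor V' W') (tmap g h)"
  using tmap_dhom[of 0 V' g 0 W' h] by (simp add: super_hom_iff_dhom)

text \<open>
  Both refinement lemmas apply a graded projection onto the smaller space slicewise: it fixes \<open>t\<close>
  and maps the tensor product into the smaller one.
\<close>

lemma tensor_refine_right:
  assumes sub: "\<And>p. fs.subspace (W' p)" and le: "\<And>p. W' p \<subseteq> W p"
    and sl: "\<And>i. (\<lambda>j. t (i, j)) \<in> svcar W'"
  shows "t \<in> tensor V W p \<Longrightarrow> t \<in> tensor V W' p" "t \<in> svcar (tensor V W) \<Longrightarrow> t \<in> svcar (tensor V W')"
proof -
  obtain r where r: "super_hom W W' r" "\<And>x. x \<in> svcar W' \<Longrightarrow> r x = x"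
    using graded_projection[OF W sub le] by blast
  have hom: "super_hom (tensor V W) (tensor V W') (tmap id r)"
    by (rule tmap_super_hom) (simp_all add: r(1) super_hom_id)
  have fixed: "tmap id r t = t"
    using r(2)[OF sl] by (auto simp: tmap_def fun_eq_iff)
  show "t \<in> tensor V W p \<Longrightarrow> t \<in> tensor V W' p"
    using hom fixed by (force simp: super_hom_def)
  show "t \<in> svcar (tensor V W')" if t: "t \<in> svcar (tensor V W)"
  proof -
    obtain a b where ab: "t = a + b" "a \<in> tensor V W 0" "b \<in> tensor V W 1"
      using t unfolding svcar_def by blast
    then have "t = tmap id r a + tmap id r b"
      using fixed tmap_add[of id r a b] subsetD[OF tensor_car] r(1) unfolding super_hom_def by (metis lin_on_id(2))
    then show ?thesis
      using ab hom unfolding super_hom_def svcar_def by blast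
  qed
qed

lemma tensor_refine_left:
  assumes sub: "\<And>p. fs.subspace (V' p)" and le: "\<And>p. V' p \<subseteq> V p"
    and sl: "\<And>j. (\<lambda>i. t (i, j)) \<in> svcar V'"
  shows "t \<in> tensor V W p \<Longrightarrow> t \<in> tensor V' W p"
proof -
  obtain r where r: "super_hom V V' r" "\<And>x. x \<in> svcar V' \<Longrightarrow> r x = x"
    using graded_projection[OF V sub le] by blast
  have hom: "super_hom (tensor V W) (tensor V' W) (tmap r id)"
    by (rule tmap_super_hom) (simp_all add: r(1) super_hom_id)
  have fixed: "tmap r id t = t"
    using r(2)[OF sl] by (auto simp: tmap_def fun_eq_iff)
  show "t \<in> tensor V W p \<Longrightarrow> t \<in> tensor V' W p"
    using hom fixed by (force simp: super_hom_def)
qed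

end

lemma tensor_mono:
  assumes "\<And>p. V p \<subseteq> V' p" "\<And>p. W p \<subseteq> W' p"
  shows "tensor V W p \<subseteq> tensor V' W' p"
  unfolding tensor_def using subsetD[OF assms(1)] subsetD[OF assms(2)] by (intro fs.span_mono) blast

section \<open>Functionals on a super-coalgebra\<close>

definition hform :: "('i, 'k::field) svs \<Rightarrow> bit \<Rightarrow> (('i \<Rightarrow> 'k) \<Rightarrow> 'k) \<Rightarrow> bool" where
  "hform V p f \<longleftrightarrow> lform (svcar V) f \<and> (\<forall>q. \<forall>x\<in>V q. q \<noteq> p \<longrightarrow> f x = 0)"

lemma hformD:
  assumes "hform V p f"
  shows "lform (svcar V) f" "x \<in> V q \<Longrightarrow> q \<noteq> p \<Longrightarrow> f x = 0"
  using assms unfolding hform_def by blast+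

lemma hform_hcomp:
  assumes "super_space V" "lform (svcar V) f"
  shows "hform V p (\<lambda>x. f (hcomp V p x))"
  unfolding hform_def
proof (intro conjI allI ballI impI)
  show "lform (svcar V) (\<lambda>x. f (hcomp V p x))"
    using hcomp_in(1)[OF assms(1)] svcar_homogeneous[OF assms(1)]
    by (intro lform_comp[OF hcomp_lin[OF assms(1)] _ assms(2)]) blast
  show "f (hcomp V p x) = 0" if "x \<in> V q" "q \<noteq> p" for q x
    using hcomp_homogeneous[OF assms(1) that(1), of p] that(2)
      lform_zero(1)[OF assms(2) svcarD(1)[OF assms(1)]] by simp
qed

lemma hform_decomp:
  assumes "super_space V" "lform (svcar V) f" "x \<in> svcar V"
  shows "f x = f (hcomp V 0 x) + f (hcomp V 1 x)"
  using lformD(1)[OF assms(2), of "hcomp V 0 x" "hcomp V 1 x"] hcomp_in[OF assms(1,3)]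
    svcar_homogeneous[OF assms(1)] by metis

lemma hform_comp:
  assumes "super_space V" "super_space W" "dhom d V W g" "hform W p f"
  shows "hform V (d + p) (\<lambda>x. f (g x))"
  unfolding hform_def
proof (intro conjI allI ballI impI)
  show "lform (svcar V) (\<lambda>x. f (g x))"
    by (rule lform_comp[OF dhomD(1)[OF assms(3)] dhom_car[OF assms(3,1,2)] hformD(1)[OF assms(4)]])
  show "f (g x) = 0" if "x \<in> V q" "q \<noteq> d + p" for q x
    using hformD(2)[OF assms(4) dhomD(2)[OF assms(3) that(1)]] that(2) by (metis bit_add_self(2))
qed

lemma hform_add: "hform V p f \<Longrightarrow> hform V p g \<Longrightarrow> hform V p (\<lambda>x. f x + g x)"
  unfolding hform_def using lform_add by fastforce

lemma hform_scaled: "hform V p f \<Longrightarrow> hform V p (\<lambda>x. c * f x)"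
  unfolding hform_def using lform_scaled by fastforce

lemma tensor_slice_hform:
  fixes V :: "('i, 'k::field) svs" and W :: "('j, 'k) svs"
  assumes V: "super_space V" and W: "super_space W"
  shows "t \<in> tensor V W q \<Longrightarrow> hform V p f \<Longrightarrow> (\<lambda>j. f (\<lambda>i. t (i, j))) \<in> W (p + q)"
    and "t \<in> tensor V W q \<Longrightarrow> hform W p g \<Longrightarrow> (\<lambda>i. g (\<lambda>j. t (i, j))) \<in> V (p + q)"
proof -
  show "(\<lambda>j. f (\<lambda>i. t (i, j))) \<in> W (p + q)" if t: "t \<in> tensor V W q" and f: "hform V p f"
    using V t
  proof (induction rule: tensor_induct)
    case zero
    have "(\<lambda>j. f (\<lambda>i. 0 (i, j))) = (0 :: 'j \<Rightarrow> 'k)"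
      using lform_zero[OF hformD(1)[OF f] svcarD(1)[OF V]] by (auto simp: fun_eq_iff)
    then show ?case
      using super_spaceD(2)[OF W, of "p + q"] by metis
  next
    case (add v w q' r y)
    have *: "(\<lambda>i. (ptens v w + y) (i, j)) = fscale (w j) v + (\<lambda>i. y (i, j))" for j
      by (auto simp: ptens_def fscale_def)
    have v: "fscale (w j) v \<in> svcar V" "v \<in> svcar V" for j
      using add svcar_homogeneous[OF V] super_spaceD(5)[OF V] by blast+
    have eq: "(\<lambda>j. f (\<lambda>i. (ptens v w + y) (i, j))) = fscale (f v) w + (\<lambda>j. f (\<lambda>i. y (i, j)))"
      using lformD[OF hformD(1)[OF f]] v tensor_slice(2)[OF V W subsetD[OF tensor_car[OF V W] add(4)]]
      unfolding * by (auto simp: fscale_def)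
    have "fscale (f v) w \<in> W (p + q)"
    proof (cases "q' = p")
      case True
      then show ?thesis
        using add(2,3) super_spaceD(5)[OF W] bit_add_eq_iff[of q' r q] by auto
    next
      case False
      then have "f v = 0"
        using hformD(2)[OF f add(1)] by simp
      then show ?thesis
        using super_spaceD(2)[OF W] by simp
    qed
    then show "(\<lambda>j. f (\<lambda>i. (ptens v w + y) (i, j))) \<in> W (p + q)"
      unfolding eq using add(5) super_spaceD(3)[OF W] by blast
  qed
  show "(\<lambda>i. g (\<lambda>j. t (i, j))) \<in> V (p + q)" if t: "t \<in> tensor V W q" and g: "hform W p g"
    using V t
  proof (induction rule: tensor_induct)
    case zero
    have "(\<lambda>i. g (\<lambda>j. 0 (i, j))) = (0 :: 'i \<Rightarrow> 'k)"
      using lform_zero[OF hformD(1)[OF g] svcarD(1)[OF W]] by (auto simp: fun_eq_iff)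
    then show ?case
      using super_spaceD(2)[OF V, of "p + q"] by metis
  next
    case (add v w q' r y)
    have *: "(\<lambda>j. (ptens v w + y) (i, j)) = fscale (v i) w + (\<lambda>j. y (i, j))" for i
      by (auto simp: ptens_def fscale_def)
    have w: "fscale (v i) w \<in> svcar W" "w \<in> svcar W" for i
      using add svcar_homogeneous[OF W] super_spaceD(5)[OF W] by blast+
    have eq: "(\<lambda>i. g (\<lambda>j. (ptens v w + y) (i, j))) = fscale (g w) v + (\<lambda>i. g (\<lambda>j. y (i, j)))"
      using lformD[OF hformD(1)[OF g]] w tensor_slice(1)[OF V W subsetD[OF tensor_car[OF V W] add(4)]]
      unfolding * by (auto simp: fscale_def)
    have "fscale (g w) v \<in> V (p + q)"
    proof (cases "r = p")
      case True
      then show ?thesis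
        using add(1,3) super_spaceD(5)[OF V] bit_add_eq_iff[of r q' q] by (auto simp: add.commute)
    next
      case False
      then have "g w = 0"
        using hformD(2)[OF g add(2)] by simp
      then show ?thesis
        using super_spaceD(2)[OF V] by simp
    qed
    then show "(\<lambda>i. g (\<lambda>j. (ptens v w + y) (i, j))) \<in> V (p + q)"
      unfolding eq using add(5) super_spaceD(3)[OF V] by blast
  qed
qed

text \<open>In Sweedler notation \<open>lact\<close> is f(x_1) x_2 and \<open>ract\<close> below is
  x_1 f(x_2), both without signs: the two actions of the dual algebra on \<open>C\<close>.\<close>

definition lact :: "('c, 'k::field) scoalg \<Rightarrow> (('c \<Rightarrow> 'k) \<Rightarrow> 'k) \<Rightarrow> ('c \<Rightarrow> 'k) \<Rightarrow> 'c \<Rightarrow> 'k" where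
  "lact C f x = (\<lambda>b. f (\<lambda>a. comult C x (a, b)))"

definition ract :: "('c, 'k::field) scoalg \<Rightarrow> (('c \<Rightarrow> 'k) \<Rightarrow> 'k) \<Rightarrow> ('c \<Rightarrow> 'k) \<Rightarrow> 'c \<Rightarrow> 'k" where
  "ract C f x = (\<lambda>a. f (\<lambda>b. comult C x (a, b)))"

text \<open>
  The order of the factors is reversed: with this convention the points of \<^const>\<open>SSp\<close> are exactly
  the algebra homomorphisms on functionals, and no signs occur.
\<close>

definition fmul ::
  "('c, 'k::field) scoalg \<Rightarrow> (('c \<Rightarrow> 'k) \<Rightarrow> 'k) \<Rightarrow> (('c \<Rightarrow> 'k) \<Rightarrow> 'k) \<Rightarrow> ('c \<Rightarrow> 'k) \<Rightarrow> 'k" where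
  "fmul C f g x = g (ract C f x)"

lemma coalgD:
  assumes C: "super_coalgebra C"
  shows "super_space (csp C)" "super_hom (csp C) (tensor (csp C) (csp C)) (comult C)"
    "lform (ccar C) (counit C)" "hform (csp C) 0 (counit C)"
    "x \<in> ccar C \<Longrightarrow> comult C (\<lambda>e. comult C x (e, c)) (a, b) = comult C (\<lambda>e. comult C x (a, e)) (b, c)"
    "x \<in> ccar C \<Longrightarrow> (\<lambda>b. counit C (\<lambda>a. comult C x (a, b))) = x"
    "x \<in> ccar C \<Longrightarrow> (\<lambda>a. counit C (\<lambda>b. comult C x (a, b))) = x"
proof -
  note c = C[unfolded super_coalgebra_def]
  show "super_space (csp C)" "super_hom (csp C) (tensor (csp C) (csp C)) (comult C)"
    using c by blast+
  show l: "lform (ccar C) (counit C)"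
    using c unfolding lform_def by blast
  have "q = 1" if "q \<noteq> 0" for q :: bit
    using that by simp
  moreover have "\<forall>x\<in>csp C 1. counit C x = 0"
    using c by blast
  ultimately show "hform (csp C) 0 (counit C)"
    unfolding hform_def using l by metis
  show "x \<in> ccar C \<Longrightarrow> comult C (\<lambda>e. comult C x (e, c)) (a, b) = comult C (\<lambda>e. comult C x (a, e)) (b, c)"
  proof -
    assume "x \<in> ccar C"
    then have "tmap (comult C) id (comult C x) ((a, b), c) = tmap id (comult C) (comult C x) (a, (b, c))"
      using c by blast
    then show ?thesis by (simp add: tmap_def)
  qed
  show "x \<in> ccar C \<Longrightarrow> (\<lambda>b. counit C (\<lambda>a. comult C x (a, b))) = x"
    "x \<in> ccar C \<Longrightarrow> (\<lambda>a. counit C (\<lambda>b. comult C x (a, b))) = x"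
    using c by blast+
qed

context
  fixes C :: "('c, 'k::field) scoalg"
  assumes C: "super_coalgebra C"
begin

lemma comult_lin: "lin_on (ccar C) (comult C)"
  using coalgD(2)[OF C] by (simp add: super_hom_def)

lemma comult_lform: "lform (ccar C) (\<lambda>x. comult C x ab)"
  by (rule lform_lin_on[OF comult_lin])

lemma comult_hom: "x \<in> csp C p \<Longrightarrow> comult C x \<in> tensor (csp C) (csp C) p"
  using coalgD(2)[OF C] by (auto simp: super_hom_def)

lemma comult_car: "x \<in> ccar C \<Longrightarrow> comult C x \<in> svcar (tensor (csp C) (csp C))"
  using dhom_car[of 0 "csp C" "tensor (csp C) (csp C)" "comult C" x] coalgD(1,2)[OF C]
    super_space_tensor[OF coalgD(1)[OF C] coalgD(1)[OF C]] by (simp add: super_hom_iff_dhom)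

lemma comult_slice:
  assumes "x \<in> ccar C"
  shows "(\<lambda>b. comult C x (a, b)) \<in> ccar C" "(\<lambda>a. comult C x (a, b)) \<in> ccar C"
  using tensor_slice(1,2)[OF coalgD(1)[OF C] coalgD(1)[OF C] comult_car[OF assms]] by blast+

lemma act_car:
  assumes "lform (ccar C) f" "x \<in> ccar C"
  shows "lact C f x \<in> ccar C" "ract C f x \<in> ccar C"
  using tensor_slice(3,4)[OF coalgD(1)[OF C] coalgD(1)[OF C] comult_car[OF assms(2)] assms(1)]
  unfolding lact_def ract_def by blast+

lemma act_lin:
  assumes "lform (ccar C) f"
  shows "lin_on (ccar C) (lact C f)" "lin_on (ccar C) (ract C f)"
proof -
  have *: "(\<lambda>a. comult C (x + y) (a, b)) = (\<lambda>a. comult C x (a, b)) + (\<lambda>a. comult C y (a, b))"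
    "(\<lambda>a. comult C (x + y) (b, a)) = (\<lambda>a. comult C x (b, a)) + (\<lambda>a. comult C y (b, a))"
    if "x \<in> ccar C" "y \<in> ccar C" for x y b
    using that comult_lin by (auto simp: lin_on_def)
  moreover have "(\<lambda>a. comult C (fscale c x) (a, b)) = fscale c (\<lambda>a. comult C x (a, b))"
    "(\<lambda>a. comult C (fscale c x) (b, a)) = fscale c (\<lambda>a. comult C x (b, a))"
    if "x \<in> ccar C" for x b c
    using that comult_lin by (auto simp: lin_on_def fscale_def)
  ultimately show "lin_on (ccar C) (lact C f)" "lin_on (ccar C) (ract C f)"
    using assms comult_slice
    by (auto simp: lin_on_iff_lform lform_def lact_def ract_def)
qed

lemma act_dhom:
  assumes "hform (csp C) p f"
  shows "dhom p (csp C) (csp C) (lact C f)" "dhom p (csp C) (csp C) (ract C f)"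
  unfolding dhom_def lact_def ract_def
  using act_lin[OF hformD(1)[OF assms], unfolded lact_def ract_def]
    tensor_slice_hform[OF coalgD(1)[OF C] coalgD(1)[OF C] comult_hom assms] by blast+

lemma comult_fubini:
  assumes "x \<in> ccar C" "lform (ccar C) f" "lform (ccar C) g"
  shows "f (\<lambda>a. g (\<lambda>b. comult C x (a, b))) = g (\<lambda>b. f (\<lambda>a. comult C x (a, b)))"
  by (rule tensor_fubini[OF coalgD(1)[OF C] coalgD(1)[OF C] comult_car[OF assms(1)] assms(2,3)])

lemma fmul_alt:
  assumes "x \<in> ccar C" "lform (ccar C) f" "lform (ccar C) g"
  shows "fmul C f g x = f (lact C g x)"
  unfolding fmul_def lact_def ract_def by (rule comult_fubini[OF assms(1,3,2)])

lemma fmul_lform: "lform (ccar C) f \<Longrightarrow> lform (ccar C) g \<Longrightarrow> lform (ccar C) (fmul C f g)"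
  using lform_comp[OF act_lin(2) act_car(2)] unfolding fmul_def[abs_def] by blast

lemma fmul_hform:
  "hform (csp C) p f \<Longrightarrow> hform (csp C) q g \<Longrightarrow> hform (csp C) (p + q) (fmul C f g)"
  using hform_comp[OF coalgD(1)[OF C] coalgD(1)[OF C] act_dhom(2)] unfolding fmul_def[abs_def] by blast

text \<open>Coassociativity read through a functional: by Fubini the second coproduct moves inside
  \<open>f\<close>, and coassociativity then moves it to the other factor.\<close>

lemma comult_act:
  assumes "x \<in> ccar C" "lform (ccar C) f"
  shows "comult C (lact C f x) (a, b) = lact C f (\<lambda>e. comult C x (e, b)) a"
    "comult C (ract C f x) (a, b) = ract C f (\<lambda>e. comult C x (a, e)) b"
proof -
  have "comult C (lact C f x) (a, b) = f (\<lambda>c. comult C (\<lambda>e. comult C x (c, e)) (a, b))"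
    unfolding lact_def by (rule comult_fubini[OF assms comult_lform, symmetric])
  also have "\<dots> = lact C f (\<lambda>e. comult C x (e, b)) a"
    unfolding lact_def coalgD(5)[OF C assms(1)] ..
  finally show "comult C (lact C f x) (a, b) = lact C f (\<lambda>e. comult C x (e, b)) a" .
  have "comult C (ract C f x) (a, b) = f (\<lambda>c. comult C (\<lambda>e. comult C x (e, c)) (a, b))"
    unfolding ract_def by (rule comult_fubini[OF assms(1) comult_lform assms(2)])
  also have "\<dots> = ract C f (\<lambda>e. comult C x (a, e)) b"
    unfolding ract_def coalgD(5)[OF C assms(1)] ..
  finally show "comult C (ract C f x) (a, b) = ract C f (\<lambda>e. comult C x (a, e)) b" .
qed

text \<open>Coassociativity makes \<open>lact\<close> a left and \<open>ract\<close> a right action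
  of the functionals under \<open>fmul\<close>; this accounts for the exchanged factors in the
  second equation.\<close>

lemma act_act:
  assumes "x \<in> ccar C" "lform (ccar C) f" "lform (ccar C) g"
  shows "lact C f (lact C g x) = lact C (fmul C f g) x"
    "ract C f (ract C g x) = ract C (fmul C g f) x"
proof -
  show "lact C f (lact C g x) = lact C (fmul C f g) x"
  proof
    fix b
    have "lact C f (lact C g x) b = f (\<lambda>a. lact C g (\<lambda>e. comult C x (e, b)) a)"
      unfolding lact_def[of C f] comult_act(1)[OF assms(1,3)] ..
    also have "\<dots> = fmul C f g (\<lambda>e. comult C x (e, b))"
      using fmul_alt[OF comult_slice(2)[OF assms(1)] assms(2,3)] by simp
    finally show "lact C f (lact C g x) b = lact C (fmul C f g) x b"
      unfolding lact_def[of C "fmul C f g"] .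
  qed
  show "ract C f (ract C g x) = ract C (fmul C g f) x"
  proof
    fix a
    show "ract C f (ract C g x) a = ract C (fmul C g f) x a"
      unfolding ract_def[of C f] comult_act(2)[OF assms(1,3)] ract_def[of C "fmul C g f"] fmul_def ..
  qed
qed

text \<open>The counit recovers a functional from the operator by which it acts, so functionals and
  operators carry the same information.\<close>

lemma counit_act:
  assumes "x \<in> ccar C" "lform (ccar C) f"
  shows "counit C (lact C f x) = f x" "counit C (ract C f x) = f x"
  unfolding lact_def ract_def
  using comult_fubini[OF assms coalgD(3)[OF C]] comult_fubini[OF assms(1) coalgD(3)[OF C] assms(2)]
    coalgD(6,7)[OF C assms(1)] by simp_all

lemma act_counit:
  assumes "x \<in> ccar C"
  shows "lact C (counit C) x = x" "ract C (counit C) x = x"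
  unfolding lact_def ract_def by (fact coalgD(6,7)[OF C assms])+

end

section \<open>Supercommutativity of the product of functionals\<close>

lemma braid_add:
  assumes V: "super_space V" and W: "super_space W"
    and "t \<in> svcar (tensor V W)" "t' \<in> svcar (tensor V W)"
  shows "braid V W (t + t') = braid V W t + braid V W t'"
  unfolding braid_def tmap_add[OF V W hcomp_lin[OF V] hcomp_lin[OF W] assms(3,4)]
  by (auto simp: fun_eq_iff algebra_simps)

lemma braid_0: "super_space V \<Longrightarrow> super_space W \<Longrightarrow> braid V W 0 = 0"
  unfolding braid_def by (simp add: tmap_0 hcomp_lin fun_eq_iff)

lemma braid_ptens_add:
  assumes V: "super_space V" and W: "super_space W" and vw: "v \<in> V q" "w \<in> W r"
    and y: "y \<in> svcar (tensor V W)"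
  shows "braid V W (ptens v w + y) = fscale (koszul q r) (ptens w v) + braid V W y"
proof -
  have "ptens v w \<in> tensor V W (q + r)"
    using vw by (intro ptens_in) simp_all
  then show ?thesis
    using braid_add[OF V W subsetD[OF tensor_car[OF V W]] y] braid_ptens[OF V W vw] by simp
qed

text \<open>Only pure tensors whose factors have parities \<open>p\<close> and \<open>q\<close>
  survive the two functionals, so the sign of the braiding is determined by the parities of
  \<open>f\<close> and \<open>g\<close>.\<close>

lemma braid_forms:
  assumes V: "super_space V" and t: "t \<in> svcar (tensor V V)" and f: "hform V p f" and g: "hform V q g"
  shows "g (\<lambda>c. f (\<lambda>d. braid V V t (c, d))) = koszul p q * f (\<lambda>c. g (\<lambda>d. t (c, d)))"
proof -
  note lf = hformD(1)[OF f] and lg = hformD(1)[OF g]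
  have "braid V V t \<in> svcar (tensor V V) \<and>
      g (\<lambda>c. f (\<lambda>d. braid V V t (c, d))) = koszul p q * f (\<lambda>c. g (\<lambda>d. t (c, d)))"
    using V t
  proof (induction rule: tensor_car_induct)
    case zero
    show "braid V V 0 \<in> svcar (tensor V V) \<and>
        g (\<lambda>c. f (\<lambda>d. braid V V 0 (c, d))) = koszul p q * f (\<lambda>c. g (\<lambda>d. 0 (c, d)))"
      unfolding braid_0[OF V V]
      using lform_zero(2)[OF lf svcarD(1)[OF V]] lform_zero(2)[OF lg svcarD(1)[OF V]]
        svcarD(1)[OF super_space_tensor[OF V V]] by simp
  next
    case (add v w q' r y)
    have vw: "v \<in> svcar V" "w \<in> svcar V"
      using add svcar_homogeneous[OF V] by blast+
    have wv: "ptens w v \<in> svcar (tensor V V)"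
      using add(1,2) subsetD[OF tensor_car[OF V V] ptens_in[where V = V and W = V]] by blast
    let ?k = "koszul q' r"
    have eq: "braid V V (ptens v w + y) = fscale ?k (ptens w v) + braid V V y"
      by (rule braid_ptens_add[OF V V add(1-3)])
    have in_car: "fscale ?k (ptens w v) + braid V V y \<in> svcar (tensor V V)"
      using svcar_closed[OF super_space_tensor[OF V V]] wv add by blast
    have bil: "h (\<lambda>c. h' (\<lambda>d. (fscale k (ptens a b) + z) (c, d))) = k * h a * h' b + h (\<lambda>c. h' (\<lambda>d. z (c, d)))"
      if h: "lform (svcar V) h" "lform (svcar V) h'" and ab: "a \<in> svcar V" "b \<in> svcar V"
        and z: "z \<in> svcar (tensor V V)" for h h' k a b z
    proof -
      have "(\<lambda>d. (fscale k (ptens a b) + z) (c, d)) = fscale (k * a c) b + (\<lambda>d. z (c, d))" for c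
        by (auto simp: fscale_def ptens_def)
      then have "h' (\<lambda>d. (fscale k (ptens a b) + z) (c, d)) = (k * a c) * h' b + h' (\<lambda>d. z (c, d))" for c
        using lformD[OF h(2)] ab tensor_slice(1)[OF V V z] svcar_closed(2)[OF V ab(2) ab(2)] by simp
      then have "(\<lambda>c. h' (\<lambda>d. (fscale k (ptens a b) + z) (c, d))) = fscale (k * h' b) a + (\<lambda>c. h' (\<lambda>d. z (c, d)))"
        by (auto simp: fscale_def)
      then show ?thesis
        using lformD[OF h(1)] ab tensor_slice(3)[OF V V z h(2)] svcar_closed(2)[OF V ab(1) ab(1)]
        by (simp add: mult_ac)
    qed
    have "?k * g w * f v = koszul p q * f v * g w"
    proof (cases "q' = p \<and> r = q")
      case True
      then show ?thesis by simp
    next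
      case False
      then have "f v = 0 \<or> g w = 0"
        using hformD(2)[OF f add(1)] hformD(2)[OF g add(2)] by blast
      then show ?thesis by auto
    qed
    moreover have "g (\<lambda>c. f (\<lambda>d. braid V V (ptens v w + y) (c, d))) =
        ?k * g w * f v + g (\<lambda>c. f (\<lambda>d. braid V V y (c, d)))"
      unfolding eq using add by (intro bil lf lg vw) blast
    moreover have "f (\<lambda>c. g (\<lambda>d. (ptens v w + y) (c, d))) = 1 * f v * g w + f (\<lambda>c. g (\<lambda>d. y (c, d)))"
      using bil[OF lf lg vw add(3), of 1] by (simp only: fs.scale_one)
    ultimately have "g (\<lambda>c. f (\<lambda>d. braid V V (ptens v w + y) (c, d))) =
        koszul p q * f (\<lambda>c. g (\<lambda>d. (ptens v w + y) (c, d)))"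
      using add(4) by (simp only: distrib_left mult_1_left mult.assoc)
    then show "braid V V (ptens v w + y) \<in> svcar (tensor V V) \<and>
        g (\<lambda>c. f (\<lambda>d. braid V V (ptens v w + y) (c, d))) =
        koszul p q * f (\<lambda>c. g (\<lambda>d. (ptens v w + y) (c, d)))"
      using in_car unfolding eq by blast
  qed
  then show ?thesis ..
qed

lemma fmul_commute:
  assumes C: "super_coalgebra C" and cc: "super_cocommutative C"
    and f: "hform (csp C) p f" and g: "hform (csp C) q g" and x: "x \<in> ccar C"
  shows "fmul C f g x = koszul p q * fmul C g f x"
proof -
  have "comult C x = braid (csp C) (csp C) (comult C x)"
    using cc x by (simp add: super_cocommutative_def)
  then show ?thesis
    using braid_forms[OF coalgD(1)[OF C] comult_car[OF C x] f g] unfolding fmul_def ract_def by metis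
qed

section \<open>Points\<close>

lemma algD:
  assumes "R \<in> SAlgf"
  shows "x \<in> acar R \<Longrightarrow> lin_on (acar R) (amult R x)"
    "x \<in> acar R \<Longrightarrow> lin_on (acar R) (\<lambda>y. amult R y x)"
    "x \<in> asp R p \<Longrightarrow> y \<in> asp R q \<Longrightarrow> amult R x y \<in> asp R (p + q)"
    "x \<in> asp R p \<Longrightarrow> y \<in> asp R q \<Longrightarrow> amult R x y = fscale (koszul p q) (amult R y x)"
    "x \<in> acar R \<Longrightarrow> amult R (aone R) x = x"
  using assms unfolding SAlgf_def by blast+

text \<open>In an even tensor the parity of the \<open>C\<close>-component agrees with that of the
  coefficient in \<open>R\<close> (\<open>swap\<close>). The sign in \<open>base_prod\<close> is
  therefore the one by which the two coefficients supercommute, and it disappears when their order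
  is reversed.\<close>

lemma base_prod_eq:
  assumes R: "R \<in> SAlgf" and C: "super_space (csp C)"
    and u: "u \<in> tensor (asp R) (csp C) 0" and v: "v \<in> tensor (asp R) (csp C) 0"
  shows "base_prod R C u v (n, (c, d)) = amult R (\<lambda>m. v (m, d)) (\<lambda>m. u (m, c)) n"
proof -
  note A = SAlgfD(1)[OF R]
  have swap: "tmap id (hcomp (csp C) p) w = tmap (hcomp (asp R) p) id w"
    if "w \<in> tensor (asp R) (csp C) 0" for w p
    using A that
  proof (induction rule: tensor_induct)
    case zero
    show "tmap id (hcomp (csp C) p) 0 = tmap (hcomp (asp R) p) id 0"
      by (simp add: tmap_0[OF A C] hcomp_lin[OF A] hcomp_lin[OF C])
  next
    case (add a b q r y)
    have "q = r"
      using add(3) by (cases q; cases r) auto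
    have "ptens a (hcomp (csp C) p b) = ptens (hcomp (asp R) p a) b"
      unfolding hcomp_homogeneous[OF A add(1)] hcomp_homogeneous[OF C add(2)] \<open>q = r\<close>
      by (auto simp: ptens_def)
    then show "tmap id (hcomp (csp C) p) (ptens a b + y) = tmap (hcomp (asp R) p) id (ptens a b + y)"
      using tmap_ptens_add[OF A C lin_on_id(2) hcomp_lin[OF C, of p] add(1,2,4)]
        tmap_ptens_add[OF A C hcomp_lin[OF A, of p] lin_on_id(2) add(1,2,4)] add(5) by (metis id_apply)
  qed
  define a b where "a = (\<lambda>m. u (m, c))" and "b = (\<lambda>m. v (m, d))"
  have ab: "a \<in> acar R" "b \<in> acar R"
    unfolding a_def b_def using tensor_slice(2)[OF A C subsetD[OF tensor_car[OF A C]]] u v by blast+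
  let ?h = "hcomp (asp R)"
  have h: "?h p a \<in> acar R" "?h p b \<in> acar R" for p
    using hcomp_in(1)[OF A] ab svcar_homogeneous[OF A] by blast+
  have "base_prod R C u v (n, (c, d)) =
      (\<Sum>p\<in>{0, 1}. \<Sum>q\<in>{0, 1}. koszul p q * amult R (?h p a) (?h q b) n)"
    unfolding base_prod_def swap[OF u] by (simp add: tmap_def a_def b_def)
  also have "\<dots> = (\<Sum>p\<in>{0, 1}. \<Sum>q\<in>{0, 1}. amult R (?h q b) (?h p a) n)"
  proof (intro sum.cong refl)
    fix p q
    have "amult R (?h p a) (?h q b) = fscale (koszul p q) (amult R (?h q b) (?h p a))"
      using hcomp_in(1)[OF A ab(1)] hcomp_in(1)[OF A ab(2)] by (rule algD(4)[OF R])
    then show "koszul p q * amult R (?h p a) (?h q b) n = amult R (?h q b) (?h p a) n"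
      by (simp add: fscale_def)
  qed
  also have "\<dots> = amult R b a n"
  proof -
    have "amult R b a = amult R (?h 0 b) a + amult R (?h 1 b) a"
      using algD(2)[OF R ab(1)] h hcomp_in(2)[OF A ab(2)] unfolding lin_on_def by metis
    moreover have "amult R y a = amult R y (?h 0 a) + amult R y (?h 1 a)" if "y \<in> acar R" for y
      using algD(1)[OF R that] h hcomp_in(2)[OF A ab(1)] unfolding lin_on_def by metis
    ultimately have "amult R b a = (amult R (?h 0 b) (?h 0 a) + amult R (?h 0 b) (?h 1 a)) +
        (amult R (?h 1 b) (?h 0 a) + amult R (?h 1 b) (?h 1 a))"
      using h by metis
    then show ?thesis by simp
  qed
  finally show ?thesis
    unfolding a_def b_def .
qed

lemma SSp_iff:
  assumes R: "R \<in> SAlgf" and C: "super_coalgebra C"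
  shows "u \<in> Ob (SSp C) R \<longleftrightarrow> u \<in> tensor (asp R) (csp C) 0 \<and>
    (\<forall>n c d. comult C (\<lambda>e. u (n, e)) (c, d) = amult R (\<lambda>m. u (m, d)) (\<lambda>m. u (m, c)) n) \<and>
    (\<lambda>n. counit C (\<lambda>c. u (n, c))) = aone R"
proof -
  have "tmap id (comult C) u = base_prod R C u u \<longleftrightarrow>
      (\<forall>n c d. comult C (\<lambda>e. u (n, e)) (c, d) = amult R (\<lambda>m. u (m, d)) (\<lambda>m. u (m, c)) n)"
    if "u \<in> tensor (asp R) (csp C) 0"
    using base_prod_eq[OF R coalgD(1)[OF C] that that] by (auto simp: fun_eq_iff tmap_def)
  then show ?thesis
    unfolding SSp_def by auto
qed

lemma SSp_Ar [simp]: "Ar (SSp C) R S \<psi> u = tmap \<psi> id u"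
  by (simp add: SSp_def)

lemma SSpD:
  assumes R: "R \<in> SAlgf" and C: "super_coalgebra C" and u: "u \<in> Ob (SSp C) R"
  shows "u \<in> tensor (asp R) (csp C) 0" "u \<in> svcar (tensor (asp R) (csp C))"
    "comult C (\<lambda>e. u (n, e)) (c, d) = amult R (\<lambda>m. u (m, d)) (\<lambda>m. u (m, c)) n"
    "(\<lambda>n. counit C (\<lambda>c. u (n, c))) = aone R"
    "(\<lambda>c. u (n, c)) \<in> ccar C" "(\<lambda>n. u (n, c)) \<in> acar R"
proof -
  note s = SSp_iff[OF R C, THEN iffD1, OF u]
  show "u \<in> tensor (asp R) (csp C) 0" "(\<lambda>n. counit C (\<lambda>c. u (n, c))) = aone R"
    "comult C (\<lambda>e. u (n, e)) (c, d) = amult R (\<lambda>m. u (m, d)) (\<lambda>m. u (m, c)) n"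
    using s by blast+
  show t: "u \<in> svcar (tensor (asp R) (csp C))"
    using s tensor_car[OF SAlgfD(1)[OF R] coalgD(1)[OF C]] by blast
  show "(\<lambda>c. u (n, c)) \<in> ccar C" "(\<lambda>n. u (n, c)) \<in> acar R"
    by (rule tensor_slice[OF SAlgfD(1)[OF R] coalgD(1)[OF C] t])+
qed

lemma alg_hom_lin: "\<psi> \<in> alg_hom R S \<Longrightarrow> lin_on (acar R) \<psi>"
  "\<psi> \<in> alg_hom R S \<Longrightarrow> super_hom (asp R) (asp S) \<psi>"
  unfolding alg_hom_def super_hom_def by blast+

lemma SSp_push:
  assumes R: "R \<in> SAlgf" and S: "S \<in> SAlgf" and C: "super_coalgebra C"
    and u: "u \<in> Ob (SSp C) R" and \<psi>: "\<psi> \<in> alg_hom R S"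
  shows "tmap \<psi> id u \<in> Ob (SSp C) S"
  unfolding SSp_iff[OF S C]
proof (intro conjI allI)
  note U = SSpD[OF R C u] and Rs = SAlgfD(1)[OF R] and Cs = coalgD(1)[OF C]
  note fub = tensor_fubini[OF Rs Cs U(2) lform_lin_on[OF alg_hom_lin(1)[OF \<psi>]]]
  have val: "tmap \<psi> id u (n, c) = \<psi> (\<lambda>m. u (m, c)) n" for n c
    by (simp add: tmap_def)
  show "tmap \<psi> id u \<in> tensor (asp S) (csp C) 0"
    using tmap_super_hom[OF Rs Cs alg_hom_lin(2)[OF \<psi>] super_hom_id] U(1) unfolding super_hom_def by blast
  fix n c d
  have "comult C (\<lambda>e. tmap \<psi> id u (n, e)) (c, d) = \<psi> (\<lambda>m. comult C (\<lambda>e. u (m, e)) (c, d)) n"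
    unfolding val by (rule fub[OF comult_lform[OF C], symmetric])
  also have "\<dots> = amult S (\<psi> (\<lambda>m. u (m, d))) (\<psi> (\<lambda>m. u (m, c))) n"
    unfolding U(3) using alg_homE(6)[OF \<psi> U(6) U(6)] by (rule fun_cong)
  finally show "comult C (\<lambda>e. tmap \<psi> id u (n, e)) (c, d) =
      amult S (\<lambda>m. tmap \<psi> id u (m, d)) (\<lambda>m. tmap \<psi> id u (m, c)) n"
    unfolding val .
next
  note U = SSpD[OF R C u] and Rs = SAlgfD(1)[OF R] and Cs = coalgD(1)[OF C]
  have "counit C (\<lambda>c. tmap \<psi> id u (n, c)) = \<psi> (\<lambda>m. counit C (\<lambda>c. u (m, c))) n" for n
    using tensor_fubini[OF Rs Cs U(2) lform_lin_on[OF alg_hom_lin(1)[OF \<psi>]] coalgD(3)[OF C]]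
    by (simp add: tmap_def)
  then show "(\<lambda>n. counit C (\<lambda>c. tmap \<psi> id u (n, c))) = aone S"
    using U(4) alg_homE(5)[OF \<psi>] by (auto simp: fun_eq_iff)
qed

lemma SSp_map_in:
  assumes R: "R \<in> SAlgf" and C: "super_coalgebra C" and D: "super_coalgebra D"
    and u: "u \<in> Ob (SSp C) R" and \<phi>: "coalg_hom C D \<phi>"
  shows "tmap id \<phi> u \<in> Ob (SSp D) R"
  unfolding SSp_iff[OF R D]
proof (intro conjI allI)
  note U = SSpD[OF R C u] and Rs = SAlgfD(1)[OF R] and Cs = coalgD(1)[OF C]
  have hom: "super_hom (csp C) (csp D) \<phi>" and lin: "lin_on (ccar C) \<phi>"
    and com: "x \<in> ccar C \<Longrightarrow> comult D (\<phi> x) = tmap \<phi> \<phi> (comult C x)" for x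
    using \<phi> by (auto simp: coalg_hom_def super_hom_def)
  have val: "tmap id \<phi> u (n, d) = \<phi> (\<lambda>c. u (n, c)) d" for n d
    by (simp add: tmap_def)
  show "tmap id \<phi> u \<in> tensor (asp R) (csp D) 0"
    using tmap_super_hom[OF Rs Cs super_hom_id hom] U(1) unfolding super_hom_def by blast
  have slice: "(\<lambda>m. \<phi> (\<lambda>e. u (m, e)) d) \<in> acar R" for d
    by (rule tensor_slice(3)[OF Rs Cs U(2) lform_lin_on[OF lin]])
  have fub: "\<phi> (\<lambda>j. f (\<lambda>m. u (m, j))) d = f (\<lambda>m. \<phi> (\<lambda>j. u (m, j)) d)" if "lform (acar R) f" for f d
    by (rule tensor_fubini[OF Rs Cs U(2) that lform_lin_on[OF lin], symmetric])
  fix n c d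
  have "comult D (\<lambda>e. tmap id \<phi> u (n, e)) (c, d) =
      \<phi> (\<lambda>i. \<phi> (\<lambda>j. amult R (\<lambda>m. u (m, j)) (\<lambda>m. u (m, i)) n) d) c"
    unfolding val by (simp add: com[OF U(5)] tmap_def U(3))
  also have "(\<lambda>i. \<phi> (\<lambda>j. amult R (\<lambda>m. u (m, j)) (\<lambda>m. u (m, i)) n) d) =
      (\<lambda>i. amult R (\<lambda>m. \<phi> (\<lambda>j. u (m, j)) d) (\<lambda>m. u (m, i)) n)"
    using fub[OF lform_lin_on[OF algD(2)[OF R U(6)]]] by blast
  also have "\<phi> \<dots> c = amult R (\<lambda>m. \<phi> (\<lambda>j. u (m, j)) d) (\<lambda>m. \<phi> (\<lambda>j. u (m, j)) c) n"
    by (rule fub[OF lform_lin_on[OF algD(1)[OF R slice]]])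
  finally show "comult D (\<lambda>e. tmap id \<phi> u (n, e)) (c, d) =
      amult R (\<lambda>m. tmap id \<phi> u (m, d)) (\<lambda>m. tmap id \<phi> u (m, c)) n"
    unfolding val .
next
  note U = SSpD[OF R C u]
  have "counit D (\<lambda>d. tmap id \<phi> u (n, d)) = counit C (\<lambda>c. u (n, c))" for n
    using \<phi> U(5)[of n] unfolding coalg_hom_def by (simp add: tmap_def)
  then show "(\<lambda>n. counit D (\<lambda>d. tmap id \<phi> u (n, d))) = aone R"
    using U(4) by simp
qed

section \<open>Supercommutative algebras of operators\<close>

definition findim :: "('i, 'k::field) svs \<Rightarrow> bool" where
  "findim V \<longleftrightarrow> (\<exists>B. finite B \<and> B \<subseteq> V 0 \<union> V 1 \<and> svcar V \<subseteq> fs.span B)"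

text \<open>The spanning family is indexed by natural numbers because the algebras to be constructed
  live on functions of a natural number.\<close>

lemma findim_enum:
  assumes "findim V"
  obtains c deg and n :: nat where "\<And>k. k < n \<Longrightarrow> c k \<in> V (deg k)" "svcar V \<subseteq> fs.span (c ` {..<n})"
proof -
  obtain B where B: "finite B" "B \<subseteq> V 0 \<union> V 1" "svcar V \<subseteq> fs.span B"
    using assms by (auto simp: findim_def)
  obtain xs where xs: "set xs = B"
    using finite_list[OF B(1)] by blast
  have "B = (!) xs ` {..<length xs}"
    using xs by (auto simp: set_conv_nth)
  moreover have "\<exists>p. xs ! k \<in> V p" if "k < length xs" for k
    using B(2) xs nth_mem[OF that] by blast
  then obtain deg where "\<And>k. k < length xs \<Longrightarrow> xs ! k \<in> V (deg k)"
    by metis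
  ultimately show ?thesis
    using B(3) that[of "length xs" "(!) xs" deg] by simp
qed

lemma findim_subspace:
  assumes "fs.subspace S" "S \<subseteq> fs.span F" "finite F"
  obtains B where "finite B" "B \<subseteq> S" "S = fs.span B"
proof -
  obtain B where B: "B \<subseteq> S" "fs.independent B" "S \<subseteq> fs.span B"
    using fs.maximal_independent_subset by blast
  have "finite B"
    using fs.independent_span_bound[OF assms(3) B(2)] B(1) assms(2) by blast
  moreover have "fs.span B \<subseteq> S"
    by (rule fs.span_minimal[OF B(1) assms(1)])
  ultimately show ?thesis
    using B that by blast
qed

lemma findimI:
  assumes V: "super_space V" and "\<And>p. V p \<subseteq> fs.span F" "finite F"
  shows "findim V"
proof -
  have "\<exists>B. finite B \<and> B \<subseteq> V p \<and> V p = fs.span B" for p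
    using findim_subspace[OF super_spaceD(1)[OF V] assms(2,3)] by metis
  then obtain B where B: "finite (B p)" "B p \<subseteq> V p" "V p = fs.span (B p)" for p
    by metis
  have "svcar V \<subseteq> fs.span (B 0 \<union> B 1)"
    unfolding svcar_def fs.span_Un using B(3) by blast
  moreover have "B 0 \<union> B 1 \<subseteq> V 0 \<union> V 1" "finite (B 0 \<union> B 1)"
    using B(1,2) by blast+
  ultimately show ?thesis
    unfolding findim_def by blast
qed

lemma dhom_cong:
  assumes "super_space V" "dhom d V W g" "\<And>x. x \<in> svcar V \<Longrightarrow> h x = g x"
  shows "dhom d V W h"
  using assms svcar_homogeneous[OF assms(1)] svcar_closed[OF assms(1)] unfolding dhom_def
  by (simp add: lin_on_def)

text \<open>The coordinate evaluations separate vectors; composing them with \<open>hcomp\<close>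
  makes them homogeneous.\<close>

lemma hform_separates:
  assumes V: "super_space V" and x: "x \<in> svcar V" and 0: "\<And>p f. hform V p f \<Longrightarrow> f x = 0"
  shows "x = 0"
proof
  fix a
  have "hcomp V p x a = 0" for p
    by (rule 0[OF hform_hcomp[OF V lform_eval]])
  then show "x a = 0 a"
    using hform_decomp[OF V lform_eval x, of a] by simp
qed

lemma lform_eq_on_span:
  assumes f: "lform S f" and g: "lform S g" and S: "fs.subspace S" and B: "B \<subseteq> S"
    and eq: "\<And>x. x \<in> B \<Longrightarrow> f x = g x" and x: "x \<in> fs.span B"
  shows "f x = g x"
proof -
  have "x \<in> S \<and> f x = g x"
    using x
  proof (induction rule: fs.span_induct_alt)
    case base
    show "0 \<in> S \<and> f 0 = g 0"
      using fs.subspace_0[OF S] lform_zero(1)[OF f] lform_zero(1)[OF g] by metis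
  next
    case (step a x y)
    have "x \<in> S" "fscale a x \<in> S"
      using step B fs.subspace_scale[OF S] by blast+
    then show "fscale a x + y \<in> S \<and> f (fscale a x + y) = g (fscale a x + y)"
      using step lformD[OF f] lformD[OF g] eq fs.subspace_add[OF S] by metis
  qed
  then show ?thesis ..
qed

locale operator_algebra =
  fixes W :: "('w, 'k::field) svs" and c :: "nat \<Rightarrow> 'w \<Rightarrow> 'k" and deg :: "nat \<Rightarrow> bit" and n :: nat
    and G :: "bit \<Rightarrow> (('w \<Rightarrow> 'k) \<Rightarrow> 'w \<Rightarrow> 'k) set" and \<omega> :: "('w \<Rightarrow> 'k) \<Rightarrow> 'k"
  assumes W: "super_space W"
    and c_in: "k < n \<Longrightarrow> c k \<in> W (deg k)"
    and c_span: "svcar W \<subseteq> fs.span (c ` {..<n})"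
    and G_dhom: "X \<in> G p \<Longrightarrow> dhom p W W X"
    and G_zero: "(\<lambda>w. 0) \<in> G p"
    and G_add: "X \<in> G p \<Longrightarrow> Y \<in> G p \<Longrightarrow> (\<lambda>w. X w + Y w) \<in> G p"
    and G_scale: "X \<in> G p \<Longrightarrow> (\<lambda>w. fscale a (X w)) \<in> G p"
    and G_comp: "X \<in> G p \<Longrightarrow> Y \<in> G q \<Longrightarrow> (\<lambda>w. X (Y w)) \<in> G (p + q)"
    and G_id: "(\<lambda>w. w) \<in> G 0"
    and G_commute: "X \<in> G p \<Longrightarrow> Y \<in> G q \<Longrightarrow> w \<in> W r \<Longrightarrow> X (Y w) = fscale (koszul p q) (Y (X w))"
    and \<omega>: "hform W 0 \<omega>"
    and nondeg: "w \<in> svcar W \<Longrightarrow> (\<And>p X. X \<in> G p \<Longrightarrow> \<omega> (X w) = 0) \<Longrightarrow> w = 0"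
begin

text \<open>Membership only concerns values on \<open>svcar W\<close>, since the operators are total
  functions that may be arbitrary elsewhere.\<close>

definition ops :: "(('w \<Rightarrow> 'k) \<Rightarrow> 'w \<Rightarrow> 'k) set" where
  "ops = {X. \<exists>X0\<in>G 0. \<exists>X1\<in>G 1. \<forall>w\<in>svcar W. X w = X0 w + X1 w}"

text \<open>
  An operator is encoded by the values of \<open>\<omega>\<close> on the images of the generators \<open>c\<close>, because algebras
  live on functions of a natural number; nondegeneracy and commutativity make the encoding injective.
\<close>

definition symb :: "(('w \<Rightarrow> 'k) \<Rightarrow> 'w \<Rightarrow> 'k) \<Rightarrow> nat \<Rightarrow> 'k" where
  "symb X = (\<lambda>k. if k < n then \<omega> (X (c k)) else 0)"

text \<open>The product decodes both factors by a choice of operators; \<open>ops_faithful\<close>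
  makes the result independent of the choice, as recorded in \<open>alg_mult\<close>.\<close>

definition alg :: "'k salg" where
  "alg = \<lparr>asp = (\<lambda>p. symb ` G p),
     amult = (\<lambda>x y. symb (\<lambda>w. (SOME X. X \<in> ops \<and> symb X = x) ((SOME Y. Y \<in> ops \<and> symb Y = y) w))),
     aone = symb (\<lambda>w. w)\<rparr>"

lemma \<omega>_lform: "lform (svcar W) \<omega>"
  by (rule hformD(1)[OF \<omega>])

lemma c_car: "k < n \<Longrightarrow> c k \<in> svcar W"
  using c_in svcar_homogeneous[OF W] by blast

lemma G_car: "X \<in> G p \<Longrightarrow> w \<in> svcar W \<Longrightarrow> X w \<in> svcar W"
  using dhom_car[OF G_dhom W W] by blast

lemma G_lin: "X \<in> G p \<Longrightarrow> lin_on (svcar W) X"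
  using dhomD(1)[OF G_dhom] by blast

lemma opsI:
  "X0 \<in> G 0 \<Longrightarrow> X1 \<in> G 1 \<Longrightarrow> (\<And>w. w \<in> svcar W \<Longrightarrow> X w = X0 w + X1 w) \<Longrightarrow> X \<in> ops"
  unfolding ops_def by blast

lemma ops_lin: "X \<in> ops \<Longrightarrow> lin_on (svcar W) X"
  unfolding ops_def
proof clarify
  fix X0 X1 assume X: "X0 \<in> G 0" "X1 \<in> G 1" "\<forall>w\<in>svcar W. X w = X0 w + X1 w"
  show "lin_on (svcar W) X"
    using G_lin[OF X(1)] G_lin[OF X(2)] X(3) svcar_closed[OF W]
    by (simp add: lin_on_def fs.scale_right_distrib algebra_simps)
qed

lemma ops_car: "X \<in> ops \<Longrightarrow> w \<in> svcar W \<Longrightarrow> X w \<in> svcar W"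
  unfolding ops_def using G_car svcar_closed(1)[OF W] by force

lemma G_ops: "X \<in> G p \<Longrightarrow> X \<in> ops"
proof -
  assume X: "X \<in> G p"
  have "p = 0 \<or> p = 1"
    by (cases p) auto
  then show "X \<in> ops"
  proof
    assume "p = 0"
    then show ?thesis
      using X by (intro opsI[OF _ G_zero]) simp_all
  next
    assume "p = 1"
    then show ?thesis
      using X by (intro opsI[OF G_zero]) simp_all
  qed
qed

lemma ops_add: "X \<in> ops \<Longrightarrow> Y \<in> ops \<Longrightarrow> (\<lambda>w. X w + Y w) \<in> ops"
proof -
  assume "X \<in> ops" "Y \<in> ops"
  then obtain X0 X1 Y0 Y1 where *: "X0 \<in> G 0" "X1 \<in> G 1" "Y0 \<in> G 0" "Y1 \<in> G 1"
    "\<And>w. w \<in> svcar W \<Longrightarrow> X w = X0 w + X1 w" "\<And>w. w \<in> svcar W \<Longrightarrow> Y w = Y0 w + Y1 w"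
    unfolding ops_def by blast
  show ?thesis
    by (rule opsI[OF G_add[OF *(1,3)] G_add[OF *(2,4)]]) (simp add: *(5,6) algebra_simps)
qed

lemma ops_scale: "X \<in> ops \<Longrightarrow> (\<lambda>w. fscale a (X w)) \<in> ops"
proof -
  assume "X \<in> ops"
  then obtain X0 X1 where *: "X0 \<in> G 0" "X1 \<in> G 1" "\<And>w. w \<in> svcar W \<Longrightarrow> X w = X0 w + X1 w"
    unfolding ops_def by blast
  show ?thesis
    by (rule opsI[OF G_scale[OF *(1)] G_scale[OF *(2)]]) (simp add: *(3) fs.scale_right_distrib)
qed

lemma ops_comp: "X \<in> ops \<Longrightarrow> Y \<in> ops \<Longrightarrow> (\<lambda>w. X (Y w)) \<in> ops"
proof -
  assume Xop: "X \<in> ops" and Yop: "Y \<in> ops"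
  then obtain X0 X1 Y0 Y1 where *: "X0 \<in> G 0" "X1 \<in> G 1" "Y0 \<in> G 0" "Y1 \<in> G 1"
    "\<And>w. w \<in> svcar W \<Longrightarrow> X w = X0 w + X1 w" "\<And>w. w \<in> svcar W \<Longrightarrow> Y w = Y0 w + Y1 w"
    unfolding ops_def by blast
  have XY: "X (Y w) = (X0 (Y0 w) + X1 (Y1 w)) + (X0 (Y1 w) + X1 (Y0 w))" if w: "w \<in> svcar W" for w
  proof -
    have Y: "Y0 w \<in> svcar W" "Y1 w \<in> svcar W"
      using G_car * w by blast+
    have "X (Y w) = X (Y0 w) + X (Y1 w)"
      using ops_lin[OF Xop] Y *(6)[OF w] by (simp add: lin_on_def)
    then show ?thesis
      using *(5) Y by (simp add: algebra_simps)
  qed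
  have "(\<lambda>w. X0 (Y0 w) + X1 (Y1 w)) \<in> G 0"
    using G_comp[OF *(1,3)] G_comp[OF *(2,4)] by (intro G_add) simp_all
  moreover have "(\<lambda>w. X0 (Y1 w) + X1 (Y0 w)) \<in> G 1"
    using G_comp[OF *(1,4)] G_comp[OF *(2,3)] by (intro G_add) simp_all
  ultimately show ?thesis
    by (rule opsI) (rule XY)
qed

lemma symb_add: "X \<in> ops \<Longrightarrow> Y \<in> ops \<Longrightarrow> symb (\<lambda>w. X w + Y w) = symb X + symb Y"
  using lformD(1)[OF \<omega>_lform] ops_car c_car by (auto simp: symb_def fun_eq_iff)

lemma symb_scale: "X \<in> ops \<Longrightarrow> symb (\<lambda>w. fscale a (X w)) = fscale a (symb X)"
proof
  fix k
  assume "X \<in> ops"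
  then show "symb (\<lambda>w. fscale a (X w)) k = fscale a (symb X) k"
    using lformD(2)[OF \<omega>_lform ops_car[OF _ c_car]] by (simp add: symb_def fscale_def[of a "symb X"] fscale_def[of a "\<lambda>k. if k < n then _ k else 0"])
qed

lemma symb_cong: "(\<And>w. w \<in> svcar W \<Longrightarrow> X w = Y w) \<Longrightarrow> symb X = symb Y"
  using c_car by (auto simp: symb_def)

lemma symb_eqD:
  assumes "X \<in> ops" "Y \<in> ops" "symb X = symb Y" "w \<in> svcar W"
  shows "\<omega> (X w) = \<omega> (Y w)"
proof (rule lform_eq_on_span[where S = "svcar W" and B = "c ` {..<n}" and f = "\<lambda>w. \<omega> (X w)"
      and g = "\<lambda>w. \<omega> (Y w)"])
  have "lform (svcar W) (\<lambda>w. \<omega> (Z w))" if "Z \<in> ops" for Z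
    by (rule lform_comp[OF ops_lin[OF that] _ \<omega>_lform]) (rule ops_car[OF that])
  then show "lform (svcar W) (\<lambda>w. \<omega> (X w))" "lform (svcar W) (\<lambda>w. \<omega> (Y w))"
    using assms by blast+
  show "\<omega> (X x) = \<omega> (Y x)" if "x \<in> c ` {..<n}" for x
  proof -
    obtain k where "k < n" "x = c k"
      using \<open>x \<in> c ` {..<n}\<close> by blast
    then show ?thesis
      using fun_cong[OF assms(3), of k] by (simp add: symb_def)
  qed
qed (use svcar_subspace[OF W] c_car c_span assms in auto)

text \<open>For any \<open>Z\<close> in \<open>G\<close> supercommutativity moves \<open>Z\<close>
  to the right of \<open>X\<close> and of \<open>Y\<close> with the same sign, since both have
  parity \<open>p\<close>; so \<omega> cannot distinguish \<open>Z (X w)\<close> from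
  \<open>Z (Y w)\<close>, and nondegeneracy applies to \<open>X w - Y w\<close>.\<close>

lemma hom_faithful:
  assumes X: "X \<in> G p" and Y: "Y \<in> G p" and eq: "\<And>v. v \<in> svcar W \<Longrightarrow> \<omega> (X v) = \<omega> (Y v)"
    and w: "w \<in> svcar W"
  shows "X w = Y w"
proof (rule lin_on_eqI[OF W G_lin[OF X] G_lin[OF Y] w])
  fix q w assume w: "w \<in> W q"
  note wc = svcar_homogeneous[OF W w]
  have "\<omega> (Z (X w - Y w)) = 0" if Z: "Z \<in> G r" for r Z
  proof -
    have k: "\<omega> (Z (X' w)) = koszul r p * \<omega> (X' (Z w))" if "X' \<in> G p" for X'
      using G_commute[OF Z that w] lformD(2)[OF \<omega>_lform G_car[OF that G_car[OF Z wc]]] by simp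
    have "\<omega> (Z (X w - Y w)) = \<omega> (Z (X w) - Z (Y w))"
      using lin_on_diff[OF G_lin[OF Z] svcar_subspace[OF W] G_car[OF X wc] G_car[OF Y wc]] by simp
    also have "\<dots> = \<omega> (Z (X w)) - \<omega> (Z (Y w))"
      by (rule lform_diff[OF \<omega>_lform svcar_subspace[OF W] G_car[OF Z G_car[OF X wc]] G_car[OF Z G_car[OF Y wc]]])
    also have "\<dots> = 0"
      using k[OF X] k[OF Y] eq[OF G_car[OF Z wc]] by simp
    finally show ?thesis .
  qed
  then have "X w - Y w = 0"
    by (intro nondeg svcarD(3)[OF W] G_car[OF X wc] G_car[OF Y wc])
  then show "X w = Y w" by simp
qed

text \<open>As \<omega> is even, on a vector of degree \<open>q\<close> it sees only the part of an
  operator that has parity \<open>q\<close>. The composite with \<omega> thus determines the even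
  and the odd part separately, and \<open>hom_faithful\<close> applies to each.\<close>

lemma ops_faithful:
  assumes X: "X \<in> ops" and Y: "Y \<in> ops" and eq: "symb X = symb Y" and w: "w \<in> svcar W"
  shows "X w = Y w"
proof -
  obtain X0 X1 where X': "X0 \<in> G 0" "X1 \<in> G 1" "\<And>w. w \<in> svcar W \<Longrightarrow> X w = X0 w + X1 w"
    using X unfolding ops_def by blast
  obtain Y0 Y1 where Y': "Y0 \<in> G 0" "Y1 \<in> G 1" "\<And>w. w \<in> svcar W \<Longrightarrow> Y w = Y0 w + Y1 w"
    using Y unfolding ops_def by blast
  have vanish: "\<omega> (Z v) = 0" if "Z \<in> G p" "v \<in> W q" "p \<noteq> q" for Z p q v
  proof -
    have "p + q \<noteq> 0"
      using that(3) by (cases p; cases q) auto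
    then show ?thesis
      using hformD(2)[OF \<omega> dhomD(2)[OF G_dhom[OF that(1)] that(2)]] by simp
  qed
  have split: "\<omega> (A w + B w) = \<omega> (A w) + \<omega> (B w)" if "A \<in> G 0" "B \<in> G 1" "w \<in> svcar W" for A B w
    using lformD(1)[OF \<omega>_lform G_car[OF that(1,3)] G_car[OF that(2,3)]] .
  have *: "\<omega> (X0 w) = \<omega> (Y0 w) \<and> \<omega> (X1 w) = \<omega> (Y1 w)" if w: "w \<in> W q" for w q
  proof -
    note wc = svcar_homogeneous[OF W w]
    have e: "\<omega> (X0 w) + \<omega> (X1 w) = \<omega> (Y0 w) + \<omega> (Y1 w)"
      using symb_eqD[OF X Y eq wc] X'(3)[OF wc] Y'(3)[OF wc] split[OF X'(1,2) wc] split[OF Y'(1,2) wc]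
      by simp
    show ?thesis
    proof (cases "q = 0")
      case True
      then have "\<omega> (X1 w) = 0" "\<omega> (Y1 w) = 0"
        using vanish[OF X'(2) w] vanish[OF Y'(2) w] by simp_all
      then show ?thesis using e by simp
    next
      case False
      then have "\<omega> (X0 w) = 0" "\<omega> (Y0 w) = 0"
        using vanish[OF X'(1) w] vanish[OF Y'(1) w] by simp_all
      then show ?thesis using e by simp
    qed
  qed
  have ext: "\<omega> (A w) = \<omega> (B w)"
    if "A \<in> G p" "B \<in> G p" "\<And>w q. w \<in> W q \<Longrightarrow> \<omega> (A w) = \<omega> (B w)" "w \<in> svcar W" for A B p w
  proof -
    note l = lform_comp[OF G_lin G_car \<omega>_lform]
    show ?thesis
      using hform_decomp[OF W l[OF that(1) that(1)] that(4)] hform_decomp[OF W l[OF that(2) that(2)] that(4)]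
        that(3)[OF hcomp_in(1)[OF W that(4)]] by simp
  qed
  have "X0 w = Y0 w" "X1 w = Y1 w"
    using ext[OF X'(1) Y'(1)] ext[OF X'(2) Y'(2)] * w by (blast intro: hom_faithful[OF X'(1) Y'(1)] hom_faithful[OF X'(2) Y'(2)])+
  then show ?thesis
    using X'(3) Y'(3) w by simp
qed

lemma alg_simps: "asp alg p = symb ` G p" "aone alg = symb (\<lambda>w. w)"
  by (simp_all add: alg_def)

lemma alg_car: "acar alg = symb ` ops"
proof
  show "acar alg \<subseteq> symb ` ops"
  proof
    fix x assume "x \<in> acar alg"
    then obtain X Y where XY: "X \<in> G 0" "Y \<in> G 1" "x = symb X + symb Y"
      unfolding svcar_def alg_simps by blast
    then have "x = symb (\<lambda>w. X w + Y w)"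
      using symb_add G_ops by metis
    then show "x \<in> symb ` ops"
      using ops_add G_ops XY by blast
  qed
  show "symb ` ops \<subseteq> acar alg"
  proof
    fix x assume "x \<in> symb ` ops"
    then obtain X where X: "X \<in> ops" "x = symb X"
      by blast
    then obtain X0 X1 where X': "X0 \<in> G 0" "X1 \<in> G 1" "\<And>w. w \<in> svcar W \<Longrightarrow> X w = X0 w + X1 w"
      unfolding ops_def by blast
    have "x = symb (\<lambda>w. X0 w + X1 w)"
      unfolding X(2) by (rule symb_cong[OF X'(3)])
    also have "\<dots> = symb X0 + symb X1"
      using symb_add G_ops X' by blast
    finally show "x \<in> acar alg"
      unfolding svcar_def alg_simps using X' by blast
  qed
qed

lemma alg_mult:
  assumes "X \<in> ops" "Y \<in> ops"
  shows "amult alg (symb X) (symb Y) = symb (\<lambda>w. X (Y w))"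
proof -
  define X' Y' where "X' = (SOME Z. Z \<in> ops \<and> symb Z = symb X)" and "Y' = (SOME Z. Z \<in> ops \<and> symb Z = symb Y)"
  have X': "X' \<in> ops \<and> symb X' = symb X"
    unfolding X'_def using someI[of "\<lambda>Z. Z \<in> ops \<and> symb Z = symb X" X] assms by simp
  have Y': "Y' \<in> ops \<and> symb Y' = symb Y"
    unfolding Y'_def using someI[of "\<lambda>Z. Z \<in> ops \<and> symb Z = symb Y" Y] assms by simp
  have "amult alg (symb X) (symb Y) = symb (\<lambda>w. X' (Y' w))"
    by (simp add: alg_def X'_def Y'_def)
  also have "\<dots> = symb (\<lambda>w. X (Y w))"
  proof (rule symb_cong)
    fix w assume w: "w \<in> svcar W"
    have "Y' w = Y w"
      using ops_faithful[of Y' Y w] Y' assms(2) w by blast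
    then show "X' (Y' w) = X (Y w)"
      using ops_faithful[of X' X "Y w"] X' assms ops_car[OF assms(2) w] by simp
  qed
  finally show ?thesis .
qed

lemma alg_SAlgf: "alg \<in> SAlgf"
proof -
  have sub: "fs.subspace (asp alg p)" for p
    unfolding fs.subspace_def alg_simps
  proof (intro conjI ballI allI)
    show "0 \<in> symb ` G p"
      using G_zero[of p] lform_zero(1)[OF \<omega>_lform svcarD(1)[OF W]]
      by (intro image_eqI[of _ _ "\<lambda>w. 0"]) (auto simp: symb_def fun_eq_iff)
    show "x + y \<in> symb ` G p" if xy: "x \<in> symb ` G p" "y \<in> symb ` G p" for x y
    proof -
      obtain X Y where "X \<in> G p" "Y \<in> G p" "x = symb X" "y = symb Y"
        using xy by blast
      then show ?thesis
        using symb_add[OF G_ops G_ops, of X p Y p] by (intro image_eqI[OF _ G_add[of X p Y]]) auto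
    qed
    show "fscale a x \<in> symb ` G p" if x: "x \<in> symb ` G p" for a x
    proof -
      obtain X where "X \<in> G p" "x = symb X"
        using x by blast
      then show ?thesis
        using symb_scale[OF G_ops, of X p a] by (intro image_eqI[OF _ G_scale[of X p a]]) auto
    qed
  qed
  have disj: "x = 0" if x: "x \<in> asp alg 0" "x \<in> asp alg 1" for x
  proof -
    obtain X Y where XY: "X \<in> G 0" "Y \<in> G 1" "x = symb X" "x = symb Y"
      using x unfolding alg_simps by blast
    have "x k = 0" for k
    proof (cases "k < n")
      case True
      \<comment> \<open>At \<open>k\<close> the even functional \<omega> annihilates whichever of
        the two operators has parity different from \<open>deg k\<close>.\<close>
      have "deg k \<noteq> 0 \<or> 1 + deg k \<noteq> 0"
        by (cases "deg k") auto
      then have "\<omega> (X (c k)) = 0 \<or> \<omega> (Y (c k)) = 0"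
        using hformD(2)[OF \<omega> dhomD(2)[OF G_dhom[OF XY(1)] c_in[OF True]]]
          hformD(2)[OF \<omega> dhomD(2)[OF G_dhom[OF XY(2)] c_in[OF True]]] by auto
      then show ?thesis
        using XY(3,4) True by (metis symb_def)
    next
      case False
      then show ?thesis using XY(3) by (simp add: symb_def)
    qed
    then show "x = 0" by auto
  qed
  have ss: "super_space (asp alg)"
    using sub disj fs.subspace_0[OF sub] unfolding super_space_def by blast
  \<comment> \<open>Symbols vanish from \<open>n\<close> on, so the unit vectors at the indices
    below \<open>n\<close> span a space containing all of them.\<close>
  let ?\<delta> = "\<lambda>k i :: nat. if i = k then 1 else 0 :: 'k"
  have "acar alg \<subseteq> fs.span (?\<delta> ` {..<n})"
  proof
    fix x assume "x \<in> acar alg"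
    then obtain X where X: "x = symb X"
      unfolding alg_car by blast
    have "x = (\<Sum>k<n. fscale (x k) (?\<delta> k))"
    proof
      fix i
      have "(\<Sum>k<n. fscale (x k) (?\<delta> k)) i = (\<Sum>k<n. if i = k then x k else 0)"
        by (induction n) (auto simp: fscale_def)
      then show "x i = (\<Sum>k<n. fscale (x k) (?\<delta> k)) i"
        by (simp add: X symb_def)
    qed
    moreover have "(\<Sum>k<n. fscale (x k) (?\<delta> k)) \<in> fs.span (?\<delta> ` {..<n})"
      by (intro fs.span_sum fs.span_scale fs.span_base) auto
    ultimately show "x \<in> fs.span (?\<delta> ` {..<n})"
      by metis
  qed
  then obtain B where fd: "finite B" "acar alg = fs.span B"
    by (rule findim_subspace[OF svcar_subspace[OF ss] _ finite_imageI[OF finite_lessThan]])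
  have lin: "lin_on (acar alg) (amult alg x) \<and> lin_on (acar alg) (\<lambda>y. amult alg y x)"
    if x: "x \<in> acar alg" for x
  proof -
    obtain X where X: "X \<in> ops" "x = symb X"
      using x unfolding alg_car by blast
    have "amult alg x (y + z) = amult alg x y + amult alg x z \<and>
        amult alg (y + z) x = amult alg y x + amult alg z x"
      if yz: "y \<in> acar alg" "z \<in> acar alg" for y z
    proof -
      obtain Y Z where Y: "Y \<in> ops" "y = symb Y" and Z: "Z \<in> ops" "z = symb Z"
        using yz unfolding alg_car by blast
      have s: "y + z = symb (\<lambda>w. Y w + Z w)"
        using symb_add Y Z by simp
      have 1: "symb (\<lambda>w. X (Y w + Z w)) = symb (\<lambda>w. X (Y w) + X (Z w))"
        using ops_lin[OF X(1)] ops_car[OF Y(1)] ops_car[OF Z(1)]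
        by (intro symb_cong) (auto simp: lin_on_def)
      have "amult alg x (y + z) = symb (\<lambda>w. X (Y w) + X (Z w))"
        unfolding s X(2) alg_mult[OF X(1) ops_add[OF Y(1) Z(1)]] by (rule 1)
      also have "\<dots> = amult alg x y + amult alg x z"
        unfolding X(2) Y(2) Z(2) alg_mult[OF X(1) Y(1)] alg_mult[OF X(1) Z(1)]
        by (rule symb_add[OF ops_comp[OF X(1) Y(1)] ops_comp[OF X(1) Z(1)]])
      finally have A: "amult alg x (y + z) = amult alg x y + amult alg x z" .
      have "amult alg (y + z) x = symb (\<lambda>w. Y (X w) + Z (X w))"
        unfolding s X(2) by (rule alg_mult[OF ops_add[OF Y(1) Z(1)] X(1)])
      also have "\<dots> = amult alg y x + amult alg z x"
        unfolding X(2) Y(2) Z(2) alg_mult[OF Y(1) X(1)] alg_mult[OF Z(1) X(1)]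
        by (rule symb_add[OF ops_comp[OF Y(1) X(1)] ops_comp[OF Z(1) X(1)]])
      finally show ?thesis using A by blast
    qed
    moreover have "amult alg x (fscale a y) = fscale a (amult alg x y) \<and>
        amult alg (fscale a y) x = fscale a (amult alg y x)" if y: "y \<in> acar alg" for a y
    proof -
      obtain Y where Y: "Y \<in> ops" "y = symb Y"
        using y unfolding alg_car by blast
      have s: "fscale a y = symb (\<lambda>w. fscale a (Y w))"
        using symb_scale Y by simp
      have 1: "symb (\<lambda>w. X (fscale a (Y w))) = symb (\<lambda>w. fscale a (X (Y w)))"
        using ops_lin[OF X(1)] ops_car[OF Y(1)] by (intro symb_cong) (auto simp: lin_on_def)
      have "amult alg x (fscale a y) = symb (\<lambda>w. fscale a (X (Y w)))"
        unfolding s X(2) alg_mult[OF X(1) ops_scale[OF Y(1)]] by (rule 1)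
      also have "\<dots> = fscale a (amult alg x y)"
        unfolding X(2) Y(2) alg_mult[OF X(1) Y(1)] by (rule symb_scale[OF ops_comp[OF X(1) Y(1)]])
      finally have A: "amult alg x (fscale a y) = fscale a (amult alg x y)" .
      have "amult alg (fscale a y) x = symb (\<lambda>w. fscale a (Y (X w)))"
        unfolding s X(2) by (rule alg_mult[OF ops_scale[OF Y(1)] X(1)])
      also have "\<dots> = fscale a (amult alg y x)"
        unfolding X(2) Y(2) alg_mult[OF Y(1) X(1)] by (rule symb_scale[OF ops_comp[OF Y(1) X(1)]])
      finally show ?thesis using A by blast
    qed
    ultimately show ?thesis
      unfolding lin_on_def by blast
  qed
  have hom: "amult alg x y \<in> asp alg (p + q)" if xy: "x \<in> asp alg p" "y \<in> asp alg q" for x y p q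
  proof -
    obtain X Y where XY: "X \<in> G p" "Y \<in> G q" "x = symb X" "y = symb Y"
      using xy unfolding alg_simps by blast
    then show ?thesis
      using alg_mult[of X Y] G_ops G_comp[OF XY(1,2)] unfolding alg_simps by blast
  qed
  have assoc: "amult alg (amult alg x y) z = amult alg x (amult alg y z)"
    if xyz: "x \<in> acar alg" "y \<in> acar alg" "z \<in> acar alg" for x y z
  proof -
    obtain X Y Z where "X \<in> ops" "Y \<in> ops" "Z \<in> ops" "x = symb X" "y = symb Y" "z = symb Z"
      using xyz unfolding alg_car by blast
    then show ?thesis
      by (simp add: alg_mult ops_comp)
  qed
  have unit: "amult alg (aone alg) x = x \<and> amult alg x (aone alg) = x" if x: "x \<in> acar alg" for x
  proof -
    obtain X where "X \<in> ops" "x = symb X"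
      using x unfolding alg_car by blast
    then show ?thesis
      using alg_mult[of X "\<lambda>w. w"] alg_mult[of "\<lambda>w. w" X] G_ops[OF G_id] unfolding alg_simps by simp
  qed
  have comm: "amult alg x y = fscale (koszul p q) (amult alg y x)"
    if xy: "x \<in> asp alg p" "y \<in> asp alg q" for x y p q
  proof -
    obtain X Y where XY: "X \<in> G p" "Y \<in> G q" "x = symb X" "y = symb Y"
      using xy unfolding alg_simps by blast
    note o = G_ops[OF XY(1)] G_ops[OF XY(2)]
    have "symb (\<lambda>w. X (Y w)) = symb (\<lambda>w. fscale (koszul p q) (Y (X w)))"
      using G_commute[OF XY(1,2) c_in] by (auto simp: symb_def)
    then show ?thesis
      unfolding XY(3,4) alg_mult[OF o] alg_mult[OF o(2,1)] symb_scale[OF ops_comp[OF o(2,1)]] .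
  qed
  have one: "aone alg \<in> asp alg 0"
    unfolding alg_simps using G_id by blast
  show ?thesis
    unfolding SAlgf_def using ss fd lin hom assoc one unit comm by blast
qed

text \<open>The map \<pi> written as a tensor with coefficients in \<open>alg\<close>: a functional
  applied to the rows gives the symbol of the operator attached to that functional.\<close>

definition coord :: "(('w \<Rightarrow> 'k) \<Rightarrow> 'c \<Rightarrow> 'k) \<Rightarrow> nat \<times> 'c \<Rightarrow> 'k" where
  "coord \<pi> = (\<lambda>(k, e). if k < n then \<pi> (c k) e else 0)"

text \<open>Points of \<open>SSp C\<close> are algebra homomorphisms on functionals, so a point with
  values in \<open>alg\<close> amounts to a multiplicative assignment of operators to functionals.
  Here this is \<open>\<Lambda>\<close>, tied to \<pi> by \<open>\<Lambda>_\<omega>\<close>. It is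
  given on homogeneous functionals only and may depend on their parity, because the right action on
  the cotensor square carries a parity-dependent sign.\<close>

lemma coord_point:
  fixes C :: "('c, 'k) scoalg"
  assumes C: "super_coalgebra C" and \<pi>: "super_hom W (csp C) \<pi>"
    and \<Lambda>_in: "\<And>p f. hform (csp C) p f \<Longrightarrow> \<Lambda> p f \<in> G p"
    and \<Lambda>_\<omega>: "\<And>p f w. hform (csp C) p f \<Longrightarrow> w \<in> svcar W \<Longrightarrow> \<omega> (\<Lambda> p f w) = f (\<pi> w)"
    and \<Lambda>_mult: "\<And>p q f g w. hform (csp C) p f \<Longrightarrow> hform (csp C) q g \<Longrightarrow> w \<in> svcar W \<Longrightarrow>
      \<omega> (\<Lambda> p f (\<Lambda> q g w)) = fmul C f g (\<pi> w)"
    and unit: "\<And>w. w \<in> svcar W \<Longrightarrow> counit C (\<pi> w) = \<omega> w"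
  shows "coord \<pi> \<in> Ob (SSp C) alg"
    and "hform (csp C) p f \<Longrightarrow> symb (\<Lambda> p f) = (\<lambda>k. f (\<lambda>e. coord \<pi> (k, e)))"
proof -
  let ?x = "coord \<pi>"
  note Cs = coalgD(1)[OF C]
  let ?h = "hcomp (csp C)"
  have \<pi>_car: "\<pi> w \<in> ccar C" if "w \<in> svcar W" for w
    using dhom_car[OF _ W Cs that] \<pi> by (simp add: super_hom_iff_dhom)
  have val: "(\<lambda>e. ?x (k, e)) = (if k < n then \<pi> (c k) else 0)" for k
    by (auto simp: fun_eq_iff coord_def)
  show symb_\<Lambda>: "symb (\<Lambda> p f) = (\<lambda>k. f (\<lambda>e. ?x (k, e)))" if f: "hform (csp C) p f" for p f
    unfolding val symb_def
    using \<Lambda>_\<omega>[OF f c_car] lform_zero(1)[OF hformD(1)[OF f] svcarD(1)[OF Cs]] by (auto simp: fun_eq_iff)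
  \<comment> \<open>Coordinate evaluations need not be homogeneous, so \<open>\<Lambda>\<close> is
    extended additively over the two homogeneous parts of a functional.\<close>
  define \<Phi> where "\<Phi> f = (\<lambda>w. \<Lambda> 0 (\<lambda>x. f (?h 0 x)) w + \<Lambda> 1 (\<lambda>x. f (?h 1 x)) w)" for f
  note hf = hform_hcomp[OF Cs]
  have \<Phi>_ops: "\<Phi> f \<in> ops" if "lform (ccar C) f" for f
    unfolding \<Phi>_def using ops_add[OF G_ops[OF \<Lambda>_in[OF hf]] G_ops[OF \<Lambda>_in[OF hf]], OF that that] .
  have \<Phi>_symb: "symb (\<Phi> f) = (\<lambda>k. f (\<lambda>e. ?x (k, e)))" if f: "lform (ccar C) f" for f
  proof -
    have "symb (\<Phi> f) = symb (\<Lambda> 0 (\<lambda>x. f (?h 0 x))) + symb (\<Lambda> 1 (\<lambda>x. f (?h 1 x)))"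
      unfolding \<Phi>_def by (rule symb_add[OF G_ops[OF \<Lambda>_in[OF hf]] G_ops[OF \<Lambda>_in[OF hf]], OF f f])
    also have "\<dots> = (\<lambda>k. f (\<lambda>e. ?x (k, e)))"
    proof
      fix k
      have "(\<lambda>e. ?x (k, e)) \<in> ccar C"
        unfolding val using \<pi>_car[OF c_car] svcarD(1)[OF Cs] by simp
      then show "(symb (\<Lambda> 0 (\<lambda>x. f (?h 0 x))) + symb (\<Lambda> 1 (\<lambda>x. f (?h 1 x)))) k = f (\<lambda>e. ?x (k, e))"
        using hform_decomp[OF Cs f] symb_\<Lambda>[OF hf[OF f]] by simp
    qed
    finally show ?thesis .
  qed
  have fmul_add: "fmul C f g x = (fmul C (\<lambda>x. f (?h 0 x)) (\<lambda>x. g (?h 0 x)) x + fmul C (\<lambda>x. f (?h 0 x)) (\<lambda>x. g (?h 1 x)) x)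
      + (fmul C (\<lambda>x. f (?h 1 x)) (\<lambda>x. g (?h 0 x)) x + fmul C (\<lambda>x. f (?h 1 x)) (\<lambda>x. g (?h 1 x)) x)"
    if f: "lform (ccar C) f" and g: "lform (ccar C) g" and x: "x \<in> ccar C" for f g x
  proof -
    have "fmul C f g x = g (\<lambda>a. f (?h 0 (\<lambda>b. comult C x (a, b))) + f (?h 1 (\<lambda>b. comult C x (a, b))))"
      unfolding fmul_def ract_def using hform_decomp[OF Cs f comult_slice(1)[OF C x]] by presburger
    also have "\<dots> = g (ract C (\<lambda>x. f (?h 0 x)) x + ract C (\<lambda>x. f (?h 1 x)) x)"
      unfolding ract_def by (simp add: plus_fun_def)
    also have "\<dots> = g (ract C (\<lambda>x. f (?h 0 x)) x) + g (ract C (\<lambda>x. f (?h 1 x)) x)"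
      using lformD(1)[OF g act_car(2)[OF C hformD(1)[OF hf[OF f]] x] act_car(2)[OF C hformD(1)[OF hf[OF f]] x]] .
    finally show ?thesis
      unfolding fmul_def using hform_decomp[OF Cs g act_car(2)[OF C hformD(1)[OF hf[OF f]] x]] by simp
  qed
  have \<Phi>_mult: "\<omega> (\<Phi> f (\<Phi> g w)) = fmul C f g (\<pi> w)"
    if f: "lform (ccar C) f" and g: "lform (ccar C) g" and w: "w \<in> svcar W" for f g w
  proof -
    let ?L = "\<lambda>p f. \<Lambda> p (\<lambda>x. f (?h p x))"
    have L: "?L p f \<in> G p" "?L p g \<in> G p" for p
      using \<Lambda>_in[OF hf] f g by blast+
    have LL: "?L p f (?L q g w) \<in> svcar W" "?L q g w \<in> svcar W" for p q
      using G_car[OF L(1) G_car[OF L(2) w]] G_car[OF L(2) w] by blast+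
    have "\<omega> (\<Phi> f v) = \<omega> (?L 0 f v) + \<omega> (?L 1 f v)" if "v \<in> svcar W" for v
      unfolding \<Phi>_def by (rule lformD(1)[OF \<omega>_lform G_car[OF L(1) that] G_car[OF L(1) that]])
    then have "\<omega> (\<Phi> f (\<Phi> g w)) = \<omega> (?L 0 f (\<Phi> g w)) + \<omega> (?L 1 f (\<Phi> g w))"
      using ops_car[OF \<Phi>_ops[OF g] w] by blast
    moreover have "\<omega> (?L p f (\<Phi> g w)) = \<omega> (?L p f (?L 0 g w)) + \<omega> (?L p f (?L 1 g w))" for p
      using G_lin[OF L(1), of p] LL lformD(1)[OF \<omega>_lform LL(1) LL(1)] unfolding \<Phi>_def lin_on_def by metis
    ultimately show ?thesis
      using \<Lambda>_mult[OF hf[OF f] hf[OF g] w] fmul_add[OF f g \<pi>_car[OF w]] by simp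
  qed
  \<comment> \<open>An ambient graded space in which the coefficients are visibly homogeneous:
    \<open>coord \<pi>\<close> is a sum of even pure tensors over \<open>F\<close>. All its slices
    lie in \<open>alg\<close>, so the left factor can afterwards be shrunk from \<open>F\<close> to
    \<open>alg\<close>.\<close>
  define F where "F p = {v :: nat \<Rightarrow> 'k. \<forall>k. v k \<noteq> 0 \<longrightarrow> k < n \<and> deg k = p}" for p
  have F_sub: "fs.subspace (F p)" for p
    unfolding fs.subspace_def F_def fscale_def by auto (metis add.right_neutral)+
  have "v = 0" if "v \<in> F 0" "v \<in> F 1" for v
  proof
    fix k
    show "v k = 0 k"
      using that by (cases "v k = 0") (auto simp: F_def)
  qed
  then have F: "super_space F"
    using F_sub fs.subspace_0[OF F_sub] unfolding super_space_def by blast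
  have alg_F: "asp alg p \<subseteq> F p" for p
  proof
    fix x assume "x \<in> asp alg p"
    then obtain X where X: "X \<in> G p" "x = symb X"
      unfolding alg_simps by blast
    have "k < n \<and> deg k = p" if "x k \<noteq> 0" for k
    proof -
      have k: "k < n" "\<omega> (X (c k)) \<noteq> 0"
        using that X(2) by (auto simp: symb_def split: if_splits)
      have "p + deg k = 0"
        using hformD(2)[OF \<omega> dhomD(2)[OF G_dhom[OF X(1)] c_in[OF k(1)]]] k(2) by blast
      then show ?thesis
        using k(1) bit_add_eq_iff[of p "deg k" 0] by simp
    qed
    then show "x \<in> F p"
      unfolding F_def by blast
  qed
  have as: "super_space (asp alg)"
    by (rule SAlgfD(1)[OF alg_SAlgf])
  have slice: "(\<lambda>k. ?x (k, e)) \<in> acar alg" for e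
  proof -
    have "(\<lambda>k. ?x (k, e)) = symb (\<Phi> (\<lambda>y. y e))"
      unfolding \<Phi>_symb[OF lform_eval] ..
    then show ?thesis
      unfolding alg_car using \<Phi>_ops[OF lform_eval] by (metis image_eqI)
  qed
  have "?x = (\<Sum>k<n. ptens (\<lambda>i. if i = k then 1 else 0) (\<pi> (c k)))"
  proof
    fix z :: "nat \<times> 'c"
    obtain i e where z: "z = (i, e)" by fastforce
    have "(\<Sum>k<n. ptens (\<lambda>i. if i = k then 1 else 0) (\<pi> (c k))) z = (\<Sum>k<n. if i = k then \<pi> (c k) e else 0)"
      unfolding z by (induction n) (auto simp: ptens_def)
    then show "?x z = (\<Sum>k<n. ptens (\<lambda>i. if i = k then 1 else 0) (\<pi> (c k))) z"
      by (simp add: z coord_def)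
  qed
  moreover have "(\<Sum>k<n. ptens (\<lambda>i. if i = k then 1 else 0) (\<pi> (c k))) \<in> tensor F (csp C) 0"
  proof (rule fs.subspace_sum[OF tensor_subspace])
    fix k assume "k \<in> {..<n}"
    then have "(\<lambda>i. if i = k then 1 else 0) \<in> F (deg k)" "\<pi> (c k) \<in> csp C (deg k)"
      using \<pi> c_in[of k] unfolding F_def super_hom_def by auto
    then show "ptens (\<lambda>i. if i = k then 1 else 0) (\<pi> (c k)) \<in> tensor F (csp C) 0"
      by (rule ptens_in) simp
  qed
  ultimately have "?x \<in> tensor F (csp C) 0"
    by metis
  then have mem: "?x \<in> tensor (asp alg) (csp C) 0"
    by (rule tensor_refine_left[OF F Cs super_spaceD(1)[OF as] alg_F slice])
  show "?x \<in> Ob (SSp C) alg"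
    unfolding SSp_iff[OF alg_SAlgf C]
  proof (intro conjI allI)
    fix k a b
    have "amult alg (\<lambda>m. ?x (m, b)) (\<lambda>m. ?x (m, a)) k = symb (\<lambda>w. \<Phi> (\<lambda>y. y b) (\<Phi> (\<lambda>y. y a) w)) k"
      using alg_mult[OF \<Phi>_ops[OF lform_eval] \<Phi>_ops[OF lform_eval], of b a]
      unfolding \<Phi>_symb[OF lform_eval] by simp
    also have "\<dots> = (if k < n then fmul C (\<lambda>y. y b) (\<lambda>y. y a) (\<pi> (c k)) else 0)"
      unfolding symb_def using \<Phi>_mult[OF lform_eval lform_eval c_car] by simp
    also have "\<dots> = (if k < n then comult C (\<pi> (c k)) (a, b) else 0)"
      by (simp add: fmul_def ract_def)
    also have "\<dots> = comult C (\<lambda>e. ?x (k, e)) (a, b)"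
      unfolding val using lform_zero(1)[OF comult_lform[OF C] svcarD(1)[OF Cs]] by simp
    finally show "comult C (\<lambda>e. ?x (k, e)) (a, b) = amult alg (\<lambda>m. ?x (m, b)) (\<lambda>m. ?x (m, a)) k"
      by simp
  next
    show "(\<lambda>k. counit C (\<lambda>e. ?x (k, e))) = aone alg"
      unfolding val alg_simps symb_def
      using unit[OF c_car] lform_zero(1)[OF coalgD(3)[OF C] svcarD(1)[OF Cs]] by (auto simp: fun_eq_iff)
  qed (rule mem)
qed

end

section \<open>The dual algebra of a finite-dimensional super-coalgebra\<close>

text \<open>For coordinate evaluations this is the equation defining a point; Fubini extends it to
  all functionals. Points are thus multiplicative with respect to \<open>fmul\<close>.\<close>

lemma point_mult:
  assumes R: "R \<in> SAlgf" and C: "super_coalgebra C" and u: "u \<in> Ob (SSp C) R"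
    and f: "lform (ccar C) f" and g: "lform (ccar C) g"
  shows "amult R (\<lambda>m. f (\<lambda>e. u (m, e))) (\<lambda>m. g (\<lambda>e. u (m, e))) k = fmul C f g (\<lambda>e. u (k, e))"
proof -
  note U = SSpD[OF R C u] and Rs = SAlgfD(1)[OF R] and Cs = coalgD(1)[OF C]
  have slice: "(\<lambda>m. f (\<lambda>e. u (m, e))) \<in> acar R"
    by (rule tensor_slice(3)[OF Rs Cs U(2) f])
  have fub: "h (\<lambda>j. F (\<lambda>m. u (m, j))) = F (\<lambda>m. h (\<lambda>j. u (m, j)))"
    if "lform (acar R) F" "lform (ccar C) h" for F h
    by (rule tensor_fubini[OF Rs Cs U(2) that, symmetric])
  have "fmul C f g (\<lambda>e. u (k, e)) = g (\<lambda>a. f (\<lambda>b. amult R (\<lambda>m. u (m, b)) (\<lambda>m. u (m, a)) k))"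
    unfolding fmul_def ract_def U(3) ..
  also have "\<dots> = g (\<lambda>a. amult R (\<lambda>m. f (\<lambda>e. u (m, e))) (\<lambda>m. u (m, a)) k)"
    using fub[OF lform_lin_on[OF algD(2)[OF R U(6)]] f] by simp
  also have "\<dots> = amult R (\<lambda>m. f (\<lambda>e. u (m, e))) (\<lambda>m. g (\<lambda>e. u (m, e))) k"
    by (rule fub[OF lform_lin_on[OF algD(1)[OF R slice]] g])
  finally show ?thesis by simp
qed

text \<open>Here \<open>u\<close> is the canonical element of the dual space tensored with
  \<open>C\<close>: applying functionals to its rows identifies \<open>A\<close> with the
  functionals on \<open>C\<close>, and the last clause says that this identification is
  injective.\<close>

definition dual_algebra :: "('c, 'k::field) scoalg \<Rightarrow> 'k salg \<Rightarrow> (nat \<times> 'c \<Rightarrow> 'k) \<Rightarrow> bool" where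
  "dual_algebra C A u \<longleftrightarrow> A \<in> SAlgf \<and> u \<in> Ob (SSp C) A \<and>
     (\<forall>p. asp A p = {\<lambda>k. f (\<lambda>e. u (k, e)) | f. hform (csp C) p f}) \<and>
     (\<forall>f g. lform (ccar C) f \<longrightarrow> lform (ccar C) g \<longrightarrow>
       (\<forall>k. f (\<lambda>e. u (k, e)) = g (\<lambda>e. u (k, e))) \<longrightarrow> (\<forall>x\<in>ccar C. f x = g x))"

text \<open>Functionals act on \<open>C\<close> by \<open>lact\<close>, and supercommute by
  cocommutativity. With the counit as \<omega>, the symbol of \<open>lact C f\<close> lists the
  values of \<open>f\<close> on the spanning family, so the operator algebra is the dual
  algebra.\<close>

theorem dual_algebra_exists:
  assumes C: "super_coalgebra C" and cc: "super_cocommutative C" and fd: "findim (csp C)"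
  shows "\<exists>A u. dual_algebra C A u"
proof -
  obtain c deg and n :: nat where c: "\<And>k. k < n \<Longrightarrow> c k \<in> csp C (deg k)"
    and span: "ccar C \<subseteq> fs.span (c ` {..<n})"
    using findim_enum[OF fd] by metis
  note Cs = coalgD(1)[OF C]
  \<comment> \<open>Agreement with some \<open>lact C f\<close> is demanded on \<open>ccar C\<close>
    only, because \<open>act_act\<close>, which gives closure under composition, holds
    there.\<close>
  define G where "G p = {X. dhom p (csp C) (csp C) X \<and>
    (\<exists>f. hform (csp C) p f \<and> (\<forall>w\<in>ccar C. X w = lact C f w))}" for p
  have GE: "\<exists>f. hform (csp C) p f \<and> (\<forall>w\<in>ccar C. X w = lact C f w)" if "X \<in> G p" for X p
    using that by (simp add: G_def)
  have GI: "X \<in> G p" if "hform (csp C) p f" "\<And>w. w \<in> ccar C \<Longrightarrow> X w = lact C f w" for X p f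
  proof -
    have "dhom p (csp C) (csp C) X"
      by (rule dhom_cong[OF Cs act_dhom(1)[OF C that(1)] that(2)])
    then show ?thesis
      using that unfolding G_def by blast
  qed
  have cong: "lact C f w = lact C g w" if "\<And>x. x \<in> ccar C \<Longrightarrow> f x = g x" "w \<in> ccar C" for f g w
    unfolding lact_def using that(1)[OF comult_slice(2)[OF C that(2)]] by simp
  interpret operator_algebra "csp C" c deg n G "counit C"
  proof
    show "(\<lambda>w. 0) \<in> G p" for p
      by (rule GI[of p "\<lambda>x. 0"]) (auto simp: hform_def lform_def lact_def fun_eq_iff)
    fix X Y p q assume X: "X \<in> G p"
    obtain f where f: "hform (csp C) p f" "\<And>w. w \<in> ccar C \<Longrightarrow> X w = lact C f w"
      using GE[OF X] by blast
    show "dhom p (csp C) (csp C) X"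
      using X by (simp add: G_def)
    show "(\<lambda>w. fscale a (X w)) \<in> G p" for a
      by (rule GI[OF hform_scaled[OF f(1), of a]]) (auto simp: f(2) lact_def fscale_def)
    show "(\<lambda>w. X w + Y w) \<in> G p" if Y: "Y \<in> G p"
    proof -
      obtain g where g: "hform (csp C) p g" "\<And>w. w \<in> ccar C \<Longrightarrow> Y w = lact C g w"
        using GE[OF Y] by blast
      show ?thesis
        by (rule GI[OF hform_add[OF f(1) g(1)]]) (auto simp: f(2) g(2) lact_def)
    qed
    assume Y: "Y \<in> G q"
    obtain g where g: "hform (csp C) q g" "\<And>w. w \<in> ccar C \<Longrightarrow> Y w = lact C g w"
      using GE[OF Y] by blast
    note lf = hformD(1)[OF f(1)] and lg = hformD(1)[OF g(1)]
    have XY: "X (Y w) = lact C (fmul C f g) w" "Y (X w) = lact C (fmul C g f) w" if "w \<in> ccar C" for w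
      using f(2) g(2) that act_car(1)[OF C lg that] act_car(1)[OF C lf that]
        act_act(1)[OF C that lf lg] act_act(1)[OF C that lg lf] by simp_all
    show "(\<lambda>w. X (Y w)) \<in> G (p + q)"
      by (rule GI[OF fmul_hform[OF C f(1) g(1)] XY(1)])
    show "X (Y w) = fscale (koszul p q) (Y (X w))" if w: "w \<in> csp C r" for w r
    proof -
      note wc = svcar_homogeneous[OF Cs w]
      have "lact C (fmul C f g) w = lact C (\<lambda>x. koszul p q * fmul C g f x) w"
        using fmul_commute[OF C cc f(1) g(1)] by (intro cong wc)
      then show ?thesis
        unfolding XY[OF wc] by (simp add: lact_def fscale_def)
    qed
  next
    show "(\<lambda>w. w) \<in> G 0"
      using act_counit(1)[OF C] by (intro GI[OF coalgD(4)[OF C]]) simp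
    fix w assume w: "w \<in> ccar C" and 0: "\<And>p X. X \<in> G p \<Longrightarrow> counit C (X w) = 0"
    have "f w = 0" if f: "hform (csp C) p f" for p f
      using 0[OF GI[OF f refl]] counit_act(1)[OF C w hformD(1)[OF f]] by simp
    then show "w = 0"
      by (rule hform_separates[OF Cs w])
  qed (use c span coalgD[OF C] in auto)
  define u where "u = coord id"
  have w1: "counit C (lact C f w) = f (id w)" if "hform (csp C) p f" "w \<in> ccar C" for p f w
    using counit_act(1)[OF C that(2) hformD(1)[OF that(1)]] by simp
  have w2: "counit C (lact C f (lact C g w)) = fmul C f g (id w)"
    if "hform (csp C) p f" "hform (csp C) q g" "w \<in> ccar C" for p q f g w
    using act_act(1)[OF C that(3) hformD(1)[OF that(1)] hformD(1)[OF that(2)]]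
      counit_act(1)[OF C that(3) fmul_lform[OF C hformD(1)[OF that(1)] hformD(1)[OF that(2)]]] by simp
  have w0: "counit C (id w) = counit C w" for w
    by simp
  have pt': "u \<in> Ob (SSp C) alg" "hform (csp C) p f \<Longrightarrow> symb (lact C f) = (\<lambda>k. f (\<lambda>e. u (k, e)))" for p f
    unfolding u_def by (rule coord_point[OF C super_hom_id, where \<Lambda> = "\<lambda>p. lact C"];
      (rule GI[OF _ refl] w1 w2 w0)?; assumption?)+
  have "asp alg p = {\<lambda>k. f (\<lambda>e. u (k, e)) | f. hform (csp C) p f}" for p
    unfolding alg_simps
  proof (intro subset_antisym subsetI)
    fix x assume "x \<in> symb ` G p"
    then obtain X where X: "X \<in> G p" "x = symb X" by blast
    obtain f where f: "hform (csp C) p f" "\<And>w. w \<in> ccar C \<Longrightarrow> X w = lact C f w"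
      using GE[OF X(1)] by blast
    have "symb X = symb (lact C f)"
      by (rule symb_cong) (rule f(2))
    then show "x \<in> {\<lambda>k. f (\<lambda>e. u (k, e)) | f. hform (csp C) p f}"
      using f(1) X(2) pt'(2)[OF f(1)] by (intro CollectI exI[of _ f] conjI) simp_all
  next
    fix x assume "x \<in> {\<lambda>k. f (\<lambda>e. u (k, e)) | f. hform (csp C) p f}"
    then obtain f where f: "hform (csp C) p f" "x = (\<lambda>k. f (\<lambda>e. u (k, e)))" by blast
    then show "x \<in> symb ` G p"
      using pt'(2)[OF f(1)] GI[OF f(1) refl] by (metis image_eqI)
  qed
  moreover have "f x = g x"
    if "lform (ccar C) f" "lform (ccar C) g" "\<And>k. f (\<lambda>e. u (k, e)) = g (\<lambda>e. u (k, e))" "x \<in> ccar C" for f g x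
  proof (rule lform_eq_on_span[OF that(1,2) svcar_subspace[OF Cs], where B = "c ` {..<n}"])
    show "f x = g x" if "x \<in> c ` {..<n}" for x
    proof -
      obtain k where "k < n" "x = c k" using \<open>x \<in> c ` {..<n}\<close> by blast
      then show ?thesis
        using \<open>\<And>k. f (\<lambda>e. u (k, e)) = g (\<lambda>e. u (k, e))\<close>[of k] by (simp add: u_def coord_def)
    qed
  qed (use c_car span that(4) in auto)
  ultimately have "dual_algebra C alg u"
    unfolding dual_algebra_def using alg_SAlgf pt'(1) by blast
  then show ?thesis by blast
qed

lemma dual_algebraD:
  assumes "super_coalgebra C" "dual_algebra C A u"
  shows "A \<in> SAlgf" "u \<in> Ob (SSp C) A"
    "x \<in> asp A p \<Longrightarrow> \<exists>f. hform (csp C) p f \<and> x = (\<lambda>k. f (\<lambda>e. u (k, e)))"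
    "hform (csp C) p f \<Longrightarrow> (\<lambda>k. f (\<lambda>e. u (k, e))) \<in> asp A p"
    "lform (ccar C) f \<Longrightarrow> lform (ccar C) g \<Longrightarrow> (\<And>k. f (\<lambda>e. u (k, e)) = g (\<lambda>e. u (k, e))) \<Longrightarrow>
      x' \<in> ccar C \<Longrightarrow> f x' = g x'"
    "acar A = {\<lambda>k. f (\<lambda>e. u (k, e)) | f. lform (ccar C) f}"
proof -
  note d = assms(2)[unfolded dual_algebra_def]
  note Cs = coalgD(1)[OF assms(1)]
  show A: "A \<in> SAlgf" and u: "u \<in> Ob (SSp C) A"
    using d by blast+
  have asp: "asp A p = {\<lambda>k. f (\<lambda>e. u (k, e)) | f. hform (csp C) p f}" for p
    using d by blast
  then show 3: "x \<in> asp A p \<Longrightarrow> \<exists>f. hform (csp C) p f \<and> x = (\<lambda>k. f (\<lambda>e. u (k, e)))" for x p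
    by blast
  show "hform (csp C) p f \<Longrightarrow> (\<lambda>k. f (\<lambda>e. u (k, e))) \<in> asp A p"
    using asp by blast
  show "lform (ccar C) f \<Longrightarrow> lform (ccar C) g \<Longrightarrow> (\<And>k. f (\<lambda>e. u (k, e)) = g (\<lambda>e. u (k, e))) \<Longrightarrow>
      x' \<in> ccar C \<Longrightarrow> f x' = g x'"
    using d by blast
  show "acar A = {\<lambda>k. f (\<lambda>e. u (k, e)) | f. lform (ccar C) f}"
  proof (intro subset_antisym subsetI)
    fix x assume "x \<in> acar A"
    then obtain y z where yz: "x = y + z" "y \<in> asp A 0" "z \<in> asp A 1"
      by (auto simp: svcar_def)
    obtain f g where "hform (csp C) 0 f" "y = (\<lambda>k. f (\<lambda>e. u (k, e)))"
        "hform (csp C) 1 g" "z = (\<lambda>k. g (\<lambda>e. u (k, e)))"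
      using 3[OF yz(2)] 3[OF yz(3)] by blast
    then have "x = (\<lambda>k. (\<lambda>v. f v + g v) (\<lambda>e. u (k, e)))" "lform (ccar C) (\<lambda>v. f v + g v)"
      using yz(1) by (simp_all add: plus_fun_def lform_add hformD(1))
    then show "x \<in> {\<lambda>k. f (\<lambda>e. u (k, e)) | f. lform (ccar C) f}"
      by (intro CollectI exI[of _ "\<lambda>v. f v + g v"] conjI)
  next
    fix x assume "x \<in> {\<lambda>k. f (\<lambda>e. u (k, e)) | f. lform (ccar C) f}"
    then obtain f where "lform (ccar C) f" "x = (\<lambda>k. f (\<lambda>e. u (k, e)))"
      by blast
    then show "x \<in> acar A"
      using tensor_slice(3)[OF SAlgfD(1)[OF A] Cs SSpD(2)[OF A assms(1) u]] by blast
  qed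
qed

text \<open>The homomorphism is forced: the functional \<open>f\<close> has to go to
  \<open>f\<close> applied to the rows of \<open>w\<close>. It is well defined because a functional
  on \<open>C\<close> is determined by its values on the rows of \<open>u\<close>, and
  multiplicative by \<open>point_mult\<close> for both points.\<close>

theorem dual_algebra_universal:
  assumes C: "super_coalgebra C" and d: "dual_algebra C A u" and R: "R \<in> SAlgf" and w: "w \<in> Ob (SSp C) R"
  shows "\<exists>\<psi>\<in>alg_hom A R. \<forall>f. lform (ccar C) f \<longrightarrow> \<psi> (\<lambda>k. f (\<lambda>e. u (k, e))) = (\<lambda>m. f (\<lambda>e. w (m, e)))"
proof -
  note D = dual_algebraD[OF C d] and Cs = coalgD(1)[OF C]
  note A = D(1) and u = D(2)
  note As = SAlgfD(1)[OF A] and Rs = SAlgfD(1)[OF R]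
  note U = SSpD[OF A C u] and w' = SSpD[OF R C w]
  let ?u = "\<lambda>f k. f (\<lambda>e. u (k, e))" and ?w = "\<lambda>f m. f (\<lambda>e. w (m, e))"
  define \<psi> where "\<psi> = (\<lambda>x\<in>acar A. ?w (SOME f. lform (ccar C) f \<and> x = ?u f))"
  have val: "\<psi> (?u f) = ?w f" if f: "lform (ccar C) f" for f
  proof -
    define g where "g = (SOME g. lform (ccar C) g \<and> ?u f = ?u g)"
    have g: "lform (ccar C) g \<and> ?u f = ?u g"
      unfolding g_def using someI[of "\<lambda>g. lform (ccar C) g \<and> ?u f = ?u g" f] f by simp
    have "?w f = ?w g"
      using D(5)[OF f] g w'(5) by (intro ext) (meson fun_cong)
    moreover have "?u f \<in> acar A"
      using f D(6) by blast
    ultimately show ?thesis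
      unfolding \<psi>_def g_def by simp
  qed
  have car: "\<exists>f. lform (ccar C) f \<and> x = ?u f" if "x \<in> acar A" for x
    using that D(6) by blast
  have "\<psi> \<in> alg_hom A R"
  proof (rule alg_homI)
    show "\<psi> \<in> extensional (acar A)"
      by (simp add: \<psi>_def)
    show "\<psi> x \<in> acar R" if x: "x \<in> acar A" for x
    proof -
      obtain f where f: "lform (ccar C) f" "x = ?u f" using car[OF x] by blast
      show ?thesis
        unfolding f(2) val[OF f(1)] by (rule tensor_slice(3)[OF Rs Cs w'(2) f(1)])
    qed
    show "\<psi> (x + y) = \<psi> x + \<psi> y" if xy: "x \<in> acar A" "y \<in> acar A" for x y
    proof -
      obtain f g where f: "lform (ccar C) f" "x = ?u f" and g: "lform (ccar C) g" "y = ?u g"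
        using car xy by blast
      have "x + y = ?u (\<lambda>v. f v + g v)"
        using f g by (simp add: plus_fun_def)
      then have "\<psi> (x + y) = ?w (\<lambda>v. f v + g v)"
        using val[OF lform_add[OF f(1) g(1)]] by simp
      then show ?thesis
        using val[OF f(1)] val[OF g(1)] f(2) g(2) by (simp add: plus_fun_def)
    qed
    show "\<psi> (fscale a x) = fscale a (\<psi> x)" if x: "x \<in> acar A" for a x
    proof -
      obtain f where f: "lform (ccar C) f" "x = ?u f" using car[OF x] by blast
      have "fscale a x = ?u (\<lambda>v. a * f v)"
        using f by (simp add: fscale_def)
      then have "\<psi> (fscale a x) = ?w (\<lambda>v. a * f v)"
        using val[OF lform_scaled[OF f(1)]] by simp
      then show ?thesis
        using val[OF f(1)] f(2) by (simp add: fscale_def)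
    qed
    show "\<psi> x \<in> asp R p" if x: "x \<in> asp A p" for p x
    proof -
      obtain f where f: "hform (csp C) p f" "x = ?u f" using D(3)[OF x] by blast
      show ?thesis
        unfolding f(2) val[OF hformD(1)[OF f(1)]]
        using tensor_slice_hform(2)[OF Rs Cs w'(1) f(1)] by simp
    qed
    show "\<psi> (aone A) = aone R"
      using val[OF coalgD(3)[OF C]] U(4) w'(4) by simp
    show "\<psi> (amult A x y) = amult R (\<psi> x) (\<psi> y)" if xy: "x \<in> acar A" "y \<in> acar A" for x y
    proof -
      obtain f g where f: "lform (ccar C) f" "x = ?u f" and g: "lform (ccar C) g" "y = ?u g"
        using car xy by blast
      have "amult A x y = ?u (fmul C f g)"
        unfolding f(2) g(2) using point_mult[OF A C u f(1) g(1)] by blast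
      moreover have "amult R (?w f) (?w g) = ?w (fmul C f g)"
        using point_mult[OF R C w f(1) g(1)] by blast
      ultimately show ?thesis
        using val[OF fmul_lform[OF C f(1) g(1)]] val[OF f(1)] val[OF g(1)] f(2) g(2) by simp
    qed
  qed
  then show ?thesis
    using val by blast
qed

section \<open>The cotensor square\<close>

text \<open>The cotensor product of \<open>C\<close> with itself over the target of \<phi>, that is,
  the space underlying the coalgebra of the fibre product of \<open>SSp C\<close> with
  itself.\<close>

definition csquare :: "('c, 'k::field) scoalg \<Rightarrow> (('c \<Rightarrow> 'k) \<Rightarrow> 'd \<Rightarrow> 'k) \<Rightarrow> ('c \<times> 'c, 'k) svs" where
  "csquare C \<phi> = cotensor (csp C) (\<lambda>x. tmap id \<phi> (comult C x)) (csp C) (\<lambda>x. tmap \<phi> id (comult C x))"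

definition proj1 :: "('c, 'k::field) scoalg \<Rightarrow> ('c \<times> 'c \<Rightarrow> 'k) \<Rightarrow> 'c \<Rightarrow> 'k" where
  "proj1 C t = (\<lambda>a. counit C (\<lambda>b. t (a, b)))"

definition proj2 :: "('c, 'k::field) scoalg \<Rightarrow> ('c \<times> 'c \<Rightarrow> 'k) \<Rightarrow> 'c \<Rightarrow> 'k" where
  "proj2 C t = (\<lambda>b. counit C (\<lambda>a. t (a, b)))"

lemma coalg_homD:
  assumes "coalg_hom C D \<phi>"
  shows "super_hom (csp C) (csp D) \<phi>" "lin_on (ccar C) \<phi>" "x \<in> csp C p \<Longrightarrow> \<phi> x \<in> csp D p"
    "x \<in> ccar C \<Longrightarrow> comult D (\<phi> x) = tmap \<phi> \<phi> (comult C x)"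
    "x \<in> ccar C \<Longrightarrow> counit D (\<phi> x) = counit C x"
  using assms unfolding coalg_hom_def super_hom_def by blast+

context
  fixes C :: "('c, 'k::field) scoalg" and D :: "('d, 'k) scoalg" and \<phi>
  assumes C: "super_coalgebra C" and D: "super_coalgebra D" and \<phi>: "coalg_hom C D \<phi>"
begin

private lemma Cs: "super_space (csp C)"
  by (rule coalgD(1)[OF C])

private lemma Ts: "super_space (tensor (csp C) (csp C))"
  by (rule super_space_tensor[OF Cs Cs])

private lemmas slice = tensor_slice[OF Cs Cs] and fub = tensor_fubini[OF Cs Cs]

lemma csquare_iff:
  "t \<in> csquare C \<phi> p \<longleftrightarrow> t \<in> tensor (csp C) (csp C) p \<and>
    (\<forall>m d n. \<phi> (lact C (\<lambda>x. x m) (\<lambda>i. t (i, n))) d = \<phi> (ract C (\<lambda>x. x n) (\<lambda>j. t (m, j))) d)"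
  by (simp add: csquare_def cotensor_def tmap_def lact_def ract_def)

lemma csquareD:
  assumes "t \<in> csquare C \<phi> p"
  shows "t \<in> tensor (csp C) (csp C) p" "t \<in> svcar (tensor (csp C) (csp C))"
    "\<phi> (lact C (\<lambda>x. x m) (\<lambda>i. t (i, n))) d = \<phi> (ract C (\<lambda>x. x n) (\<lambda>j. t (m, j))) d"
  using assms tensor_car[OF Cs Cs] unfolding csquare_iff by blast+

lemma \<phi>_act_lform: "lform (ccar C) f \<Longrightarrow> lform (ccar C) (\<lambda>x. \<phi> (lact C f x) d)"
  "lform (ccar C) f \<Longrightarrow> lform (ccar C) (\<lambda>x. \<phi> (ract C f x) d)"
  by (rule lform_comp[OF act_lin(1)[OF C] act_car(1)[OF C] lform_lin_on[OF coalg_homD(2)[OF \<phi>]]]; assumption)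
    (rule lform_comp[OF act_lin(2)[OF C] act_car(2)[OF C] lform_lin_on[OF coalg_homD(2)[OF \<phi>]]]; assumption)

lemma csquare_subspace: "fs.subspace (csquare C \<phi> p)"
  unfolding fs.subspace_def
proof (intro conjI ballI allI)
  note lf = \<phi>_act_lform[OF lform_eval]
  note l0 = lform_zero(2)[OF lf(1) svcarD(1)[OF Cs]] lform_zero(2)[OF lf(2) svcarD(1)[OF Cs]]
  show "0 \<in> csquare C \<phi> p"
    unfolding csquare_iff using fs.subspace_0[OF tensor_subspace] l0 by (auto simp: zero_fun_def)
  show "s + t \<in> csquare C \<phi> p" if st: "s \<in> csquare C \<phi> p" "t \<in> csquare C \<phi> p" for s t
    unfolding csquare_iff
  proof (intro conjI allI)
    show "s + t \<in> tensor (csp C) (csp C) p"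
      using fs.subspace_add[OF tensor_subspace] st csquareD(1) by blast
    fix m d n
    note S = csquareD[OF st(1)] and T = csquareD[OF st(2)]
    have "(\<lambda>i. (s + t) (i, n)) = (\<lambda>i. s (i, n)) + (\<lambda>i. t (i, n))"
      "(\<lambda>j. (s + t) (m, j)) = (\<lambda>j. s (m, j)) + (\<lambda>j. t (m, j))"
      by auto
    then show "\<phi> (lact C (\<lambda>x. x m) (\<lambda>i. (s + t) (i, n))) d = \<phi> (ract C (\<lambda>x. x n) (\<lambda>j. (s + t) (m, j))) d"
      using lformD(1)[OF lf(1) slice(2)[OF S(2)] slice(2)[OF T(2)]]
        lformD(1)[OF lf(2) slice(1)[OF S(2)] slice(1)[OF T(2)]] S(3) T(3) by metis
  qed
  show "fscale a t \<in> csquare C \<phi> p" if t: "t \<in> csquare C \<phi> p" for a t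
    unfolding csquare_iff
  proof (intro conjI allI)
    show "fscale a t \<in> tensor (csp C) (csp C) p"
      using fs.subspace_scale[OF tensor_subspace] t csquareD(1) by blast
    fix m d n
    note T = csquareD[OF t]
    have "(\<lambda>i. fscale a t (i, n)) = fscale a (\<lambda>i. t (i, n))" "(\<lambda>j. fscale a t (m, j)) = fscale a (\<lambda>j. t (m, j))"
      by (auto simp: fscale_def)
    then show "\<phi> (lact C (\<lambda>x. x m) (\<lambda>i. fscale a t (i, n))) d = \<phi> (ract C (\<lambda>x. x n) (\<lambda>j. fscale a t (m, j))) d"
      using lformD(2)[OF lf(1) slice(2)[OF T(2)]] lformD(2)[OF lf(2) slice(1)[OF T(2)]] T(3) by metis
  qed
qed

lemma csquare_le: "csquare C \<phi> p \<subseteq> tensor (csp C) (csp C) p"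
  using csquareD(1) by blast

lemma super_space_csquare: "super_space (csquare C \<phi>)"
  by (rule super_space_sub[OF Ts csquare_subspace csquare_le])

lemma csquare_car: "svcar (csquare C \<phi>) \<subseteq> svcar (tensor (csp C) (csp C))"
  by (rule svcar_mono[OF csquare_le])

text \<open>The equalizer condition involves only the right coaction on the first factor. The left
  action commutes with it by coassociativity, so the condition survives;
  \<open>csquare_right\<close> is the mirror image.\<close>

lemma csquare_left:
  assumes f: "hform (csp C) p f" and t: "t \<in> csquare C \<phi> q"
  shows "tmap (lact C f) id t \<in> csquare C \<phi> (p + q)"
  unfolding csquare_iff
proof (intro conjI allI)
  note T = csquareD[OF t] and lf = hformD(1)[OF f]
  show "tmap (lact C f) id t \<in> tensor (csp C) (csp C) (p + q)"
    using dhomD(2)[OF tmap_dhom[OF Cs Cs act_dhom(1)[OF C f] dhom_id(2)] T(1)] by simp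
  fix m d n
  let ?F = "\<lambda>y. lact C f y m"
  have F: "lform (ccar C) ?F"
    by (rule lform_lin_on[OF act_lin(1)[OF C lf]])
  let ?x = "\<lambda>i. t (i, n)"
  have x: "?x \<in> ccar C"
    by (rule slice(2)[OF T(2)])
  have "lact C (\<lambda>x. x m) (\<lambda>i. tmap (lact C f) id t (i, n)) = (\<lambda>b. ?F (\<lambda>e. comult C ?x (e, b)))"
    using comult_act(1)[OF C x lf] by (simp add: tmap_def lact_def[of C "\<lambda>x. x m"])
  then have "\<phi> (lact C (\<lambda>x. x m) (\<lambda>i. tmap (lact C f) id t (i, n))) d =
      ?F (\<lambda>e. \<phi> (lact C (\<lambda>x. x e) ?x) d)"
    using comult_fubini[OF C x F lform_lin_on[OF coalg_homD(2)[OF \<phi>]]] by (simp add: lact_def[of C "\<lambda>x. x _"])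
  also have "\<dots> = ?F (\<lambda>e. \<phi> (ract C (\<lambda>x. x n) (\<lambda>j. t (e, j))) d)"
    unfolding T(3) ..
  also have "\<dots> = \<phi> (ract C (\<lambda>x. x n) (\<lambda>j. ?F (\<lambda>i. t (i, j)))) d"
    by (rule fub[OF T(2) F \<phi>_act_lform(2)[OF lform_eval]])
  finally show "\<phi> (lact C (\<lambda>x. x m) (\<lambda>i. tmap (lact C f) id t (i, n))) d =
      \<phi> (ract C (\<lambda>x. x n) (\<lambda>j. tmap (lact C f) id t (m, j))) d"
    by (simp add: tmap_def)
qed

lemma csquare_right:
  assumes f: "hform (csp C) p f" and t: "t \<in> csquare C \<phi> q"
  shows "tmap id (ract C f) t \<in> csquare C \<phi> (p + q)"
  unfolding csquare_iff
proof (intro conjI allI)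
  note T = csquareD[OF t] and lf = hformD(1)[OF f]
  show "tmap id (ract C f) t \<in> tensor (csp C) (csp C) (p + q)"
    using dhomD(2)[OF tmap_dhom[OF Cs Cs dhom_id(2) act_dhom(2)[OF C f]] T(1)] by simp
  fix m d n
  let ?F = "\<lambda>y. ract C f y n"
  have F: "lform (ccar C) ?F"
    by (rule lform_lin_on[OF act_lin(2)[OF C lf]])
  let ?x = "\<lambda>j. t (m, j)"
  have x: "?x \<in> ccar C"
    by (rule slice(1)[OF T(2)])
  have "ract C (\<lambda>x. x n) (\<lambda>j. tmap id (ract C f) t (m, j)) = (\<lambda>a. ?F (\<lambda>e. comult C ?x (a, e)))"
    using comult_act(2)[OF C x lf] by (simp add: tmap_def ract_def[of C "\<lambda>x. x n"])
  then have "\<phi> (ract C (\<lambda>x. x n) (\<lambda>j. tmap id (ract C f) t (m, j))) d =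
      ?F (\<lambda>e. \<phi> (ract C (\<lambda>x. x e) ?x) d)"
    using comult_fubini[OF C x lform_lin_on[OF coalg_homD(2)[OF \<phi>]] F] by (simp add: ract_def[of C "\<lambda>x. x _"])
  also have "\<dots> = ?F (\<lambda>e. \<phi> (lact C (\<lambda>x. x m) (\<lambda>i. t (i, e))) d)"
    unfolding T(3) ..
  also have "\<dots> = \<phi> (lact C (\<lambda>x. x m) (\<lambda>i. ?F (\<lambda>j. t (i, j)))) d"
    by (rule fub[OF T(2) \<phi>_act_lform(1)[OF lform_eval] F, symmetric])
  finally show "\<phi> (lact C (\<lambda>x. x m) (\<lambda>i. tmap id (ract C f) t (i, n))) d =
      \<phi> (ract C (\<lambda>x. x n) (\<lambda>j. tmap id (ract C f) t (m, j))) d"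
    by (simp add: tmap_def)
qed

lemma proj_hom:
  "super_hom (csquare C \<phi>) (csp C) (proj1 C)" "super_hom (csquare C \<phi>) (csp C) (proj2 C)"
proof -
  note e = coalgD(3)[OF C]
  have "proj1 C (s + t) = proj1 C s + proj1 C t" "proj2 C (s + t) = proj2 C s + proj2 C t"
    if "s \<in> svcar (tensor (csp C) (csp C))" "t \<in> svcar (tensor (csp C) (csp C))" for s t
    using lformD(1)[OF e slice(1)[OF that(1)] slice(1)[OF that(2)]]
      lformD(1)[OF e slice(2)[OF that(1)] slice(2)[OF that(2)]]
    by (auto simp: proj1_def proj2_def plus_fun_def)
  moreover have "proj1 C (fscale a t) = fscale a (proj1 C t)" "proj2 C (fscale a t) = fscale a (proj2 C t)"
    if "t \<in> svcar (tensor (csp C) (csp C))" for a t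
    using lformD(2)[OF e slice(1)[OF that]] lformD(2)[OF e slice(2)[OF that]]
    by (auto simp: proj1_def proj2_def fscale_def)
  ultimately have "lin_on (svcar (tensor (csp C) (csp C))) (proj1 C)" "lin_on (svcar (tensor (csp C) (csp C))) (proj2 C)"
    unfolding lin_on_def by blast+
  then have "lin_on (svcar (csquare C \<phi>)) (proj1 C)" "lin_on (svcar (csquare C \<phi>)) (proj2 C)"
    using lin_on_subset[OF _ csquare_car] by blast+
  moreover have "proj1 C t \<in> csp C p" "proj2 C t \<in> csp C p" if "t \<in> csquare C \<phi> p" for t p
    using tensor_slice_hform[OF Cs Cs csquareD(1)[OF that] coalgD(4)[OF C]] by (simp_all add: proj1_def proj2_def)
  ultimately show "super_hom (csquare C \<phi>) (csp C) (proj1 C)" "super_hom (csquare C \<phi>) (csp C) (proj2 C)"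
    unfolding super_hom_def by blast+
qed

lemma proj_car:
  assumes "t \<in> svcar (csquare C \<phi>)"
  shows "proj1 C t \<in> ccar C" "proj2 C t \<in> ccar C"
  using dhom_car[OF _ super_space_csquare Cs assms] proj_hom by (simp_all add: super_hom_iff_dhom)

text \<open>Apply the counit to the last coordinate of the equalizer condition: one side becomes the
  coaction of \<open>proj1 C t\<close>, the other collapses to \<phi> applied to the second factor
  of \<open>t\<close>.\<close>

lemma coact_proj1:
  assumes "t \<in> csquare C \<phi> p"
  shows "\<phi> (lact C (\<lambda>x. x m) (proj1 C t)) d = \<phi> (\<lambda>j. t (m, j)) d"
proof -
  note T = csquareD[OF assms] and e = coalgD(3)[OF C]
  have x: "(\<lambda>j. t (m, j)) \<in> ccar C"
    by (rule slice(1)[OF T(2)])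
  have "\<phi> (lact C (\<lambda>x. x m) (proj1 C t)) d = counit C (\<lambda>n. \<phi> (lact C (\<lambda>x. x m) (\<lambda>i. t (i, n))) d)"
    unfolding proj1_def by (rule fub[OF T(2) \<phi>_act_lform(1)[OF lform_eval] e])
  also have "\<dots> = counit C (\<lambda>n. \<phi> (\<lambda>a. comult C (\<lambda>j. t (m, j)) (a, n)) d)"
    unfolding T(3) ract_def ..
  also have "\<dots> = \<phi> (\<lambda>j. t (m, j)) d"
    using comult_fubini[OF C x lform_lin_on[OF coalg_homD(2)[OF \<phi>]] e] coalgD(7)[OF C x] by simp
  finally show ?thesis .
qed

text \<open>Obtained from \<open>coact_proj1\<close> by applying the counit to the first factor as
  well.\<close>

lemma \<phi>_proj:
  assumes "t \<in> svcar (csquare C \<phi>)"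
  shows "\<phi> (proj1 C t) = \<phi> (proj2 C t)"
proof (rule lin_on_eqI[OF super_space_csquare _ _ assms])
  have lin: "lin_on (svcar (csquare C \<phi>)) (proj1 C)" "lin_on (svcar (csquare C \<phi>)) (proj2 C)"
    using proj_hom by (simp_all add: super_hom_def)
  show "lin_on (svcar (csquare C \<phi>)) (\<lambda>t. \<phi> (proj1 C t))" "lin_on (svcar (csquare C \<phi>)) (\<lambda>t. \<phi> (proj2 C t))"
    using lin_on_comp[OF lin(1) proj_car(1) coalg_homD(2)[OF \<phi>]] lin_on_comp[OF lin(2) proj_car(2) coalg_homD(2)[OF \<phi>]]
    by blast+
  fix p t assume t: "t \<in> csquare C \<phi> p"
  note T = csquareD[OF t] and e = coalgD(3)[OF C]
  have x: "proj1 C t \<in> ccar C"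
    using proj_car(1) svcar_homogeneous[OF super_space_csquare t] by blast
  show "\<phi> (proj1 C t) = \<phi> (proj2 C t)"
  proof
    fix d
    have "\<phi> (proj1 C t) d = counit C (\<lambda>m. \<phi> (\<lambda>b. comult C (proj1 C t) (m, b)) d)"
      using comult_fubini[OF C x e lform_lin_on[OF coalg_homD(2)[OF \<phi>]]] coalgD(6)[OF C x] by simp
    also have "\<dots> = counit C (\<lambda>m. \<phi> (\<lambda>j. t (m, j)) d)"
      using coact_proj1[OF t] by (simp add: lact_def)
    also have "\<dots> = \<phi> (proj2 C t) d"
      unfolding proj2_def by (rule fub[OF T(2) e lform_lin_on[OF coalg_homD(2)[OF \<phi>]]])
    finally show "\<phi> (proj1 C t) d = \<phi> (proj2 C t) d" .
  qed
qed

end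

section \<open>Closing a family of operators under composition\<close>

text \<open>A left and a right action on the cotensor square compose to an operator of neither kind,
  whereas \<open>operator_algebra\<close> asks for a closed family. The closure is taken formally,
  so supercommutativity has to be checked on generators only.\<close>

inductive op_closure ::
  "(bit \<Rightarrow> (('w \<Rightarrow> 'k::field) \<Rightarrow> 'w \<Rightarrow> 'k) set) \<Rightarrow> bit \<Rightarrow> (('w \<Rightarrow> 'k) \<Rightarrow> 'w \<Rightarrow> 'k) \<Rightarrow> bool"
  for S where
  gen: "X \<in> S p \<Longrightarrow> op_closure S p X"
| zero: "op_closure S p (\<lambda>w. 0)"
| ident: "op_closure S 0 (\<lambda>w. w)"
| add: "op_closure S p X \<Longrightarrow> op_closure S p Y \<Longrightarrow> op_closure S p (\<lambda>w. X w + Y w)"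
| scale: "op_closure S p X \<Longrightarrow> op_closure S p (\<lambda>w. fscale a (X w))"
| comp: "op_closure S p X \<Longrightarrow> op_closure S q Y \<Longrightarrow> op_closure S (p + q) (\<lambda>w. X (Y w))"

lemma op_closure_dhom:
  assumes W: "super_space W" and S: "\<And>p X. X \<in> S p \<Longrightarrow> dhom p W W X"
  shows "op_closure S p X \<Longrightarrow> dhom p W W X"
proof (induction rule: op_closure.induct)
  case (zero p)
  show "dhom p W W (\<lambda>w. 0)"
    using super_spaceD(2)[OF W] by (simp add: dhom_def lin_on_def)
next
  case (add p X Y)
  note X = add.IH(1)[unfolded dhom_def lin_on_def] and Y = add.IH(2)[unfolded dhom_def lin_on_def]
  show "dhom p W W (\<lambda>w. X w + Y w)"
    unfolding dhom_def lin_on_def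
  proof (intro conjI ballI allI)
    show "X (x + y) + Y (x + y) = X x + Y x + (X y + Y y)" if "x \<in> svcar W" "y \<in> svcar W" for x y
      using X Y that by (simp only: add_ac)
    show "X (fscale c x) + Y (fscale c x) = fscale c (X x + Y x)" if "x \<in> svcar W" for c x
      using X Y that by (simp only: fs.scale_right_distrib)
    show "X x + Y x \<in> W (p + q)" if "x \<in> W q" for q x
      using X Y that super_spaceD(3)[OF W] by blast
  qed
next
  case (scale p X a)
  then show "dhom p W W (\<lambda>w. fscale a (X w))"
    using super_spaceD(5)[OF W] by (simp add: dhom_def lin_on_def fs.scale_right_distrib mult.commute)
next
  case (comp p X q Y)
  then show ?case
    using dhom_comp[OF W W] by blast
qed (simp_all add: S)

lemma op_closure_commute_one:
  assumes W: "super_space W" and S: "\<And>p X. X \<in> S p \<Longrightarrow> dhom p W W X" and Y: "dhom q W W Y"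
    and gen: "\<And>p X r w. X \<in> S p \<Longrightarrow> w \<in> W r \<Longrightarrow> X (Y w) = fscale (koszul p q) (Y (X w))"
  shows "op_closure S p X \<Longrightarrow> w \<in> W r \<Longrightarrow> X (Y w) = fscale (koszul p q) (Y (X w))"
proof (induction arbitrary: w r rule: op_closure.induct)
  case (zero p)
  show "0 = fscale (koszul p q) (Y 0)"
    using lin_on_zero[OF dhomD(1)[OF Y] svcarD(1)[OF W]] by simp
next
  case (add p X Z)
  have "X w \<in> svcar W" "Z w \<in> svcar W"
    using dhom_car[OF op_closure_dhom[OF W S] W W] add.hyps svcar_homogeneous[OF W add.prems] by blast+
  then have "Y (X w + Z w) = Y (X w) + Y (Z w)"
    using dhomD(1)[OF Y] by (simp only: lin_on_def)
  then show "X (Y w) + Z (Y w) = fscale (koszul p q) (Y (X w + Z w))"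
    unfolding add.IH(1)[OF add.prems] add.IH(2)[OF add.prems] by (simp only: fs.scale_right_distrib)
next
  case (scale p X a)
  have "X w \<in> svcar W"
    using dhom_car[OF op_closure_dhom[OF W S] W W] scale.hyps svcar_homogeneous[OF W scale.prems] by blast
  then show ?case
    using scale.IH[OF scale.prems] dhomD(1)[OF Y] by (simp add: lin_on_def mult.commute)
next
  case (comp p X p' Z)
  note X = op_closure_dhom[OF W S comp.hyps(1)] and Z = op_closure_dhom[OF W S comp.hyps(2)]
  have Zw: "Z w \<in> W (p' + r)"
    by (rule dhomD(2)[OF Z comp.prems])
  have "Y (Z w) \<in> svcar W"
    by (rule dhom_car[OF Y W W svcar_homogeneous[OF W Zw]])
  then have "X (Z (Y w)) = fscale (koszul p' q) (X (Y (Z w)))"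
    using comp.IH(2)[OF comp.prems] dhomD(1)[OF X] by (simp add: lin_on_def)
  then show ?case
    using comp.IH(1)[OF Zw] by (simp add: koszul_add mult.commute)
qed (use gen in simp_all)

text \<open>Two inductions: first every element of the closure supercommutes with a fixed generator,
  then, by symmetry of the sign, the generator may be replaced by an arbitrary element.\<close>

lemma op_closure_commute:
  assumes W: "super_space W" and S: "\<And>p X. X \<in> S p \<Longrightarrow> dhom p W W X"
    and gen: "\<And>p q X Y r w. X \<in> S p \<Longrightarrow> Y \<in> S q \<Longrightarrow> w \<in> W r \<Longrightarrow> X (Y w) = fscale (koszul p q) (Y (X w))"
    and X: "op_closure S p X" and Y: "op_closure S q Y" and w: "w \<in> W r"
  shows "X (Y w) = fscale (koszul p q) (Y (X w))"
proof (rule op_closure_commute_one[OF W S op_closure_dhom[OF W S Y] _ X w])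
  fix p X r w assume X: "X \<in> S p" and w: "w \<in> W r"
  have "Y (X w) = fscale (koszul q p) (X (Y w))"
    by (rule op_closure_commute_one[OF W S S[OF X] gen[OF _ X] Y w])
  then show "X (Y w) = fscale (koszul p q) (Y (X w))"
    by (simp add: koszul_commute[of p q])
qed

text \<open>With this sign the right action on the cotensor square supercommutes with the left one.\<close>

definition twist :: "('i, 'k::field) svs \<Rightarrow> bit \<Rightarrow> ('i \<Rightarrow> 'k) \<Rightarrow> 'i \<Rightarrow> 'k" where
  "twist V p x = hcomp V 0 x + fscale (koszul p 1) (hcomp V 1 x)"

lemma twist_homogeneous: "super_space V \<Longrightarrow> x \<in> V q \<Longrightarrow> twist V p x = fscale (koszul p q) x"
  unfolding twist_def by (cases q) (simp_all add: hcomp_homogeneous)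

lemma twist_dhom: "super_space V \<Longrightarrow> dhom 0 V V (twist V p)"
  unfolding dhom_def
proof (intro conjI allI ballI)
  assume V: "super_space V"
  show "lin_on (svcar V) (twist V p)"
    using hcomp_lin[OF V, of 0] hcomp_lin[OF V, of 1] unfolding lin_on_def twist_def
    by (simp add: fs.scale_right_distrib algebra_simps)
  show "twist V p x \<in> V (0 + q)" if "x \<in> V q" for q x
    using twist_homogeneous[OF V that] super_spaceD(5)[OF V that] by simp
qed

lemma hform_twist:
  assumes V: "super_space V" and f: "hform V p f" and x: "x \<in> svcar V"
  shows "f (twist V q x) = koszul q p * f x"
proof -
  note lf = hformD(1)[OF f] and h = hcomp_in[OF V x] svcar_homogeneous[OF V hcomp_in(1)[OF V x]]
  have "f (twist V q x) = f (hcomp V 0 x) + koszul q 1 * f (hcomp V 1 x)"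
    unfolding twist_def using lformD[OF lf] h(3) svcar_closed(2)[OF V h(3) h(3)] by simp
  moreover have "f (hcomp V r x) = 0" if "r \<noteq> p" for r
    using hformD(2)[OF f h(1)] that by blast
  ultimately show ?thesis
    using hform_decomp[OF V lf x] by (cases p) simp_all
qed

lemma findim_tensor_span:
  assumes "svcar V \<subseteq> fs.span B" "svcar W \<subseteq> fs.span B'" "super_space V" "super_space W"
  shows "tensor V W p \<subseteq> fs.span ((\<lambda>(v, w). ptens v w) ` (B \<times> B'))" (is "_ \<subseteq> fs.span ?F")
  unfolding tensor_def
proof (rule fs.span_minimal[OF _ fs.subspace_span], clarify)
  fix v w q r assume "v \<in> V q" "w \<in> W r"
  then have vw: "v \<in> fs.span B" "w \<in> fs.span B'"
    using assms svcar_homogeneous by blast+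
  have 1: "ptens v b \<in> fs.span ?F" if "b \<in> B'" for b
  proof (rule fs.span_induct[OF vw(1)])
    show "fs.subspace {v. ptens v b \<in> fs.span ?F}"
      unfolding fs.subspace_def
    proof (intro conjI ballI allI)
      have "ptens 0 b = 0"
        by (auto simp: ptens_def)
      then show "0 \<in> {v. ptens v b \<in> fs.span ?F}"
        using fs.span_zero by (metis mem_Collect_eq)
    qed (use fs.span_add fs.span_scale in \<open>auto simp: ptens_simps\<close>)
    show "ptens x b \<in> fs.span ?F" if "x \<in> B" for x
      using that \<open>b \<in> B'\<close> by (intro fs.span_base) blast
  qed
  show "ptens v w \<in> fs.span ?F"
  proof (rule fs.span_induct[OF vw(2)])
    show "fs.subspace {w. ptens v w \<in> fs.span ?F}"
      unfolding fs.subspace_def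
    proof (intro conjI ballI allI)
      have "ptens v 0 = 0"
        by (auto simp: ptens_def)
      then show "0 \<in> {w. ptens v w \<in> fs.span ?F}"
        using fs.span_zero by (metis mem_Collect_eq)
    qed (use fs.span_add fs.span_scale in \<open>auto simp: ptens_simps\<close>)
    show "ptens v b \<in> fs.span ?F" if "b \<in> B'" for b
      by (rule 1[OF that])
  qed
qed

text \<open>\<open>T\<close> plays the role of the dual algebra of the cotensor square, and
  \<open>x1\<close>, \<open>x2\<close> are the points given by its two projections. It is generated
  by the left action on the first tensor factor and the right action on the second. The last clause
  holds because the rows of \<open>x1\<close> and \<open>x2\<close> are the projections of a
  spanning family of the cotensor square.\<close>

theorem cotensor_test_algebra:
  fixes C :: "('c, 'k::field) scoalg" and D :: "('d, 'k) scoalg"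
  assumes C: "super_coalgebra C" and D: "super_coalgebra D" and \<phi>: "coalg_hom C D \<phi>"
    and cc: "super_cocommutative C" and fd: "findim (csp C)"
  shows "\<exists>T\<in>SAlgf. \<exists>x1\<in>Ob (SSp C) T. \<exists>x2\<in>Ob (SSp C) T. tmap id \<phi> x1 = tmap id \<phi> x2 \<and>
    (\<forall>f. lform (ccar C) f \<longrightarrow> (\<forall>k. f (\<lambda>e. x1 (k, e)) = f (\<lambda>e. x2 (k, e))) \<longrightarrow>
      (\<forall>t\<in>svcar (csquare C \<phi>). f (proj1 C t) = f (proj2 C t)))"
proof -
  note Cs = coalgD(1)[OF C]
  note slice = tensor_slice[OF Cs Cs] and fub = tensor_fubini[OF Cs Cs]
  define W where "W = csquare C \<phi>"
  note W = super_space_csquare[OF C D \<phi>, folded W_def] and W_car = csquare_car[OF C D \<phi>, folded W_def]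
  note pr = proj_hom[OF C D \<phi>, folded W_def] and pr_car = proj_car[OF C D \<phi>, folded W_def]
  have "findim W"
  proof -
    obtain B where B: "finite B" "ccar C \<subseteq> fs.span B"
      using fd unfolding findim_def by blast
    have "W p \<subseteq> fs.span ((\<lambda>(v, w). ptens v w) ` (B \<times> B))" for p
      using findim_tensor_span[OF B(2) B(2) Cs Cs, of p] csquare_le[OF C D \<phi>, of p] unfolding W_def by blast
    then show ?thesis
      by (rule findimI[OF W]) (simp add: B(1))
  qed
  then obtain c deg and n :: nat where c: "\<And>k. k < n \<Longrightarrow> c k \<in> W (deg k)"
    and span: "svcar W \<subseteq> fs.span (c ` {..<n})"
    using findim_enum by metis
  \<comment> \<open>\<open>Lo\<close> acts on the first factor and \<open>So\<close> on the second,
    so they commute strictly. \<open>Ro\<close> inserts the sign that supercommutativity requires;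
    as it depends on the parity of the functional, \<open>Ro\<close> takes this parity as an
    argument.\<close>
  define Lo where "Lo f = tmap (lact C f) (id :: ('c \<Rightarrow> 'k) \<Rightarrow> _)" for f
  define So where "So f = tmap (id :: ('c \<Rightarrow> 'k) \<Rightarrow> _) (ract C f)" for f
  define Ro where "Ro p f t = twist W p (So f t)" for p f t
  define S where "S p = {Lo f | f. hform (csp C) p f} \<union> {Ro p f | f. hform (csp C) p f}" for p
  \<comment> \<open>The counit on both tensor factors; \<open>eps\<close> below shows that the other
    projection gives the same functional.\<close>
  define \<omega> where "\<omega> t = counit C (proj1 C t)" for t
  have Lo_val: "Lo f t (a, b) = lact C f (\<lambda>i. t (i, b)) a" and So_val: "So f t (a, b) = ract C f (\<lambda>j. t (a, j)) b"
    for f t a b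
    by (simp_all add: Lo_def So_def tmap_def)
  have Lo_dhom: "dhom p W W (Lo f)" and So_dhom: "dhom p W W (So f)" if f: "hform (csp C) p f" for p f
    unfolding dhom_def Lo_def So_def
    using lin_on_subset[OF tmap_lin_on[OF Cs Cs act_lin(1)[OF C hformD(1)[OF f]] lin_on_id(2)] W_car]
      lin_on_subset[OF tmap_lin_on[OF Cs Cs lin_on_id(2) act_lin(2)[OF C hformD(1)[OF f]]] W_car]
      csquare_left[OF C D \<phi> f, folded W_def] csquare_right[OF C D \<phi> f, folded W_def] by blast+
  have Ro_dhom: "dhom p W W (Ro p f)" if f: "hform (csp C) p f" for p f
    unfolding Ro_def using dhom_comp[OF W W So_dhom[OF f] twist_dhom[OF W]] by simp
  have S_dhom: "dhom p W W X" if "X \<in> S p" for p X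
    using that Lo_dhom Ro_dhom unfolding S_def by blast
  have LL: "Lo f (Lo g w) = Lo (fmul C f g) w" and SS: "So f (So g w) = So (fmul C g f) w"
    and LS: "Lo f (So g w) = So g (Lo f w)"
    if f: "lform (ccar C) f" and g: "lform (ccar C) g" and w: "w \<in> svcar W" for f g w
  proof -
    have t: "w \<in> svcar (tensor (csp C) (csp C))"
      using w W_car by blast
    show "Lo f (Lo g w) = Lo (fmul C f g) w"
      using act_act(1)[OF C slice(2)[OF t] f g] by (auto simp: Lo_val fun_eq_iff)
    show "So f (So g w) = So (fmul C g f) w"
      using act_act(2)[OF C slice(1)[OF t] f g] by (auto simp: So_val fun_eq_iff)
    show "Lo f (So g w) = So g (Lo f w)"
      using fub[OF t lform_lin_on[OF act_lin(1)[OF C f]] lform_lin_on[OF act_lin(2)[OF C g]]]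
      by (auto simp: So_val Lo_val fun_eq_iff)
  qed
  have L_cong: "Lo f w = fscale a (Lo g w)" and S_cong: "So f w = fscale a (So g w)"
    if "\<And>x. x \<in> ccar C \<Longrightarrow> f x = a * g x" "w \<in> svcar W" for f g a w
  proof -
    have t: "w \<in> svcar (tensor (csp C) (csp C))"
      using that(2) W_car by blast
    show "Lo f w = fscale a (Lo g w)" "So f w = fscale a (So g w)"
      using that(1)[OF comult_slice(2)[OF C slice(2)[OF t]]] that(1)[OF comult_slice(1)[OF C slice(1)[OF t]]]
      by (auto simp: Lo_val So_val lact_def ract_def fscale_def fun_eq_iff)
  qed
  have Ro_hom: "Ro p f w = fscale (koszul p (p + r)) (So f w)" if "hform (csp C) p f" "w \<in> W r" for p f w r
    unfolding Ro_def by (rule twist_homogeneous[OF W dhomD(2)[OF So_dhom[OF that(1)] that(2)]])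
  have RR_hom: "Ro p f (Ro q g w) = Ro (p + q) (fmul C f g) w"
    if f: "hform (csp C) p f" and g: "hform (csp C) q g" and w: "w \<in> W r" for p q f g w r
  proof -
    note lf = hformD(1)[OF f] and lg = hformD(1)[OF g] and wc = svcar_homogeneous[OF W w]
    have gw: "So g w \<in> W (q + r)"
      by (rule dhomD(2)[OF So_dhom[OF g] w])
    have "Ro p f (Ro q g w) = fscale (koszul q (q + r)) (Ro p f (So g w))"
      unfolding Ro_hom[OF g w] using dhomD(1)[OF Ro_dhom[OF f]] svcar_homogeneous[OF W gw]
      by (simp add: lin_on_def)
    also have "\<dots> = fscale (koszul q (q + r) * koszul p (p + (q + r))) (So (fmul C g f) w)"
      unfolding Ro_hom[OF f gw] SS[OF lf lg wc] by simp
    \<comment> \<open>\<open>SS\<close> reverses the product; cocommutativity restores the order at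
      the price of a sign, which the twist compensates.\<close>
    also have "So (fmul C g f) w = fscale (koszul q p) (So (fmul C f g) w)"
      using fmul_commute[OF C cc g f] by (intro S_cong wc)
    also have "fscale (koszul q (q + r) * koszul p (p + (q + r))) \<dots> =
        fscale (koszul (p + q) (p + q + r)) (So (fmul C f g) w)"
      by (cases p; cases q; cases r) (simp_all add: koszul_def)
    also have "\<dots> = Ro (p + q) (fmul C f g) w"
      by (rule Ro_hom[OF fmul_hform[OF C f g] w, symmetric])
    finally show ?thesis .
  qed
  have RR: "Ro p f (Ro q g w) = Ro (p + q) (fmul C f g) w"
    if f: "hform (csp C) p f" and g: "hform (csp C) q g" and w: "w \<in> svcar W" for p q f g w
    by (rule lin_on_eqI[OF W dhomD(1)[OF dhom_comp[OF W W Ro_dhom[OF g] Ro_dhom[OF f]]]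
          dhomD(1)[OF Ro_dhom[OF fmul_hform[OF C f g]]] w RR_hom[OF f g]])
  have commute: "X (Y w) = fscale (koszul p q) (Y (X w))"
    if X: "X \<in> S p" and Y: "Y \<in> S q" and w: "w \<in> W r" for p q X Y w r
  proof -
    note wc = svcar_homogeneous[OF W w]
    have LR: "Lo f (Ro q g w) = fscale (koszul p q) (Ro q g (Lo f w))"
      if f: "hform (csp C) p f" and g: "hform (csp C) q g" for p q f g
    proof -
      note lf = hformD(1)[OF f] and lg = hformD(1)[OF g]
      have "Lo f (Ro q g w) = fscale (koszul q (q + r)) (Lo f (So g w))"
        unfolding Ro_hom[OF g w] using dhomD(1)[OF Lo_dhom[OF f]]
          svcar_homogeneous[OF W dhomD(2)[OF So_dhom[OF g] w]] by (simp add: lin_on_def)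
      also have "\<dots> = fscale (koszul p q * koszul q (q + (p + r))) (So g (Lo f w))"
        unfolding LS[OF lf lg wc] by (cases p; cases q; cases r) (simp_all add: koszul_def)
      also have "\<dots> = fscale (koszul p q) (Ro q g (Lo f w))"
        unfolding Ro_hom[OF g dhomD(2)[OF Lo_dhom[OF f] w]] by simp
      finally show ?thesis .
    qed
    have LLc: "Lo f (Lo g w) = fscale (koszul p q) (Lo g (Lo f w))"
      if f: "hform (csp C) p f" and g: "hform (csp C) q g" for f g
      unfolding LL[OF hformD(1)[OF f] hformD(1)[OF g] wc] LL[OF hformD(1)[OF g] hformD(1)[OF f] wc]
      using fmul_commute[OF C cc f g] by (intro L_cong wc)
    have RRc: "Ro p f (Ro q g w) = fscale (koszul p q) (Ro q g (Ro p f w))"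
      if f: "hform (csp C) p f" and g: "hform (csp C) q g" for f g
    proof -
      have "So (fmul C f g) w = fscale (koszul p q) (So (fmul C g f) w)"
        using fmul_commute[OF C cc f g] by (intro S_cong wc)
      then show ?thesis
        unfolding RR[OF f g wc] RR[OF g f wc] Ro_hom[OF fmul_hform[OF C f g] w] Ro_hom[OF fmul_hform[OF C g f] w]
        by (simp add: add.commute mult.commute)
    qed
    have RL: "Ro p f (Lo g w) = fscale (koszul p q) (Lo g (Ro p f w))"
      if f: "hform (csp C) p f" and g: "hform (csp C) q g" for f g
      unfolding LR[OF g f] koszul_commute[of q p] by simp
    show ?thesis
      using X Y LLc RRc RL LR unfolding S_def by blast
  qed
  have t_of: "w \<in> svcar (tensor (csp C) (csp C))" if "w \<in> svcar W" for w
    using that W_car by blast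
  have \<omega>_hform: "hform W 0 \<omega>"
    using hform_comp[OF W Cs _ coalgD(4)[OF C], of 0 "proj1 C"] pr(1)
    unfolding \<omega>_def[abs_def] super_hom_iff_dhom by simp
  have \<omega>_L: "\<omega> (Lo f w) = f (proj1 C w)" if f: "lform (ccar C) f" and w: "w \<in> svcar W" for f w
  proof -
    have "proj1 C (Lo f w) = lact C f (proj1 C w)"
    proof
      fix a
      show "proj1 C (Lo f w) a = lact C f (proj1 C w) a"
        unfolding proj1_def Lo_val
        by (rule fub[OF t_of[OF w] lform_lin_on[OF act_lin(1)[OF C f]] coalgD(3)[OF C], symmetric])
    qed
    then show ?thesis
      unfolding \<omega>_def using counit_act(1)[OF C pr_car(1)[OF w] f] by simp
  qed
  have proj1_So: "proj1 C (So g w) = (\<lambda>a. g (\<lambda>j. w (a, j)))" if g: "lform (ccar C) g" and w: "w \<in> svcar W" for g w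
    unfolding proj1_def So_val using counit_act(2)[OF C slice(1)[OF t_of[OF w]] g] by simp
  have \<omega>_R: "\<omega> (Ro p f w) = f (proj2 C w)" if f: "hform (csp C) p f" and w: "w \<in> svcar W" for p f w
  proof -
    have "\<omega> (Ro p f w) = \<omega> (So f w)"
      unfolding Ro_def using hform_twist[OF W \<omega>_hform dhom_car[OF So_dhom[OF f] W W w]] by simp
    also have "\<dots> = f (proj2 C w)"
      unfolding \<omega>_def proj1_So[OF hformD(1)[OF f] w] proj2_def
      by (rule fub[OF t_of[OF w] coalgD(3)[OF C] hformD(1)[OF f]])
    finally show ?thesis .
  qed
  interpret operator_algebra W c deg n "\<lambda>p. {X. op_closure S p X}" \<omega>
  proof
    show "dhom p W W X" if "X \<in> {X. op_closure S p X}" for p X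
      using op_closure_dhom[of W S, OF W S_dhom] that by blast
    show "X (Y w) = fscale (koszul p q) (Y (X w))"
      if "X \<in> {X. op_closure S p X}" "Y \<in> {X. op_closure S q X}" "w \<in> W r" for p q X Y w r
    proof (rule op_closure_commute[where S = S and W = W and w = w and r = r])
      show "\<And>p q X Y r w. X \<in> S p \<Longrightarrow> Y \<in> S q \<Longrightarrow> w \<in> W r \<Longrightarrow> X (Y w) = fscale (koszul p q) (Y (X w))"
        by (rule commute)
    qed (use W S_dhom that in auto)
    fix w assume w: "w \<in> svcar W" and 0: "\<And>p X. X \<in> {X. op_closure S p X} \<Longrightarrow> \<omega> (X w) = 0"
    \<comment> \<open>Up to sign, \<omega> after \<open>Lo f\<close> and \<open>Ro q g\<close>
      evaluates \<open>f\<close> and \<open>g\<close> on the two factors of \<open>w\<close>, and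
      such products of homogeneous functionals separate tensors.\<close>
    have z: "f (\<lambda>a. g (\<lambda>j. w (a, j))) = 0" if f: "hform (csp C) p f" and g: "hform (csp C) q g" for p q f g
    proof -
      have "op_closure S (p + q) (\<lambda>w. Lo f (Ro q g w))"
        using f g by (intro op_closure.intros) (auto simp: S_def)
      then have "0 = \<omega> (Lo f (Ro q g w))"
        using 0 by simp
      also have "\<dots> = f (proj1 C (twist W q (So g w)))"
        unfolding Ro_def[symmetric] by (rule \<omega>_L[OF hformD(1)[OF f] dhom_car[OF Ro_dhom[OF g] W W w]])
      also have "\<dots> = koszul q p * f (proj1 C (So g w))"
        using hform_twist[OF W _ dhom_car[OF So_dhom[OF g] W W w]] hform_comp[OF W Cs _ f, of 0 "proj1 C"] pr(1)
        by (simp add: super_hom_iff_dhom)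
      finally show ?thesis
        unfolding proj1_So[OF hformD(1)[OF g] w] by (simp add: koszul_def split: if_splits)
    qed
    have "(\<lambda>a. g (\<lambda>j. w (a, j))) = 0" if g: "hform (csp C) q g" for q g
      by (rule hform_separates[OF Cs slice(3)[OF t_of[OF w] hformD(1)[OF g]]]) (rule z[OF _ g])
    then have "g (\<lambda>j. w (a, j)) = 0" if "hform (csp C) q g" for q g a
      using that by (metis zero_fun_apply)
    then have "(\<lambda>j. w (a, j)) = 0" for a
      by (rule hform_separates[OF Cs slice(1)[OF t_of[OF w]]])
    then show "w = 0"
      by (auto simp: fun_eq_iff)
  qed (use W c span \<omega>_hform in \<open>auto intro: op_closure.intros\<close>)
  have gen: "Lo f \<in> {X. op_closure S p X}" "Ro p f \<in> {X. op_closure S p X}" if "hform (csp C) p f" for p f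
    using that by (auto intro!: op_closure.gen simp: S_def)
  have x1: "coord (proj1 C) \<in> Ob (SSp C) alg"
  proof (rule coord_point(1)[OF C pr(1), where \<Lambda> = "\<lambda>p. Lo"])
    show "\<omega> (Lo f (Lo g w)) = fmul C f g (proj1 C w)"
      if "hform (csp C) p f" "hform (csp C) q g" "w \<in> svcar W" for p q f g w
      unfolding LL[OF hformD(1)[OF that(1)] hformD(1)[OF that(2)] that(3)]
      by (rule \<omega>_L[OF fmul_lform[OF C hformD(1)[OF that(1)] hformD(1)[OF that(2)]] that(3)])
    show "\<omega> (Lo f w) = f (proj1 C w)" if "hform (csp C) p f" "w \<in> svcar W" for p f w
      by (rule \<omega>_L[OF hformD(1)[OF that(1)] that(2)])
  qed (use gen in \<open>auto simp: \<omega>_def\<close>)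
  have eps: "counit C (proj2 C w) = \<omega> w" if "w \<in> svcar W" for w
    unfolding \<omega>_def proj1_def proj2_def by (rule fub[OF t_of[OF that] coalgD(3)[OF C] coalgD(3)[OF C], symmetric])
  have x2: "coord (proj2 C) \<in> Ob (SSp C) alg"
  proof (rule coord_point(1)[OF C pr(2), where \<Lambda> = "\<lambda>p. Ro p"])
    show "\<omega> (Ro p f (Ro q g w)) = fmul C f g (proj2 C w)"
      if "hform (csp C) p f" "hform (csp C) q g" "w \<in> svcar W" for p q f g w
      unfolding RR[OF that] by (rule \<omega>_R[OF fmul_hform[OF C that(1,2)] that(3)])
  qed (use gen \<omega>_R eps in auto)
  have row: "(\<lambda>e. coord (proj1 C) (k, e)) = (if k < n then proj1 C (c k) else 0)"
    "(\<lambda>e. coord (proj2 C) (k, e)) = (if k < n then proj2 C (c k) else 0)" for k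
    by (auto simp: coord_def fun_eq_iff)
  have "tmap id \<phi> (coord (proj1 C)) = tmap id \<phi> (coord (proj2 C))"
  proof
    fix z :: "nat \<times> 'd"
    obtain k d where z: "z = (k, d)" by fastforce
    show "tmap id \<phi> (coord (proj1 C)) z = tmap id \<phi> (coord (proj2 C)) z"
      unfolding z tmap_def id_apply prod.case row
      using \<phi>_proj[OF C D \<phi>, folded W_def, OF c_car[of k]] by simp
  qed
  moreover have "f (proj1 C t) = f (proj2 C t)"
    if f: "lform (ccar C) f" and eq: "\<And>k. f (\<lambda>e. coord (proj1 C) (k, e)) = f (\<lambda>e. coord (proj2 C) (k, e))"
      and t: "t \<in> svcar W" for f t
  proof (rule lform_eq_on_span[where f = "\<lambda>t. f (proj1 C t)" and g = "\<lambda>t. f (proj2 C t)" and B = "c ` {..<n}"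
        and S = "svcar W"])
    have lin: "lin_on (svcar W) (proj1 C)" "lin_on (svcar W) (proj2 C)"
      using pr by (simp_all add: super_hom_def)
    show "lform (svcar W) (\<lambda>t. f (proj1 C t))" "lform (svcar W) (\<lambda>t. f (proj2 C t))"
      using lform_comp[OF lin(1) pr_car(1) f] lform_comp[OF lin(2) pr_car(2) f] by blast+
    show "f (proj1 C x) = f (proj2 C x)" if "x \<in> c ` {..<n}" for x
    proof -
      obtain k where "k < n" "x = c k"
        using \<open>x \<in> c ` {..<n}\<close> by blast
      then show ?thesis
        using eq[of k] unfolding row by simp
    qed
  qed (use svcar_subspace[OF W] c_car span t in auto)
  ultimately show ?thesis
    unfolding W_def[symmetric] using alg_SAlgf x1 x2 by blast
qed

section \<open>Descent along a faithful pullback\<close>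

lemma supercomoduleD:
  assumes "supercomodule D M"
  shows "super_space (msp M)" "super_hom (msp M) (tensor (msp M) (csp D)) (coact M)"
    "x \<in> mcar M \<Longrightarrow> coact M (\<lambda>e. coact M x (e, b)) (m, a) = comult D (\<lambda>e. coact M x (m, e)) (a, b)"
    "x \<in> mcar M \<Longrightarrow> (\<lambda>m. counit D (\<lambda>a. coact M x (m, a))) = x"
proof -
  note s = assms[unfolded supercomodule_def]
  show "super_space (msp M)" "super_hom (msp M) (tensor (msp M) (csp D)) (coact M)"
    "x \<in> mcar M \<Longrightarrow> (\<lambda>m. counit D (\<lambda>a. coact M x (m, a))) = x"
    using s by blast+
  assume "x \<in> mcar M"
  then have "tmap (coact M) id (coact M x) ((m, a), b) = tmap id (comult D) (coact M x) (m, (a, b))"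
    using s by blast
  then show "coact M (\<lambda>e. coact M x (e, b)) (m, a) = comult D (\<lambda>e. coact M x (m, e)) (a, b)"
    by (simp add: tmap_def)
qed

lemma supercomoduleI:
  assumes "super_space (msp M)" "super_hom (msp M) (tensor (msp M) (csp D)) (coact M)"
    "\<And>x m a b. x \<in> mcar M \<Longrightarrow> coact M (\<lambda>e. coact M x (e, b)) (m, a) = comult D (\<lambda>e. coact M x (m, e)) (a, b)"
    "\<And>x. x \<in> mcar M \<Longrightarrow> (\<lambda>m. counit D (\<lambda>a. coact M x (m, a))) = x"
  shows "supercomodule D M"
  using assms by (simp add: supercomodule_def tmap_def)

lemma super_hom_car:
  assumes "super_hom V W g" "super_space V" "super_space W" "x \<in> svcar V"
  shows "g x \<in> svcar W"
  using dhom_car[OF _ assms(2-4)] assms(1) by (simp add: super_hom_iff_dhom)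

text \<open>
  The quotient is realised inside \<open>M\<close>, as the complement cut out by a graded projection onto \<open>I\<close>.
\<close>

lemma quotient_comodule:
  fixes M :: "('m, 'd, 'k::field) scomod"
  assumes D: "super_coalgebra D" and M: "supercomodule D M"
    and sub: "\<And>p. fs.subspace (I p)" and le: "\<And>p. I p \<subseteq> msp M p"
    and stable: "\<And>p x. x \<in> I p \<Longrightarrow> coact M x \<in> tensor I (csp D) p"
  shows "\<exists>(N :: ('m, 'd, 'k) scomod) q. supercomodule D N \<and> comod_hom M N q \<and>
    (\<forall>x\<in>mcar M. q x = 0 \<longleftrightarrow> x \<in> svcar I)"
proof -
  note Md = supercomoduleD[OF M] and Ds = coalgD(1)[OF D]
  note Ms = Md(1)
  have Is: "super_space I"
    by (rule super_space_sub[OF Ms sub le])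
  have I_car: "svcar I \<subseteq> mcar M"
    by (rule svcar_mono[OF le])
  obtain r where r: "super_hom (msp M) I r" "\<And>x. x \<in> svcar I \<Longrightarrow> r x = x"
    using graded_projection[OF Ms sub le] by blast
  have r_lin: "lin_on (mcar M) r" and r_in: "\<And>x p. x \<in> msp M p \<Longrightarrow> r x \<in> I p"
    using r(1) by (auto simp: super_hom_def)
  have r_car: "r x \<in> svcar I" if "x \<in> mcar M" for x
    by (rule super_hom_car[OF r(1) Ms Is that])
  define q where "q x = x - r x" for x
  have q_lin: "lin_on (mcar M) q"
    using r_lin unfolding lin_on_def q_def by (simp add: fs.scale_right_diff_distrib)
  have q_in: "q x \<in> msp M p" if "x \<in> msp M p" for x p
    unfolding q_def using super_spaceD(4)[OF Ms that] r_in[OF that] le by blast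
  have q_car: "q x \<in> mcar M" if "x \<in> mcar M" for x
    unfolding q_def using svcarD(3)[OF Ms that] r_car[OF that] I_car by blast
  have q0: "q x = 0 \<longleftrightarrow> x \<in> svcar I" if "x \<in> mcar M" for x
    using r_car[OF that] r(2) unfolding q_def by (metis eq_iff_diff_eq_0)
  have qq: "q (q x) = q x" if x: "x \<in> mcar M" for x
  proof -
    have "r (q x) = r x - r (r x)"
      unfolding q_def using lin_on_diff[OF r_lin svcar_subspace[OF Ms] x] r_car[OF x] I_car by blast
    also have "\<dots> = 0"
      using r(2)[OF r_car[OF x]] by simp
    finally show ?thesis
      unfolding q_def[of "q x"] by simp
  qed
  define N :: "('m, 'd, 'k) scomod" where
    "N = \<lparr>msp = (\<lambda>p. q ` msp M p), coact = (\<lambda>y. tmap q id (coact M y))\<rparr>"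
  have N_sel: "msp N p = q ` msp M p" "coact N y = tmap q id (coact M y)" for p y
    by (simp_all add: N_def)
  have N_le: "msp N p \<subseteq> msp M p" for p
    unfolding N_sel using q_in by blast
  have N_sub: "fs.subspace (msp N p)" for p
    unfolding N_sel
    by (rule subspace_lin_image[OF lin_on_subset[OF q_lin] super_spaceD(1)[OF Ms]])
      (use svcar_homogeneous[OF Ms] in blast)
  note Ns = super_space_sub[OF Ms N_sub N_le]
  have N_car: "mcar N \<subseteq> mcar M"
    by (rule svcar_mono[OF N_le])
  have q_hom: "super_hom (msp M) (msp N) q"
    using q_lin unfolding super_hom_def N_sel by blast
  have q_fix: "q y = y" if y: "y \<in> mcar N" for y
  proof -
    have "q y = id y"
    proof (rule lin_on_eqI[OF Ns lin_on_subset[OF q_lin N_car] lin_on_id(2) y])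
      fix p y assume "y \<in> msp N p"
      then obtain x where "x \<in> msp M p" "y = q x"
        unfolding N_sel by blast
      then show "q y = id y"
        using qq svcar_homogeneous[OF Ms] by simp
    qed
    then show ?thesis by simp
  qed
  have co_car: "coact M x \<in> svcar (tensor (msp M) (csp D))" if "x \<in> mcar M" for x
    by (rule super_hom_car[OF Md(2) Ms super_space_tensor[OF Ms Ds] that])
  have co_I: "super_hom I (tensor I (csp D)) (coact M)"
    using stable Md(2) lin_on_subset[OF _ I_car] unfolding super_hom_def by blast
  \<comment> \<open>This makes the coaction descend: \<open>x\<close> and \<open>q x\<close> differ
    by \<open>r x\<close> in the subcomodule, whose coaction has its first factor in
    \<open>I\<close> and is annihilated by \<open>q\<close>.\<close>
  have kill: "tmap q id (coact M (q x)) = tmap q id (coact M x)" if x: "x \<in> mcar M" for x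
  proof -
    have rx: "r x \<in> svcar I" "r x \<in> mcar M"
      using r_car[OF x] I_car by blast+
    have "coact M (r x) \<in> svcar (tensor I (csp D))"
      by (rule super_hom_car[OF co_I Is super_space_tensor[OF Is Ds] rx(1)])
    then have "q (\<lambda>i. coact M (r x) (i, d)) = 0" for d
      using tensor_slice(2)[OF Is Ds] q0 I_car by blast
    then have "tmap q id (coact M (r x)) = 0"
      by (auto simp: tmap_def fun_eq_iff)
    moreover have "tmap q id (coact M x) = tmap q id (coact M (q x)) + tmap q id (coact M (r x))"
    proof -
      have "coact M x = coact M (q x) + coact M (r x)"
        using Md(2) q_car[OF x] rx(2) unfolding super_hom_def lin_on_def q_def by (metis diff_add_cancel)
      then show ?thesis
        using tmap_add[OF Ms Ds q_lin lin_on_id(2) co_car[OF q_car[OF x]] co_car[OF rx(2)]] by simp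
    qed
    ultimately show ?thesis by simp
  qed
  have co_hom: "super_hom (msp M) (tensor (msp N) (csp D)) (\<lambda>y. tmap q id (coact M y))"
    using dhom_comp[OF Ms super_space_tensor[OF Ms Ds], of 0 "coact M" 0 "tensor (msp N) (csp D)" "tmap q id"]
      Md(2) tmap_super_hom[OF Ms Ds q_hom super_hom_id] by (simp add: super_hom_iff_dhom)
  have "supercomodule D N"
  proof (rule supercomoduleI[OF Ns])
    show "super_hom (msp N) (tensor (msp N) (csp D)) (coact N)"
      unfolding N_sel(2)[abs_def] using co_hom N_le lin_on_subset[OF _ N_car] unfolding super_hom_def by blast
    fix x assume x: "x \<in> mcar N"
    then have xM: "x \<in> mcar M"
      using N_car by blast
    note sl = tensor_slice[OF Ms Ds co_car[OF xM]] and fub = tensor_fubini[OF Ms Ds co_car[OF xM] lform_lin_on[OF q_lin]]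
    have val: "coact N z (i, b) = q (\<lambda>e. coact M z (e, b)) i" for z i b
      by (simp add: N_sel tmap_def)
    show "coact N (\<lambda>e. coact N x (e, b)) (m, a) = comult D (\<lambda>e. coact N x (m, e)) (a, b)" for m a b
    proof -
      have "coact N (\<lambda>e. coact N x (e, b)) (m, a) = tmap q id (coact M (q (\<lambda>e. coact M x (e, b)))) (m, a)"
        by (simp add: N_sel tmap_def)
      also have "\<dots> = q (\<lambda>i. coact M (\<lambda>e. coact M x (e, b)) (i, a)) m"
        unfolding kill[OF sl(2)] by (simp add: tmap_def)
      also have "\<dots> = q (\<lambda>i. comult D (\<lambda>e. coact M x (i, e)) (a, b)) m"
        unfolding Md(3)[OF xM] ..
      also have "\<dots> = comult D (\<lambda>e. coact N x (m, e)) (a, b)"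
        unfolding val by (rule fub[OF comult_lform[OF D]])
      finally show ?thesis .
    qed
    show "(\<lambda>m. counit D (\<lambda>a. coact N x (m, a))) = x"
    proof
      fix m
      have "counit D (\<lambda>a. coact N x (m, a)) = q (\<lambda>i. counit D (\<lambda>a. coact M x (i, a))) m"
        unfolding val by (rule fub[OF coalgD(3)[OF D], symmetric])
      then show "counit D (\<lambda>a. coact N x (m, a)) = x m"
        unfolding Md(4)[OF xM] q_fix[OF x] .
    qed
  qed
  moreover have "comod_hom M N q"
    unfolding comod_hom_def using q_hom kill by (simp add: N_sel)
  ultimately show ?thesis
    using q0 by blast
qed

lemma super_hom_restrict:
  assumes "super_hom V W g" "\<And>p. V' p \<subseteq> V p"
  shows "super_hom V' W g"
proof -
  have "svcar V' \<subseteq> svcar V"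
    by (rule svcar_mono[OF assms(2)])
  then have "lin_on (svcar V') g"
    using assms(1) lin_on_subset unfolding super_hom_def by blast
  moreover have "g ` V' p \<subseteq> W p" for p
    using assms(1) assms(2)[of p] unfolding super_hom_def by blast
  ultimately show ?thesis
    unfolding super_hom_def by blast
qed

lemma zero_comod_hom:
  fixes M :: "('m, 'd, 'k::field) scomod" and N :: "('n, 'd, 'k) scomod"
  assumes "supercomodule D N"
  shows "comod_hom M N (\<lambda>x. 0)"
proof -
  note Ns = supercomoduleD(1)[OF assms]
  have "tmap (\<lambda>x. 0) id t = (0 :: 'n \<times> 'd \<Rightarrow> 'k)" for t :: "'m \<times> 'd \<Rightarrow> 'k"
    by (auto simp: tmap_def fun_eq_iff)
  moreover have "coact N 0 = 0"
    using supercomoduleD(2)[OF assms] lin_on_zero[OF _ svcarD(1)[OF Ns]] unfolding super_hom_def by blast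
  moreover have "0 \<in> msp N p" for p
    by (rule super_spaceD(2)[OF Ns])
  ultimately show ?thesis
    unfolding comod_hom_def super_hom_def lin_on_def by (simp add: image_subset_iff)
qed

lemma super_hom_image:
  assumes V: "super_space V" and W: "super_space W" and g: "super_hom V W g"
  shows "fs.subspace (g ` V p)" "g ` V p \<subseteq> W p" "super_space (\<lambda>p. g ` V p)"
    "svcar (\<lambda>p. g ` V p) = g ` svcar V" "super_hom V (\<lambda>p. g ` V p) g"
proof -
  have lin: "lin_on (svcar V) g"
    using g by (simp add: super_hom_def)
  have "V p \<subseteq> svcar V" for p
    using svcar_homogeneous[OF V] by blast
  then show 1: "fs.subspace (g ` V p)" for p
    by (intro subspace_lin_image[OF lin_on_subset[OF lin]] super_spaceD(1)[OF V])
  show 2: "g ` V p \<subseteq> W p" for p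
    using g by (auto simp: super_hom_def)
  show "super_space (\<lambda>p. g ` V p)"
    by (rule super_space_sub[OF W 1 2])
  show "super_hom V (\<lambda>p. g ` V p) g"
    using lin by (simp add: super_hom_def)
  have add: "g (x + y) = g x + g y" if "x \<in> V 0" "y \<in> V 1" for x y
    using lin that svcar_homogeneous[OF V] unfolding lin_on_def by blast
  show "svcar (\<lambda>p. g ` V p) = g ` svcar V"
  proof (intro subset_antisym subsetI)
    fix z assume "z \<in> svcar (\<lambda>p. g ` V p)"
    then obtain x y where xy: "x \<in> V 0" "y \<in> V 1" "z = g x + g y"
      unfolding svcar_def by blast
    then have "z = g (x + y)" "x + y \<in> svcar V"
      using add unfolding svcar_def by auto
    then show "z \<in> g ` svcar V" by blast
  next
    fix z assume "z \<in> g ` svcar V"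
    then obtain x y where xy: "x \<in> V 0" "y \<in> V 1" "z = g (x + y)"
      unfolding svcar_def by blast
    then show "z \<in> svcar (\<lambda>p. g ` V p)"
      unfolding svcar_def using add by auto
  qed
qed

lemma comult_image:
  assumes C: "super_coalgebra C" and \<phi>: "coalg_hom C D \<phi>" and E: "super_space E" "\<And>p. E p \<subseteq> csp C p"
    and st: "\<And>p x. x \<in> E p \<Longrightarrow> comult C x \<in> tensor E E p" and D: "super_coalgebra D"
    and y: "y \<in> \<phi> ` E p"
  shows "comult D y \<in> tensor (\<lambda>p. \<phi> ` E p) (\<lambda>p. \<phi> ` E p) p"
proof -
  obtain x where x: "x \<in> E p" "y = \<phi> x"
    using y by blast
  note hom = super_hom_restrict[OF coalg_homD(1)[OF \<phi>] E(2)]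
  note im = super_hom_image(5)[OF E(1) coalgD(1)[OF D] hom]
  have xc: "x \<in> ccar C"
    using svcar_homogeneous[OF coalgD(1)[OF C]] E(2) x(1) by blast
  have "tmap \<phi> \<phi> (comult C x) \<in> tensor (\<lambda>p. \<phi> ` E p) (\<lambda>p. \<phi> ` E p) p"
    using tmap_super_hom[OF E(1) E(1) im im] st[OF x(1)] unfolding super_hom_def by blast
  then show ?thesis
    unfolding x(2) coalg_homD(4)[OF \<phi> xc] .
qed

lemma pullback_faithfulD:
  fixes C :: "('i, 'k::field) scoalg" and M N :: "('i, 'i, 'k) scomod"
  assumes "pullback_faithful C D \<phi>" "supercomodule D M" "supercomodule D N"
    and "comod_hom M N g" "comod_hom M N h"
    and "\<And>t. t \<in> mcar (pullback C \<phi> M) \<Longrightarrow> pullback_map g t = pullback_map h t" and "x \<in> mcar M"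
  shows "g x = h x"
proof -
  have "\<forall>t\<in>mcar (pullback C \<phi> M). pullback_map g t = pullback_map h t"
    using assms(6) by (rule ballI)
  then have "\<forall>x\<in>mcar M. g x = h x"
    by (rule assms(1)[unfolded pullback_faithful_def, THEN spec, THEN spec, THEN spec, THEN spec,
          THEN mp, THEN mp, THEN mp, THEN mp, THEN mp, OF assms(2-5)])
  then show ?thesis
    using assms(7) by (rule bspec)
qed

text \<open>Faithfulness is tested on the quotient map of \<open>D\<close> by the image of \<phi>.
  An element of the cotensor product of \<open>D\<close> with \<open>C\<close> is the coaction of an
  element of \<open>C\<close>, so its first factor lies in the image; the quotient map dies after
  pullback and is therefore zero.\<close>

theorem pullback_faithful_surj:
  fixes C :: "('i, 'k::field) scoalg"
  assumes C: "super_coalgebra C" and D: "super_coalgebra D" and \<phi>: "coalg_hom C D \<phi>"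
    and faith: "pullback_faithful C D \<phi>"
  shows "\<phi> ` ccar C = ccar D"
proof -
  note Cs = coalgD(1)[OF C] and Ds = coalgD(1)[OF D] and hom = coalg_homD(1)[OF \<phi>]
  define M :: "('i, 'i, 'k) scomod" where "M = \<lparr>msp = csp D, coact = comult D\<rparr>"
  have M_sel [simp]: "msp M = csp D" "coact M = comult D"
    by (simp_all add: M_def)
  have M: "supercomodule D M"
  proof (rule supercomoduleI, unfold M_sel)
    show "super_space (csp D)" "super_hom (csp D) (tensor (csp D) (csp D)) (comult D)"
      by (rule coalgD(1,2)[OF D])+
    fix x assume x: "x \<in> ccar D"
    show "comult D (\<lambda>e. comult D x (e, b)) (m, a) = comult D (\<lambda>e. comult D x (m, e)) (a, b)" for m a b
      by (rule coalgD(5)[OF D x])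
    show "(\<lambda>m. counit D (\<lambda>a. comult D x (m, a))) = x"
      by (rule coalgD(7)[OF D x])
  qed
  note im = super_hom_image[OF Cs Ds hom]
  have "comult D y \<in> tensor (\<lambda>p. \<phi> ` csp C p) (csp D) p" if "y \<in> \<phi> ` csp C p" for y p
    using comult_image[OF C \<phi> Cs order_refl comult_hom[OF C] D that]
      tensor_mono[of "\<lambda>p. \<phi> ` csp C p" "\<lambda>p. \<phi> ` csp C p" "\<lambda>p. \<phi> ` csp C p" "csp D" p] im(2) by blast
  then obtain N :: "('i, 'i, 'k) scomod" and q where N: "supercomodule D N" "comod_hom M N q"
    and q: "\<And>x. x \<in> ccar D \<Longrightarrow> q x = 0 \<longleftrightarrow> x \<in> \<phi> ` ccar C"
    using quotient_comodule[OF D M, of "\<lambda>p. \<phi> ` csp C p"] im(1,2,4) by auto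
  have zero: "comod_hom M N (\<lambda>x. 0)"
    using zero_comod_hom[OF N(1)] .
  have slice_hom: "(\<lambda>d. t (d, n)) \<in> \<phi> ` ccar C"
    if t: "t \<in> cotensor (csp D) (comult D) (csp C) (\<lambda>x. tmap \<phi> id (comult C x)) p" for t n p
  proof -
    have tt: "t \<in> svcar (tensor (csp D) (csp C))"
      using t tensor_car[OF Ds Cs] by (auto simp: cotensor_def)
    have cond: "comult D (\<lambda>i. t (i, n)) (m, d) = \<phi> (ract C (\<lambda>x. x n) (\<lambda>j. t (m, j))) d" for m d n
      using t by (simp add: cotensor_def tmap_def ract_def)
    \<comment> \<open>The element corresponding to \<open>t\<close> under the isomorphism of the
      cotensor product of \<open>D\<close> and \<open>C\<close> over \<open>D\<close> with
      \<open>C\<close>; the computation below shows that \<open>t\<close> is its coaction.\<close>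
    define c where "c = (\<lambda>n. counit D (\<lambda>d. t (d, n)))"
    have c: "c \<in> ccar C"
      unfolding c_def by (rule tensor_slice(4)[OF Ds Cs tt coalgD(3)[OF D]])
    have lf: "lform (ccar C) (\<lambda>x. \<phi> (ract C (\<lambda>x. x n) x) d)" for d
      by (rule lform_comp[OF act_lin(2)[OF C lform_eval] act_car(2)[OF C lform_eval] lform_lin_on[OF coalg_homD(2)[OF \<phi>]]])
    have "t (d, n) = \<phi> (ract C (\<lambda>x. x n) c) d" for d
    proof -
      have "t (d, n) = counit D (\<lambda>m. comult D (\<lambda>i. t (i, n)) (m, d))"
        using coalgD(6)[OF D tensor_slice(2)[OF Ds Cs tt, of n]] by (metis (no_types, lifting))
      also have "\<dots> = counit D (\<lambda>m. \<phi> (ract C (\<lambda>x. x n) (\<lambda>j. t (m, j))) d)"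
        unfolding cond ..
      also have "\<dots> = \<phi> (ract C (\<lambda>x. x n) c) d"
        unfolding c_def by (rule tensor_fubini[OF Ds Cs tt coalgD(3)[OF D] lf])
      finally show ?thesis .
    qed
    then show ?thesis
      using act_car(2)[OF C lform_eval c] by blast
  qed
  have "pullback_map q t = pullback_map (\<lambda>x. 0) t" if t: "t \<in> mcar (pullback C \<phi> M)" for t
  proof -
    obtain a b where ab: "t = a + b"
        "a \<in> cotensor (csp D) (comult D) (csp C) (\<lambda>x. tmap \<phi> id (comult C x)) 0"
        "b \<in> cotensor (csp D) (comult D) (csp C) (\<lambda>x. tmap \<phi> id (comult C x)) 1"
      using t by (auto simp: pullback_def svcar_def)
    have "(\<lambda>d. t (d, n)) \<in> \<phi> ` ccar C" for n
    proof -
      have "(\<lambda>d. t (d, n)) = (\<lambda>d. a (d, n)) + (\<lambda>d. b (d, n))"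
        unfolding ab by auto
      then show ?thesis
        using slice_hom[OF ab(2), of n] slice_hom[OF ab(3), of n] svcar_closed(1)[OF im(3)] unfolding im(4) by simp
    qed
    moreover have "\<phi> ` ccar C \<subseteq> ccar D"
      using super_hom_car[OF hom Cs Ds] by blast
    ultimately have "q (\<lambda>d. t (d, n)) = 0" for n
      using q by blast
    then show ?thesis
      by (auto simp: pullback_map_def tmap_def fun_eq_iff)
  qed
  then have q_zero: "q x = 0" if "x \<in> ccar D" for x
    by (rule pullback_faithfulD[OF faith M N(1) N(2) zero]) (simp_all add: that)
  have "ccar D \<subseteq> \<phi> ` ccar C"
    using q q_zero by blast
  moreover have "\<phi> ` ccar C \<subseteq> ccar D"
    using super_hom_car[OF hom Cs Ds] by blast
  ultimately show ?thesis by blast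
qed

text \<open>Faithfulness is tested on the kernel of \<phi>, a right comodule over \<open>D\<close>,
  with the quotient map by the space \<open>I\<close> of differences of projections. Pulled back,
  the kernel becomes the part of the cotensor square whose first factor lies in the kernel, and
  there all slices in the first factor lie in \<open>I\<close>. So the quotient map vanishes after
  pullback, hence on the kernel itself.\<close>

theorem pullback_faithful_kernel:
  fixes C :: "('i, 'k::field) scoalg"
  assumes C: "super_coalgebra C" and D: "super_coalgebra D" and \<phi>: "coalg_hom C D \<phi>"
    and faith: "pullback_faithful C D \<phi>" and x: "x \<in> ccar C" "\<phi> x = 0"
  shows "\<exists>t\<in>svcar (csquare C \<phi>). x = proj1 C t - proj2 C t"
proof -
  note Cs = coalgD(1)[OF C] and Ds = coalgD(1)[OF D] and hom = coalg_homD(1)[OF \<phi>]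
  note lin\<phi> = coalg_homD(2)[OF \<phi>]
  note slice = tensor_slice[OF Cs Cs] and fub = tensor_fubini[OF Cs Cs]
  note Ws = super_space_csquare[OF C D \<phi>] and pr = proj_hom[OF C D \<phi>]
  define \<theta> where "\<theta> x = tmap id \<phi> (comult C x)" for x
  have \<theta>_val: "\<theta> x (m, d) = \<phi> (\<lambda>b. comult C x (m, b)) d" for x m d
    by (simp add: \<theta>_def tmap_def)
  have \<theta>_ract: "(\<lambda>m. \<theta> x (m, d)) = ract C (\<lambda>y. \<phi> y d) x" for x d
    by (simp add: \<theta>_val ract_def)
  have lf: "lform (ccar C) (\<lambda>y. \<phi> y d)" for d
    by (rule lform_lin_on[OF lin\<phi>])
  have \<theta>_hom: "super_hom (csp C) (tensor (csp C) (csp D)) \<theta>"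
    using dhom_comp[OF Cs super_space_tensor[OF Cs Cs], of 0 "comult C" 0 "tensor (csp C) (csp D)" "tmap id \<phi>"]
      coalgD(2)[OF C] tmap_super_hom[OF Cs Cs super_hom_id hom]
    unfolding \<theta>_def[abs_def] by (simp add: super_hom_iff_dhom)
  have \<theta>_assoc: "\<theta> (\<lambda>e. \<theta> x (e, b)) (m, a) = comult D (\<lambda>e. \<theta> x (m, e)) (a, b)" if x: "x \<in> ccar C" for x m a b
  proof -
    have "\<theta> (\<lambda>e. \<theta> x (e, b)) (m, a) = \<phi> (ract C (\<lambda>y. \<phi> y b) (\<lambda>e. comult C x (m, e))) a"
      unfolding \<theta>_ract unfolding \<theta>_val comult_act(2)[OF C x lf] ..
    also have "\<dots> = comult D (\<phi> (\<lambda>e. comult C x (m, e))) (a, b)"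
      unfolding coalg_homD(4)[OF \<phi> comult_slice(1)[OF C x]] by (simp add: tmap_def ract_def)
    finally show ?thesis
      by (simp add: \<theta>_val)
  qed
  have \<theta>_counit: "(\<lambda>m. counit D (\<lambda>a. \<theta> x (m, a))) = x" if x: "x \<in> ccar C" for x
    using coalg_homD(5)[OF \<phi> comult_slice(1)[OF C x]] coalgD(7)[OF C x] by (simp add: \<theta>_val)
  define C\<phi> :: "('i, 'i, 'k) scomod" where "C\<phi> = \<lparr>msp = csp C, coact = \<theta>\<rparr>"
  have C\<phi>_sel [simp]: "msp C\<phi> = csp C" "coact C\<phi> = \<theta>"
    by (simp_all add: C\<phi>_def)
  have C\<phi>: "supercomodule D C\<phi>"
    by (rule supercomoduleI) (simp_all add: Cs \<theta>_hom \<theta>_assoc \<theta>_counit)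
  define K where "K p = {x \<in> csp C p. \<phi> x = 0}" for p
  have Kc: "y \<in> ccar C \<and> \<phi> y = 0" if "y \<in> K p" for y p
    using that svcar_homogeneous[OF Cs] unfolding K_def by blast
  have K_sub: "fs.subspace (K p)" for p
    unfolding fs.subspace_def
  proof (intro conjI ballI allI)
    show "0 \<in> K p"
      using lin_on_zero[OF lin\<phi> svcarD(1)[OF Cs]] super_spaceD(2)[OF Cs, of p] by (simp add: K_def)
    show "y + z \<in> K p" if "y \<in> K p" "z \<in> K p" for y z
    proof -
      have "\<phi> (y + z) = \<phi> y + \<phi> z"
        using lin\<phi> Kc[OF that(1)] Kc[OF that(2)] unfolding lin_on_def by blast
      then show ?thesis
        using that super_spaceD(3)[OF Cs, of y p z] by (simp add: K_def)
    qed
    show "fscale a y \<in> K p" if "y \<in> K p" for a y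
    proof -
      have "\<phi> (fscale a y) = fscale a (\<phi> y)"
        using lin\<phi> Kc[OF that] unfolding lin_on_def by blast
      then show ?thesis
        using that super_spaceD(5)[OF Cs, of y p a] by (simp add: K_def)
    qed
  qed
  have K_le: "K p \<subseteq> csp C p" for p
    unfolding K_def by blast
  note Ks = super_space_sub[OF Cs K_sub K_le] and K_car = svcar_mono[of K, OF K_le]
  have K_iff: "z \<in> svcar K" if z: "z \<in> ccar C" "\<phi> z = 0" for z
  proof -
    have "\<phi> (hcomp (csp C) p z) = 0" for p
      unfolding super_hom_hcomp[OF hom Cs Ds z(1)] z(2)
      by (rule lin_on_zero[OF hcomp_lin[OF Ds] svcarD(1)[OF Ds]])
    then have Kp: "hcomp (csp C) p z \<in> K p" for p
      unfolding K_def using hcomp_in(1)[OF Cs z(1)] by blast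
    show ?thesis
      unfolding svcar_def by (intro CollectI exI conjI) (rule hcomp_in(2)[OF Cs z(1), symmetric], (rule Kp)+)
  qed
  have K_\<phi>: "\<phi> z = 0" if z: "z \<in> svcar K" for z
  proof -
    obtain a b where ab: "z = a + b" "a \<in> K 0" "b \<in> K 1"
      using z unfolding svcar_def by blast
    then have "a \<in> ccar C" "b \<in> ccar C" "\<phi> a = 0" "\<phi> b = 0"
      using svcar_homogeneous[OF Cs] unfolding K_def by blast+
    then show ?thesis
      using lin\<phi> ab(1) by (simp add: lin_on_def)
  qed
  define M :: "('i, 'i, 'k) scomod" where "M = \<lparr>msp = K, coact = \<theta>\<rparr>"
  have M_sel [simp]: "msp M = K" "coact M = \<theta>"
    by (simp_all add: M_def)
  \<comment> \<open>Slices of the coaction stay in the kernel because applying \<phi> to them gives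
    a slice of the coproduct of \<open>\<phi> x\<close>, which is zero.\<close>
  have \<theta>K: "\<theta> x \<in> tensor K (csp D) p" if x: "x \<in> K p" for x p
  proof (rule tensor_refine_left[OF Cs Ds K_sub K_le])
    have xc: "x \<in> csp C p" "x \<in> ccar C" "\<phi> x = 0"
      using x svcar_homogeneous[OF Cs] unfolding K_def by blast+
    show "\<theta> x \<in> tensor (csp C) (csp D) p"
      using \<theta>_hom xc(1) unfolding super_hom_def by blast
    fix d
    show "(\<lambda>m. \<theta> x (m, d)) \<in> svcar K"
    proof (rule K_iff)
      show "(\<lambda>m. \<theta> x (m, d)) \<in> ccar C"
        unfolding \<theta>_ract by (rule act_car(2)[OF C lf xc(2)])
      show "\<phi> (\<lambda>m. \<theta> x (m, d)) = 0"
      proof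
        fix d'
        have "\<phi> (\<lambda>m. \<theta> x (m, d)) d' = comult D (\<phi> x) (d', d)"
          unfolding coalg_homD(4)[OF \<phi> xc(2)] by (simp add: \<theta>_val tmap_def)
        then show "\<phi> (\<lambda>m. \<theta> x (m, d)) d' = 0 d'"
          unfolding xc(3) using lin_on_zero[OF comult_lin[OF D] svcarD(1)[OF Ds]] by simp
      qed
    qed
  qed
  have M: "supercomodule D M"
  proof (rule supercomoduleI)
    show "super_hom (msp M) (tensor (msp M) (csp D)) (coact M)"
      using \<theta>K \<theta>_hom lin_on_subset[OF _ K_car] unfolding super_hom_def M_sel by blast
  qed (use Ks \<theta>_assoc \<theta>_counit K_car in auto)
  define \<delta> where "\<delta> t = proj1 C t - proj2 C t" for t
  have \<delta>_hom: "super_hom (csquare C \<phi>) (csp C) \<delta>"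
    using pr super_spaceD(4)[OF Cs] unfolding super_hom_def \<delta>_def lin_on_def
    by (auto simp: fs.scale_right_diff_distrib image_subset_iff)
  define I where "I p = \<delta> ` csquare C \<phi> p" for p
  note im = super_hom_image[OF Ws Cs \<delta>_hom, folded I_def]
  have I_car: "svcar I \<subseteq> ccar C"
    by (rule svcar_mono[OF im(2)])
  \<comment> \<open>For a homogeneous functional, let its right action operate on the second factor
    of \<open>t\<close>: the tensor stays in the cotensor square, and the difference of its
    projections is the vector in question. A general functional is split into homogeneous
    parts.\<close>
  have delta_right: "(\<lambda>a. f (\<lambda>j. t (a, j)) - ract C f (proj2 C t) a) \<in> svcar I"
    if f: "lform (ccar C) f" and t: "t \<in> csquare C \<phi> p" for f t p
  proof -
    note T = csquareD[OF C D \<phi> t]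
    have hom_case: "(\<lambda>a. h (\<lambda>j. t (a, j)) - ract C h (proj2 C t) a) \<in> I (q + p)" if h: "hform (csp C) q h" for h q
    proof -
      note lh = hformD(1)[OF h]
      have "proj1 C (tmap id (ract C h) t) = (\<lambda>a. h (\<lambda>j. t (a, j)))"
        unfolding proj1_def using counit_act(2)[OF C slice(1)[OF T(2)] lh] by (simp add: tmap_def)
      moreover have "proj2 C (tmap id (ract C h) t) = ract C h (proj2 C t)"
      proof
        fix b
        show "proj2 C (tmap id (ract C h) t) b = ract C h (proj2 C t) b"
          unfolding proj2_def using fub[OF T(2) coalgD(3)[OF C] lform_lin_on[OF act_lin(2)[OF C lh]]]
          by (simp add: tmap_def)
      qed
      ultimately have "\<delta> (tmap id (ract C h) t) = (\<lambda>a. h (\<lambda>j. t (a, j)) - ract C h (proj2 C t) a)"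
        unfolding \<delta>_def by auto
      then show ?thesis
        unfolding I_def using csquare_right[OF C D \<phi> h t] by (metis image_eqI)
    qed
    let ?f = "\<lambda>q x. f (hcomp (csp C) q x)"
    have p2: "proj2 C t \<in> ccar C"
      using proj_car(2)[OF C D \<phi>] svcar_homogeneous[OF Ws t] by blast
    have "(\<lambda>a. f (\<lambda>j. t (a, j)) - ract C f (proj2 C t) a) =
        (\<lambda>a. ?f 0 (\<lambda>j. t (a, j)) - ract C (?f 0) (proj2 C t) a) +
        (\<lambda>a. ?f 1 (\<lambda>j. t (a, j)) - ract C (?f 1) (proj2 C t) a)"
    proof
      fix a
      show "f (\<lambda>j. t (a, j)) - ract C f (proj2 C t) a =
        ((\<lambda>a. ?f 0 (\<lambda>j. t (a, j)) - ract C (?f 0) (proj2 C t) a) +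
        (\<lambda>a. ?f 1 (\<lambda>j. t (a, j)) - ract C (?f 1) (proj2 C t) a)) a"
        using hform_decomp[OF Cs f slice(1)[OF T(2)], of a] hform_decomp[OF Cs f comult_slice(1)[OF C p2], of a]
        by (simp add: ract_def)
    qed
    then show ?thesis
      using svcar_closed(1)[OF im(3) svcar_homogeneous[OF im(3) hom_case[OF hform_hcomp[OF Cs f]]]
          svcar_homogeneous[OF im(3) hom_case[OF hform_hcomp[OF Cs f]]]] by simp
  qed
  \<comment> \<open>By \<open>coact_proj1\<close> the coaction of \<open>proj1 C t\<close> is
    \<open>t\<close> with \<phi> applied to the second factor, so \<open>delta_right\<close> covers
    every slice.\<close>
  have stable: "\<theta> y \<in> tensor I (csp D) p" if y: "y \<in> I p" for y p
  proof (rule tensor_refine_left[OF Cs Ds im(1,2)])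
    obtain t where t: "t \<in> csquare C \<phi> p" "y = \<delta> t"
      using y unfolding I_def by blast
    note T = csquareD[OF C D \<phi> t(1)]
    have pc: "proj1 C t \<in> ccar C" "proj2 C t \<in> ccar C"
      using proj_car[OF C D \<phi> svcar_homogeneous[OF Ws t(1)]] by blast+
    show "\<theta> y \<in> tensor (csp C) (csp D) p"
      using \<theta>_hom im(2)[of p] y unfolding super_hom_def by blast
    fix d
    have "(\<lambda>m. \<theta> y (m, d)) = (\<lambda>m. \<phi> (\<lambda>j. t (m, j)) d - ract C (\<lambda>x. \<phi> x d) (proj2 C t) m)"
    proof
      fix m
      have "\<theta> y = \<theta> (proj1 C t) - \<theta> (proj2 C t)"
        using \<theta>_hom lin_on_diff[OF _ svcar_subspace[OF Cs] pc] unfolding t(2) \<delta>_def super_hom_def by blast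
      moreover have "\<theta> (proj1 C t) (m, d) = \<phi> (\<lambda>j. t (m, j)) d"
        using coact_proj1[OF C D \<phi> t(1), of m d] by (simp add: \<theta>_val lact_def)
      moreover have "\<theta> (proj2 C t) (m, d) = ract C (\<lambda>x. \<phi> x d) (proj2 C t) m"
        by (simp add: \<theta>_val ract_def)
      ultimately show "\<theta> y (m, d) = \<phi> (\<lambda>j. t (m, j)) d - ract C (\<lambda>x. \<phi> x d) (proj2 C t) m"
        by simp
    qed
    then show "(\<lambda>m. \<theta> y (m, d)) \<in> svcar I"
      using delta_right[OF lf t(1)] by simp
  qed
  \<comment> \<open>The quotient is taken of all of \<open>C\<close> and restricted to the kernel
    afterwards, so \<open>I\<close> only has to be a subcomodule of \<open>C\<close>.\<close>
  obtain N :: "('i, 'i, 'k) scomod" and q where N: "supercomodule D N" "comod_hom C\<phi> N q"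
    and q: "\<And>x. x \<in> ccar C \<Longrightarrow> q x = 0 \<longleftrightarrow> x \<in> svcar I"
    using quotient_comodule[OF D C\<phi>, of I] im(1,2) stable by auto
  have qM: "comod_hom M N q"
    using N(2) K_car K_le lin_on_subset[OF _ K_car] unfolding comod_hom_def super_hom_def M_sel C\<phi>_sel
    by blast
  have zero: "comod_hom M N (\<lambda>x. 0)"
    using zero_comod_hom[OF N(1)] .
  \<comment> \<open>The counit of \<open>C\<close> factors through \<phi> and vanishes on the
    kernel, so \<open>proj2 C t\<close> is zero and \<open>delta_right\<close> leaves the slice
    itself.\<close>
  have slice_I: "(\<lambda>a. t (a, n)) \<in> svcar I"
    if t: "t \<in> cotensor K \<theta> (csp C) (\<lambda>x. tmap \<phi> id (comult C x)) p" for t n p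
  proof -
    have tK: "t \<in> tensor K (csp C) p"
      using t by (simp add: cotensor_def)
    have "tensor K (csp C) p \<subseteq> tensor (csp C) (csp C) p"
      by (rule tensor_mono) (simp_all add: K_le)
    then have tc: "t \<in> csquare C \<phi> p"
      using t unfolding csquare_def cotensor_def \<theta>_def by blast
    have "\<phi> (\<lambda>i. t (i, n)) = 0" for n
      by (rule K_\<phi>[OF tensor_slice(2)[OF Ks Cs subsetD[OF tensor_car[OF Ks Cs] tK]]])
    then have "counit C (\<lambda>i. t (i, n)) = 0" for n
      using coalg_homD(5)[OF \<phi> slice(2)[OF csquareD(2)[OF C D \<phi> tc]]]
        lform_zero(1)[OF coalgD(3)[OF D] svcarD(1)[OF Ds]] by metis
    then have p2: "proj2 C t = 0"
      by (auto simp: proj2_def fun_eq_iff)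
    have "ract C (\<lambda>x. x n) 0 = 0"
      by (rule lin_on_zero[OF act_lin(2)[OF C lform_eval] svcarD(1)[OF Cs]])
    then show ?thesis
      using delta_right[OF lform_eval tc, of n] unfolding p2 by simp
  qed
  have "pullback_map q t = pullback_map (\<lambda>x. 0) t" if t: "t \<in> mcar (pullback C \<phi> M)" for t
  proof -
    obtain a b where ab: "t = a + b"
        "a \<in> cotensor K \<theta> (csp C) (\<lambda>x. tmap \<phi> id (comult C x)) 0"
        "b \<in> cotensor K \<theta> (csp C) (\<lambda>x. tmap \<phi> id (comult C x)) 1"
      using t by (auto simp: pullback_def svcar_def)
    have "(\<lambda>m. t (m, n)) \<in> svcar I" for n
    proof -
      have "(\<lambda>m. t (m, n)) = (\<lambda>m. a (m, n)) + (\<lambda>m. b (m, n))"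
        unfolding ab by auto
      then show ?thesis
        using slice_I[OF ab(2), of n] slice_I[OF ab(3), of n] svcar_closed(1)[OF im(3)] by simp
    qed
    then have "q (\<lambda>m. t (m, n)) = 0" for n
      using q I_car by blast
    then show ?thesis
      by (auto simp: pullback_map_def tmap_def fun_eq_iff)
  qed
  then have "q x = 0"
    by (rule pullback_faithfulD[OF faith M N(1) qM zero]) (simp_all add: K_iff[OF x])
  then have "x \<in> svcar I"
    using q[OF x(1)] by blast
  then show ?thesis
    unfolding im(4) \<delta>_def by blast
qed

section \<open>Finite-dimensional sub-coalgebras\<close>

definition sub_coalgebra :: "('c, 'k::field) scoalg \<Rightarrow> ('c, 'k) svs \<Rightarrow> bool" where
  "sub_coalgebra C E \<longleftrightarrow> (\<forall>p. fs.subspace (E p)) \<and> (\<forall>p. E p \<subseteq> csp C p) \<and>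
     (\<forall>p. \<forall>x\<in>E p. comult C x \<in> tensor E E p)"

lemma sub_coalgebraD:
  assumes "super_coalgebra C" "sub_coalgebra C E"
  shows "fs.subspace (E p)" "E p \<subseteq> csp C p" "x \<in> E p \<Longrightarrow> comult C x \<in> tensor E E p"
    "super_space E" "svcar E \<subseteq> ccar C"
proof -
  show 1: "fs.subspace (E p)" and 2: "E p \<subseteq> csp C p"
    and "x \<in> E p \<Longrightarrow> comult C x \<in> tensor E E p" for p
    using assms(2) unfolding sub_coalgebra_def by blast+
  show "super_space E"
    by (rule super_space_sub[OF coalgD(1)[OF assms(1)] 1 2])
  show "svcar E \<subseteq> ccar C"
    by (rule svcar_mono[OF 2])
qed

lemma restrict_super_coalgebra:
  assumes C: "super_coalgebra C" and E: "sub_coalgebra C E"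
  shows "super_coalgebra (C\<lparr>csp := E\<rparr>)"
proof -
  note e = sub_coalgebraD[OF C E]
  note c = C[unfolded super_coalgebra_def]
  have in_C: "x \<in> ccar C" if "x \<in> svcar E" for x
    using that e(5) by blast
  have "lin_on (svcar E) (comult C)"
    by (rule lin_on_subset[OF comult_lin[OF C] e(5)])
  then have "super_hom E (tensor E E) (comult C)"
    using e(3) unfolding super_hom_def by blast
  moreover have "\<forall>x\<in>E 1. counit C x = 0"
    using c e(2) by blast
  ultimately show ?thesis
    using c e(4) in_C unfolding super_coalgebra_def by simp
qed

text \<open>The braiding depends on the ambient space through \<open>hcomp\<close> only, and
  homogeneous components of elements of \<open>E\<close> are the same in \<open>E\<close> and in
  \<open>C\<close>.\<close>

lemma restrict_super_cocommutative:
  assumes C: "super_coalgebra C" and cc: "super_cocommutative C" and E: "sub_coalgebra C E"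
  shows "super_cocommutative (C\<lparr>csp := E\<rparr>)"
proof -
  note e = sub_coalgebraD[OF C E]
  have "braid (csp C) (csp C) t = braid E E t" if t: "t \<in> svcar (tensor E E)" for t
  proof -
    note sl = tensor_slice[OF e(4) e(4) t]
    have h: "hcomp (csp C) p x = hcomp E p x" if "x \<in> svcar E" for p x
      by (rule hcomp_sub[OF coalgD(1)[OF C] e(4) e(2) that])
    have "tmap (hcomp (csp C) p) (hcomp (csp C) q) t = tmap (hcomp E p) (hcomp E q) t" for p q
    proof -
      have "hcomp (csp C) p (\<lambda>i. hcomp E q (\<lambda>j. t (i, j)) j') = hcomp E p (\<lambda>i. hcomp E q (\<lambda>j. t (i, j)) j')" for j'
        by (rule h[OF sl(3)[OF lform_lin_on[OF hcomp_lin[OF e(4)]]]])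
      then show ?thesis
        unfolding tmap_def h[OF sl(1)] by simp
    qed
    then show ?thesis
      unfolding braid_def by simp
  qed
  moreover have "comult C x \<in> svcar (tensor E E)" if "x \<in> svcar E" for x
    using comult_car[OF restrict_super_coalgebra[OF C E], of x] that by simp
  moreover have "comult C x = braid (csp C) (csp C) (comult C x)" if "x \<in> svcar E" for x
    using cc e(5) that unfolding super_cocommutative_def by blast
  ultimately show ?thesis
    unfolding super_cocommutative_def by simp
qed

lemma image_sub_coalgebra:
  assumes C: "super_coalgebra C" and D: "super_coalgebra D" and \<phi>: "coalg_hom C D \<phi>" and E: "sub_coalgebra C E"
  shows "sub_coalgebra D (\<lambda>p. \<phi> ` E p)" "svcar (\<lambda>p. \<phi> ` E p) = \<phi> ` svcar E"
    "coalg_hom (C\<lparr>csp := E\<rparr>) (D\<lparr>csp := \<lambda>p. \<phi> ` E p\<rparr>) \<phi>"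
proof -
  note e = sub_coalgebraD[OF C E]
  note im = super_hom_image[OF e(4) coalgD(1)[OF D] super_hom_restrict[OF coalg_homD(1)[OF \<phi>] e(2)]]
  show "sub_coalgebra D (\<lambda>p. \<phi> ` E p)"
    unfolding sub_coalgebra_def using im(1,2) comult_image[OF C \<phi> e(4,2,3) D] by blast
  show "svcar (\<lambda>p. \<phi> ` E p) = \<phi> ` svcar E"
    by (rule im(4))
  have "comult D (\<phi> x) = tmap \<phi> \<phi> (comult C x) \<and> counit D (\<phi> x) = counit C x" if "x \<in> svcar E" for x
    using coalg_homD(4,5)[OF \<phi>] that e(5) by blast
  then show "coalg_hom (C\<lparr>csp := E\<rparr>) (D\<lparr>csp := \<lambda>p. \<phi> ` E p\<rparr>) \<phi>"
    unfolding coalg_hom_def using im(5) by simp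
qed

lemma findim_image:
  assumes E: "super_space E" and g: "super_hom E (\<lambda>p. g ` E p) g" and fd: "findim E"
    and im: "super_space (\<lambda>p. g ` E p)"
  shows "findim (\<lambda>p. g ` E p)"
proof -
  obtain B where B: "finite B" "B \<subseteq> E 0 \<union> E 1" "svcar E \<subseteq> fs.span B"
    using fd unfolding findim_def by blast
  have "B \<subseteq> svcar E"
    using B(2) svcar_homogeneous[OF E] by blast
  then have "svcar E = fs.span B"
    using B(3) fs.span_minimal[OF _ svcar_subspace[OF E]] by blast
  then have lin: "lin_on (fs.span B) g"
    using g by (simp add: super_hom_def)
  have "g ` E p \<subseteq> fs.span (g ` B)" for p
    using lin_on_span_image[OF lin] svcar_homogeneous[OF E] B(3) by blast
  then show ?thesis
    by (rule findimI[OF im]) (simp add: B(1))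
qed

text \<open>A tensor is a finite sum of pure tensors of homogeneous vectors, and the right factors
  of these span all the slices.\<close>

lemma hcomp_slices_findim:
  assumes V: "super_space V" and W: "super_space W" and t: "t \<in> svcar (tensor V W)"
  shows "\<exists>F. finite F \<and> (\<forall>p a. hcomp W p (\<lambda>b. t (a, b)) \<in> fs.span F)"
  using V t
proof (induction rule: tensor_car_induct)
  case zero
  have "hcomp W p (\<lambda>b. 0 (a, b)) = 0" for p a
    using lin_on_zero[OF hcomp_lin[OF W] svcarD(1)[OF W]] by (simp add: zero_fun_def)
  then show "\<exists>F. finite F \<and> (\<forall>p a. hcomp W p (\<lambda>b. 0 (a, b)) \<in> fs.span F)"
    using fs.span_zero by (intro exI[of _ "{}"]) simp
next
  case (add v w q r y)
  then obtain F where F: "finite F" "\<And>p a. hcomp W p (\<lambda>b. y (a, b)) \<in> fs.span F"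
    by blast
  have "hcomp W p (\<lambda>b. (ptens v w + y) (a, b)) \<in> fs.span (insert w F)" for p a
  proof -
    have wc: "fscale (v a) w \<in> W r" "fscale (v a) w \<in> svcar W"
      using super_spaceD(5)[OF W add(2)] svcar_homogeneous[OF W] by blast+
    have "(\<lambda>b. (ptens v w + y) (a, b)) = fscale (v a) w + (\<lambda>b. y (a, b))"
      by (auto simp: ptens_def fscale_def)
    then have "hcomp W p (\<lambda>b. (ptens v w + y) (a, b)) = hcomp W p (fscale (v a) w) + hcomp W p (\<lambda>b. y (a, b))"
      using hcomp_lin[OF W, of p] wc(2) tensor_slice(1)[OF V W add(3)] by (simp add: lin_on_def)
    moreover have "hcomp W p (fscale (v a) w) \<in> fs.span (insert w F)"
      unfolding hcomp_homogeneous[OF W wc(1)] using fs.span_zero by (auto intro: fs.span_scale fs.span_base)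
    moreover have "hcomp W p (\<lambda>b. y (a, b)) \<in> fs.span (insert w F)"
      using F(2) fs.span_mono[OF subset_insertI] by blast
    ultimately show ?thesis
      using fs.span_add by metis
  qed
  then show "\<exists>F. finite F \<and> (\<forall>p a. hcomp W p (\<lambda>b. (ptens v w + y) (a, b)) \<in> fs.span F)"
    using F(1) by (intro exI[of _ "insert w F"]) simp
qed

lemma braid_tensor:
  assumes V: "super_space V" and E: "\<And>p. E p \<subseteq> V p" and t: "t \<in> tensor V E p"
  shows "braid V V t \<in> tensor E V p"
  using V t
proof (induction rule: tensor_induct)
  case zero
  show "braid V V 0 \<in> tensor E V p"
    unfolding braid_0[OF V V] by (rule fs.subspace_0[OF tensor_subspace])
next
  case (add v w q r y)
  have "tensor V E p \<subseteq> tensor V V p"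
    by (rule tensor_mono[OF order_refl E])
  then have y: "y \<in> svcar (tensor V V)"
    using add(4) tensor_car[OF V V] by blast
  have w: "w \<in> V r"
    using add(2) E by blast
  have "ptens w v \<in> tensor E V p"
    by (rule ptens_in[where V = E and W = V, OF add(2,1)]) (simp add: add(3)[symmetric] add.commute)
  then show "braid V V (ptens v w + y) \<in> tensor E V p"
    unfolding braid_ptens_add[OF V V add(1) w y]
    using add(5) by (intro fs.subspace_add[OF tensor_subspace] fs.subspace_scale[OF tensor_subspace])
qed

text \<open>
  The right coideal generated by \<open>X\<close> is spanned by slices of coproducts, so it is visibly
  finite-dimensional; by cocommutativity it is also a left coideal.
\<close>

theorem finite_sub_coalgebra:
  fixes C :: "('c, 'k::field) scoalg"
  assumes C: "super_coalgebra C" and cc: "super_cocommutative C" and X: "finite X" "X \<subseteq> ccar C"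
  shows "\<exists>E. sub_coalgebra C E \<and> findim E \<and> X \<subseteq> svcar E"
proof -
  note Cs = coalgD(1)[OF C] and Ts = super_space_tensor[OF coalgD(1)[OF C] coalgD(1)[OF C]]
  let ?h = "hcomp (csp C)"
  define S where "S p = {?h p (\<lambda>b. comult C x (a, b)) | x a. x \<in> X}" for p
  define E where "E p = fs.span (S p)" for p
  have xc: "x \<in> ccar C" if "x \<in> X" for x
    using X(2) that by blast
  have S_in: "S p \<subseteq> csp C p" for p
    unfolding S_def using hcomp_in(1)[OF Cs comult_slice(1)[OF C xc]] by blast
  have E_sub: "fs.subspace (E p)" for p
    unfolding E_def by simp
  have E_le: "E p \<subseteq> csp C p" for p
    unfolding E_def by (rule fs.span_minimal[OF S_in super_spaceD(1)[OF Cs]])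
  note Es = super_space_sub[OF Cs E_sub E_le]
  note TEs = super_space_tensor[OF Cs Es]
  have slice_E: "(\<lambda>b. comult C x (a, b)) \<in> svcar E" if x: "x \<in> X" for x a
  proof -
    have "?h p (\<lambda>b. comult C x (a, b)) \<in> E p" for p
      unfolding E_def S_def using x by (intro fs.span_base) blast
    then have "?h p (\<lambda>b. comult C x (a, b)) \<in> svcar E" for p
      by (rule svcar_homogeneous[OF Es])
    then show ?thesis
      using svcar_closed(1)[OF Es] hcomp_in(2)[OF Cs comult_slice(1)[OF C xc[OF x]]] by metis
  qed
  have comult_E: "comult C x \<in> svcar (tensor (csp C) E)" if x: "x \<in> X" for x
    by (rule tensor_refine_right(2)[OF Cs Cs E_sub E_le slice_E[OF x] comult_car[OF C xc[OF x]]])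
  have X_E: "X \<subseteq> svcar E"
  proof
    fix x assume x: "x \<in> X"
    show "x \<in> svcar E"
      using tensor_slice(4)[OF Cs Es comult_E[OF x] coalgD(3)[OF C]] coalgD(6)[OF C xc[OF x]] by simp
  qed
  have "\<exists>F. finite F \<and> (\<forall>p a. ?h p (\<lambda>b. comult C x (a, b)) \<in> fs.span F)" if "x \<in> X" for x
    by (rule hcomp_slices_findim[OF Cs Cs comult_car[OF C xc[OF that]]])
  then obtain F where F: "\<And>x. x \<in> X \<Longrightarrow> finite (F x)"
    "\<And>x p a. x \<in> X \<Longrightarrow> ?h p (\<lambda>b. comult C x (a, b)) \<in> fs.span (F x)"
    by metis
  have "E p \<subseteq> fs.span (\<Union>x\<in>X. F x)" for p
    unfolding E_def
  proof (rule fs.span_minimal[OF _ fs.subspace_span])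
    show "S p \<subseteq> fs.span (\<Union>x\<in>X. F x)"
      unfolding S_def using F(2) fs.span_mono[of "F _" "\<Union>x\<in>X. F x"] by blast
  qed
  then have fd: "findim E"
    by (rule findimI[OF Es]) (simp add: X(1) F(1))
  have right: "comult C e \<in> tensor (csp C) E p" if e: "e \<in> E p" for e p
  proof -
    have "e \<in> csp C p \<and> comult C e \<in> tensor (csp C) E p"
      using e[unfolded E_def]
    proof (induction rule: fs.span_induct_alt)
      case base
      show "0 \<in> csp C p \<and> comult C 0 \<in> tensor (csp C) E p"
        using super_spaceD(2)[OF Cs] lin_on_zero[OF comult_lin[OF C] svcarD(1)[OF Cs]] fs.subspace_0[OF tensor_subspace]
        by metis
    next
      case (step k s y)
      obtain x a where x: "x \<in> X" "s = ?h p (\<lambda>b. comult C x (a, b))"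
        using step(1) unfolding S_def by blast
      have s: "s \<in> csp C p"
        using step(1) S_in by blast
      let ?e = "\<lambda>b. comult C x (a, b)"
      have ec: "?e \<in> ccar C"
        by (rule comult_slice(1)[OF C xc[OF x(1)]])
      \<comment> \<open>By coassociativity this slice arises by applying a functional to the first
        factor of the coproduct of \<open>x\<close>, whose second factor lies in \<open>E\<close>
        already.\<close>
      have "(\<lambda>d. comult C ?e (c, d)) \<in> svcar E" for c
      proof -
        have "(\<lambda>d. comult C ?e (c, d)) = (\<lambda>d. comult C (\<lambda>i. comult C x (i, d)) (a, c))"
          using coalgD(5)[OF C xc[OF x(1)]] by simp
        then show ?thesis
          using tensor_slice(4)[OF Cs Es comult_E[OF x(1)] comult_lform[OF C]] by simp
      qed
      then have de: "comult C ?e \<in> svcar (tensor (csp C) E)"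
        by (rule tensor_refine_right(2)[OF Cs Cs E_sub E_le _ comult_car[OF C ec]])
      have "comult C s = hcomp (tensor (csp C) (csp C)) p (comult C ?e)"
        unfolding x(2) by (rule super_hom_hcomp[OF coalgD(2)[OF C] Cs Ts ec])
      also have "\<dots> = hcomp (tensor (csp C) E) p (comult C ?e)"
        by (rule hcomp_sub[OF Ts TEs tensor_mono[OF order_refl E_le] de])
      finally have "comult C s \<in> tensor (csp C) E p"
        using hcomp_in(1)[OF TEs de] by simp
      moreover have "comult C (fscale k s + y) = fscale k (comult C s) + comult C y"
        using comult_lin[OF C] svcar_homogeneous[OF Cs s] svcar_homogeneous[OF Cs, of y p]
          svcar_closed(2)[OF Cs svcar_homogeneous[OF Cs s] svcar_homogeneous[OF Cs s]] step(2)
        by (simp add: lin_on_def)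
      ultimately have "comult C (fscale k s + y) \<in> tensor (csp C) E p"
        using step(2) fs.subspace_add[OF tensor_subspace] fs.subspace_scale[OF tensor_subspace] by metis
      moreover have "fscale k s + y \<in> csp C p"
        using super_spaceD(3)[OF Cs super_spaceD(5)[OF Cs s]] step(2) by blast
      ultimately show "fscale k s + y \<in> csp C p \<and> comult C (fscale k s + y) \<in> tensor (csp C) E p"
        by blast
    qed
    then show ?thesis ..
  qed
  have "comult C e \<in> tensor E E p" if e: "e \<in> E p" for e p
  proof (rule tensor_refine_left[OF Cs Es E_sub E_le _ right[OF e]])
    have ec: "e \<in> ccar C"
      using e E_le svcar_homogeneous[OF Cs] by blast
    have "braid (csp C) (csp C) (comult C e) \<in> tensor E (csp C) p"
      by (rule braid_tensor[OF Cs E_le right[OF e]])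
    then have "comult C e \<in> tensor E (csp C) p"
      using cc ec unfolding super_cocommutative_def by simp
    then show "(\<lambda>i. comult C e (i, j)) \<in> svcar E" for j
      using tensor_slice(2)[OF Es Cs] tensor_car[OF Es Cs] by blast
  qed
  then have "sub_coalgebra C E"
    unfolding sub_coalgebra_def using E_sub E_le by blast
  then show ?thesis
    using fd X_E by blast
qed

text \<open>The sets collect the factors of an expression of \<open>t\<close> as a finite sum of
  homogeneous pure tensors. They are chosen before the subspaces, so that later a single
  sub-coalgebra can be made to contain them.\<close>

lemma tensor_finite_support:
  assumes V: "super_space V" and W: "super_space W" and t: "t \<in> tensor V W p"
  shows "\<exists>X Y. finite X \<and> finite Y \<and> X \<subseteq> svcar V \<and> Y \<subseteq> svcar W \<and>
    (\<forall>V' W'. super_space V' \<longrightarrow> super_space W' \<longrightarrow> (\<forall>q. V' q \<subseteq> V q) \<longrightarrow> (\<forall>q. W' q \<subseteq> W q) \<longrightarrow>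
      X \<subseteq> svcar V' \<longrightarrow> Y \<subseteq> svcar W' \<longrightarrow> t \<in> tensor V' W' p)"
  using V t
proof (induction rule: tensor_induct)
  case zero
  have "0 \<in> tensor V' W' p" for V' :: "('a, 'b) svs" and W' :: "('c, 'b) svs"
    by (rule fs.subspace_0[OF tensor_subspace])
  then show ?case
    by (intro exI[of _ "{}"]) blast
next
  case (add v w q r y)
  then obtain X Y where XY: "finite X" "finite Y" "X \<subseteq> svcar V" "Y \<subseteq> svcar W"
    and ty: "\<And>V' W'. super_space V' \<Longrightarrow> super_space W' \<Longrightarrow> (\<And>q. V' q \<subseteq> V q) \<Longrightarrow> (\<And>q. W' q \<subseteq> W q) \<Longrightarrow>
      X \<subseteq> svcar V' \<Longrightarrow> Y \<subseteq> svcar W' \<Longrightarrow> y \<in> tensor V' W' p"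
    by blast
  have "ptens v w + y \<in> tensor V' W' p"
    if s: "super_space V'" "super_space W'" "\<And>q. V' q \<subseteq> V q" "\<And>q. W' q \<subseteq> W q"
      and sub: "insert v X \<subseteq> svcar V'" "insert w Y \<subseteq> svcar W'" for V' W'
  proof -
    have "v \<in> V' q" "w \<in> W' r"
      using homogeneous_in_sub[OF V s(1,3) add(1)] homogeneous_in_sub[OF W s(2,4) add(2)] sub by blast+
    then have "ptens v w \<in> tensor V' W' p"
      using add(3) by (rule ptens_in)
    moreover have "y \<in> tensor V' W' p"
      using sub by (intro ty s) auto
    ultimately show ?thesis
      by (rule fs.subspace_add[OF tensor_subspace])
  qed
  moreover have "finite (insert v X)" "finite (insert w Y)" "insert v X \<subseteq> svcar V" "insert w Y \<subseteq> svcar W"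
    using XY add(1,2) svcar_homogeneous[OF V] svcar_homogeneous[OF W] by auto
  ultimately show ?case
    by (intro exI[of _ "insert v X"] exI[of _ "insert w Y"]) blast
qed

section \<open>Points of formal superschemes\<close>

lemma kfunctorD:
  assumes "kfunctor X"
  shows "A \<in> SAlgf \<Longrightarrow> B \<in> SAlgf \<Longrightarrow> \<phi> \<in> alg_hom A B \<Longrightarrow> x \<in> Ob X A \<Longrightarrow> Ar X A B \<phi> x \<in> Ob X B"
    "A \<in> SAlgf \<Longrightarrow> B \<in> SAlgf \<Longrightarrow> E \<in> SAlgf \<Longrightarrow> \<phi> \<in> alg_hom A B \<Longrightarrow> \<psi> \<in> alg_hom B E \<Longrightarrow> x \<in> Ob X A \<Longrightarrow>
      Ar X A E (compose (acar A) \<psi> \<phi>) x = Ar X B E \<psi> (Ar X A B \<phi> x)"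
  using assms unfolding kfunctor_def by blast+

lemma nat_transD:
  assumes "nat_trans X Y f"
  shows "A \<in> SAlgf \<Longrightarrow> x \<in> Ob X A \<Longrightarrow> f A x \<in> Ob Y A"
    "A \<in> SAlgf \<Longrightarrow> B \<in> SAlgf \<Longrightarrow> \<phi> \<in> alg_hom A B \<Longrightarrow> x \<in> Ob X A \<Longrightarrow>
      f B (Ar X A B \<phi> x) = Ar Y A B \<phi> (f A x)"
  using assms unfolding nat_trans_def by blast+

text \<open>The point comes from the tautological point of some member of the system. Cancellation
  holds because the transition homomorphisms are surjective: two homomorphisms that agree after
  composition with one of them are equal.\<close>

lemma superscheme_presented:
  fixes Z :: "('k::field, 'z) kfun"
  assumes Z: "formal_superscheme Z" and S: "S \<in> SAlgf" and z: "z \<in> Ob Z S"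
  shows "\<exists>B\<in>SAlgf. \<exists>b\<in>Ob Z B. \<exists>u\<in>alg_hom B S. z = Ar Z B S u b \<and>
    (\<forall>R\<in>SAlgf. \<forall>v\<in>alg_hom B R. \<forall>w\<in>alg_hom B R. Ar Z B R v b = Ar Z B R w b \<longrightarrow> v = w)"
proof -
  obtain I :: "('k salg \<times> 'z) set" and le A t \<sigma> where sys: "directed_system I le A t"
    and iso: "nat_iso (SSpf_colim I le A t) Z \<sigma>"
    using Z unfolding formal_superscheme_def by blast
  define x where "x = (\<lambda>i. \<sigma> (A i) (colim_rel I le A t (A i) `` {(i, \<lambda>a\<in>acar (A i). a)}))"
  note cone = nat_iso_cone[OF sys iso, folded fun_cong[OF x_def]]
  obtain i u where i: "i \<in> I" and u: "u \<in> alg_hom (A i) S" and zu: "z = Ar Z (A i) S u (x i)"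
    using cone(2)[OF S z] by blast
  have "v = w" if R: "R \<in> SAlgf" and v: "v \<in> alg_hom (A i) R" and w: "w \<in> alg_hom (A i) R"
    and eq: "Ar Z (A i) R v (x i) = Ar Z (A i) R w (x i)" for R v w
  proof -
    have "((i, v), (i, w)) \<in> colim_rel I le A t R"
      using cone(3)[OF R i i v w] eq by blast
    then obtain k where k: "k \<in> I" "le i k"
      and e: "compose (acar (A k)) v (t i k) = compose (acar (A k)) w (t i k)"
      unfolding colim_rel_def by blast
    have "v a = w a" if "a \<in> acar (A i)" for a
    proof -
      have "a \<in> t i k ` acar (A k)"
        using sysD(7)[OF sys i k] that by simp
      then obtain b where b: "b \<in> acar (A k)" "a = t i k b"
        by blast
      then show ?thesis
        using fun_cong[OF e, of b] by (simp add: compose_def)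
    qed
    then show ?thesis
      by (rule extensionalityI[OF alg_homD(3)[OF v] alg_homD(3)[OF w]])
  qed
  then show ?thesis
    using sysD(5)[OF sys i] cone(1)[OF i] u zu by blast
qed

text \<open>Representable functors turn injections into injections, and so does a filtered limit of
  them, because equality of two points is tested at a common index.\<close>

lemma superscheme_inj:
  fixes Z :: "('k::field, 'z) kfun"
  assumes Z: "formal_superscheme Z" and R: "R \<in> SAlgf" and S: "S \<in> SAlgf"
    and \<psi>: "\<psi> \<in> alg_hom R S" and inj: "inj_on \<psi> (acar R)"
    and z: "z \<in> Ob Z R" "z' \<in> Ob Z R" and eq: "Ar Z R S \<psi> z = Ar Z R S \<psi> z'"
  shows "z = z'"
proof -
  have kf: "kfunctor Z"
    using Z by (simp add: formal_superscheme_def)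
  obtain I :: "('k salg \<times> 'z) set" and le A t \<sigma> where sys: "directed_system I le A t"
    and iso: "nat_iso (SSpf_colim I le A t) Z \<sigma>"
    using Z unfolding formal_superscheme_def by blast
  define x where "x = (\<lambda>i. \<sigma> (A i) (colim_rel I le A t (A i) `` {(i, \<lambda>a\<in>acar (A i). a)}))"
  note cone = nat_iso_cone[OF sys iso, folded fun_cong[OF x_def]]
  obtain i u where i: "i \<in> I" and u: "u \<in> alg_hom (A i) R" and zu: "z = Ar Z (A i) R u (x i)"
    using cone(2)[OF R z(1)] by blast
  obtain j v where j: "j \<in> I" and v: "v \<in> alg_hom (A j) R" and zv: "z' = Ar Z (A j) R v (x j)"
    using cone(2)[OF R z(2)] by blast
  note Ai = sysD(5)[OF sys i] and Aj = sysD(5)[OF sys j]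
  have "Ar Z (A i) S (compose (acar (A i)) \<psi> u) (x i) = Ar Z (A j) S (compose (acar (A j)) \<psi> v) (x j)"
    using eq kfunctorD(2)[OF kf Ai R S u \<psi> cone(1)[OF i]] kfunctorD(2)[OF kf Aj R S v \<psi> cone(1)[OF j]] zu zv
    by simp
  then have "((i, compose (acar (A i)) \<psi> u), (j, compose (acar (A j)) \<psi> v)) \<in> colim_rel I le A t S"
    using cone(3)[OF S i j alg_hom_compose[OF Ai u \<psi>] alg_hom_compose[OF Aj v \<psi>]] by blast
  then obtain k where k: "k \<in> I" "le i k" "le j k"
    and e: "compose (acar (A k)) (compose (acar (A i)) \<psi> u) (t i k) =
      compose (acar (A k)) (compose (acar (A j)) \<psi> v) (t j k)"
    unfolding colim_rel_def by blast
  have tik: "t i k \<in> alg_hom (A k) (A i)" and tjk: "t j k \<in> alg_hom (A k) (A j)"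
    using sysD(6)[OF sys] i j k by blast+
  have "compose (acar (A k)) u (t i k) = compose (acar (A k)) v (t j k)"
  proof
    fix a
    show "compose (acar (A k)) u (t i k) a = compose (acar (A k)) v (t j k) a"
    proof (cases "a \<in> acar (A k)")
      case True
      have 1: "t i k a \<in> acar (A i)" "t j k a \<in> acar (A j)"
        using alg_homE(1)[OF tik True] alg_homE(1)[OF tjk True] by blast+
      have "\<psi> (u (t i k a)) = \<psi> (v (t j k a))"
        using fun_cong[OF e, of a] True 1 by (simp add: compose_def)
      then have "u (t i k a) = v (t j k a)"
        using inj_onD[OF inj] alg_homE(1)[OF u 1(1)] alg_homE(1)[OF v 1(2)] by blast
      then show ?thesis
        using True by (simp add: compose_def)
    qed (simp add: compose_def)
  qed
  then have "((i, u), (j, v)) \<in> colim_rel I le A t R"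
    unfolding colim_rel_def using i j k u v by blast
  then show ?thesis
    using cone(3)[OF R i j u v] zu zv by blast
qed

text \<open>An injective homomorphism reflects sums, products and parities, so the set-theoretic
  lift is itself a homomorphism.\<close>

lemma alg_hom_factor:
  assumes B: "B \<in> SAlgf" and A: "A \<in> SAlgf" and B0: "B0 \<in> SAlgf" and \<psi>: "\<psi> \<in> alg_hom B A"
    and inj: "inj_on \<psi> (acar B)" and \<alpha>: "\<alpha> \<in> alg_hom B0 A" and im: "\<alpha> ` acar B0 \<subseteq> \<psi> ` acar B"
  shows "\<exists>\<beta>\<in>alg_hom B0 B. compose (acar B0) \<psi> \<beta> = \<alpha>"
proof -
  note Bs = SAlgfD(1)[OF B] and B0s = SAlgfD(1)[OF B0]
  note \<psi>E = alg_homE[OF \<psi>] and \<alpha>E = alg_homE[OF \<alpha>]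
  define \<beta> where "\<beta> = (\<lambda>x\<in>acar B0. inv_into (acar B) \<psi> (\<alpha> x))"
  have \<beta>: "\<beta> x \<in> acar B" "\<psi> (\<beta> x) = \<alpha> x" if "x \<in> acar B0" for x
  proof -
    have "\<alpha> x \<in> \<psi> ` acar B"
      using that im by blast
    then show "\<beta> x \<in> acar B" "\<psi> (\<beta> x) = \<alpha> x"
      using that unfolding \<beta>_def by (simp_all add: inv_into_into f_inv_into_f)
  qed
  have eqI: "\<beta> x = y" if "x \<in> acar B0" "y \<in> acar B" "\<psi> y = \<alpha> x" for x y
    using inj_onD[OF inj _ \<beta>(1)[OF that(1)] that(2)] \<beta>(2)[OF that(1)] that(3) by simp
  have "\<beta> \<in> alg_hom B0 B"
  proof (rule alg_homI)
    show "\<beta> \<in> extensional (acar B0)"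
      by (simp add: \<beta>_def)
    show "\<beta> x \<in> acar B" if "x \<in> acar B0" for x
      by (rule \<beta>(1)[OF that])
    show "\<beta> (x + y) = \<beta> x + \<beta> y" if "x \<in> acar B0" "y \<in> acar B0" for x y
      using that svcar_closed(1)[OF B0s] svcar_closed(1)[OF Bs] \<beta> \<psi>E(2) \<alpha>E(2) by (intro eqI) simp_all
    show "\<beta> (fscale c x) = fscale c (\<beta> x)" if "x \<in> acar B0" for c x
      using that svcar_closed(2)[OF B0s that that] svcar_closed(2)[OF Bs \<beta>(1)[OF that] \<beta>(1)[OF that]]
        \<beta> \<psi>E(3) \<alpha>E(3) by (intro eqI) simp_all
    show "\<beta> x \<in> asp B p" if x: "x \<in> asp B0 p" for p x
    proof -
      have xc: "x \<in> acar B0"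
        by (rule svcar_homogeneous[OF B0s x])
      have "\<psi> (hcomp (asp B) p (\<beta> x)) = hcomp (asp A) p (\<psi> (\<beta> x))"
        by (rule super_hom_hcomp[OF alg_hom_lin(2)[OF \<psi>] Bs SAlgfD(1)[OF A] \<beta>(1)[OF xc]])
      also have "\<dots> = \<alpha> x"
        using hcomp_homogeneous[OF SAlgfD(1)[OF A] \<alpha>E(4)[OF x], of p] \<beta>(2)[OF xc] by simp
      finally have "\<beta> x = hcomp (asp B) p (\<beta> x)"
        using hcomp_in(1)[OF Bs \<beta>(1)[OF xc]] svcar_homogeneous[OF Bs] by (intro eqI xc) blast+
      then show ?thesis
        using hcomp_in(1)[OF Bs \<beta>(1)[OF xc], of p] by simp
    qed
    show "\<beta> (aone B0) = aone B"
      using SAlgfD(2)[OF B0] SAlgfD(2)[OF B] \<psi>E(5) \<alpha>E(5) by (intro eqI) simp_all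
    show "\<beta> (amult B0 x y) = amult B (\<beta> x) (\<beta> y)" if "x \<in> acar B0" "y \<in> acar B0" for x y
      using that SAlgfD(3)[OF B0] SAlgfD(3)[OF B] \<beta> \<psi>E(6) \<alpha>E(6) by (intro eqI) simp_all
  qed
  moreover have "compose (acar B0) \<psi> \<beta> = \<alpha>"
  proof (rule extensionalityI[of _ "acar B0"])
    show "compose (acar B0) \<psi> \<beta> \<in> extensional (acar B0)"
      by (simp add: compose_def)
    show "\<alpha> \<in> extensional (acar B0)"
      by (rule alg_homD(3)[OF \<alpha>])
    show "compose (acar B0) \<psi> \<beta> x = \<alpha> x" if "x \<in> acar B0" for x
      using that \<beta>(2) by (simp add: compose_def)
  qed
  ultimately show ?thesis by blast
qed

section \<open>Morphisms out of the dual algebra\<close>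

lemma tmap_compose_hom:
  assumes R: "R \<in> SAlgf" and C: "super_coalgebra C" and u: "u \<in> Ob (SSp C) R"
  shows "tmap (compose (acar R) \<psi> \<chi>) id u = tmap \<psi> id (tmap \<chi> id u)"
  using SSpD(6)[OF R C u] by (simp add: tmap_def compose_def fun_eq_iff)

lemma tmap_hom_map:
  assumes R: "R \<in> SAlgf" and C: "super_coalgebra C" and u: "u \<in> Ob (SSp C) R"
    and \<chi>: "\<chi> \<in> alg_hom R S" and \<phi>: "lin_on (ccar C) \<phi>"
  shows "tmap \<chi> id (tmap id \<phi> u) = tmap id \<phi> (tmap \<chi> id u)"
  using tensor_fubini[OF SAlgfD(1)[OF R] coalgD(1)[OF C] SSpD(2)[OF R C u] lform_lin_on[OF alg_hom_lin(1)[OF \<chi>]]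
      lform_lin_on[OF \<phi>]]
  by (auto simp: tmap_def fun_eq_iff)

text \<open>With the next two lemmas this says that the dual algebra represents
  \<open>SSp C\<close>: pushing \<open>u\<close> forward identifies homomorphisms with
  points.\<close>

lemma dual_hom_val:
  assumes C: "super_coalgebra C" and d: "dual_algebra C A u" and \<chi>: "\<chi> \<in> alg_hom A R" and f: "lform (ccar C) f"
  shows "\<chi> (\<lambda>k. f (\<lambda>e. u (k, e))) = (\<lambda>n. f (\<lambda>e. tmap \<chi> id u (n, e)))"
proof
  note D = dual_algebraD[OF C d]
  fix n
  show "\<chi> (\<lambda>k. f (\<lambda>e. u (k, e))) n = f (\<lambda>e. tmap \<chi> id u (n, e))"
    using tensor_fubini[OF SAlgfD(1)[OF D(1)] coalgD(1)[OF C] SSpD(2)[OF D(1) C D(2)]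
        lform_lin_on[OF alg_hom_lin(1)[OF \<chi>]] f]
    by (simp add: tmap_def)
qed

lemma dual_hom_unique:
  assumes C: "super_coalgebra C" and d: "dual_algebra C A u"
    and \<chi>: "\<chi> \<in> alg_hom A R" "\<chi>' \<in> alg_hom A R" and eq: "tmap \<chi> id u = tmap \<chi>' id u"
  shows "\<chi> = \<chi>'"
proof (rule extensionalityI[OF alg_homD(3)[OF \<chi>(1)] alg_homD(3)[OF \<chi>(2)]])
  fix x assume "x \<in> acar A"
  then obtain f where f: "lform (ccar C) f" "x = (\<lambda>k. f (\<lambda>e. u (k, e)))"
    using dual_algebraD(6)[OF C d] by blast
  show "\<chi> x = \<chi>' x"
    unfolding f(2) dual_hom_val[OF C d \<chi>(1) f(1)] dual_hom_val[OF C d \<chi>(2) f(1)] eq ..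
qed

lemma dual_hom_exists:
  assumes C: "super_coalgebra C" and d: "dual_algebra C A u" and R: "R \<in> SAlgf" and w: "w \<in> Ob (SSp C) R"
  shows "\<exists>\<chi>\<in>alg_hom A R. tmap \<chi> id u = w"
proof -
  obtain \<chi> where \<chi>: "\<chi> \<in> alg_hom A R"
    and val: "\<And>f. lform (ccar C) f \<Longrightarrow> \<chi> (\<lambda>k. f (\<lambda>e. u (k, e))) = (\<lambda>m. f (\<lambda>e. w (m, e)))"
    using dual_algebra_universal[OF assms] by blast
  have "tmap \<chi> id u = w"
    using val[OF lform_eval] by (auto simp: tmap_def fun_eq_iff)
  then show ?thesis
    using \<chi> by blast
qed

text \<open>In the sign-free form \<open>SSp_iff\<close> the equations of a point do not involve the
  graded space of the coalgebra; only the membership does.\<close>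

lemma SSp_restrict_iff:
  assumes R: "R \<in> SAlgf" and C: "super_coalgebra C" and E: "sub_coalgebra C E"
  shows "w \<in> Ob (SSp (C\<lparr>csp := E\<rparr>)) R \<longleftrightarrow> w \<in> Ob (SSp C) R \<and> w \<in> tensor (asp R) E 0"
proof -
  have "tensor (asp R) E 0 \<subseteq> tensor (asp R) (csp C) 0"
    by (rule tensor_mono[OF order_refl sub_coalgebraD(2)[OF C E]])
  then show ?thesis
    unfolding SSp_iff[OF R C] SSp_iff[OF R restrict_super_coalgebra[OF C E]] by auto
qed

text \<open>Directedness of the finite-dimensional sub-coalgebras: it suffices to contain finite
  spanning sets of the given ones.\<close>

lemma sub_coalgebra_above:
  fixes C :: "('c, 'k::field) scoalg"
  assumes C: "super_coalgebra C" and cc: "super_cocommutative C" and X: "finite X" "X \<subseteq> ccar C"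
    and E: "sub_coalgebra C E" "findim E" and E': "sub_coalgebra C E'" "findim E'"
  shows "\<exists>F. sub_coalgebra C F \<and> findim F \<and> X \<subseteq> svcar F \<and> (\<forall>p. E p \<subseteq> F p) \<and> (\<forall>p. E' p \<subseteq> F p)"
proof -
  obtain B where B: "finite B" "B \<subseteq> E 0 \<union> E 1" "svcar E \<subseteq> fs.span B"
    using E(2) unfolding findim_def by blast
  obtain B' where B': "finite B'" "B' \<subseteq> E' 0 \<union> E' 1" "svcar E' \<subseteq> fs.span B'"
    using E'(2) unfolding findim_def by blast
  note e = sub_coalgebraD[OF C E(1)] and e' = sub_coalgebraD[OF C E'(1)]
  have "B \<subseteq> ccar C" "B' \<subseteq> ccar C"
    using B(2) B'(2) svcar_homogeneous[OF e(4)] svcar_homogeneous[OF e'(4)] e(5) e'(5) by blast+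
  then obtain F where F: "sub_coalgebra C F" "findim F" "X \<union> B \<union> B' \<subseteq> svcar F"
    using finite_sub_coalgebra[OF C cc, of "X \<union> B \<union> B'"] X B(1) B'(1) by auto
  note f = sub_coalgebraD[OF C F(1)]
  have le: "H p \<subseteq> F p" if "super_space H" "H p \<subseteq> csp C p" "svcar H \<subseteq> fs.span Y" "Y \<subseteq> svcar F" for H Y p
  proof
    fix x assume x: "x \<in> H p"
    have "fs.span Y \<subseteq> svcar F"
      by (rule fs.span_minimal[OF that(4) svcar_subspace[OF f(4)]])
    then have "x \<in> svcar F"
      using x svcar_homogeneous[OF that(1)] that(3) by blast
    then show "x \<in> F p"
      using homogeneous_in_sub[OF coalgD(1)[OF C] f(4,2)] x that(2) by blast
  qed
  show ?thesis
    using F le[OF e(4,2) B(3)] le[OF e'(4,2) B'(3)] by blast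
qed

section \<open>Descent of points\<close>

text \<open>On functionals \<open>\<psi>\<close> is the transpose of \<phi>, and the transpose of a
  surjection is injective.\<close>

lemma dual_image_inj:
  fixes C :: "('c, 'k::field) scoalg" and D :: "('d, 'k) scoalg"
  assumes C: "super_coalgebra C" and D: "super_coalgebra D" and \<phi>: "coalg_hom C D \<phi>" and surj: "\<phi> ` ccar C = ccar D"
    and A: "dual_algebra C A u" and B: "dual_algebra D B v"
    and \<psi>: "\<psi> \<in> alg_hom B A" "tmap \<psi> id v = tmap id \<phi> u"
  shows "inj_on \<psi> (acar B)"
    and "lform (ccar D) f \<Longrightarrow> \<psi> (\<lambda>k. f (\<lambda>e. v (k, e))) = (\<lambda>k. f (\<phi> (\<lambda>e. u (k, e))))"
proof -
  note Ad = dual_algebraD[OF C A] and Bd = dual_algebraD[OF D B]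
  show val: "\<psi> (\<lambda>k. f (\<lambda>e. v (k, e))) = (\<lambda>k. f (\<phi> (\<lambda>e. u (k, e))))" if "lform (ccar D) f" for f
    unfolding dual_hom_val[OF D B \<psi>(1) that] \<psi>(2) by (simp add: tmap_def)
  have lf: "lform (ccar C) (\<lambda>x. f (\<phi> x))" if "lform (ccar D) f" for f
    by (rule lform_comp[OF coalg_homD(2)[OF \<phi>] _ that]) (use surj in blast)
  show "inj_on \<psi> (acar B)"
  proof (rule inj_onI)
    fix x y assume xy: "x \<in> acar B" "y \<in> acar B" "\<psi> x = \<psi> y"
    obtain f where f: "lform (ccar D) f" "x = (\<lambda>k. f (\<lambda>e. v (k, e)))"
      using xy(1) Bd(6) by blast
    obtain g where g: "lform (ccar D) g" "y = (\<lambda>k. g (\<lambda>e. v (k, e)))"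
      using xy(2) Bd(6) by blast
    have "(\<lambda>k. f (\<phi> (\<lambda>e. u (k, e)))) = (\<lambda>k. g (\<phi> (\<lambda>e. u (k, e))))"
      using xy(3) unfolding f(2) g(2) val[OF f(1)] val[OF g(1)] .
    then have "f (\<phi> z) = g (\<phi> z)" if "z \<in> ccar C" for z
      by (intro Ad(5)[OF lf[OF f(1)] lf[OF g(1)] _ that]) (rule fun_cong)
    then have eq: "f w = g w" if "w \<in> ccar D" for w
      using that surj by (metis imageE)
    show "x = y"
      unfolding f(2) g(2) by (intro ext eq SSpD(5)[OF Bd(1) D Bd(2)])
  qed
qed

text \<open>The equalizer condition does not depend on the ambient coalgebra, so only the finitely
  many tensor factors of \<open>t\<close> have to lie in \<open>F\<close>.\<close>

lemma csquare_restrict: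
  assumes C: "super_coalgebra C" and D: "super_coalgebra D" and \<phi>: "coalg_hom C D \<phi>"
    and t: "t \<in> svcar (csquare C \<phi>)"
  shows "\<exists>X. finite X \<and> X \<subseteq> ccar C \<and>
    (\<forall>F. sub_coalgebra C F \<longrightarrow> X \<subseteq> svcar F \<longrightarrow> t \<in> svcar (csquare (C\<lparr>csp := F\<rparr>) \<phi>))"
proof -
  note Cs = coalgD(1)[OF C]
  have hom: "\<exists>X. finite X \<and> X \<subseteq> ccar C \<and>
      (\<forall>F. sub_coalgebra C F \<longrightarrow> X \<subseteq> svcar F \<longrightarrow> t \<in> csquare (C\<lparr>csp := F\<rparr>) \<phi> p)"
    if t: "t \<in> csquare C \<phi> p" for t p
  proof -
    from tensor_finite_support[OF Cs Cs csquareD(1)[OF C D \<phi> t]]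
    obtain X Y where XY: "finite X" "finite Y" "X \<subseteq> ccar C" "Y \<subseteq> ccar C"
      and tF: "\<forall>V' W'. super_space V' \<longrightarrow> super_space W' \<longrightarrow> (\<forall>q. V' q \<subseteq> csp C q) \<longrightarrow>
        (\<forall>q. W' q \<subseteq> csp C q) \<longrightarrow> X \<subseteq> svcar V' \<longrightarrow> Y \<subseteq> svcar W' \<longrightarrow> t \<in> tensor V' W' p"
      by (elim exE conjE) (rule that)
    have "t \<in> csquare (C\<lparr>csp := F\<rparr>) \<phi> p" if F: "sub_coalgebra C F" "X \<union> Y \<subseteq> svcar F" for F
    proof -
      have "t \<in> tensor F F p"
        using F(2) by (intro tF[rule_format] sub_coalgebraD[OF C F(1)]) auto
      then show ?thesis
        using t by (simp add: csquare_def cotensor_def)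
    qed
    then show ?thesis
      using XY by (intro exI[of _ "X \<union> Y"]) blast
  qed
  obtain a b where ab: "t = a + b" "a \<in> csquare C \<phi> 0" "b \<in> csquare C \<phi> 1"
    using t unfolding svcar_def by blast
  obtain X where X: "finite X" "X \<subseteq> ccar C"
    "\<And>F. sub_coalgebra C F \<Longrightarrow> X \<subseteq> svcar F \<Longrightarrow> a \<in> csquare (C\<lparr>csp := F\<rparr>) \<phi> 0"
    using hom[OF ab(2)] by blast
  obtain Y where Y: "finite Y" "Y \<subseteq> ccar C"
    "\<And>F. sub_coalgebra C F \<Longrightarrow> Y \<subseteq> svcar F \<Longrightarrow> b \<in> csquare (C\<lparr>csp := F\<rparr>) \<phi> 1"
    using hom[OF ab(3)] by blast
  have "t \<in> svcar (csquare (C\<lparr>csp := F\<rparr>) \<phi>)" if "sub_coalgebra C F" "X \<union> Y \<subseteq> svcar F" for F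
    unfolding ab(1) svcar_def using X(3)[OF that(1)] Y(3)[OF that(1)] that(2) by blast
  then show ?thesis
    using X(1,2) Y(1,2) by (intro exI[of _ "X \<union> Y"]) blast
qed

lemma lform_factor:
  assumes V: "super_space V" and \<phi>: "lin_on (svcar V) \<phi>" and f: "lform (svcar V) f"
    and ker: "\<And>x. x \<in> svcar V \<Longrightarrow> \<phi> x = 0 \<Longrightarrow> f x = 0"
  shows "\<exists>f'. lform (\<phi> ` svcar V) f' \<and> (\<forall>x\<in>svcar V. f' (\<phi> x) = f x)"
proof -
  define f' where "f' y = f (inv_into (svcar V) \<phi> y)" for y
  have val: "f' (\<phi> x) = f x" if x: "x \<in> svcar V" for x
  proof -
    let ?x = "inv_into (svcar V) \<phi> (\<phi> x)"
    have i: "?x \<in> svcar V" "\<phi> ?x = \<phi> x"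
      using x by (simp_all add: inv_into_into f_inv_into_f)
    have "\<phi> (?x - x) = 0"
      using lin_on_diff[OF \<phi> svcar_subspace[OF V] i(1) x] i(2) by simp
    then have "f (?x - x) = 0"
      by (rule ker[OF svcarD(3)[OF V i(1) x]])
    then show ?thesis
      unfolding f'_def using lform_diff[OF f svcar_subspace[OF V] i(1) x] by simp
  qed
  have "lform (\<phi> ` svcar V) f'"
    unfolding lform_def
  proof (intro conjI ballI allI)
    fix y z assume "y \<in> \<phi> ` svcar V" "z \<in> \<phi> ` svcar V"
    then obtain a b where ab: "a \<in> svcar V" "b \<in> svcar V" "y = \<phi> a" "z = \<phi> b"
      by blast
    have "y + z = \<phi> (a + b)"
      using \<phi> ab by (simp add: lin_on_def)
    then show "f' (y + z) = f' y + f' z"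
      using val[OF svcar_closed(1)[OF V ab(1,2)]] val[OF ab(1)] val[OF ab(2)] lformD(1)[OF f ab(1,2)] ab(3,4) by simp
  next
    fix c y assume "y \<in> \<phi> ` svcar V"
    then obtain a where a: "a \<in> svcar V" "y = \<phi> a"
      by blast
    have "fscale c y = \<phi> (fscale c a)"
      using \<phi> a by (simp add: lin_on_def)
    then show "f' (fscale c y) = c * f' y"
      using val[OF svcar_closed(2)[OF V a(1) a(1)]] val[OF a(1)] lformD(2)[OF f a(1)] a(2) by simp
  qed
  then show ?thesis
    using val by blast
qed

text \<open>Since \<open>\<psi>\<close> is injective, \<open>alg_hom_factor\<close> lets a
  homomorphism into \<open>A\<close> descend to \<open>B\<close> once its values lie in the image of
  \<open>\<psi>\<close>. This image consists of the functionals on \<open>E\<close> that factor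
  through \<phi>, so the task is to show that certain functionals vanish on the kernel of \<phi> in
  \<open>E\<close>.\<close>

theorem descend_point:
  fixes C :: "('i, 'k::field) scoalg" and D :: "('i, 'k) scoalg" and Z :: "('k, 'z) kfun"
  assumes C: "super_coalgebra C" and cc: "super_cocommutative C" and D: "super_coalgebra D"
    and \<phi>: "coalg_hom C D \<phi>" and faith: "pullback_faithful C D \<phi>"
    and Z: "formal_superscheme Z" and g: "nat_trans (SSp C) Z g"
    and equ: "\<And>T x1 x2. T \<in> SAlgf \<Longrightarrow> x1 \<in> Ob (SSp C) T \<Longrightarrow> x2 \<in> Ob (SSp C) T \<Longrightarrow>
      tmap id \<phi> x1 = tmap id \<phi> x2 \<Longrightarrow> g T x1 = g T x2"
    and E: "sub_coalgebra C E" "findim E" and A: "dual_algebra (C\<lparr>csp := E\<rparr>) A u"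
    and B: "dual_algebra (D\<lparr>csp := \<lambda>p. \<phi> ` E p\<rparr>) B v"
    and \<psi>: "\<psi> \<in> alg_hom B A" "tmap \<psi> id v = tmap id \<phi> u"
  shows "\<exists>z\<in>Ob Z B. Ar Z B A \<psi> z = g A u"
proof -
  note e = sub_coalgebraD[OF C E(1)] and CE = restrict_super_coalgebra[OF C E(1)]
  note img = image_sub_coalgebra[OF C D \<phi> E(1)]
  note DE = restrict_super_coalgebra[OF D img(1)]
  note Ad = dual_algebraD[OF CE A] and Bd = dual_algebraD[OF DE B]
  have kf: "kfunctor Z"
    using Z by (simp add: formal_superscheme_def)
  have surj: "\<phi> ` svcar (csp (C\<lparr>csp := E\<rparr>)) = svcar (csp (D\<lparr>csp := \<lambda>p. \<phi> ` E p\<rparr>))"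
    using img(2) by simp
  note \<psi>_inj = dual_image_inj[OF CE DE img(3) surj A B \<psi>]
  have u_in: "u \<in> Ob (SSp C) A" "u \<in> tensor (asp A) E 0"
    using Ad(2) unfolding SSp_restrict_iff[OF Ad(1) C E(1)] by blast+
  let ?K = "{x \<in> svcar E. \<phi> x = 0}"
  have lin\<phi>: "lin_on (svcar E) \<phi>"
    by (rule lin_on_subset[OF coalg_homD(2)[OF \<phi>] e(5)])
  have K_sub: "fs.subspace ?K"
    unfolding fs.subspace_def
    using svcarD(1)[OF e(4)] svcar_closed[OF e(4)] lin_on_zero[OF lin\<phi> svcarD(1)[OF e(4)]] lin\<phi>
    by (simp add: lin_on_def)
  obtain B1 where "finite B1" "svcar E \<subseteq> fs.span B1"
    using E(2) unfolding findim_def by blast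
  then obtain Y where Y: "finite Y" "Y \<subseteq> ?K" "?K = fs.span Y"
    using findim_subspace[OF K_sub, of B1] by blast
  \<comment> \<open>Bundled so that the tensors and their supports can be chosen simultaneously for
    all \<open>x\<close> in \<open>Y\<close>.\<close>
  define lifts where "lifts x t X \<longleftrightarrow> x = proj1 C t - proj2 C t \<and> finite X \<and> X \<subseteq> ccar C \<and>
    (\<forall>F. sub_coalgebra C F \<longrightarrow> X \<subseteq> svcar F \<longrightarrow> t \<in> svcar (csquare (C\<lparr>csp := F\<rparr>) \<phi>))" for x t X
  have "\<exists>t X. lifts x t X" if "x \<in> Y" for x
  proof -
    have "x \<in> ccar C" "\<phi> x = 0"
      using that Y(2) e(5) by blast+
    then obtain t where t: "t \<in> svcar (csquare C \<phi>)" and x: "x = proj1 C t - proj2 C t"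
      using pullback_faithful_kernel[OF C D \<phi> faith] by blast
    from csquare_restrict[OF C D \<phi> t] obtain X where "finite X \<and> X \<subseteq> ccar C \<and>
        (\<forall>F. sub_coalgebra C F \<longrightarrow> X \<subseteq> svcar F \<longrightarrow> t \<in> svcar (csquare (C\<lparr>csp := F\<rparr>) \<phi>))"
      by (elim exE) (rule that)
    with x have "lifts x t X"
      unfolding lifts_def by (rule conjI)
    then show ?thesis by blast
  qed
  then obtain t X where "\<And>x. x \<in> Y \<Longrightarrow> lifts x (t x) (X x)"
    by metis
  then have tX: "\<And>x. x \<in> Y \<Longrightarrow> x = proj1 C (t x) - proj2 C (t x)"
    "\<And>x. x \<in> Y \<Longrightarrow> finite (X x)" "\<And>x. x \<in> Y \<Longrightarrow> X x \<subseteq> ccar C"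
    "\<And>x F. x \<in> Y \<Longrightarrow> sub_coalgebra C F \<Longrightarrow> X x \<subseteq> svcar F \<Longrightarrow> t x \<in> svcar (csquare (C\<lparr>csp := F\<rparr>) \<phi>)"
    unfolding lifts_def by blast+
  have UX: "finite (\<Union>x\<in>Y. X x)" "(\<Union>x\<in>Y. X x) \<subseteq> ccar C"
    using Y(1) tX(2,3) by blast+
  \<comment> \<open>All supports fit into one finite-dimensional sub-coalgebra, whose cotensor
    square contains every chosen tensor.\<close>
  obtain F where F: "sub_coalgebra C F" "findim F" "(\<Union>x\<in>Y. X x) \<subseteq> svcar F" "\<And>p. E p \<subseteq> F p"
    using sub_coalgebra_above[OF C cc UX E E] by blast
  note f = sub_coalgebraD[OF C F(1)] and CF = restrict_super_coalgebra[OF C F(1)]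
    and ccF = restrict_super_cocommutative[OF C cc F(1)]
  have EF: "svcar E \<subseteq> svcar F"
    by (rule svcar_mono[OF F(4)])
  have fdF: "findim (csp (C\<lparr>csp := F\<rparr>))"
    using F(2) by simp
  have \<phi>F: "coalg_hom (C\<lparr>csp := F\<rparr>) D \<phi>"
    using super_hom_restrict[OF coalg_homD(1)[OF \<phi>] f(2)] coalg_homD(4,5)[OF \<phi>] f(5)
    unfolding coalg_hom_def by auto
  have proj_F: "proj1 (C\<lparr>csp := F\<rparr>) = proj1 C" "proj2 (C\<lparr>csp := F\<rparr>) = proj2 C"
    by (auto simp: proj1_def proj2_def fun_eq_iff)
  from cotensor_test_algebra[OF CF D \<phi>F ccF fdF, unfolded proj_F]
  obtain T x1 x2 where T: "T \<in> SAlgf" and x: "x1 \<in> Ob (SSp (C\<lparr>csp := F\<rparr>)) T" "x2 \<in> Ob (SSp (C\<lparr>csp := F\<rparr>)) T"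
    and x12: "tmap id \<phi> x1 = tmap id \<phi> x2"
    and test: "\<forall>f. lform (ccar (C\<lparr>csp := F\<rparr>)) f \<longrightarrow> (\<forall>k. f (\<lambda>e. x1 (k, e)) = f (\<lambda>e. x2 (k, e))) \<longrightarrow>
      (\<forall>t\<in>svcar (csquare (C\<lparr>csp := F\<rparr>) \<phi>). f (proj1 C t) = f (proj2 C t))"
    by (elim bexE conjE) (rule that)
  obtain A' u' where A': "dual_algebra (C\<lparr>csp := F\<rparr>) A' u'"
    using dual_algebra_exists[OF CF ccF fdF] by blast
  note A'd = dual_algebraD[OF CF A']
  have xC: "x1 \<in> Ob (SSp C) T" "x2 \<in> Ob (SSp C) T"
    using x unfolding SSp_restrict_iff[OF T C F(1)] by blast+
  have u'C: "u' \<in> Ob (SSp C) A'"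
    using A'd(2) unfolding SSp_restrict_iff[OF A'd(1) C F(1)] by blast
  obtain \<chi>1 where \<chi>1: "\<chi>1 \<in> alg_hom A' T" "tmap \<chi>1 id u' = x1"
    using dual_hom_exists[OF CF A' T x(1)] by blast
  obtain \<chi>2 where \<chi>2: "\<chi>2 \<in> alg_hom A' T" "tmap \<chi>2 id u' = x2"
    using dual_hom_exists[OF CF A' T x(2)] by blast
  have "tensor (asp A) E 0 \<subseteq> tensor (asp A) F 0"
    by (rule tensor_mono[OF order_refl F(4)])
  then have "u \<in> Ob (SSp (C\<lparr>csp := F\<rparr>)) A"
    unfolding SSp_restrict_iff[OF Ad(1) C F(1)] using u_in by blast
  \<comment> \<open>This homomorphism is the restriction of functionals from \<open>F\<close> to
    \<open>E\<close>.\<close>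
  then obtain \<rho> where \<rho>: "\<rho> \<in> alg_hom A' A" "tmap \<rho> id u' = u"
    using dual_hom_exists[OF CF A' Ad(1)] by blast
  \<comment> \<open>It is the value at the universal point of \<open>F\<close> that has to be
    presented, since both test points are specialisations of that point.\<close>
  obtain B0 b \<alpha> where B0: "B0 \<in> SAlgf" and b: "b \<in> Ob Z B0" and \<alpha>: "\<alpha> \<in> alg_hom B0 A'"
    and zb: "g A' u' = Ar Z B0 A' \<alpha> b"
    and cancel: "\<And>R v w. R \<in> SAlgf \<Longrightarrow> v \<in> alg_hom B0 R \<Longrightarrow> w \<in> alg_hom B0 R \<Longrightarrow>
      Ar Z B0 R v b = Ar Z B0 R w b \<Longrightarrow> v = w"
    using superscheme_presented[OF Z A'd(1) nat_transD(1)[OF g A'd(1) u'C]] by blast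
  have push: "Ar Z B0 R (compose (acar B0) \<chi> \<alpha>) b = g R (tmap \<chi> id u')"
    if "R \<in> SAlgf" "\<chi> \<in> alg_hom A' R" for R \<chi>
    using kfunctorD(2)[OF kf B0 A'd(1) that(1) \<alpha> that(2) b] nat_transD(2)[OF g A'd(1) that u'C] zb by simp
  have "Ar Z B0 T (compose (acar B0) \<chi>1 \<alpha>) b = Ar Z B0 T (compose (acar B0) \<chi>2 \<alpha>) b"
    unfolding push[OF T \<chi>1(1)] push[OF T \<chi>2(1)] \<chi>1(2) \<chi>2(2) by (rule equ[OF T xC x12])
  then have eq\<chi>: "compose (acar B0) \<chi>1 \<alpha> = compose (acar B0) \<chi>2 \<alpha>"
    by (rule cancel[OF T alg_hom_compose[OF B0 \<alpha> \<chi>1(1)] alg_hom_compose[OF B0 \<alpha> \<chi>2(1)]])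
  have "\<rho> (\<alpha> c) \<in> \<psi> ` acar B" if c: "c \<in> acar B0" for c
  proof -
    obtain h where h: "lform (svcar F) h" "\<alpha> c = (\<lambda>k. h (\<lambda>e. u' (k, e)))"
      using alg_homE(1)[OF \<alpha> c] A'd(6) by auto
    have hF: "lform (ccar (C\<lparr>csp := F\<rparr>)) h"
      using h(1) by simp
    have "\<chi>1 (\<alpha> c) = \<chi>2 (\<alpha> c)"
      using fun_cong[OF eq\<chi>, of c] c by (simp add: compose_def)
    then have "(\<lambda>k. h (\<lambda>e. x1 (k, e))) = (\<lambda>k. h (\<lambda>e. x2 (k, e)))"
      unfolding h(2) dual_hom_val[OF CF A' \<chi>1(1) hF] dual_hom_val[OF CF A' \<chi>2(1) hF] \<chi>1(2) \<chi>2(2) .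
    then have hx: "h (proj1 C t) = h (proj2 C t)" if "t \<in> svcar (csquare (C\<lparr>csp := F\<rparr>) \<phi>)" for t
      using test[rule_format, OF hF _ that] fun_cong by metis
    have h0: "h x = 0" if x: "x \<in> Y" for x
    proof -
      have t: "t x \<in> svcar (csquare (C\<lparr>csp := F\<rparr>) \<phi>)"
        using F(3) x by (intro tX(4)[OF x F(1)]) blast
      have p: "proj1 C (t x) \<in> svcar F" "proj2 C (t x) \<in> svcar F"
        using proj_car[OF CF D \<phi>F t] unfolding proj_F by simp_all
      have "h (proj1 C (t x) - proj2 C (t x)) = 0"
        using lform_diff[OF h(1) svcar_subspace[OF f(4)] p] hx[OF t] by simp
      then show ?thesis
        using tX(1)[OF x] by simp
    qed
    have hE: "lform (svcar E) h"
      by (rule lform_subset[OF h(1) EF])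
    have ker: "h x = 0" if "x \<in> svcar E" "\<phi> x = 0" for x
    proof -
      have "x \<in> fs.span Y"
        using that Y(3) by blast
      moreover have "lform (svcar E) (\<lambda>x. 0)"
        by (simp add: lform_def)
      moreover have "Y \<subseteq> svcar E"
        using Y(2) by blast
      ultimately show ?thesis
        using lform_eq_on_span[OF hE _ svcar_subspace[OF e(4)] _ h0] by blast
    qed
    obtain h' where h': "lform (\<phi> ` svcar E) h'" "\<And>x. x \<in> svcar E \<Longrightarrow> h' (\<phi> x) = h x"
      using lform_factor[OF e(4) lin\<phi> hE ker] by blast
    have h'D: "lform (svcar (csp (D\<lparr>csp := \<lambda>p. \<phi> ` E p\<rparr>))) h'"
      using h'(1) img(2) by simp
    have "\<rho> (\<alpha> c) = (\<lambda>k. h (\<lambda>e. u (k, e)))"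
      unfolding h(2) dual_hom_val[OF CF A' \<rho>(1) hF] \<rho>(2) ..
    also have "\<dots> = \<psi> (\<lambda>k. h' (\<lambda>e. v (k, e)))"
      unfolding \<psi>_inj(2)[OF h'D] using h'(2) SSpD(5)[OF Ad(1) CE Ad(2)] by simp
    finally show ?thesis
      using Bd(6) h'D by blast
  qed
  then have "compose (acar B0) \<rho> \<alpha> ` acar B0 \<subseteq> \<psi> ` acar B"
    by (auto simp: compose_def)
  then obtain \<beta> where \<beta>: "\<beta> \<in> alg_hom B0 B" "compose (acar B0) \<psi> \<beta> = compose (acar B0) \<rho> \<alpha>"
    using alg_hom_factor[OF Bd(1) Ad(1) B0 \<psi>(1) \<psi>_inj(1) alg_hom_compose[OF B0 \<alpha> \<rho>(1)]] by blast
  have "Ar Z B A \<psi> (Ar Z B0 B \<beta> b) = Ar Z B0 A (compose (acar B0) \<psi> \<beta>) b"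
    by (rule kfunctorD(2)[OF kf B0 Bd(1) Ad(1) \<beta>(1) \<psi>(1) b, symmetric])
  also have "\<dots> = g A u"
    unfolding \<beta>(2) push[OF Ad(1) \<rho>(1)] \<rho>(2) ..
  finally show ?thesis
    using kfunctorD(1)[OF kf B0 Bd(1) \<beta>(1) b] by blast
qed

text \<open>A point involves only finitely many elements of \<open>D\<close>; their preimages under
  the surjection \<phi> generate a finite-dimensional sub-coalgebra of \<open>C\<close>.\<close>

lemma SSp_sub_coalgebra:
  fixes C :: "('c, 'k::field) scoalg" and D :: "('d, 'k) scoalg"
  assumes C: "super_coalgebra C" and cc: "super_cocommutative C" and D: "super_coalgebra D"
    and \<phi>: "coalg_hom C D \<phi>" and surj: "\<phi> ` ccar C = ccar D" and R: "R \<in> SAlgf" and y: "y \<in> Ob (SSp D) R"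
  shows "\<exists>E. sub_coalgebra C E \<and> findim E \<and> y \<in> tensor (asp R) (\<lambda>p. \<phi> ` E p) 0"
proof -
  note Rs = SAlgfD(1)[OF R] and Ds = coalgD(1)[OF D]
  from tensor_finite_support[OF Rs Ds SSpD(1)[OF R D y]]
  obtain X Y where X: "X \<subseteq> acar R" and Y: "finite Y" "Y \<subseteq> ccar D"
    and XY: "\<forall>V' W'. super_space V' \<longrightarrow> super_space W' \<longrightarrow> (\<forall>q. V' q \<subseteq> asp R q) \<longrightarrow>
      (\<forall>q. W' q \<subseteq> csp D q) \<longrightarrow> X \<subseteq> svcar V' \<longrightarrow> Y \<subseteq> svcar W' \<longrightarrow> y \<in> tensor V' W' 0"
    by (elim exE conjE) (rule that)
  obtain Y' where Y': "finite Y'" "Y' \<subseteq> ccar C" "Y = \<phi> ` Y'"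
    using finite_subset_image[OF Y(1), of \<phi> "ccar C"] Y(2) surj by blast
  obtain E where E: "sub_coalgebra C E" "findim E" "Y' \<subseteq> svcar E"
    using finite_sub_coalgebra[OF C cc Y'(1,2)] by blast
  note img = image_sub_coalgebra[OF C D \<phi> E(1)]
  have "y \<in> tensor (asp R) (\<lambda>p. \<phi> ` E p) 0"
  proof (rule XY[rule_format])
    show "Y \<subseteq> svcar (\<lambda>p. \<phi> ` E p)"
      unfolding img(2) Y'(3) using E(3) by blast
  qed (use Rs X sub_coalgebraD(4,2)[OF D img(1)] in auto)
  then show ?thesis
    using E(1,2) by blast
qed

lemma coalg_hom_id: "super_coalgebra C \<Longrightarrow> coalg_hom C C id"
  unfolding coalg_hom_def by (simp add: super_hom_id tmap_def)

text \<open>The transpose of \<phi> on functionals, obtained from the universal property instead of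
  by a direct construction.\<close>

lemma dual_map_exists:
  assumes C: "super_coalgebra C" and D: "super_coalgebra D" and \<phi>: "coalg_hom C D \<phi>"
    and A: "dual_algebra C A u" and B: "dual_algebra D B v"
  shows "\<exists>\<psi>\<in>alg_hom B A. tmap \<psi> id v = tmap id \<phi> u"
proof -
  note Ad = dual_algebraD[OF C A]
  show ?thesis
    by (rule dual_hom_exists[OF D B Ad(1) SSp_map_in[OF Ad(1) C D Ad(2) \<phi>]])
qed

text \<open>
  The algebra of functionals on a finite-dimensional \<open>\<phi>(E)\<close> embeds into that of \<open>E\<close>, so every point
  of \<open>SSp D\<close> is a specialisation of one that lifts to \<open>SSp C\<close> over a larger algebra.
\<close>

lemma SSp_cover:
  fixes C :: "('c, 'k::field) scoalg" and D :: "('d, 'k) scoalg"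
  assumes C: "super_coalgebra C" and cc: "super_cocommutative C" and D: "super_coalgebra D" and ccD: "super_cocommutative D"
    and \<phi>: "coalg_hom C D \<phi>" and surj: "\<phi> ` ccar C = ccar D" and R: "R \<in> SAlgf" and y: "y \<in> Ob (SSp D) R"
  shows "\<exists>A\<in>SAlgf. \<exists>B\<in>SAlgf. \<exists>u\<in>Ob (SSp C) A. \<exists>v\<in>Ob (SSp D) B. \<exists>\<chi>\<in>alg_hom B R. \<exists>\<psi>\<in>alg_hom B A.
    tmap \<chi> id v = y \<and> tmap \<psi> id v = tmap id \<phi> u \<and> inj_on \<psi> (acar B)"
proof -
  obtain E where E: "sub_coalgebra C E" "findim E" "y \<in> tensor (asp R) (\<lambda>p. \<phi> ` E p) 0"
    using SSp_sub_coalgebra[OF C cc D \<phi> surj R y] by blast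
  note img = image_sub_coalgebra[OF C D \<phi> E(1)]
  note CE = restrict_super_coalgebra[OF C E(1)] and DE = restrict_super_coalgebra[OF D img(1)]
  have fdD: "findim (\<lambda>p. \<phi> ` E p)"
    using findim_image[OF sub_coalgebraD(4)[OF C E(1)] _ E(2) sub_coalgebraD(4)[OF D img(1)]] coalg_homD(1)[OF img(3)]
    by simp
  obtain A u where A: "dual_algebra (C\<lparr>csp := E\<rparr>) A u"
    using dual_algebra_exists[OF CE restrict_super_cocommutative[OF C cc E(1)]] E(2) by auto
  obtain B v where B: "dual_algebra (D\<lparr>csp := \<lambda>p. \<phi> ` E p\<rparr>) B v"
    using dual_algebra_exists[OF DE restrict_super_cocommutative[OF D ccD img(1)]] fdD by auto
  note Ad = dual_algebraD[OF CE A] and Bd = dual_algebraD[OF DE B]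
  obtain \<psi> where \<psi>: "\<psi> \<in> alg_hom B A" "tmap \<psi> id v = tmap id \<phi> u"
    using dual_map_exists[OF CE DE img(3) A B] by blast
  have "\<phi> ` svcar (csp (C\<lparr>csp := E\<rparr>)) = svcar (csp (D\<lparr>csp := \<lambda>p. \<phi> ` E p\<rparr>))"
    using img(2) by simp
  then have inj: "inj_on \<psi> (acar B)"
    by (rule dual_image_inj(1)[OF CE DE img(3) _ A B \<psi>])
  have "y \<in> Ob (SSp (D\<lparr>csp := \<lambda>p. \<phi> ` E p\<rparr>)) R"
    unfolding SSp_restrict_iff[OF R D img(1)] using y E(3) by blast
  then obtain \<chi> where "\<chi> \<in> alg_hom B R" "tmap \<chi> id v = y"
    using dual_hom_exists[OF DE B R] by blast
  moreover have "u \<in> Ob (SSp C) A" "v \<in> Ob (SSp D) B"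
    using Ad(2) Bd(2) unfolding SSp_restrict_iff[OF Ad(1) C E(1)] SSp_restrict_iff[OF Bd(1) D img(1)] by blast+
  ultimately show ?thesis
    using Ad(1) Bd(1) \<psi> inj by blast
qed

text \<open>The value at \<open>y\<close> is read off any presentation of \<open>y\<close> as a
  specialisation of the universal point of some \<phi>(E). Finite-dimensional sub-coalgebras are
  directed, so independence of the presentation reduces to compatibility of the descended points
  along one inclusion.\<close>

theorem SSp_descent:
  fixes C :: "('i, 'k::field) scoalg" and D :: "('i, 'k) scoalg" and Z :: "('k, 'z) kfun"
  assumes C: "super_coalgebra C" and cc: "super_cocommutative C" and D: "super_coalgebra D" and ccD: "super_cocommutative D"
    and \<phi>: "coalg_hom C D \<phi>" and faith: "pullback_faithful C D \<phi>"
    and Z: "formal_superscheme Z" and g: "nat_trans (SSp C) Z g"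
    and equ: "\<And>T x1 x2. T \<in> SAlgf \<Longrightarrow> x1 \<in> Ob (SSp C) T \<Longrightarrow> x2 \<in> Ob (SSp C) T \<Longrightarrow>
      tmap id \<phi> x1 = tmap id \<phi> x2 \<Longrightarrow> g T x1 = g T x2"
  shows "\<exists>h. nat_trans (SSp D) Z h \<and> (\<forall>R\<in>SAlgf. \<forall>x\<in>Ob (SSp C) R. h R (tmap id \<phi> x) = g R x)"
proof -
  have kf: "kfunctor Z"
    using Z by (simp add: formal_superscheme_def)
  note surj = pullback_faithful_surj[OF C D \<phi> faith]
  define good where "good E \<longleftrightarrow> sub_coalgebra C E \<and> findim E" for E
  let ?C = "\<lambda>E. C\<lparr>csp := E\<rparr>" and ?D = "\<lambda>E. D\<lparr>csp := \<lambda>p. \<phi> ` E p\<rparr>"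
  have E_sub: "sub_coalgebra C E" and E_fd: "findim E" if "good E" for E
    using that by (simp_all add: good_def)
  note img = image_sub_coalgebra[OF C D \<phi> E_sub]
  note CE = restrict_super_coalgebra[OF C E_sub] and DE = restrict_super_coalgebra[OF D img(1)]
  have fdD: "findim (\<lambda>p. \<phi> ` E p)" if "good E" for E
    using findim_image[OF sub_coalgebraD(4)[OF C E_sub[OF that]] _ E_fd[OF that] sub_coalgebraD(4)[OF D img(1)[OF that]]]
      coalg_homD(1)[OF img(3)[OF that]] by simp
  have "\<exists>A u. dual_algebra (?C E) A u" if "good E" for E
    using dual_algebra_exists[OF CE[OF that] restrict_super_cocommutative[OF C cc E_sub[OF that]]] E_fd[OF that] by simp
  then obtain A u where A: "\<And>E. good E \<Longrightarrow> dual_algebra (?C E) (A E) (u E)"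
    by metis
  have "\<exists>B v. dual_algebra (?D E) B v" if "good E" for E
    using dual_algebra_exists[OF DE[OF that] restrict_super_cocommutative[OF D ccD img(1)[OF that]]] fdD[OF that] by simp
  then obtain B v where B: "\<And>E. good E \<Longrightarrow> dual_algebra (?D E) (B E) (v E)"
    by metis
  note Ad = dual_algebraD[OF CE A] and Bd = dual_algebraD[OF DE B]
  have u_in: "u E \<in> Ob (SSp C) (A E)" "u E \<in> tensor (asp (A E)) E 0" if "good E" for E
    using Ad(2)[OF that that] unfolding SSp_restrict_iff[OF Ad(1)[OF that that] C E_sub[OF that]] by blast+
  have v_in: "v E \<in> Ob (SSp D) (B E)" "v E \<in> tensor (asp (B E)) (\<lambda>p. \<phi> ` E p) 0" if "good E" for E
    using Bd(2)[OF that that] unfolding SSp_restrict_iff[OF Bd(1)[OF that that] D img(1)[OF that]] by blast+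
  have AS: "A E \<in> SAlgf" and BS: "B E \<in> SAlgf" if "good E" for E
    using Ad(1)[OF that that] Bd(1)[OF that that] by blast+
  have "\<exists>\<psi>. \<psi> \<in> alg_hom (B E) (A E) \<and> tmap \<psi> id (v E) = tmap id \<phi> (u E)" if "good E" for E
    using dual_map_exists[OF CE[OF that] DE[OF that] img(3)[OF that] A[OF that] B[OF that]] by blast
  then obtain \<psi> where \<psi>: "\<And>E. good E \<Longrightarrow> \<psi> E \<in> alg_hom (B E) (A E)"
    "\<And>E. good E \<Longrightarrow> tmap (\<psi> E) id (v E) = tmap id \<phi> (u E)"
    by metis
  have \<psi>_inj: "inj_on (\<psi> E) (acar (B E))" if "good E" for E
    by (rule dual_image_inj(1)[OF CE[OF that] DE[OF that] img(3)[OF that] _ A[OF that] B[OF that] \<psi>(1,2)[OF that]])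
      (simp add: img(2)[OF that])
  have "\<exists>z. z \<in> Ob Z (B E) \<and> Ar Z (B E) (A E) (\<psi> E) z = g (A E) (u E)" if "good E" for E
    using descend_point[OF C cc D \<phi> faith Z g equ E_sub[OF that] E_fd[OF that] A[OF that] B[OF that] \<psi>(1,2)[OF that]]
    by blast
  then obtain z where z: "\<And>E. good E \<Longrightarrow> z E \<in> Ob Z (B E)"
    "\<And>E. good E \<Longrightarrow> Ar Z (B E) (A E) (\<psi> E) (z E) = g (A E) (u E)"
    by metis
  have uniqD: "\<chi> = \<chi>'" if "good E" "\<chi> \<in> alg_hom (B E) R" "\<chi>' \<in> alg_hom (B E) R"
    "tmap \<chi> id (v E) = tmap \<chi>' id (v E)" for E R \<chi> \<chi>'
    by (rule dual_hom_unique[OF DE[OF that(1)] B[OF that(1)] that(2-4)])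
  \<comment> \<open>Here \<open>\<rho>\<close> is the restriction of functionals from \<phi>(F) to
    \<phi>(E). The two points of \<open>Z\<close> are compared after applying the injection
    \<open>\<psi> E\<close>, where both become \<open>g (A E) (u E)\<close>.\<close>
  have refine: "\<exists>\<rho>\<in>alg_hom (B F) (B E). tmap \<rho> id (v F) = v E \<and> Ar Z (B F) (B E) \<rho> (z F) = z E"
    if E: "good E" and F: "good F" and le: "\<And>p. E p \<subseteq> F p" for E F
  proof -
    have "tensor (asp (A E)) E 0 \<subseteq> tensor (asp (A E)) F 0"
      by (rule tensor_mono[OF order_refl le])
    then have "u E \<in> Ob (SSp (?C F)) (A E)"
      unfolding SSp_restrict_iff[OF AS[OF E] C E_sub[OF F]] using u_in[OF E] by blast
    then obtain \<sigma> where \<sigma>: "\<sigma> \<in> alg_hom (A F) (A E)" "tmap \<sigma> id (u F) = u E"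
      using dual_hom_exists[OF CE[OF F] A[OF F] AS[OF E]] by blast
    have "tensor (asp (B E)) (\<lambda>p. \<phi> ` E p) 0 \<subseteq> tensor (asp (B E)) (\<lambda>p. \<phi> ` F p) 0"
      by (rule tensor_mono[OF order_refl image_mono[OF le]])
    then have "v E \<in> Ob (SSp (?D F)) (B E)"
      unfolding SSp_restrict_iff[OF BS[OF E] D img(1)[OF F]] using v_in[OF E] by blast
    then obtain \<rho> where \<rho>: "\<rho> \<in> alg_hom (B F) (B E)" "tmap \<rho> id (v F) = v E"
      using dual_hom_exists[OF DE[OF F] B[OF F] BS[OF E]] by blast
    have eq: "compose (acar (B F)) (\<psi> E) \<rho> = compose (acar (B F)) \<sigma> (\<psi> F)"
    proof (rule uniqD[OF F])
      show "compose (acar (B F)) (\<psi> E) \<rho> \<in> alg_hom (B F) (A E)"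
        by (rule alg_hom_compose[OF BS[OF F] \<rho>(1) \<psi>(1)[OF E]])
      show "compose (acar (B F)) \<sigma> (\<psi> F) \<in> alg_hom (B F) (A E)"
        by (rule alg_hom_compose[OF BS[OF F] \<psi>(1)[OF F] \<sigma>(1)])
      show "tmap (compose (acar (B F)) (\<psi> E) \<rho>) id (v F) = tmap (compose (acar (B F)) \<sigma> (\<psi> F)) id (v F)"
        unfolding tmap_compose_hom[OF BS[OF F] D v_in(1)[OF F]] \<rho>(2) \<psi>(2)[OF E] \<psi>(2)[OF F]
          tmap_hom_map[OF AS[OF F] C u_in(1)[OF F] \<sigma>(1) coalg_homD(2)[OF \<phi>]] \<sigma>(2) ..
    qed
    have \<rho>z: "Ar Z (B F) (B E) \<rho> (z F) \<in> Ob Z (B E)"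
      by (rule kfunctorD(1)[OF kf BS[OF F] BS[OF E] \<rho>(1) z(1)[OF F]])
    have "Ar Z (B E) (A E) (\<psi> E) (Ar Z (B F) (B E) \<rho> (z F)) = Ar Z (B F) (A E) (compose (acar (B F)) (\<psi> E) \<rho>) (z F)"
      by (rule kfunctorD(2)[OF kf BS[OF F] BS[OF E] AS[OF E] \<rho>(1) \<psi>(1)[OF E] z(1)[OF F], symmetric])
    also have "\<dots> = Ar Z (A F) (A E) \<sigma> (Ar Z (B F) (A F) (\<psi> F) (z F))"
      unfolding eq by (rule kfunctorD(2)[OF kf BS[OF F] AS[OF F] AS[OF E] \<psi>(1)[OF F] \<sigma>(1) z(1)[OF F]])
    also have "\<dots> = g (A E) (u E)"
      unfolding z(2)[OF F] using nat_transD(2)[OF g AS[OF F] AS[OF E] \<sigma>(1) u_in(1)[OF F]] \<sigma>(2) by simp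
    finally have "Ar Z (B F) (B E) \<rho> (z F) = z E"
      using superscheme_inj[OF Z BS[OF E] AS[OF E] \<psi>(1)[OF E] \<psi>_inj[OF E] \<rho>z z(1)[OF E]] z(2)[OF E] by simp
    then show ?thesis
      using \<rho> by blast
  qed
  \<comment> \<open>The graph of the morphism under construction; the facts that follow show that it
    is total, single-valued, natural and compatible with \<open>g\<close>.\<close>
  define H where "H R y w \<longleftrightarrow> (\<exists>E. good E \<and> (\<exists>\<chi>\<in>alg_hom (B E) R. tmap \<chi> id (v E) = y \<and> w = Ar Z (B E) R \<chi> (z E)))"
    for R y w
  have H_ex: "\<exists>w. H R y w" if R: "R \<in> SAlgf" and y: "y \<in> Ob (SSp D) R" for R y
  proof -
    obtain E where E: "sub_coalgebra C E" "findim E" "y \<in> tensor (asp R) (\<lambda>p. \<phi> ` E p) 0"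
      using SSp_sub_coalgebra[OF C cc D \<phi> surj R y] by blast
    have gE: "good E"
      using E by (simp add: good_def)
    have "y \<in> Ob (SSp (?D E)) R"
      unfolding SSp_restrict_iff[OF R D img(1)[OF gE]] using y E(3) by blast
    then obtain \<chi> where "\<chi> \<in> alg_hom (B E) R" "tmap \<chi> id (v E) = y"
      using dual_hom_exists[OF DE[OF gE] B[OF gE] R] by blast
    then show ?thesis
      unfolding H_def using gE by blast
  qed
  have H_fun: "w = w'" if R: "R \<in> SAlgf" and H: "H R y w" "H R y w'" for R y w w'
  proof -
    obtain E \<chi> where E: "good E" and \<chi>: "\<chi> \<in> alg_hom (B E) R" "tmap \<chi> id (v E) = y" "w = Ar Z (B E) R \<chi> (z E)"
      using H(1) unfolding H_def by blast
    obtain E' \<chi>' where E': "good E'" and \<chi>': "\<chi>' \<in> alg_hom (B E') R" "tmap \<chi>' id (v E') = y"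
      "w' = Ar Z (B E') R \<chi>' (z E')"
      using H(2) unfolding H_def by blast
    obtain F where F: "sub_coalgebra C F" "findim F" "\<And>p. E p \<subseteq> F p" "\<And>p. E' p \<subseteq> F p"
      using sub_coalgebra_above[OF C cc finite.emptyI empty_subsetI E_sub[OF E] E_fd[OF E] E_sub[OF E'] E_fd[OF E']] by blast
    have gF: "good F"
      using F by (simp add: good_def)
    obtain \<rho> where \<rho>: "\<rho> \<in> alg_hom (B F) (B E)" "tmap \<rho> id (v F) = v E" "Ar Z (B F) (B E) \<rho> (z F) = z E"
      using refine[OF E gF F(3)] by blast
    obtain \<rho>' where \<rho>': "\<rho>' \<in> alg_hom (B F) (B E')" "tmap \<rho>' id (v F) = v E'" "Ar Z (B F) (B E') \<rho>' (z F) = z E'"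
      using refine[OF E' gF F(4)] by blast
    have "compose (acar (B F)) \<chi> \<rho> = compose (acar (B F)) \<chi>' \<rho>'"
    proof (rule uniqD[OF gF alg_hom_compose[OF BS[OF gF] \<rho>(1) \<chi>(1)] alg_hom_compose[OF BS[OF gF] \<rho>'(1) \<chi>'(1)]])
      show "tmap (compose (acar (B F)) \<chi> \<rho>) id (v F) = tmap (compose (acar (B F)) \<chi>' \<rho>') id (v F)"
        unfolding tmap_compose_hom[OF BS[OF gF] D v_in(1)[OF gF]] \<rho>(2) \<rho>'(2) \<chi>(2) \<chi>'(2) ..
    qed
    then show "w = w'"
      unfolding \<chi>(3) \<chi>'(3) \<rho>(3)[symmetric] \<rho>'(3)[symmetric]
        kfunctorD(2)[OF kf BS[OF gF] BS[OF E] R \<rho>(1) \<chi>(1) z(1)[OF gF], symmetric]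
        kfunctorD(2)[OF kf BS[OF gF] BS[OF E'] R \<rho>'(1) \<chi>'(1) z(1)[OF gF], symmetric] by simp
  qed
  have H_in: "w \<in> Ob Z R" if "R \<in> SAlgf" "H R y w" for R y w
    using that kfunctorD(1)[OF kf BS that(1) _ z(1)] unfolding H_def by blast
  have H_push: "H S (tmap \<eta> id y) (Ar Z R S \<eta> w)"
    if R: "R \<in> SAlgf" and S: "S \<in> SAlgf" and \<eta>: "\<eta> \<in> alg_hom R S" and H: "H R y w" for R S \<eta> y w
  proof -
    obtain E \<chi> where E: "good E" and \<chi>: "\<chi> \<in> alg_hom (B E) R" "tmap \<chi> id (v E) = y" "w = Ar Z (B E) R \<chi> (z E)"
      using H unfolding H_def by blast
    have "tmap (compose (acar (B E)) \<eta> \<chi>) id (v E) = tmap \<eta> id y"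
      unfolding tmap_compose_hom[OF BS[OF E] D v_in(1)[OF E]] \<chi>(2) ..
    moreover have "Ar Z R S \<eta> w = Ar Z (B E) S (compose (acar (B E)) \<eta> \<chi>) (z E)"
      unfolding \<chi>(3) by (rule kfunctorD(2)[OF kf BS[OF E] R S \<chi>(1) \<eta> z(1)[OF E], symmetric])
    ultimately show ?thesis
      unfolding H_def using E alg_hom_compose[OF BS[OF E] \<chi>(1) \<eta>] by blast
  qed
  have H_map: "H R (tmap id \<phi> x) (g R x)" if R: "R \<in> SAlgf" and x: "x \<in> Ob (SSp C) R" for R x
  proof -
    \<comment> \<open>Taking the identity of \<open>C\<close> in place of \<phi> yields a
      finite-dimensional sub-coalgebra of \<open>C\<close> that carries \<open>x\<close>.\<close>
    obtain E where E: "sub_coalgebra C E" "findim E" "x \<in> tensor (asp R) (\<lambda>p. id ` E p) 0"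
      using SSp_sub_coalgebra[OF C cc C coalg_hom_id[OF C] _ R x] by auto
    have gE: "good E"
      using E by (simp add: good_def)
    have "x \<in> Ob (SSp (?C E)) R"
      unfolding SSp_restrict_iff[OF R C E(1)] using x E(3) by simp
    then obtain \<chi> where \<chi>: "\<chi> \<in> alg_hom (A E) R" "tmap \<chi> id (u E) = x"
      using dual_hom_exists[OF CE[OF gE] A[OF gE] R] by blast
    have "tmap (compose (acar (B E)) \<chi> (\<psi> E)) id (v E) = tmap id \<phi> x"
      unfolding tmap_compose_hom[OF BS[OF gE] D v_in(1)[OF gE]] \<psi>(2)[OF gE]
        tmap_hom_map[OF AS[OF gE] C u_in(1)[OF gE] \<chi>(1) coalg_homD(2)[OF \<phi>]] \<chi>(2) ..
    moreover have "g R x = Ar Z (B E) R (compose (acar (B E)) \<chi> (\<psi> E)) (z E)"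
      using kfunctorD(2)[OF kf BS[OF gE] AS[OF gE] R \<psi>(1)[OF gE] \<chi>(1) z(1)[OF gE]] z(2)[OF gE]
        nat_transD(2)[OF g AS[OF gE] R \<chi>(1) u_in(1)[OF gE]] \<chi>(2) by simp
    ultimately show ?thesis
      unfolding H_def using gE alg_hom_compose[OF BS[OF gE] \<psi>(1)[OF gE] \<chi>(1)] by blast
  qed
  define h where "h R y = (SOME w. H R y w)" for R y
  have h: "H R y (h R y)" if "R \<in> SAlgf" "y \<in> Ob (SSp D) R" for R y
    unfolding h_def by (rule someI_ex[OF H_ex[OF that]])
  have "nat_trans (SSp D) Z h"
    unfolding nat_trans_def
  proof (intro conjI ballI)
    show "h R \<in> Ob (SSp D) R \<rightarrow> Ob Z R" if "R \<in> SAlgf" for R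
      using H_in[OF that h[OF that]] by blast
    show "h S (Ar (SSp D) R S \<eta> y) = Ar Z R S \<eta> (h R y)"
      if R: "R \<in> SAlgf" and S: "S \<in> SAlgf" and \<eta>: "\<eta> \<in> alg_hom R S" and y: "y \<in> Ob (SSp D) R" for R S \<eta> y
      unfolding SSp_Ar by (rule H_fun[OF S h[OF S SSp_push[OF R S D y \<eta>]] H_push[OF R S \<eta> h[OF R y]]])
  qed
  moreover have "h R (tmap id \<phi> x) = g R x" if R: "R \<in> SAlgf" and x: "x \<in> Ob (SSp C) R" for R x
    by (rule H_fun[OF R h[OF R SSp_map_in[OF R C D x \<phi>]] H_map[OF R x]])
  ultimately show ?thesis by blast
qed

section \<open>The coequalizer property, transported from \<open>SSp C\<close> and
  \<open>SSp D\<close> to \<open>X\<close> and \<open>Y\<close>\<close>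

theorem theorem1p3:
  fixes X :: "('k::field, 'x) kfun" and Y :: "('k, 'y) kfun"
    and f :: "'k salg \<Rightarrow> 'x \<Rightarrow> 'y"
  assumes "CHAR('k) \<noteq> 2"
    and "infinite (UNIV :: 'i set)"
    and "formal_superscheme X" and "formal_superscheme Y"
    and "nat_trans X Y f"
    and "faithfully_flat TYPE('i) X Y f"
  shows "coequalizer TYPE('z) (fibre_product X f X f) X Y (\<lambda>_. fst) (\<lambda>_. snd) f"
proof -
  let ?P = "fibre_product X f X f"
  obtain C :: "('i, 'k) scoalg" and \<alpha> and D :: "('i, 'k) scoalg" and \<beta> \<phi> where
    O: "O_star X C \<alpha>" "O_star Y D \<beta>" "O_star_map f C \<alpha> D \<beta> \<phi>" and faith: "pullback_faithful C D \<phi>"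
    using assms(6) unfolding faithfully_flat_def by blast
  have C: "super_coalgebra C" "super_cocommutative C" and \<alpha>: "nat_iso (SSp C) X \<alpha>"
    and D: "super_coalgebra D" "super_cocommutative D" and \<beta>: "nat_iso (SSp D) Y \<beta>"
    and \<phi>: "coalg_hom C D \<phi>"
    using O unfolding O_star_def O_star_map_def by blast+
  note surj = pullback_faithful_surj[OF C(1) D(1) \<phi> faith]
  have \<alpha>T: "nat_trans (SSp C) X \<alpha>" and \<beta>T: "nat_trans (SSp D) Y \<beta>"
    and \<alpha>b: "\<And>R. R \<in> SAlgf \<Longrightarrow> bij_betw (\<alpha> R) (Ob (SSp C) R) (Ob X R)"
    and \<beta>b: "\<And>R. R \<in> SAlgf \<Longrightarrow> bij_betw (\<beta> R) (Ob (SSp D) R) (Ob Y R)"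
    using \<alpha> \<beta> unfolding nat_iso_def by blast+
  have f\<alpha>: "f R (\<alpha> R c) = \<beta> R (tmap id \<phi> c)" if "R \<in> SAlgf" "c \<in> Ob (SSp C) R" for R c
    using O(3) that unfolding O_star_map_def nat_eq_def nat_comp_def SSp_map_def by blast
  have ex: "\<exists>h. nat_trans Y Z h \<and> nat_eq X (nat_comp h f) g \<and>
      (\<forall>h'. nat_trans Y Z h' \<and> nat_eq X (nat_comp h' f) g \<longrightarrow> nat_eq Y h' h)"
    if Z: "formal_superscheme Z" and g: "nat_trans X Z g"
      and eq: "nat_eq ?P (nat_comp g (\<lambda>_. fst)) (nat_comp g (\<lambda>_. snd))" for Z :: "('k, 'z) kfun" and g
  proof -
    have g\<alpha>: "nat_trans (SSp C) Z (nat_comp g \<alpha>)"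
      unfolding nat_trans_def nat_comp_def
      using nat_transD[OF g] nat_transD[OF \<alpha>T] by (simp add: Pi_iff)
    have equ: "nat_comp g \<alpha> T x1 = nat_comp g \<alpha> T x2"
      if T: "T \<in> SAlgf" and x: "x1 \<in> Ob (SSp C) T" "x2 \<in> Ob (SSp C) T" and e: "tmap id \<phi> x1 = tmap id \<phi> x2" for T x1 x2
    proof -
      \<comment> \<open>Two points of \<open>SSp C\<close> with the same image in
        \<open>SSp D\<close> give a point of the fibre product, where the hypothesis on
        \<open>g\<close> applies.\<close>
      have "(\<alpha> T x1, \<alpha> T x2) \<in> Ob ?P T"
        unfolding fibre_product_def using nat_transD(1)[OF \<alpha>T T] x f\<alpha>[OF T] e by simp
      then show ?thesis
        using eq T unfolding nat_eq_def nat_comp_def by fastforce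
    qed
    obtain h0 where h0: "nat_trans (SSp D) Z h0"
      "\<And>R c. R \<in> SAlgf \<Longrightarrow> c \<in> Ob (SSp C) R \<Longrightarrow> h0 R (tmap id \<phi> c) = g R (\<alpha> R c)"
      using SSp_descent[OF C D \<phi> faith Z g\<alpha> equ] unfolding nat_comp_def by blast
    \<comment> \<open>The preimage is unique because \<open>\<beta> R\<close> is bijective on
      points.\<close>
    define h where "h R y = h0 R (inv_into (Ob (SSp D) R) (\<beta> R) y)" for R y
    have h\<beta>: "h R (\<beta> R w) = h0 R w" if "R \<in> SAlgf" "w \<in> Ob (SSp D) R" for R w
      unfolding h_def using \<beta>b[OF that(1)] that(2) by (simp add: bij_betw_def)
    have Y_pt: "\<exists>w\<in>Ob (SSp D) R. y = \<beta> R w" if "R \<in> SAlgf" "y \<in> Ob Y R" for R y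
      using \<beta>b[OF that(1)] that(2) unfolding bij_betw_def by blast
    have hT: "nat_trans Y Z h"
      unfolding nat_trans_def
    proof (intro conjI ballI)
      show "h R \<in> Ob Y R \<rightarrow> Ob Z R" if R: "R \<in> SAlgf" for R
      proof
        fix y assume "y \<in> Ob Y R"
        then obtain w where w: "w \<in> Ob (SSp D) R" "y = \<beta> R w"
          using Y_pt[OF R] by blast
        then show "h R y \<in> Ob Z R"
          using h\<beta>[OF R w(1)] nat_transD(1)[OF h0(1) R w(1)] by simp
      qed
      show "h S (Ar Y R S \<eta> y) = Ar Z R S \<eta> (h R y)"
        if R: "R \<in> SAlgf" and S: "S \<in> SAlgf" and \<eta>: "\<eta> \<in> alg_hom R S" and y: "y \<in> Ob Y R" for R S \<eta> y
      proof -
        obtain w where w: "w \<in> Ob (SSp D) R" "y = \<beta> R w"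
          using Y_pt[OF R y] by blast
        have "Ar Y R S \<eta> y = \<beta> S (tmap \<eta> id w)"
          using nat_transD(2)[OF \<beta>T R S \<eta> w(1)] w(2) by simp
        then show ?thesis
          using h\<beta>[OF S SSp_push[OF R S D(1) w(1) \<eta>]] nat_transD(2)[OF h0(1) R S \<eta> w(1)] h\<beta>[OF R w(1)] w(2) by simp
      qed
    qed
    have hf: "nat_eq X (nat_comp h f) g"
      unfolding nat_eq_def nat_comp_def
    proof (intro ballI)
      fix R x assume R: "R \<in> SAlgf" and x: "x \<in> Ob X R"
      obtain c where c: "c \<in> Ob (SSp C) R" "x = \<alpha> R c"
        using \<alpha>b[OF R] x unfolding bij_betw_def by blast
      show "h R (f R x) = g R x"
        using f\<alpha>[OF R c(1)] h\<beta>[OF R SSp_map_in[OF R C(1) D(1) c(1) \<phi>]] h0(2)[OF R c(1)] c(2) by simp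
    qed
    have uniq: "nat_eq Y h' h" if h': "nat_trans Y Z h'" "nat_eq X (nat_comp h' f) g" for h'
      unfolding nat_eq_def
    proof (intro ballI)
      fix R y assume R: "R \<in> SAlgf" and y: "y \<in> Ob Y R"
      obtain w where w: "w \<in> Ob (SSp D) R" "y = \<beta> R w"
        using Y_pt[OF R y] by blast
      obtain A B u v \<chi> \<psi> where A: "A \<in> SAlgf" and B: "B \<in> SAlgf" and u: "u \<in> Ob (SSp C) A" and v: "v \<in> Ob (SSp D) B"
        and \<chi>: "\<chi> \<in> alg_hom B R" "tmap \<chi> id v = w" and \<psi>: "\<psi> \<in> alg_hom B A" "tmap \<psi> id v = tmap id \<phi> u"
        and inj: "inj_on \<psi> (acar B)"
        using SSp_cover[OF C D \<phi> surj R w(1)] by blast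
      have \<beta>v: "\<beta> B v \<in> Ob Y B"
        by (rule nat_transD(1)[OF \<beta>T B v])
      \<comment> \<open>Every factorisation of \<open>g\<close> is pinned down by \<open>g\<close>
        at the point \<open>u\<close> covering \<open>v\<close>, and its value at \<open>y\<close>
        follows by naturality along \<open>\<chi>\<close>.\<close>
      have cover: "Ar Z B A \<psi> (k B (\<beta> B v)) = g A (\<alpha> A u)" and spec: "k R y = Ar Z B R \<chi> (k B (\<beta> B v))"
        if k: "nat_trans Y Z k" "nat_eq X (nat_comp k f) g" for k
      proof -
        have "Ar Z B A \<psi> (k B (\<beta> B v)) = k A (Ar Y B A \<psi> (\<beta> B v))"
          by (rule nat_transD(2)[OF k(1) B A \<psi>(1) \<beta>v, symmetric])
        also have "Ar Y B A \<psi> (\<beta> B v) = f A (\<alpha> A u)"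
          using nat_transD(2)[OF \<beta>T B A \<psi>(1) v] \<psi>(2) f\<alpha>[OF A u] by simp
        also have "k A (f A (\<alpha> A u)) = g A (\<alpha> A u)"
          using k(2) A nat_transD(1)[OF \<alpha>T A u] unfolding nat_eq_def nat_comp_def by blast
        finally show "Ar Z B A \<psi> (k B (\<beta> B v)) = g A (\<alpha> A u)" .
        have "y = Ar Y B R \<chi> (\<beta> B v)"
          using nat_transD(2)[OF \<beta>T B R \<chi>(1) v] \<chi>(2) w(2) by simp
        then show "k R y = Ar Z B R \<chi> (k B (\<beta> B v))"
          using nat_transD(2)[OF k(1) B R \<chi>(1) \<beta>v] by simp
      qed
      \<comment> \<open>The two morphisms are compared over the larger algebra \<open>A\<close>,
        where the point lifts to \<open>X\<close>.\<close>
      have "h' B (\<beta> B v) = h B (\<beta> B v)"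
      proof (rule superscheme_inj[OF Z B A \<psi>(1) inj nat_transD(1)[OF h'(1) B \<beta>v] nat_transD(1)[OF hT B \<beta>v]])
        show "Ar Z B A \<psi> (h' B (\<beta> B v)) = Ar Z B A \<psi> (h B (\<beta> B v))"
          unfolding cover[OF h'] cover[OF hT hf] ..
      qed
      then show "h' R y = h R y"
        unfolding spec[OF h'] spec[OF hT hf] by (rule arg_cong)
    qed
    show ?thesis
    proof (intro exI conjI allI impI)
      show "nat_eq Y h' h" if "nat_trans Y Z h' \<and> nat_eq X (nat_comp h' f) g" for h'
        by (rule uniq[OF conjunct1[OF that] conjunct2[OF that]])
    qed (rule hT hf)+
  qed
  have "nat_trans ?P X (\<lambda>_. fst)" "nat_trans ?P X (\<lambda>_. snd)"
    unfolding nat_trans_def fibre_product_def by auto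
  moreover have "nat_eq ?P (nat_comp f (\<lambda>_. fst)) (nat_comp f (\<lambda>_. snd))"
    unfolding nat_eq_def nat_comp_def fibre_product_def by auto
  ultimately show ?thesis
    unfolding coequalizer_def using assms(5) ex by blast
qed

end
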